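(* Let $1\le d<n$ be integers. For a full-rank lattice $\mathcal L\subseteq\mathbb R^n$ and all $H>0$, $$N(\mathcal L,d,H)=c(n,d)\frac{H^n}{(\det\mathcal L)^d}+O\left(\sum_{j\in F_{n,d}}b'_j(\mathcal L)H^{\gamma_j}\right),$$ where the implied constant in the big-O notation depends only on $n$, and $F_{n,d}$ is a set of indices of cardinality at most $n^{3n}$. Each $j\in F_{n,d}$ is associated with $\gamma_j\in[0,n-b(n,d)]$ and $b'_j$ of the form $$b'_j(\mathcal L)=\prod_{i=1}^n(\det\mathcal L_i)^{-\beta_i}$$ for some real $\beta_i\ge0$ (depending on $j$) such that $\sum_{i=1}^n i\beta_i=d\gamma_j$; this makes the right-hand side of the formula scale-invariant, i.e. it remains unchanged if $\mathcal L$ and $H$ are replaced by $c\mathcal L$ and $c^dH$, respectively. Also, if $d<n-1$, the leading error term is $$\frac{H^{n-b(n,d)}}{(\det\mathcal L)^{d-b(n,d)}(\det\mathcal L_{n-d})^{b(n,d)}}.$$ If $d=n-1$, then the largest $\gamma_j$ for $j\in F_{n,d}$ may be chosen to be $n-1+\eta$, for any $\eta>0$.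
   Context: $N(\mathcal L,d,H)$ is the number of (not necessarily primitive) rank $d$ sublattices of $\mathcal L$ of determinant at most $H$. The determinant of a lattice in $\mathbb R^n$ is its covolume within its real span. The $i$-th successive minimum of $\mathcal L$ is $\lambda_i(\mathcal L)=\inf\{r>0:\dim\mathrm{span}_{\mathbb R}(\mathcal L\cap B(r))\ge i\}$, where $B(r)$ is the closed ball of radius $r$ about the origin in $\mathbb R^n$. Choose linearly independent vectors $v_1,\dots,v_n\in\mathcal L$ with $\|v_i\|=\lambda_i(\mathcal L)$ and put $\mathcal L_i=\mathcal L\cap\mathrm{span}_{\mathbb R}(v_1,\dots,v_i)$. The constants are $$a(n,d)=\frac1n\binom nd\prod_{i=1}^d\frac{V(n-i+1)}{V(i)}\cdot\frac{\zeta(i)}{\zeta(n-i+1)},\quad c(n,d)=a(n,d)\prod_{i=1}^d\zeta(n-i+1),\quad b(n,d)=\max\left(\frac1d,\frac1{n-d}\right),$$ where $V(i)=\pi^{i/2}/\Gamma(i/2+1)$ is the volume of the unit ball in $\mathbb R^i$ and $\zeta$ is the Riemann zeta function, except that $\zeta(1)$ is understood to be $1$.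
   Formalization: For d=n-1, where b(n,d)=1, the requirement that all γ_j lie in [0,n-b(n,d)] contradicts a largest γ_j of n-1+η; there one γ_j equals n-1+η, the others stay in [0,n-1], and the implied constant may depend on n and η. *)

theory Defs
  imports "HOL-Analysis.Analysis"
begin

section \<open>Lattices\<close>

definition int_span :: "'a::real_vector set \<Rightarrow> 'a set" where
  "int_span B = {\<Sum>b\<in>B. of_int (c b) *\<^sub>R b | c :: 'a \<Rightarrow> int. True}"

definition is_lattice_basis :: "'a::euclidean_space set \<Rightarrow> 'a set \<Rightarrow> bool" where
  "is_lattice_basis B L \<longleftrightarrow> independent B \<and> L = int_span B"

definition is_lattice :: "'a::euclidean_space set \<Rightarrow> bool" where
  "is_lattice L \<longleftrightarrow> (\<exists>B. is_lattice_basis B L)"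

definition is_full_lattice :: "'a::euclidean_space set \<Rightarrow> bool" where
  "is_full_lattice L \<longleftrightarrow> is_lattice L \<and> span L = UNIV"

text \<open>
  Lebesgue measure of a subset \<open>A\<close> of a linear subspace \<open>W\<close>, of the dimension of \<open>W\<close>: the
  standard Lebesgue measure in the coordinates with respect to an orthonormal basis \<open>E\<close> of
  \<open>W\<close>. By orthogonal invariance the choice of \<open>E\<close> is immaterial.
\<close>
definition subspace_volume :: "'a::euclidean_space set \<Rightarrow> 'a set \<Rightarrow> real" where
  "subspace_volume W A =
     (let E = (SOME E. pairwise orthogonal E \<and> (\<forall>e\<in>E. norm e = 1) \<and> span E = W)
      in measure (\<Pi>\<^sub>M e\<in>E. (lborel :: real measure))
           {x \<in> E \<rightarrow>\<^sub>E UNIV. (\<Sum>e\<in>E. x e *\<^sub>R e) \<in> A})"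

definition fundamental_parallelepiped :: "'a::real_vector set \<Rightarrow> 'a set" where
  "fundamental_parallelepiped B = {\<Sum>b\<in>B. c b *\<^sub>R b | c :: 'a \<Rightarrow> real. \<forall>b\<in>B. 0 \<le> c b \<and> c b < 1}"

text \<open>
  The determinant of \<open>L\<close>, i.e. its covolume within its real span: the volume of a fundamental
  domain. It does not depend on the chosen basis, since two bases of \<open>L\<close> differ by an integer
  matrix of determinant \<open>1\<close> or \<open>- 1\<close>.
\<close>
definition covolume :: "'a::euclidean_space set \<Rightarrow> real" where
  "covolume L =
     subspace_volume (span L) (fundamental_parallelepiped (SOME B. is_lattice_basis B L))"

text \<open>\<open>num_sublattices L d H\<close> is \<open>N(L,d,H)\<close>; the set being counted is finite for every lattice \<open>L\<close>.\<close>
definition num_sublattices :: "'a::euclidean_space set \<Rightarrow> nat \<Rightarrow> real \<Rightarrow> nat" where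
  "num_sublattices L d H =
     card {M. is_lattice M \<and> M \<subseteq> L \<and> dim (span M) = d \<and> covolume M \<le> H}"

definition succ_min :: "'a::euclidean_space set \<Rightarrow> nat \<Rightarrow> real" where
  "succ_min L i = Inf {r. 0 < r \<and> i \<le> dim (span (L \<inter> cball 0 r))}"

text \<open>The vectors are numbered from \<open>1\<close> to \<open>n\<close>; the value \<open>v 0\<close> is irrelevant.\<close>
definition minimal_vectors :: "(real ^ 'n) set \<Rightarrow> (nat \<Rightarrow> real ^ 'n) \<Rightarrow> bool" where
  "minimal_vectors L v \<longleftrightarrow>
     (\<forall>i\<in>{1..CARD('n)}. v i \<in> L \<and> norm (v i) = succ_min L i) \<and>
     inj_on v {1..CARD('n)} \<and> independent (v ` {1..CARD('n)})"

definition flag_lattice :: "'a::euclidean_space set \<Rightarrow> (nat \<Rightarrow> 'a) \<Rightarrow> nat \<Rightarrow> 'a set" where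
  "flag_lattice L v i = L \<inter> span (v ` {1..i})"


section \<open>Constants\<close>

text \<open>
  The Riemann zeta function at positive integers, with the convention that its value at \<open>1\<close>
  is \<open>1\<close>.
\<close>
definition zeta_conv :: "nat \<Rightarrow> real" where
  "zeta_conv s = (if s = 1 then 1 else (\<Sum>m. 1 / real (Suc m) ^ s))"

definition a_const :: "nat \<Rightarrow> nat \<Rightarrow> real" where
  "a_const n d = 1 / real n * real (n choose d) *
     (\<Prod>i=1..d. unit_ball_vol (real (n - i + 1)) / unit_ball_vol (real i) *
                (zeta_conv i / zeta_conv (n - i + 1)))"

definition c_const :: "nat \<Rightarrow> nat \<Rightarrow> real" where
  "c_const n d = a_const n d * (\<Prod>i=1..d. zeta_conv (n - i + 1))"

definition b_exp :: "nat \<Rightarrow> nat \<Rightarrow> real" where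
  "b_exp n d = max (1 / real d) (1 / real (n - d))"


section \<open>The terms of the asymptotic formula\<close>

definition main_term :: "nat \<Rightarrow> (real ^ 'n) set \<Rightarrow> real \<Rightarrow> real" where
  "main_term d L H = c_const CARD('n) d * (H ^ CARD('n) / covolume L ^ d)"

definition b_coeff :: "(nat \<Rightarrow> real) \<Rightarrow> (real ^ 'n) set \<Rightarrow> (nat \<Rightarrow> real ^ 'n) \<Rightarrow> real" where
  "b_coeff \<beta> L v = (\<Prod>i=1..CARD('n). covolume (flag_lattice L v i) powr (- \<beta> i))"

definition error_sum ::
    "nat set \<Rightarrow> (nat \<Rightarrow> real) \<Rightarrow> (nat \<Rightarrow> nat \<Rightarrow> real) \<Rightarrow>
     (real ^ 'n) set \<Rightarrow> (nat \<Rightarrow> real ^ 'n) \<Rightarrow> real \<Rightarrow> real" where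
  "error_sum F \<gamma> \<beta> L v H = (\<Sum>j\<in>F. b_coeff (\<beta> j) L v * H powr \<gamma> j)"

text \<open>
  The conditions on the index set and the exponents, apart from the upper bound on \<open>\<gamma> j\<close>.
  Indices are natural numbers without loss of generality.
\<close>
definition exponent_system ::
    "nat \<Rightarrow> nat \<Rightarrow> nat set \<Rightarrow> (nat \<Rightarrow> real) \<Rightarrow> (nat \<Rightarrow> nat \<Rightarrow> real) \<Rightarrow> bool" where
  "exponent_system n d F \<gamma> \<beta> \<longleftrightarrow>
     finite F \<and> card F \<le> n ^ (3 * n) \<and>
     (\<forall>j\<in>F. 0 \<le> \<gamma> j \<and> (\<forall>i\<in>{1..n}. 0 \<le> \<beta> j i) \<and>
            (\<Sum>i=1..n. real i * \<beta> j i) = real d * \<gamma> j)"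

end

theory Submission
  imports Defs
begin

text \<open>
 Let \<open>b\<^sub>1, \<dots>, b\<^sub>n\<close> be a reduced basis of \<open>L\<close>. A rank \<open>d\<close> sublattice meeting \<open>\<real> b\<^sub>1\<close> trivially is the graph of a
 functional over its projection \<open>M\<close> along \<open>b\<^sub>1\<close>; the admissible functionals are the points of a shifted
 dual lattice of \<open>M\<close> in a ball. Summing these ball counts over \<open>M\<close>, with the asymptotic formula for the
 projected lattice turned into a Beta integral, increases \<open>n\<close> and keeps \<open>d\<close>; the error exponent is
 \<open>n - 1/d\<close>. A sublattice not contained in the span of \<open>b\<^sub>1, \<dots>, b\<^bsub>n-1\<^esub>\<close> is determined by its intersection
 with that hyperplane and a point of a shifted lattice in the orthogonal complement, which increases
 both \<open>n\<close> and \<open>d\<close> and gives \<open>n - 1/(n-d)\<close>. Both inductions start from \<open>d = 1\<close>. The error terms are sums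
 over sublattices, bounded by sorting these by the dyadic Gram--Schmidt profile of a reduced basis;
 rescaling to Gram--Schmidt norms \<open>\<ge> 1\<close> absorbs the secondary errors in one power of \<open>H\<close>.
\<close>

text \<open>The saving \<open>b\<close> is \<open>1 / (n - d)\<close> if rank and dimension are
  raised together from rank one, and \<open>1 / d\<close> if, for \<open>d\<close> at least 2, the
  last steps raise the dimension at fixed \<open>d\<close>; these start in dimension
  \<open>d + 1\<close>, from the other induction with corank one. The joint induction requires
  \<open>b < 1\<close>, while \<open>b_exp\<close> is 1 for \<open>d = n - 1\<close>: this is the
  origin of \<open>\<eta>\<close>. A ball count attached to a sublattice \<open>M\<close> has
  relative error of the order of one over radius times \<open>s0 M\<close>, the first Gram--Schmidt
  norm of a reduced basis. Hence sums of \<open>1 / s0 M\<close> must be bounded sharply, not just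
  numbers of sublattices. They behave as if \<open>s0 M\<close> were about
  \<open>U powr (1 / q)\<close> for rank \<open>q\<close> and determinant \<open>U\<close>; the
  profile inequalities make this precise, and the \<open>1 / q\<close> in the exponents comes from
  there. Duality carries the bound over to complements, where the corank takes the place of
  \<open>q\<close>. Facts on determinants (independence of the basis, the index formula, equality
  with the Lebesgue covolume) are read off from numbers of lattice points in large balls, so no
  matrices occur.\<close>

section \<open>Additive subgroups and integer spans of lists\<close>

definition sgrp :: "'a::real_vector set => bool" where
 "sgrp M \<longleftrightarrow> 0 \<in> M \<and> (\<forall>x\<in>M. \<forall>y\<in>M. x - y \<in> M)"

lemma sgrp_0: "sgrp M ==> 0 \<in> M" by (simp add: sgrp_def)
lemma sgrp_diff: "sgrp M ==> x \<in> M ==> y \<in> M ==> x - y \<in> M" by (simp add: sgrp_def)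
lemma sgrp_minus: "sgrp M ==> x \<in> M ==> - x \<in> M" by (metis diff_0 sgrp_def)
lemma sgrp_add: "sgrp M ==> x \<in> M ==> y \<in> M ==> x + y \<in> M"
 by (metis diff_minus_eq_add sgrp_diff sgrp_minus)
lemma sgrp_int:
 assumes "sgrp M" "x \<in> M" shows "of_int c *\<^sub>R x \<in> M"
proof (induction c rule: int_induct[where k = 0])
 case base thus ?case using assms by (simp add: sgrp_0)
next
 case (step1 i) thus ?case using assms by (simp add: scaleR_left_distrib sgrp_add)
next
 case (step2 i) thus ?case using assms by (simp add: scaleR_left_diff_distrib sgrp_diff)
qed
lemma sgrp_sum: "sgrp M ==> (\<And>i. i \<in> I ==> f i \<in> M) ==> sum f I \<in> M"
 by (induction I rule: infinite_finite_induct) (auto simp: sgrp_0 sgrp_add)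

lemma sgrp_Int: "sgrp M ==> sgrp N ==> sgrp (M \<inter> N)" by (auto simp: sgrp_def)
lemma sgrp_subspace: "subspace W ==> sgrp W" by (auto simp: sgrp_def subspace_0 subspace_diff)
lemma sgrp_span [simp]: "sgrp (span W)" by (simp add: sgrp_subspace)
lemma sgrp_image: "linear f ==> sgrp M ==> sgrp (f ` M)"
 unfolding sgrp_def by (auto simp: image_iff) (metis linear_0, metis linear_diff)

text \<open>Generators come in lists because Gram--Schmidt depends on their order; splitting off the
  first coefficient matches projection along the head of the list.\<close>

primrec zs :: "'a::real_vector list => 'a set" where
 "zs [] = {0}"
| "zs (x # xs) = {of_int c *\<^sub>R x + y |c y. y \<in> zs xs}"

lemma zs_ConsI: "y \<in> zs xs ==> of_int c *\<^sub>R x + y \<in> zs (x # xs)" by auto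
lemma zs_ConsE: assumes "z \<in> zs (x # xs)" obtains c y where "z = of_int c *\<^sub>R x + y" "y \<in> zs xs"
 using assms by auto

lemma sgrp_zs [simp]: "sgrp (zs xs)"
proof (induction xs)
 case Nil thus ?case by (simp add: sgrp_def)
next
 case (Cons x xs)
 have 0: "0 \<in> zs (x # xs)" using zs_ConsI[OF sgrp_0[OF Cons], of 0 x] by (simp del: zs.simps)
 have "a - b \<in> zs (x # xs)" if ab: "a \<in> zs (x # xs)" "b \<in> zs (x # xs)" for a b
 proof -
  from ab obtain c y c' y' where *: "a = of_int c *\<^sub>R x + y" "y \<in> zs xs" "b = of_int c' *\<^sub>R x + y'" "y' \<in> zs xs"
   by (elim zs_ConsE) blast
  have "a - b = of_int (c - c') *\<^sub>R x + (y - y')" by (simp add: * algebra_simps)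
  thus ?thesis using zs_ConsI[OF sgrp_diff[OF Cons *(2,4)]] by metis
 qed
 with 0 show ?case unfolding sgrp_def by blast
qed

lemma zs_tail: "zs xs \<subseteq> zs (x # xs)"
 using zs_ConsI[of _ xs 0 x] by (auto simp del: zs.simps)

lemma set_sub_zs: "set xs \<subseteq> zs xs"
proof (induction xs)
 case (Cons x xs)
 have "x \<in> zs (x # xs)" using zs_ConsI[OF sgrp_0[OF sgrp_zs], of 1 x xs] by (simp del: zs.simps)
 thus ?case using Cons zs_tail[of xs x] by (auto simp del: zs.simps)
qed simp

lemma zs_least: "sgrp M ==> set xs \<subseteq> M ==> zs xs \<subseteq> M"
 by (induction xs) (auto simp: sgrp_0 sgrp_add sgrp_int)

lemma zs_mono: "set xs \<subseteq> zs ys ==> zs xs \<subseteq> zs ys" by (simp add: zs_least)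
lemma zs_cong_set: "set xs = set ys ==> zs xs = zs ys" by (metis subset_antisym set_sub_zs zs_mono)

lemma span_zs: "span (zs xs) = span (set xs)"
proof
 show "span (zs xs) \<subseteq> span (set xs)" by (metis sgrp_span span_minimal span_superset subspace_span zs_least)
 show "span (set xs) \<subseteq> span (zs xs)" by (simp add: set_sub_zs span_mono)
qed

lemma zs_image: "linear f ==> zs (map f xs) = f ` zs xs"
proof (induction xs)
 case Nil thus ?case by (simp add: linear_0)
next
 case (Cons x xs)
 have e: "f (of_int c *\<^sub>R x + y) = of_int c *\<^sub>R f x + f y" for c y
  using Cons.prems by (simp add: linear_add linear_scale)
 show ?case
 proof (intro equalityI subsetI)
  fix z assume "z \<in> zs (map f (x # xs))"
  then obtain c y where "z = of_int c *\<^sub>R f x + f y" "y \<in> zs xs" using Cons by auto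
  thus "z \<in> f ` zs (x # xs)" using e zs_ConsI[of y xs c x] by (metis image_eqI)
 next
  fix z assume "z \<in> f ` zs (x # xs)"
  then obtain c y where "z = f (of_int c *\<^sub>R x + y)" "y \<in> zs xs" by auto
  thus "z \<in> zs (map f (x # xs))" using e[of c y] Cons by auto
 qed
qed

lemma zs_append: "zs (xs @ ys) = {a + b |a b. a \<in> zs xs \<and> b \<in> zs ys}"
proof (intro equalityI subsetI)
 fix z assume "z \<in> zs (xs @ ys)"
 thus "z \<in> {a + b |a b. a \<in> zs xs \<and> b \<in> zs ys}"
 proof (induction xs arbitrary: z)
  case (Cons x xs)
  from Cons.prems obtain c y where 1: "z = of_int c *\<^sub>R x + y" "y \<in> zs (xs @ ys)" by auto
  from Cons.IH[OF 1(2)] obtain a b where 2: "y = a + b" "a \<in> zs xs" "b \<in> zs ys" by blast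
  have "z = (of_int c *\<^sub>R x + a) + b" by (simp add: 1 2)
  thus ?case using zs_ConsI[OF 2(2)] 2(3) by blast
 qed simp
next
 fix z assume "z \<in> {a + b |a b. a \<in> zs xs \<and> b \<in> zs ys}"
 moreover have "zs xs \<subseteq> zs (xs @ ys)" "zs ys \<subseteq> zs (xs @ ys)"
  using set_sub_zs[of "xs @ ys"] by (simp_all add: zs_mono)
 ultimately show "z \<in> zs (xs @ ys)" using sgrp_add[OF sgrp_zs] by blast
qed

lemma zs_snoc: "zs (xs @ [b]) = {a + of_int k *\<^sub>R b |a k. a \<in> zs xs}"
 unfolding zs_append by auto

lemma zs_comb: "zs xs = {\<Sum>i<length xs. of_int (c i) *\<^sub>R xs ! i |c :: nat => int. True}"
proof (induction xs)
 case (Cons x xs)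
 have "(\<Sum>i<Suc n. of_int (c i) *\<^sub>R (x # xs) ! i) = of_int (c 0) *\<^sub>R x + (\<Sum>i<n. of_int (c (Suc i)) *\<^sub>R xs ! i)"
  for c :: "nat => int" and n by (subst sum.lessThan_Suc_shift) simp
 note e = this
 let ?A = "\<lambda>c. \<Sum>i<length xs. of_int (c (Suc i)) *\<^sub>R xs ! i"
 show ?case
 proof (intro equalityI subsetI)
  fix z assume "z \<in> zs (x # xs)"
  then obtain k c where "z = of_int k *\<^sub>R x + (\<Sum>i<length xs. of_int (c i) *\<^sub>R xs ! i)" using Cons by auto
  hence "z = (\<Sum>i<length (x#xs). of_int (case_nat k c i) *\<^sub>R (x#xs) ! i)" by (simp add: e del: sum.lessThan_Suc)
  thus "z \<in> {\<Sum>i<length (x#xs). of_int (c i) *\<^sub>R (x#xs) ! i |c :: nat => int. True}" by blast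
 next
  fix z assume "z \<in> {\<Sum>i<length (x#xs). of_int (c i) *\<^sub>R (x#xs) ! i |c :: nat => int. True}"
  then obtain c :: "nat => int" where "z = of_int (c 0) *\<^sub>R x + (?A c)"
   unfolding length_Cons e by blast
  moreover have "(?A c) \<in> zs xs"
   unfolding Cons by (rule CollectI, rule exI[of _ "\<lambda>i. c (Suc i)"]) simp
  ultimately show "z \<in> zs (x # xs)" using zs_ConsI by blast
 qed
qed auto

section \<open>Gram--Schmidt norms\<close>

text \<open>Orthogonal projection along \<open>x\<close>; by division by zero, \<open>prj 0\<close>
  is the identity.\<close>

definition prj :: "'a::real_inner => 'a => 'a" where
 "prj x y = y - ((y \<bullet> x) / (x \<bullet> x)) *\<^sub>R x"

lemma linear_prj [simp]: "linear (prj x)"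
 by (auto simp: prj_def algebra_simps inner_add_left add_divide_distrib intro!: linearI)
lemma prj_orth [simp]: "prj x y \<bullet> x = 0" "x \<bullet> prj x y = 0"
 by (auto simp: prj_def inner_diff_left inner_diff_right inner_commute)
lemma prj_inner: "z \<bullet> x = 0 ==> prj x y \<bullet> z = y \<bullet> z"
 by (simp add: prj_def inner_diff_left inner_commute[of x z])
lemma prj_self [simp]: "prj x x = 0" by (simp add: prj_def)
lemma prj_scale [simp]: "prj x (c *\<^sub>R x) = 0" by (simp add: prj_def)
lemma prj_id: "y \<bullet> x = 0 ==> prj x y = y" by (simp add: prj_def)
lemma prj_add: "prj x (y + z) = prj x y + prj x z" by (simp add: linear_add)
lemma prj_decomp: "y = ((y \<bullet> x) / (x \<bullet> x)) *\<^sub>R x + prj x y" by (simp add: prj_def)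
lemma norm_orth_add: "u \<bullet> v = 0 ==> (norm (u + v))\<^sup>2 = (norm u)\<^sup>2 + (norm v)\<^sup>2"
 by (simp add: power2_norm_eq_inner inner_add_left inner_add_right inner_commute)
lemma norm_prj: "(norm y)\<^sup>2 = ((y \<bullet> x) / norm x)\<^sup>2 + (norm (prj x y))\<^sup>2"
proof (cases "x = 0")
 case False
 let ?A = "norm (((y \<bullet> x) / (x \<bullet> x)) *\<^sub>R x)"
 have "(norm y)\<^sup>2 = ?A\<^sup>2 + (norm (prj x y))\<^sup>2"
  by (subst (1) prj_decomp[of y x], subst norm_orth_add) auto
 also have "?A = \<bar>y \<bullet> x\<bar> / norm x"
  using False by (simp add: dot_square_norm power2_eq_square)
 finally show ?thesis by (simp add: power_divide)
qed (simp add: prj_def)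
lemma norm_prj_le: "norm (prj x y) <= norm y"
 by (rule power2_le_imp_le) (auto simp: norm_prj[of y x])

lemma span_insert_prj: "span (insert x (prj x ` S)) = span (insert x S)"
proof -
 have 1: "prj x y \<in> span (insert x S)" if "y \<in> S" for y
  unfolding prj_def using that by (intro span_diff span_scale span_base) auto
 have 2: "y \<in> span (insert x (prj x ` S))" if "y \<in> S" for y
  by (subst prj_decomp[of y x]) (intro span_add span_scale span_base, use that in auto)
 show ?thesis by (rule span_eq[THEN iffD2]) (use 1 2 in \<open>auto intro: span_base\<close>)
qed

text \<open>The Gram--Schmidt norms. Projecting the whole tail at each step replaces the subtraction
  of all earlier components, so that inductions can peel off the first basis vector and continue in
  its orthogonal complement.\<close>

fun gs :: "'a::real_inner list => real list" where
 "gs [] = []"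
| "gs (x # xs) = norm x # gs (map (prj x) xs)"

lemma length_gs [simp]: "length (gs xs) = length xs"
 by (induction xs rule: gs.induct) auto

lemma gs_nonneg: "g \<in> set (gs xs) ==> 0 <= g"
 by (induction xs rule: gs.induct) auto

text \<open>Linear independence of the list, in the form in which it is used;
  \<open>bas_iff_dim\<close> gives the equivalence.\<close>

definition bas :: "'a::real_inner list => bool" where "bas xs \<longleftrightarrow> 0 \<notin> set (gs xs)"

lemma bas_Nil [simp]: "bas []" and bas_Cons: "bas (x # xs) \<longleftrightarrow> x \<noteq> 0 \<and> bas (map (prj x) xs)"
 by (auto simp: bas_def)
lemma bas_pos: "bas xs ==> g \<in> set (gs xs) ==> 0 < g"
 using gs_nonneg[of g xs] by (auto simp: bas_def less_le)
lemma bas_nth_pos: "bas xs ==> i < length xs ==> 0 < gs xs ! i"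
 by (auto intro: bas_pos)

text \<open>The covolume of \<open>zs xs\<close>. That it depends on \<open>zs xs\<close> only is
  seen in \<open>vol_unique\<close>, through ball counts.\<close>

definition vol :: "'a::real_inner list => real" where "vol xs = prod_list (gs xs)"

lemma vol_Nil [simp]: "vol [] = 1" and vol_Cons: "vol (x # xs) = norm x * vol (map (prj x) xs)"
 by (auto simp: vol_def)
lemma prod_list_pos: "(\<And>x. x \<in> set xs ==> 0 < x) ==> 0 < prod_list (xs :: real list)"
 by (induction xs) auto

lemma vol_pos: "bas xs ==> 0 < vol xs"
 unfolding vol_def by (rule prod_list_pos) (rule bas_pos)

text \<open>Projection onto the orthogonal complement of the span of \<open>xs\<close>; it is
  computed in practice through the characterization \<open>prjs_eqI\<close>.\<close>

fun prjs :: "'a::real_inner list => 'a => 'a" where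
 "prjs [] y = y"
| "prjs (x # xs) y = prjs (map (prj x) xs) (prj x y)"

lemma gs_append: "gs (xs @ ys) = gs xs @ gs (map (prjs xs) ys)"
proof (induction xs arbitrary: ys rule: gs.induct)
 case 1
 have "prjs [] = (\<lambda>y. y)" by (rule ext) simp
 thus ?case by simp
next
 case (2 x xs) thus ?case by (simp add: comp_def)
qed

lemma linear_prjs [simp]: "linear (prjs xs)"
proof (induction xs rule: gs.induct)
 case (2 x xs)
 have "prjs (x # xs) = prjs (map (prj x) xs) \<circ> prj x" by auto
 thus ?case using 2 linear_compose linear_prj by metis
qed (simp add: linear_iff)

lemma span_set_Cons_prj: "span (set (x # xs)) = span (insert x (set (map (prj x) xs)))"
 by (simp add: span_insert_prj)

lemma prjs_orth_diff:
 "(\<forall>x\<in>set xs. prjs xs y \<bullet> x = 0) \<and> y - prjs xs y \<in> span (set xs)"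
proof (induction xs arbitrary: y rule: gs.induct)
 case (2 x xs)
 let ?xs = "map (prj x) xs"
 let ?A = "prjs ?xs (prj x y)"
 have IH: "\<forall>z\<in>set ?xs. ?A \<bullet> z = 0" "prj x y - ?A \<in> span (set ?xs)"
  using 2 by auto
 have "v \<bullet> x = 0" if "v \<in> span (set ?xs)" for v
  using that by (induction rule: span_induct_alt) (auto simp: inner_add_left)
 from this[OF IH(2)] have ox: "?A \<bullet> x = 0" by (simp add: inner_diff_left)
 have "?A \<bullet> z = 0" if "z \<in> set xs" for z
  using IH(1) that ox by (subst prj_decomp[of z x]) (auto simp: inner_add_right)
 moreover have "y - ?A \<in> span (set (x # xs))"
 proof -
  have "y - ?A = (y \<bullet> x / (x \<bullet> x)) *\<^sub>R x + (prj x y - ?A)"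
   by (simp add: prj_def)
  also have "\<dots> \<in> span (insert x (set ?xs))"
   by (intro span_add span_scale) (auto intro: span_base subsetD[OF span_mono IH(2)])
  finally show ?thesis by (simp only: span_set_Cons_prj)
 qed
 ultimately show ?case using ox by auto
qed simp

lemma orth_span: "(\<And>x. x \<in> S ==> u \<bullet> x = 0) ==> v \<in> span S ==> u \<bullet> v = 0"
 by (rotate_tac 1, induction rule: span_induct_alt) (auto simp: inner_add_right)

lemma prjs_orth: "v \<in> span (set xs) ==> prjs xs y \<bullet> v = 0"
 using prjs_orth_diff by (metis orth_span)
lemma prjs_diff: "y - prjs xs y \<in> span (set xs)" using prjs_orth_diff by blast

text \<open>Two candidates differ by a vector of the span that is orthogonal to the span.\<close>

lemma prjs_eqI:
 assumes "\<And>x. x \<in> set xs ==> u \<bullet> x = 0" "y - u \<in> span (set xs)"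
 shows "prjs xs y = u"
proof -
 have "prjs xs y - u \<in> span (set xs)"
  using span_diff[OF assms(2) prjs_diff[of y xs]] by (simp add: algebra_simps)
 hence "(prjs xs y - u) \<bullet> (prjs xs y - u) = 0"
  using orth_span[OF assms(1)] prjs_orth by (metis diff_zero inner_diff_left)
 thus ?thesis by simp
qed

lemma prjs_span [simp]: "v \<in> span (set xs) ==> prjs xs v = 0"
 by (rule prjs_eqI) auto

lemma gs_snoc: "gs (xs @ [w]) = gs xs @ [norm (prjs xs w)]"
 by (simp add: gs_append)

lemma bas_append: "bas (xs @ ys) \<longleftrightarrow> bas xs \<and> bas (map (prjs xs) ys)"
 by (auto simp: bas_def gs_append)

lemma prjs_0_iff: "prjs xs w = 0 \<longleftrightarrow> w \<in> span (set xs)"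
 using prjs_span prjs_diff[of w xs] by force

lemma bas_snoc: "bas (xs @ [w]) \<longleftrightarrow> bas xs \<and> w \<notin> span (set xs)"
 by (auto simp: bas_def gs_snoc prjs_0_iff)

lemma bas_iff_dim: "bas xs \<longleftrightarrow> dim (set xs) = length (xs :: 'a::euclidean_space list)"
proof (induction xs rule: rev_induct)
 case (snoc w xs)
 have le: "dim (set xs) <= length xs"
  by (rule order_trans[OF dim_le_card'[OF finite_set] card_length])
 show ?case unfolding bas_snoc using snoc le by (auto simp: dim_insert)
qed simp

lemma dim_set_le: "dim (set xs) <= length (xs :: 'a::euclidean_space list)"
 by (rule order_trans[OF dim_le_card'[OF finite_set] card_length])

lemma bas_indep: assumes "bas (xs :: 'a::euclidean_space list)" shows "independent (set xs)" "distinct xs"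
proof -
 have d: "dim (set xs) = length xs" using assms by (simp add: bas_iff_dim)
 hence c: "card (set xs) = length xs" using card_length[of xs] dim_le_card'[OF finite_set, of xs] by linarith
 thus "distinct xs" by (simp add: card_distinct)
 show "independent (set xs)" by (rule card_le_dim_spanning[of _ "span (set xs)"]) (auto simp: d c span_superset)
qed

lemma bas_if_indep: "independent (set xs) ==> distinct xs ==> bas (xs :: 'a::euclidean_space list)"
 by (simp add: bas_iff_dim dim_eq_card_independent distinct_card)

lemma dim_zs: "bas xs ==> dim (zs xs) = length (xs :: 'a::euclidean_space list)"
 by (metis bas_iff_dim dim_span span_zs)

lemma gs_le_norm: "i < length xs ==> gs xs ! i <= norm (xs ! i)"
proof (induction xs arbitrary: i rule: gs.induct)
 case (2 x xs) thus ?case by (cases i) (auto intro: order_trans[OF _ norm_prj_le])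
qed simp

section \<open>Lattice points in balls\<close>

text \<open>The slice at height \<open>s\<close> of the unit ball of dimension \<open>k + 1\<close>
  is a ball of dimension \<open>k\<close> whose volume is \<open>hk k s\<close> times that of the
  unit ball.\<close>

definition hk :: "nat => real => real" where
 "hk k s = (if \<bar>s\<bar> <= 1 then sqrt (1 - s\<^sup>2) ^ k else 0)"

lemma hk_nonneg: "0 <= hk k s"
 by (auto simp: hk_def abs_square_le_1)
lemma hk_le1: "hk k s <= 1"
proof -
 have "sqrt (1 - s\<^sup>2) ^ k <= 1" if "\<bar>s\<bar> <= 1"
  using that by (intro power_le_one) (auto simp: abs_square_le_1)
 thus ?thesis by (simp add: hk_def)
qed
lemma hk_even: "hk k (- s) = hk k s" by (simp add: hk_def)
lemma hk_antimono: "0 <= s ==> s <= t ==> hk k t <= hk k s"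
 using hk_nonneg[of k s]
 by (auto simp: hk_def abs_square_le_1 intro!: power_mono power_mono[of s t 2] real_sqrt_le_mono)

text \<open>The recursion between ball volumes in consecutive dimensions, read off from a Beta
  integral; the 2 appears because only the upper half of the ball is sliced.\<close>

lemma hk_integral:
 "(hk k has_integral (unit_ball_vol (Suc k) / (2 * unit_ball_vol k))) {0..1}"
proof -
 let ?C = "unit_ball_vol (Suc k)"
 let ?B = "unit_ball_vol k"
 let ?A = "\<lambda>x::real. sqrt (1 - x\<^sup>2) ^ k"
 have c: "continuous_on {a..b} ?A" for a b by (intro continuous_intros)
 define I where "I = integral {0..1} ?A"
 have I: "(?A has_integral I) {0..1}"
  unfolding I_def using integrable_integral[OF integrable_continuous_real[OF c]] .
 have "((\<lambda>x::real. sqrt (1 - (-x)\<^sup>2) ^ k) has_integral I) {-1..-0}"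
  using I by (subst has_integral_reflect_real) auto
 hence "(?A has_integral I) {-1..0}" by simp
 from has_integral_combine[OF _ _ this I]
 have "(?A has_integral (2 * I)) {-1..1}" by simp
 from nn_integral_has_integral_lebesgue[OF _ this]
 have "ennreal (2 * I) = (\<integral>\<^sup>+x. indicator {-1..1} x * sqrt (1 - x^2) ^ k \<partial>lborel)"
  by (simp add: abs_square_le_1 abs_le_iff mult.commute)
 also have "\<dots> = ennreal (Beta (1 / 2) (real k / 2 + 1))" by (rule emeasure_cball_aux_integral)
 finally have "2 * I = Beta (1 / 2) (real k / 2 + 1)"
  using I by (subst (asm) ennreal_inj) (auto simp: Beta_def abs_square_le_1 intro!: has_integral_nonneg[OF I] divide_nonneg_nonneg mult_nonneg_nonneg Gamma_real_nonneg)
 moreover have "?B * Beta (1/2) (k / 2 + 1) = ?C"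
  by (auto simp: unit_ball_vol_def Beta_def Gamma_eq_zero_iff field_simps
     Gamma_one_half_real powr_half_sqrt [symmetric] powr_add [symmetric])
 moreover have vp: "?B > 0" by simp
 ultimately have "?B * (2 * I) = ?C" by (simp only:)
 hence "I = ?C / (2 * ?B)"
  using vp by (metis mult.assoc mult.commute nonzero_eq_divide_eq less_irrefl mult_eq_0_iff zero_neq_numeral)
 moreover have "(hk k has_integral I) {0..1}"
  by (rule has_integral_eq[OF _ I]) (auto simp: hk_def)
 ultimately show ?thesis by simp
qed

text \<open>On unit steps the sums over left and right end points enclose the integral and differ by
  at most \<open>f s\<close>. The initial piece \<open>{0..s}\<close> of the integral is also at
  most 1 and enters with the opposite sign, so the two errors do not add up.\<close>

lemma antimono_sum_integral:
 fixes f :: "real => real"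
 assumes mono: "\<And>x y. 0 <= x ==> x <= y ==> f y <= f x" and pos: "\<And>x. 0 <= f x" and f0: "f 0 <= 1"
  and s: "0 <= s" "s <= 1" and z: "f (s + N) = 0"
  and I: "(f has_integral I) {0..s + real N}"
 shows "\<bar>(\<Sum>j<N. f (s + real j)) - I\<bar> <= 1"
proof -
 let ?A = "\<lambda>a. integral {a..a+1} f"
 have int: "f integrable_on {a..b}" if "0 <= a" for a b
 proof -
  have "mono_on {a..b} (\<lambda>x. - f x)" using mono that by (auto simp: mono_on_def)
  from integrable_on_mono_on[OF this] show ?thesis by (simp add: integrable_neg_iff)
 qed
 have step: "f (a + 1) <= ?A a \<and> ?A a <= f a" if "0 <= a" for a
 proof
  have "integral {a..a+1} (\<lambda>_. f (a + 1)) <= ?A a"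
   by (rule integral_le) (use mono that int in auto)
  thus "f (a + 1) <= ?A a" by simp
  have "?A a <= integral {a..a+1} (\<lambda>_. f a)"
   by (rule integral_le) (use mono that int in auto)
  thus "?A a <= f a" by simp
 qed
 have ind: "(\<Sum>j<n. f (s + real j + 1)) <= integral {s..s+real n} f \<and> integral {s..s+real n} f <= (\<Sum>j<n. f (s + real j))" for n
 proof (induction n)
  case (Suc n)
  have "integral {s..s+real (Suc n)} f = integral {s..s+real n} f + integral {s+real n..s+real n + 1} f"
   using Henstock_Kurzweil_Integration.integral_combine[of s "s+real n" "s + real (Suc n)" f] int s by (simp add: add_ac)
  thus ?case using Suc step[of "s + real n"] s by (simp add: add_ac)
 qed simp
 have I': "I = integral {0..s} f + integral {s..s+real N} f"
  using Henstock_Kurzweil_Integration.integral_combine[of 0 s "s+real N" f] int s integral_unique[OF I] by simp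
 let ?B = "integral {0..s} f"
 have "?B <= integral {0..s} (\<lambda>_. 1)"
  by (rule integral_le) (use mono f0 s int order_trans[OF mono f0] in auto)
 hence i1: "?B <= 1" using s by simp
 have i0: "0 <= ?B" by (rule integral_nonneg) (use int pos in auto)
 have "(\<Sum>j<N. f (s + real j)) <= f s + (\<Sum>j<N. f (s + real j + 1))"
 proof (cases N)
  case (Suc M)
  have "(\<Sum>j<N. f (s + real j)) = f s + (\<Sum>j<M. f (s + real j + 1))"
   unfolding Suc by (subst sum.lessThan_Suc_shift) (simp add: add_ac)
  thus ?thesis using pos by (simp add: Suc)
 qed (use pos in simp)
 moreover have "f s <= 1" using mono[of 0 s] s f0 by simp
 ultimately show ?thesis using ind[of N] I' i0 i1 by linarith
qed

lemma hk_half_sum: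
 fixes B a :: real and k :: nat
 assumes B: "0 < B"
 shows "\<bar>(\<Sum>c\<in>{c::int. 0 <= c + a \<and> c + a <= B}. hk k ((c + a) / B)) - B * (unit_ball_vol (Suc k) / (2 * unit_ball_vol k))\<bar> <= 1"
proof -
 let ?E = "\<lambda>c. c + a"
 let ?C = "unit_ball_vol (Suc k) / (2 * unit_ball_vol k)"
 let ?A = "(\<lambda>x. (1 / (1/B)) *\<^sub>R x + - ((1 / (1/B)) *\<^sub>R 0)) ` cbox 0 1"
 \<comment> \<open>The least integer with \<open>m + a\<close> nonnegative; \<open>s\<close> is then
   the first sample point and lies in the unit interval.\<close>
 define m where "m = \<lceil>- a\<rceil>"
 define s where "s = m + a"
 have s: "0 <= s" "s <= 1" unfolding s_def m_def by linarith+
 define N where "N = nat \<lceil>B\<rceil> + 1"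
 have N: "B < real N" "B < s + real N" using s unfolding N_def by linarith+
 let ?f = "\<lambda>x. hk k (x / B)" and ?I = "B * ?C"
 let ?B = "\<Sum>j\<in>{j. j < N \<and> s + real j <= B}. ?f (s + real j)"
 have "((\<lambda>x. hk k ((1 / B) * x + 0)) has_integral (1 / \<bar>1 / B\<bar>) *\<^sub>R ?C) ?A"
  using has_integral_affinity[OF hk_integral[of k, folded cbox_interval], of "1 / B" 0] B by simp
 moreover have "?A = {0..B}"
  using B image_mult_atLeastAtMost[of B 0 1] by simp
 ultimately have "(?f has_integral ?I) {0..B}" using B by simp
 hence "((\<lambda>x. if x \<in> {0..B} then ?f x else 0) has_integral ?I) {0..s + real N}"
  by (subst has_integral_restrict) (use N in auto)
 hence I: "(?f has_integral ?I) {0..s + real N}"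
  by (rule has_integral_eq[rotated]) (use B in \<open>auto simp: hk_def divide_simps\<close>)
 have "\<bar>(\<Sum>j<N. ?f (s + real j)) - ?I\<bar> <= 1"
 proof (rule antimono_sum_integral[OF _ _ _ s _ I])
  show "hk k (y / B) <= hk k (x / B)" if "0 <= x" "x <= y" for x y
   by (rule hk_antimono) (use that B in \<open>auto intro!: divide_right_mono\<close>)
  show "hk k ((s + real N) / B) = 0" using B N s by (auto simp: hk_def divide_simps)
 qed (auto simp: hk_nonneg hk_le1)
 moreover have "(\<Sum>c\<in>{c::int. 0 <= ?E c \<and> ?E c <= B}. ?f (?E c)) = ?B"
 proof (rule sum.reindex_bij_witness[of _ "\<lambda>j. m + int j" "\<lambda>c. nat (c - m)"])
  fix c :: int assume c: "c \<in> {c. 0 <= ?E c \<and> ?E c <= B}"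
  hence mc: "m <= c" unfolding m_def by (simp add: ceiling_le_iff)
  thus "m + int (nat (c - m)) = c" by simp
  let ?D = "real (nat (c - m))"
  have e: "?D = c - m" using mc by simp
  show "nat (c - m) \<in> {j. j < N \<and> s + real j <= B}"
  proof -
   have "?D < real N" using c N(1) s e unfolding s_def by auto
   thus ?thesis using c e by (auto simp: s_def)
  qed
  show "?f (s + ?D) = ?f (?E c)" by (simp add: e s_def add.commute)
 qed (use s in \<open>auto simp: s_def\<close>)
 moreover have "?B = (\<Sum>j<N. ?f (s + real j))"
  using B s by (intro sum.mono_neutral_left) (auto simp: hk_def divide_simps)
 ultimately show ?thesis by simp
qed

lemma finite_int_interval: "finite {c::int. a <= c + A \<and> c + A <= (b::real)}"
 by (rule finite_subset[of _ "{\<lfloor>a - A\<rfloor>..\<lceil>b - A\<rceil>}"]) (auto simp: floor_le_iff le_ceiling_iff)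

text \<open>Nonnegative and nonpositive sample points are treated separately, the latter by
  evenness, with error 1 each. A sample point at zero is counted twice, which accounts for the third
  unit.\<close>

lemma hk_sum:
 fixes B a :: real and k :: nat
 assumes B: "0 < B"
 shows "\<bar>(\<Sum>c\<in>{c::int. \<bar>c + a\<bar> <= B}. hk k ((c + a) / B)) - B * (unit_ball_vol (Suc k) / unit_ball_vol k)\<bar> <= 3"
proof -
 let ?B = "\<lambda>c. c + a"
 let ?A = "B * (unit_ball_vol (Suc k) / (2 * unit_ball_vol k))"
 let ?P = "{c::int. 0 <= ?B c \<and> ?B c <= B}" and ?M = "{c::int. 0 <= c - a \<and> c - a <= B}"
 let ?N = "{c::int. - B <= ?B c \<and> ?B c <= 0}" and ?Z = "{c::int. ?B c = 0}"
 let ?f = "\<lambda>c::int. hk k ((?B c) / B)"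
 have U: "{c::int. \<bar>?B c\<bar> <= B} = ?P \<union> ?N" and Z: "?P \<inter> ?N = ?Z" using B by auto
 have "sum ?f ?N = (\<Sum>c\<in>?M. hk k ((c + - a) / B))"
 proof (rule sum.reindex_bij_witness[of _ uminus uminus])
  fix c :: int
  let ?D = "(?B c) / B"
  let ?C = "(real_of_int (- c) + - a) / B"
  have "hk k ?D = hk k (- ?D)" by (simp only: hk_even)
  also have "- ?D = ?C" by (simp add: minus_divide_left)
  finally show "hk k ?C = hk k ?D" by simp
 qed auto
 with hk_half_sum[OF B, where a="- a" and k=k]
 have 2: "\<bar>sum ?f ?N - ?A\<bar> <= 1" by simp
 have "sum ?f (?P \<union> ?N) = sum ?f ?P + sum ?f ?N - sum ?f ?Z"
  by (subst sum_Un) (auto simp: finite_int_interval Z)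
 moreover have "0 <= sum ?f ?Z" by (intro sum_nonneg hk_nonneg)
 moreover have "sum ?f ?Z <= 1"
 proof (cases "?Z = {}")
  case False
  then obtain c :: int where "?B c = 0" by blast
  hence "?Z \<subseteq> {c}" by auto
  hence "?Z = {c}" using \<open>c + a = 0\<close> by blast
  thus ?thesis using hk_le1 by simp
 qed simp
 moreover have "B * (unit_ball_vol (Suc k) / unit_ball_vol k)
   = ?A + ?A"
  by (simp add: field_simps)
 ultimately show ?thesis using hk_half_sum[OF B, where a=a and k=k] 2 unfolding U
  by linarith
qed

section \<open>Translates of dual lattices in balls\<close>

text \<open>The points in a ball of a translate of the lattice dual to \<open>zs xs\<close>. Both
  inductions produce sets of this dual form; lattices themselves are recovered by biduality in
  \<open>zs_shift_DL\<close>.\<close>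

definition DL :: "'a::real_inner list => (nat => real) => real => 'a set" where
 "DL xs A R = {f \<in> span (set xs). (\<forall>i<length xs. \<exists>c::int. f \<bullet> xs ! i = c + A i) \<and> norm f <= R}"

lemma prj_span_Cons:
 assumes "f \<in> span (set (x # xs))" shows "prj x f \<in> span (set (map (prj x) xs))"
proof -
 have "prj x f \<in> prj x ` span (insert x (set xs))" using assms by auto
 hence "prj x f \<in> span (prj x ` insert x (set xs))" by (simp only: linear_span_image[OF linear_prj])
 thus ?thesis by (simp add: span_insert_0)
qed

lemma span_prj_orth: "v \<in> span (set (map (prj x) xs)) ==> v \<bullet> x = 0"
 by (subst inner_commute, rule orth_span[of "set (map (prj x) xs)"]) auto

text \<open>Slicing by the value at \<open>x\<close>: the integer \<open>c\<close> fixes the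
  component along \<open>x\<close>, Pythagoras leaves a smaller radius for the rest in the
  orthogonal complement, and removing the component along \<open>x\<close> shifts the values at the
  other vectors.\<close>

lemma DL_Cons:
 fixes x :: "'a::real_inner" and u :: "nat => real"
 assumes x: "x \<noteq> 0" and r: "0 <= r"
 shows "DL (x # xs) u r = (\<Union>c\<in>{c::int. \<bar>c + u 0\<bar> <= r * norm x}. (\<lambda>v. ((c + u 0) / (x \<bullet> x)) *\<^sub>R x + v) `
   DL (map (prj x) xs) (\<lambda>i. u (Suc i) - ((c + u 0) / (x \<bullet> x)) * (x \<bullet> xs ! i)) (sqrt (r\<^sup>2 - ((c + u 0) / norm x)\<^sup>2)))"
  (is "?L = (\<Union>c\<in>?I. ?f c ` ?D c)")
proof (intro equalityI subsetI)
 let ?F = "r\<^sup>2"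
 let ?C = "\<lambda>c. (c + u 0) / (x \<bullet> x)"
 let ?B = "\<lambda>c. ((c + u 0) / norm x)\<^sup>2"
 fix p assume p: "p \<in> ?L"
 hence n: "norm p <= r" and sp: "p \<in> span (set (x # xs))"
  and ints: "\<And>i. i < Suc (length xs) ==> \<exists>c::int. p \<bullet> (x # xs) ! i = c + u i" by (auto simp: DL_def)
 from ints[of 0] obtain c :: int where c: "p \<bullet> x = c + u 0" by auto
 let ?v = "prj x p"
 have \<phi>e: "p = (?C c) *\<^sub>R x + ?v" using prj_decomp[of p x] c by simp
 have nn: "(norm p)\<^sup>2 = ?B c + (norm ?v)\<^sup>2" using norm_prj[of p x] c by simp
 moreover have "(norm p)\<^sup>2 <= ?F" using n by (simp add: power_mono)
 ultimately have 1: "(norm ?v)\<^sup>2 <= ?F - ?B c" by simp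
 hence v: "norm ?v <= sqrt (?F - ?B c)" by (simp add: real_le_rsqrt)
 have "?B c <= ?F" using 1 zero_le_power2[of "norm ?v"] by linarith
 hence "\<bar>(c + u 0) / norm x\<bar> <= r" using r by (simp add: abs_le_square_iff[symmetric])
 hence I: "c \<in> ?I" using x by (simp add: divide_simps)
 have "\<exists>k::int. ?v \<bullet> map (prj x) xs ! i = k + (u (Suc i) - (?C c) * (x \<bullet> xs ! i))" if i: "i < length xs" for i
 proof -
  obtain k :: int where k: "p \<bullet> xs ! i = k + u (Suc i)" using ints[of "Suc i"] i by auto
  have "?v \<bullet> map (prj x) xs ! i = ?v \<bullet> xs ! i" using prj_inner[of ?v x "xs ! i"] i by (simp add: inner_commute)
  also have "\<dots> = p \<bullet> xs ! i - (?C c) * (x \<bullet> xs ! i)"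
   by (subst (2) \<phi>e) (simp add: inner_add_left)
  finally show ?thesis using k by auto
 qed
 hence "?v \<in> ?D c" unfolding DL_def using prj_span_Cons[OF sp] v by auto
 thus "p \<in> (\<Union>c\<in>?I. ?f c ` ?D c)" using I \<phi>e by blast
next
 let ?H = "map (prj x) xs"
 let ?G = "r\<^sup>2"
 fix p assume "p \<in> (\<Union>c\<in>?I. ?f c ` ?D c)"
 then obtain c v where c: "c \<in> ?I" and v: "v \<in> ?D c" and p: "p = ?f c v" by blast
 let ?E = "c + u 0"
 let ?A = "(?E / norm x)\<^sup>2"
 have vs: "v \<in> span (set ?H)" using v by (simp add: DL_def)
 have vx: "v \<bullet> x = 0" by (rule span_prj_orth[OF vs])
 have "p \<in> span (insert x (set ?H))" unfolding p
  by (intro span_add span_scale) (auto intro: span_base subsetD[OF span_mono vs])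
 hence sp: "p \<in> span (set (x # xs))" by (simp only: span_set_Cons_prj)
 have \<phi>x: "p \<bullet> x = ?E" using x by (simp add: p inner_add_left vx)
 have ints: "\<exists>k::int. p \<bullet> (x # xs) ! i = k + u i" if i: "i < Suc (length xs)" for i
 proof (cases i)
  case 0 thus ?thesis using \<phi>x by auto
 next
  case (Suc j)
  then obtain k :: int where k: "v \<bullet> ?H ! j = k + (u (Suc j) - (?E / (x \<bullet> x)) * (x \<bullet> xs ! j))"
   using v i by (auto simp: DL_def)
  have "v \<bullet> ?H ! j = v \<bullet> xs ! j" using prj_inner[OF vx] i Suc by (simp add: inner_commute)
  hence "p \<bullet> xs ! j = k + u (Suc j)" using k by (simp add: p inner_add_left)
  thus ?thesis using Suc by auto
 qed
 have nn: "(norm p)\<^sup>2 = ?A + (norm v)\<^sup>2"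
  using norm_prj[of p x] \<phi>x by (simp add: p prj_add prj_id[OF vx])
 have le: "?A <= ?G"
 proof -
  have "\<bar>?E / norm x\<bar> <= \<bar>r\<bar>" using c x r by (simp add: divide_simps)
  thus ?thesis by (simp only: abs_le_square_iff)
 qed
 have "norm v <= sqrt (?G - ?A)" using v by (simp add: DL_def)
 hence "(norm v)\<^sup>2 <= (sqrt (?G - ?A))\<^sup>2" by (simp add: power_mono)
 hence "(norm p)\<^sup>2 <= ?G" using nn le by simp
 hence "norm p <= r" using r power2_le_imp_le by blast
 thus "p \<in> ?L" unfolding DL_def using sp ints by auto
qed

text \<open>By \<open>er_eq\<close> this is the sum over \<open>i\<close> of the products of
  \<open>1 + R * ls ! l\<close> over all \<open>l\<close> other than \<open>i\<close>. In the
  recursion the first summand is the number of slices times the error of a slice, and the second is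
  the cost of replacing a sum over slices by an integral.\<close>

primrec er :: "real => real list => real" where
 "er R [] = 0"
| "er R (g # ls) = (1 + R * g) * er R ls + (\<Prod>h\<leftarrow>ls. 1 + R * h)"

lemma prod_list_mono:
 "(\<And>x. x \<in> set xs ==> 0 <= f x \<and> f x <= g x) ==> (\<Prod>x\<leftarrow>xs. f x) <= (\<Prod>x\<leftarrow>xs. g x :: real)"
proof (induction xs)
 case (Cons a xs)
 have "0 <= (\<Prod>x\<leftarrow>xs. f x)" using Cons.prems by (intro prod_list_nonneg) auto
 moreover have "0 <= f a" "f a <= g a" using Cons.prems[of a] by auto
 moreover have "(\<Prod>x\<leftarrow>xs. f x) <= (\<Prod>x\<leftarrow>xs. g x)" using Cons by auto
 ultimately show ?case by (simp add: mult_mono')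
qed simp

lemma prod_list_ge1: "(\<And>x. x \<in> set xs ==> 1 <= x) ==> 1 <= prod_list (xs :: real list)"
proof (induction xs)
 case (Cons a xs)
 hence "1 <= a" "1 <= prod_list xs" by auto
 hence "1 * 1 <= a * prod_list xs" by (intro mult_mono) auto
 thus ?case by simp
qed simp

lemma er_nonneg: "0 <= R ==> (\<And>g. g \<in> set ls ==> 0 <= g) ==> 0 <= er R ls"
 by (induction ls) (auto intro!: add_nonneg_nonneg mult_nonneg_nonneg prod_list_nonneg)

lemma er_mono: "0 <= R ==> R <= \<rho>' ==> (\<And>g. g \<in> set ls ==> 0 <= g) ==> er R ls <= er \<rho>' ls"
proof (induction ls)
 case (Cons g ls)
 have "(1 + R * g) * er R ls <= (1 + \<rho>' * g) * er \<rho>' ls"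
  using Cons by (intro mult_mono er_nonneg add_left_mono mult_right_mono add_nonneg_nonneg mult_nonneg_nonneg) auto
 moreover have "(\<Prod>h\<leftarrow>ls. 1 + R * h) <= (\<Prod>h\<leftarrow>ls. 1 + \<rho>' * h)"
  using Cons.prems by (intro prod_list_mono) (auto intro!: mult_right_mono)
 ultimately show ?case by (simp add: add_mono)
qed simp

lemma pow_prod_le: "0 <= (R::real) ==> (\<And>g. g \<in> set ls ==> 0 <= g) ==> R ^ length ls * prod_list ls <= (\<Prod>h\<leftarrow>ls. 1 + R * h)"
proof (induction ls)
 case (Cons g ls)
 have "R ^ length (g # ls) * prod_list (g # ls) = (R * g) * (R ^ length ls * prod_list ls)" by simp
 also have "\<dots> <= (1 + R * g) * (\<Prod>h\<leftarrow>ls. 1 + R * h)"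
  using Cons by (intro mult_mono) (auto intro!: mult_nonneg_nonneg prod_list_nonneg)
 finally show ?case by simp
qed simp

text \<open>Induction on the dimension by slices. The inductive errors are multiplied by the number
  of slices, and by \<open>hk_sum\<close> the sum of the slice volumes differs from the volume of
  the ball by at most three times the largest slice.\<close>

theorem DL_count:
 "\<exists>C\<ge>1. \<forall>(xs::'a::real_inner list) u r. length xs = d --> bas xs --> 0 <= r -->
   finite (DL xs u r) \<and> \<bar>card (DL xs u r) - unit_ball_vol d * r ^ d * vol xs\<bar> <= C * er r (gs xs)"
proof (induction d)
 case 0
 have "DL [] u r = {0::'a}" if "0 <= r" for u r using that by (auto simp: DL_def)
 thus ?case by (auto intro!: exI[of _ 1])
next
 case (Suc d)
 then obtain C where C1: "C \<ge> 1" and C: "\<And>(xs::'a list) u r. length xs = d ==> bas xs ==> 0 <= r ==>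
   finite (DL xs u r) \<and> \<bar>card (DL xs u r) - unit_ball_vol d * r ^ d * vol xs\<bar> <= C * er r (gs xs)" by blast
 let ?O = "unit_ball_vol (Suc d)"
 let ?H = "unit_ball_vol d"
 \<comment> \<open>There are at most \<open>2 * B + 3\<close>, hence at most
   \<open>3 * (1 + B)\<close>, slices; the other 3 is the error in \<open>hk_sum\<close>.\<close>
 define K where "K = 3 * C + 3 * ?H"
 have vp: "0 < unit_ball_vol (real d)" by simp
 have "finite (DL ys u r) \<and> \<bar>card (DL ys u r) - ?O * r ^ Suc d * vol ys\<bar> <= K * er r (gs ys)"
  if ys: "length ys = Suc d" "bas ys" and \<rho>0: "0 <= r" for ys :: "'a list" and u r
 proof -
  let ?N = "r ^ d"
  let ?J = "er r (gs ys)"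
  let ?I = "?O * r ^ Suc d * vol ys"
  let ?D = "u 0"
  let ?C = "DL ys u r"
  obtain x xs where yx: "ys = x # xs" using ys by (cases ys) auto
  let ?M = "\<lambda>i c. u (Suc i) - ((c + ?D) / (x \<bullet> x)) * (x \<bullet> xs ! i)"
  let ?xs = "map (prj x) xs" and ?G = "gs (map (prj x) xs)"
  let ?F = "er r ?G"
  let ?E = "\<Prod>h\<leftarrow>?G. 1 + r * h"
  let ?A = "?H * ?N * vol ?xs"
  have x: "x \<noteq> 0" and bx: "bas ?xs" and len: "length ?xs = d" using ys yx by (auto simp: bas_Cons)
  have G0: "\<And>g. g \<in> set ?G ==> 0 <= g" by (rule gs_nonneg)
  have P1: "1 <= ?E" by (rule prod_list_ge1) (auto simp: \<rho>0 G0)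
  show ?thesis
  proof (cases "r = 0")
   \<comment> \<open>For radius 0 the step width \<open>B\<close> vanishes and the slices cannot be
     rescaled, but the set has at most one element.\<close>
   case True
   have s: "?C \<subseteq> {0}" by (auto simp: DL_def True)
   hence f: "finite ?C" by (rule finite_subset) simp
   have "card ?C <= 1" using card_mono[OF _ s] by simp
   moreover have "1 <= K * ?J"
   proof -
    have "1 <= ?J" using P1 er_nonneg[OF \<rho>0, of ?G, OF G0] by (simp add: yx True)
    moreover have "1 <= K" using C1 vp unfolding K_def by linarith
    ultimately have "1 * 1 <= K * ?J" by (intro mult_mono) auto
    thus ?thesis by simp
   qed
   ultimately show ?thesis using f True by simp
  next
   case False
   hence r: "0 < r" using \<rho>0 by simp
   define B where "B = r * norm x"
   let ?Q = "(1 + B) * ?F"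
   let ?L = "\<lambda>c. (c + ?D) / B"
   let ?K = "(2 * B + 3) * (C * ?F)"
   have B: "0 < B" using r x by (simp add: B_def)
   define I where "I = {c::int. \<bar>c + ?D\<bar> <= B}"
   define R where "R c = sqrt (r\<^sup>2 - ((real_of_int c + ?D) / norm x)\<^sup>2)" for c
   let ?P = "\<lambda>c. ?H * R c ^ d * vol ?xs"
   define D where "D c = DL ?xs (\<lambda>i. ?M i c) (R c)" for c :: int
   define f where "f c v = ((c + ?D) / (x \<bullet> x)) *\<^sub>R x + v" for c :: int and v
   have eq: "?C = (\<Union>c\<in>I. f c ` D c)"
    unfolding yx DL_Cons[OF x \<rho>0] I_def D_def f_def R_def B_def by simp
   have Ifin: "finite I" unfolding I_def abs_le_iff
    by (rule finite_subset[OF _ finite_int_interval[of "-B" "?D" B]]) auto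
   have Re: "R c = r * sqrt (1 - (?L c)\<^sup>2)" and R1: "\<bar>?L c\<bar> <= 1" if "c \<in> I" for c :: int
   proof -
    have "r\<^sup>2 - ((c + ?D) / norm x)\<^sup>2 = r\<^sup>2 * (1 - (?L c)\<^sup>2)"
     using r x by (simp add: B_def field_simps)
    thus "R c = r * sqrt (1 - (?L c)\<^sup>2)" using r by (simp add: R_def real_sqrt_mult)
    show "\<bar>?L c\<bar> <= 1" using that B by (simp add: I_def)
   qed
   have R: "0 <= R c" "R c <= r" "R c ^ d = ?N * hk d (?L c)" if "c \<in> I" for c
   proof -
    note r1 = R1[OF that]
    have s: "(?L c)\<^sup>2 <= 1" using r1 by (simp add: abs_square_le_1)
    show "0 <= R c" using s r unfolding Re[OF that] by (intro mult_nonneg_nonneg real_sqrt_ge_zero) linarith+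
    show "R c <= r" using r unfolding Re[OF that] by (intro mult_left_le) auto
    show "R c ^ d = ?N * hk d (?L c)"
     unfolding Re[OF that] using r1 by (simp add: power_mult_distrib hk_def)
   qed
   have fin: "finite (D c)" and cd: "\<bar>card (D c) - ?P c\<bar> <= C * ?F" if "c \<in> I" for c
   proof -
    note CC = C[OF len bx R(1)[OF that], of "\<lambda>i. ?M i c", folded D_def]
    thus "finite (D c)" by blast
    have "C * er (R c) ?G <= C * ?F"
     using C1 by (intro mult_left_mono er_mono R(1,2)[OF that]) (auto simp: gs_nonneg)
    thus "\<bar>card (D c) - ?P c\<bar> <= C * ?F" using CC by linarith
   qed
   have inj: "inj_on (f c) (D c)" for c by (auto simp: inj_on_def f_def)
   have fx: "f c v \<bullet> x = c + ?D" if "v \<in> D c" for c v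
    using span_prj_orth[of v x xs] that x by (auto simp: f_def D_def DL_def inner_add_left)
   have disj: "f c ` D c \<inter> f c' ` D c' = {}" if "c \<noteq> c'" for c c'
   proof -
    have False if "z \<in> f c ` D c" "z \<in> f c' ` D c'" for z
    proof -
     have "z \<bullet> x = c + ?D" "z \<bullet> x = c' + ?D" using that fx by auto
     thus False using \<open>c \<noteq> c'\<close> by simp
    qed
    thus ?thesis by blast
   qed
   have "card ?C = (\<Sum>c\<in>I. card (f c ` D c))"
    unfolding eq using disj fin by (intro card_UN_disjoint Ifin) auto
   also have "\<dots> = (\<Sum>c\<in>I. card (D c))" by (intro sum.cong refl card_image inj)
   finally have card: "real (card ?C) = (\<Sum>c\<in>I. real (card (D c)))" by simp
   \<comment> \<open>With exponent 0 every summand of \<open>hk_sum\<close> is 1, so that it counts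
     the slices.\<close>
   have cI: "card I <= 2 * B + 3"
   proof -
    have "(\<Sum>c\<in>I. hk 0 (?L c)) = (\<Sum>c\<in>I. 1)"
     by (intro sum.cong refl) (auto simp: hk_def dest: R1)
    thus ?thesis using hk_sum[OF B, where a="?D" and k=0] unfolding I_def by simp
   qed
   define S where "S = (\<Sum>c\<in>I. hk d (?L c))"
   let ?R = "\<bar>real (card ?C) - ?A * S\<bar>"
   let ?B = "S - B * (?O / ?H)"
   have main: "(\<Sum>c\<in>I. ?P c) = ?A * S"
    unfolding S_def sum_distrib_left by (intro sum.cong refl) (simp add: R)
   have e1: "?R <= ?K"
   proof -
    have "?R
      = \<bar>\<Sum>c\<in>I. real (card (D c)) - ?P c\<bar>"
     by (simp add: card main[symmetric] sum_subtractf)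
    also have "\<dots> <= (\<Sum>c\<in>I. C * ?F)"
     by (rule order_trans[OF sum_abs]) (intro sum_mono cd)
    also have "\<dots> = card I * (C * ?F)" by simp
    also have "\<dots> <= ?K"
     using cI C1 er_nonneg[OF \<rho>0 G0] by (intro mult_right_mono) auto
    finally show ?thesis .
   qed
   have v0: "0 < vol ?xs" by (rule vol_pos[OF bx])
   have e2: "\<bar>?A * S - ?I\<bar>
     <= 3 * ?H * (?N * vol ?xs)"
   proof -
    have "\<bar>?B\<bar> <= 3"
     using hk_sum[OF B, where a="?D" and k=d] unfolding S_def I_def .
    hence "?A * \<bar>?B\<bar>
      <= ?A * 3"
     using r v0 vp by (intro mult_left_mono) auto
    also have "?A * \<bar>?B\<bar>
      = \<bar>?A * ?B\<bar>"
     using r v0 vp by (simp add: abs_mult)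
    also have "?A * ?B
      = ?A * S - ?I"
    proof -
     have "?H \<noteq> 0" using vp by linarith
     thus ?thesis by (simp add: yx vol_Cons B_def field_simps)
    qed
    finally show ?thesis by (simp add: mult_ac)
   qed
   have "?N * vol ?xs <= ?E"
    using pow_prod_le[OF \<rho>0 G0, of ?G] len by (simp add: vol_def)
   hence e3: "3 * ?H * (?N * vol ?xs) <= K * ?E"
    using C1 vp P1 \<rho>0 vol_pos[OF bx] unfolding K_def by (intro mult_mono) auto
   have "?K <= 3 * (1 + B) * (C * ?F)"
    using B C1 er_nonneg[OF \<rho>0 G0] by (intro mult_right_mono) auto
   also have "\<dots> = 3 * C * ?Q" by simp
   also have "\<dots> <= K * ?Q"
    using B C1 vp er_nonneg[OF \<rho>0 G0] unfolding K_def by (intro mult_right_mono) auto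
   finally have e4: "?K <= K * ?Q" .
   have "?J = ?Q + ?E" by (simp add: yx B_def)
   hence "K * ?J = K * ?Q + K * ?E" by (simp add: algebra_simps)
   hence "\<bar>card ?C - ?I\<bar> <= K * ?J"
    using e1 e2 e3 e4 by linarith
   moreover have "finite ?C" unfolding eq using Ifin fin by auto
   ultimately show ?thesis by blast
  qed
 qed
 moreover have "K \<ge> 1" using C1 vp unfolding K_def by linarith
 ultimately show ?case by blast
qed

section \<open>Dual bases\<close>

text \<open>The dual basis. Its tail is the dual basis of the projected tail and hence orthogonal to
  \<open>x\<close>; its head is \<open>x\<close> made orthogonal to \<open>xs\<close> and normalised
  to have inner product 1 with \<open>x\<close>.\<close>

fun du :: "'a::real_inner list => 'a list" where
 "du [] = []"
| "du (x # xs) = (1 / (x \<bullet> x)) *\<^sub>R (x - (\<Sum>j<length xs. (x \<bullet> xs ! j) *\<^sub>R du (map (prj x) xs) ! j)) # du (map (prj x) xs)"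

lemma length_du [simp]: "length (du xs) = length xs"
 by (induction xs rule: gs.induct) auto

lemma span_prj_sub: "v \<in> span (set (map (prj x) xs)) ==> v \<in> span (set (x # xs))"
 unfolding span_set_Cons_prj by (rule subsetD[OF span_mono]) auto

lemma du_span: "set (du xs) \<subseteq> span (set xs)"
proof (induction xs rule: gs.induct)
 case (2 x xs)
 let ?A = "span (set (x # xs))"
 let ?D = "du (map (prj x) xs)"
 have D: "set ?D \<subseteq> ?A" using 2 span_prj_sub by blast
 have "(1 / (x \<bullet> x)) *\<^sub>R (x - (\<Sum>j<length xs. (x \<bullet> xs ! j) *\<^sub>R ?D ! j)) \<in> ?A"
 proof (intro span_scale span_diff span_sum)
  show "x \<in> ?A" by (simp add: span_base)
  fix j assume "j \<in> {..<length xs}"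
  thus "?D ! j \<in> ?A" by (intro subsetD[OF D] nth_mem) simp
 qed
 thus ?case using D by simp
qed simp

lemma du_inner:
 "bas xs ==> i < length xs ==> j < length xs ==> du xs ! i \<bullet> xs ! j = (if i = j then 1 else 0)"
proof (induction xs arbitrary: i j rule: gs.induct)
 case (2 x xs)
 let ?xs = "map (prj x) xs"
 let ?D = "du ?xs"
 let ?A = "\<Sum>j<length xs. (x \<bullet> xs ! j) *\<^sub>R ?D ! j"
 have x: "x \<noteq> 0" and b: "bas ?xs" using 2 by (auto simp: bas_Cons)
 have Dx: "?D ! k \<bullet> x = 0" if "k < length xs" for k
  using du_span[of ?xs] that by (intro span_prj_orth[of _ x xs]) auto
 have DD: "?D ! k \<bullet> xs ! l = (if k = l then 1 else 0)" if "k < length xs" "l < length xs" for k l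
  using 2(1)[OF b, of k l] that prj_inner[OF Dx[OF that(1)], of "xs ! l"] by (simp add: inner_commute)
 show ?case
 proof (cases i)
  case 0
  show ?thesis
  proof (cases j)
   case 0
   have "?A \<bullet> x = 0"
    by (simp add: inner_sum_left Dx)
   thus ?thesis using x \<open>i = 0\<close> 0 by (simp add: inner_diff_left)
  next
   case (Suc l)
   hence l: "l < length xs" using 2 by simp
   have "?A \<bullet> xs ! l = (\<Sum>j<length xs. if j = l then x \<bullet> xs ! l else 0)"
    unfolding inner_sum_left by (intro sum.cong) (auto simp: DD l)
   thus ?thesis using \<open>i = 0\<close> Suc l by (simp add: inner_diff_left)
  qed
 next
  case (Suc k)
  thus ?thesis using 2 Dx DD by (cases j) auto
 qed
qed simp

text \<open>In reversed order the head of \<open>du\<close> comes last. The other dual vectors are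
  orthogonal to \<open>x\<close>, and projecting them away leaves \<open>x\<close> divided by its
  squared norm.\<close>

lemma rev_du_gs: "bas xs ==> gs (rev (du xs)) = rev (map inverse (gs xs))"
proof (induction xs rule: gs.induct)
 case (2 x xs)
 let ?A = "1 / (x \<bullet> x)"
 let ?xs = "map (prj x) xs"
 let ?D = "du ?xs"
 have x: "x \<noteq> 0" and b: "bas ?xs" using 2 by (auto simp: bas_Cons)
 have Dx: "y \<bullet> x = 0" if "y \<in> set ?D" for y
  using du_span[of ?xs] that by (intro span_prj_orth[of _ x xs]) auto
 have "prjs (rev ?D) (du (x # xs) ! 0) = ?A *\<^sub>R x"
 proof (rule prjs_eqI)
  have "- (?A *\<^sub>R (\<Sum>j<length xs. (x \<bullet> xs ! j) *\<^sub>R ?D ! j)) \<in> span (set (rev ?D))"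
   by (intro span_neg span_scale span_sum) (auto intro!: span_base)
  thus "du (x # xs) ! 0 - ?A *\<^sub>R x \<in> span (set (rev ?D))" by (simp add: algebra_simps)
 qed (use Dx in \<open>auto simp: inner_commute\<close>)
 moreover have "norm (?A *\<^sub>R x) = inverse (norm x)"
  using x by (simp add: dot_square_norm power2_eq_square field_simps)
 ultimately show ?case using 2(1)[OF b] by (simp add: gs_snoc)
qed simp

lemma bas_rev_du: "bas xs ==> bas (rev (du xs))"
 by (auto simp: bas_def rev_du_gs)

lemma vol_rev_du: "bas xs ==> vol (rev (du xs)) = 1 / vol xs"
proof -
 have "prod_list (rev (map inverse ys)) = inverse (prod_list ys)" for ys :: "real list"
  by (induction ys) (auto simp: mult.commute)
 thus "bas xs ==> ?thesis" by (simp add: vol_def rev_du_gs divide_inverse)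
qed

lemma span_du: "bas xs ==> span (set (du xs)) = span (set (xs :: 'a::euclidean_space list))"
proof (rule subspace_dim_equal)
 show "span (set (du xs)) \<subseteq> span (set xs)" by (simp add: du_span span_minimal)
 assume "bas xs"
 thus "dim (span (set xs)) <= dim (span (set (du xs)))"
  using bas_rev_du[of xs] by (simp add: bas_iff_dim)
qed auto

lemma span_orth_0: "v \<in> span S ==> (\<And>x. x \<in> S ==> v \<bullet> x = 0) ==> v = (0::'a::real_inner)"
 using orth_span[of S v v] by auto

lemma du_expand:
 assumes "bas xs" "v \<in> span (set (xs :: 'a::euclidean_space list))"
 shows "v = (\<Sum>i<length xs. (v \<bullet> xs ! i) *\<^sub>R du xs ! i)"
proof -
 let ?A = "\<Sum>i<length xs. (v \<bullet> xs ! i) *\<^sub>R du xs ! i"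
 let ?w = "v - ?A"
 have "?w = 0"
 proof (rule span_orth_0[of _ "set xs"])
  show "?w \<in> span (set xs)" using assms du_span[of xs]
   by (intro span_diff span_sum span_scale) (auto simp: subset_iff)
  fix x assume "x \<in> set xs"
  then obtain j where j: "j < length xs" "x = xs ! j" by (auto simp: in_set_conv_nth)
  have "?A \<bullet> xs ! j = (\<Sum>i<length xs. if i = j then v \<bullet> xs ! j else 0)"
   unfolding inner_sum_left by (intro sum.cong) (auto simp: du_inner assms j)
  thus "?w \<bullet> x = 0" using j by (simp add: inner_diff_left)
 qed
 thus ?thesis by simp
qed

lemma du_coords:
 assumes "bas xs" "v \<in> span (set (xs :: 'a::euclidean_space list))"
 shows "v = (\<Sum>i<length xs. (v \<bullet> du xs ! i) *\<^sub>R xs ! i)"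
proof -
 let ?A = "\<Sum>i<length xs. (v \<bullet> du xs ! i) *\<^sub>R xs ! i"
 let ?w = "v - ?A"
 have "?w = 0"
 proof (rule span_orth_0[of _ "set (du xs)"])
  show "?w \<in> span (set (du xs))" unfolding span_du[OF assms(1)] using assms
   by (intro span_diff span_sum span_scale) (auto intro: span_base)
  fix x assume "x \<in> set (du xs)"
  then obtain j where j: "j < length xs" "x = du xs ! j" by (auto simp: in_set_conv_nth)
  have "?A \<bullet> du xs ! j = (\<Sum>i<length xs. if i = j then v \<bullet> du xs ! j else 0)"
   unfolding inner_sum_left by (intro sum.cong) (auto simp: inner_commute[of "xs ! _"] du_inner assms j)
  thus "?w \<bullet> x = 0" using j by (simp add: inner_diff_left)
 qed
 thus ?thesis by simp
qed

lemma zs_iff_du: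
 fixes v :: "'a::euclidean_space"
 assumes "bas xs"
 shows "v \<in> zs xs \<longleftrightarrow> v \<in> span (set xs) \<and> (\<forall>i<length xs. \<exists>c::int. v \<bullet> du xs ! i = c)"
  (is "_ \<longleftrightarrow> ?R")
proof
 assume v: "v \<in> zs xs"
 then obtain c :: "nat => int" where c: "v = (\<Sum>i<length xs. of_int (c i) *\<^sub>R xs ! i)" unfolding zs_comb by blast
 have "v \<bullet> du xs ! j = c j" if j: "j < length xs" for j
 proof -
  have "v \<bullet> du xs ! j = (\<Sum>i<length xs. if i = j then of_int (c j) else 0)"
   unfolding c inner_sum_left by (intro sum.cong) (auto simp: inner_commute[of "xs ! _"] du_inner assms j)
  thus ?thesis using j by simp
 qed
 moreover have "v \<in> span (set xs)" using v span_zs[of xs] span_base by blast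
 ultimately show ?R by blast
next
 assume R: ?R
 then obtain c :: "nat => int" where c: "\<And>i. i < length xs ==> v \<bullet> du xs ! i = c i" by metis
 have "v = (\<Sum>i<length xs. of_int (c i) *\<^sub>R xs ! i)"
  using du_coords[OF assms, of v] R c by simp
 thus "v \<in> zs xs" unfolding zs_comb by blast
qed

lemma zs_du_iff:
 fixes v :: "'a::euclidean_space"
 assumes "bas xs"
 shows "v \<in> zs (du xs) \<longleftrightarrow> v \<in> span (set xs) \<and> (\<forall>i<length xs. \<exists>c::int. v \<bullet> xs ! i = c)"
  (is "_ \<longleftrightarrow> ?R")
proof
 assume v: "v \<in> zs (du xs)"
 then obtain c :: "nat => int" where c: "v = (\<Sum>i<length xs. of_int (c i) *\<^sub>R du xs ! i)" unfolding zs_comb by auto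
 have "v \<bullet> xs ! j = c j" if j: "j < length xs" for j
 proof -
  have "v \<bullet> xs ! j = (\<Sum>i<length xs. if i = j then of_int (c j) else 0)"
   unfolding c inner_sum_left by (intro sum.cong) (auto simp: du_inner assms j)
  thus ?thesis using j by simp
 qed
 moreover have "v \<in> span (set xs)" using v span_zs[of "du xs"] span_base span_du[OF assms] by blast
 ultimately show ?R by blast
next
 assume R: ?R
 then obtain c :: "nat => int" where c: "\<And>i. i < length xs ==> v \<bullet> xs ! i = c i" by metis
 have "v = (\<Sum>i<length (du xs). of_int (c i) *\<^sub>R du xs ! i)"
  using du_expand[OF assms, of v] R c by simp
 thus "v \<in> zs (du xs)" unfolding zs_comb by blast
qed

section \<open>Asymptotic counts and the determinant\<close>

text \<open>Each product in \<open>er\<close> omits one factor and so has degree less than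
  \<open>length ls\<close> in \<open>R\<close>.\<close>

lemma er_lim: "((\<lambda>R. er R ls / R ^ length ls) \<longlongrightarrow> 0) at_top"
proof (induction ls)
 case (Cons g ls)
 let ?A = "\<lambda>ls (R::real). (\<Prod>h\<leftarrow>ls. 1 + R * h) / R ^ length ls"
 have inv: "((\<lambda>R::real. 1 / R) \<longlongrightarrow> 0) at_top"
  using tendsto_inverse_0_at_top[OF filterlim_ident] by (simp add: inverse_eq_divide)
 have "((\<lambda>R. ?A ls R) \<longlongrightarrow> prod_list ls) at_top" for ls :: "real list"
 proof (induction ls)
  case (Cons h ls)
  have "((\<lambda>R. (1 / R + h) * (?A ls R)) \<longlongrightarrow> (0 + h) * prod_list ls) at_top"
   by (intro tendsto_intros inv Cons)
  moreover have "\<forall>\<^sub>F R in at_top. (1 / R + h) * (?A ls R) = (\<Prod>h\<leftarrow>h#ls. 1 + R * h) / R ^ length (h#ls)"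
   using eventually_gt_at_top[of 0] by eventually_elim (simp add: field_simps)
  ultimately show ?case by (simp add: tendsto_cong)
 qed simp
 note P = this[of ls]
 let ?B = "\<lambda>(R::real). (1 / R + g) * (er R ls / R ^ length ls) + (1 / R) * (?A ls R)"
 have "((\<lambda>R. ?B R) \<longlongrightarrow> (0 + g) * 0 + 0 * prod_list ls) at_top"
  by (intro tendsto_intros inv Cons P)
 moreover have "\<forall>\<^sub>F R in at_top. ?B R = er R (g#ls) / R ^ length (g#ls)"
  using eventually_gt_at_top[of 0] by eventually_elim (simp add: field_simps)
 ultimately show ?case by (simp add: tendsto_cong)
qed simp

lemma DL_lim:
 assumes "bas xs"
 shows "((\<lambda>R. card (DL xs a R) / R ^ length xs) \<longlongrightarrow> unit_ball_vol (length xs) * vol xs) at_top"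
proof -
 let ?d = "length xs"
 let ?C = "\<lambda>(R::real). card (DL xs a R) - unit_ball_vol ?d * R ^ ?d * vol xs"
 let ?A = "\<lambda>(R::real). card (DL xs a R) / R ^ ?d - unit_ball_vol ?d * vol xs"
 obtain C where C: "\<And>R. 0 <= R ==> \<bar>?C R\<bar> <= C * er R (gs xs)"
  using DL_count[of ?d] assms by blast
 let ?B = "\<lambda>R. C * (er R (gs xs) / R ^ ?d)"
 have "(?B \<longlongrightarrow> C * 0) at_top"
  using er_lim[of "gs xs"] by (intro tendsto_intros) simp
 hence "(?B \<longlongrightarrow> 0) at_top" by simp
 hence "((\<lambda>R. ?A R) \<longlongrightarrow> 0) at_top"
 proof (rule Lim_null_comparison[rotated])
  show "\<forall>\<^sub>F R in at_top. norm (?A R) <= C * (er R (gs xs) / R ^ ?d)"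
   using eventually_gt_at_top[of 0]
  proof eventually_elim
   case (elim R)
   have "?A R = (?C R) / R ^ ?d"
    using elim by (simp add: field_simps)
   also have "norm \<dots> <= (C * er R (gs xs)) / R ^ ?d"
    using C[of R] elim by (simp add: divide_right_mono)
   finally show ?case by simp
  qed
 qed
 thus ?thesis by (simp add: LIM_zero_iff)
qed

text \<open>Biduality: a lattice is cut out by integrality on its dual basis. The dual basis is
  reversed because in that order its Gram--Schmidt norms are the inverses given by
  \<open>rev_du_gs\<close>.\<close>

lemma zs_shift_DL:
 assumes b: "bas (xs :: 'a::euclidean_space list)" and t: "t \<in> span (set xs)"
 shows "(+) t ` zs xs \<inter> cball 0 R = DL (rev (du xs)) (\<lambda>i. t \<bullet> rev (du xs) ! i) R"
proof -
 have *: "v \<in> (+) t ` zs xs \<longleftrightarrow> v - t \<in> zs xs" for v by (auto simp: image_iff) (metis add_diff_cancel_left' diff_add_cancel add.commute)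
 have st: "v - t \<in> span (set xs) \<longleftrightarrow> v \<in> span (set xs)" for v
  using t by (metis diff_add_cancel span_add span_diff)
 have "(\<forall>i<length xs. \<exists>c::int. (v - t) \<bullet> du xs ! i = c) \<longleftrightarrow> (\<forall>i<length xs. \<exists>c::int. v \<bullet> rev (du xs) ! i = c + t \<bullet> rev (du xs) ! i)" for v
 proof
  assume L: "\<forall>i<length xs. \<exists>c::int. (v - t) \<bullet> du xs ! i = c"
  show "\<forall>i<length xs. \<exists>c::int. v \<bullet> rev (du xs) ! i = c + t \<bullet> rev (du xs) ! i"
  proof safe
   fix i assume "i < length xs"
   thus "\<exists>c::int. v \<bullet> rev (du xs) ! i = c + t \<bullet> rev (du xs) ! i"
    using L[rule_format, of "length xs - Suc i"] by (auto simp: rev_nth inner_diff_left diff_eq_eq)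
  qed
 next
  assume L: "\<forall>i<length xs. \<exists>c::int. v \<bullet> rev (du xs) ! i = c + t \<bullet> rev (du xs) ! i"
  show "\<forall>i<length xs. \<exists>c::int. (v - t) \<bullet> du xs ! i = c"
  proof safe
   fix i assume "i < length xs"
   thus "\<exists>c::int. (v - t) \<bullet> du xs ! i = c"
    using L[rule_format, of "length xs - Suc i"] by (auto simp: rev_nth inner_diff_left diff_eq_eq)
  qed
 qed
 note ints = this
 have "v \<in> (+) t ` zs xs \<inter> cball 0 R \<longleftrightarrow> v \<in> DL (rev (du xs)) (\<lambda>i. t \<bullet> rev (du xs) ! i) R" for v
  unfolding DL_def Int_iff * zs_iff_du[OF b] st ints using span_du[OF b] by simp
 thus ?thesis by blast
qed

lemma zs_shift_lim:
 assumes b: "bas (xs :: 'a::euclidean_space list)" and t: "t \<in> span (set xs)"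
 shows "((\<lambda>R. card ((+) t ` zs xs \<inter> cball 0 R) / R ^ length xs) \<longlongrightarrow> unit_ball_vol (length xs) / vol xs) at_top"
 using DL_lim[OF bas_rev_du[OF b], of "\<lambda>i. t \<bullet> rev (du xs) ! i"]
 by (simp add: zs_shift_DL[OF b t] vol_rev_du[OF b])

lemma zs_lim:
 assumes b: "bas (xs :: 'a::euclidean_space list)"
 shows "((\<lambda>R. card (zs xs \<inter> cball 0 R) / R ^ length xs) \<longlongrightarrow> unit_ball_vol (length xs) / vol xs) at_top"
proof -
 have "(+) 0 ` zs xs = zs xs" by auto
 thus ?thesis using zs_shift_lim[OF b, of 0] by (simp add: span_zero)
qed

lemma zs_finite:
 assumes b: "bas (xs :: 'a::euclidean_space list)"
 shows "finite (zs xs \<inter> cball 0 R)"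
proof (cases "0 <= R")
 case True
 let ?A = "DL (rev (du xs)) (\<lambda>i. 0 \<bullet> rev (du xs) ! i) R"
 have "zs xs \<inter> cball 0 R = ?A"
  using zs_shift_DL[OF b, of 0 R] by (simp add: span_zero)
 moreover have "finite ?A"
  using DL_count[of "length xs"] bas_rev_du[OF b] True by (metis length_du length_rev)
 ultimately show ?thesis by simp
qed auto

text \<open>Both volumes are determined by the density of the same set of lattice points in large
  balls.\<close>

lemma vol_unique:
 assumes "bas xs" "bas (ys :: 'a::euclidean_space list)" "zs xs = zs ys"
 shows "vol xs = vol ys" "length xs = length ys"
proof -
 let ?A = "unit_ball_vol (length xs)"
 show l: "length xs = length ys" using assms dim_zs by metis
 have "?A / vol xs = ?A / vol ys"
  using tendsto_unique[OF _ zs_lim[OF assms(1)]] zs_lim[OF assms(2)] l assms(3) by simp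
 moreover have "?A \<noteq> 0" using unit_ball_vol_pos[of "real (length xs)"] by (metis less_irrefl of_nat_0_le_iff)
 ultimately show "vol xs = vol ys" using vol_pos[OF assms(1)] vol_pos[OF assms(2)] by (simp add: field_simps)
qed

definition ldet :: "'a::euclidean_space set => real" where
 "ldet M = vol (SOME xs. bas xs \<and> zs xs = M)"

lemma ldet_zs: assumes "bas xs" shows "ldet (zs xs) = vol xs"
proof -
 let ?A = "SOME ys. bas ys \<and> zs ys = zs xs"
 have "bas ?A \<and> zs ?A = zs xs"
  by (rule someI[of _ xs]) (simp add: assms)
 thus ?thesis unfolding ldet_def using vol_unique assms by blast
qed

section \<open>Discrete subgroups and reduced bases\<close>

definition dsg :: "'a::euclidean_space set => bool" where
 "dsg M \<longleftrightarrow> sgrp M \<and> (\<forall>r. finite (M \<inter> cball 0 r))"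

lemma dsg_sgrp: "dsg M ==> sgrp M" by (simp add: dsg_def)
lemma dsg_zs: "bas xs ==> dsg (zs xs)" by (simp add: dsg_def zs_finite)
lemma dsg_sub: "dsg L ==> sgrp M ==> M \<subseteq> L ==> dsg M"
 unfolding dsg_def by (meson Int_mono finite_subset order_refl)

lemma round_lift:
 fixes x :: "'a::real_inner"
 obtains c :: int where "\<bar>(y - of_int c *\<^sub>R x) \<bullet> x\<bar> <= (x \<bullet> x) / 2"
proof
 let ?B = "x \<bullet> x"
 let ?t = "(y \<bullet> x) / ?B"
 let ?A = "of_int (round ?t)"
 let ?C = "(y - ?A *\<^sub>R x) \<bullet> x"
 show "\<bar>?C\<bar> <= ?B / 2"
 proof (cases "x = 0")
  case False
  hence e: "?C = (?t - ?A) * ?B"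
   by (simp add: inner_diff_left field_simps)
  have "\<bar>?t - ?A\<bar> <= 1 / 2" using of_int_round_abs_le[of ?t] by (simp add: abs_minus_commute)
  hence "\<bar>?t - ?A\<bar> * ?B <= 1 / 2 * ?B" by (intro mult_right_mono) auto
  thus ?thesis unfolding e by (simp add: abs_mult)
 qed simp
qed

text \<open>Two elements of \<open>M\<close> with the same projection differ by a multiple of
  \<open>x\<close>, and \<open>Z\<close> admits integral multiples only.\<close>

lemma lift_zs:
 assumes M: "sgrp M" "x \<in> M" "x \<noteq> 0" and Z: "\<And>t. t *\<^sub>R x \<in> M ==> t \<in> \<int>"
  and ys: "set ys \<subseteq> M" "zs (map (prj x) ys) = prj x ` M"
 shows "zs (x # ys) = M"
proof
 show "zs (x # ys) \<subseteq> M" using M ys by (intro zs_least) auto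
 show "M \<subseteq> zs (x # ys)"
 proof
  fix z assume z: "z \<in> M"
  hence "prj x z \<in> prj x ` zs ys" using ys(2) by (simp add: zs_image)
  then obtain w where w: "w \<in> zs ys" "prj x z = prj x w" by blast
  hence wM: "w \<in> M" using zs_least[OF M(1) ys(1)] by blast
  let ?A = "(z - w) \<bullet> x / (x \<bullet> x)"
  have p: "prj x (z - w) = 0" using w(2) by (simp add: linear_diff)
  hence zw: "z - w = ?A *\<^sub>R x" by (metis add.right_neutral prj_decomp)
  hence "?A \<in> \<int>" using Z sgrp_diff[OF M(1) z wM] by metis
  then obtain c :: int where "?A = of_int c" by (auto elim: Ints_cases)
  hence "z = of_int c *\<^sub>R x + w" using zw by (simp add: algebra_simps)
  thus "z \<in> zs (x # ys)" using zs_ConsI[OF w(1)] by simp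
 qed
qed

text \<open>By rounding, every projected point of norm at most \<open>r\<close> has a preimage in
  \<open>M\<close> of norm at most \<open>r + norm x\<close>, and there are finitely many of
  these.\<close>

lemma dsg_prj:
 assumes "dsg M" "x \<in> M" shows "dsg (prj x ` M)"
 unfolding dsg_def
proof (intro conjI allI)
 let ?D = "x \<bullet> x"
 show "sgrp (prj x ` M)" using assms by (simp add: sgrp_image dsg_sgrp)
 fix r
 let ?C = "prj x ` (M \<inter> cball 0 (r + norm x))"
 let ?A = "prj x ` M \<inter> cball 0 r"
 have "?A \<subseteq> ?C"
 proof
  fix w assume w: "w \<in> ?A"
  then obtain y where y: "y \<in> M" "w = prj x y" by blast
  obtain c :: int where c: "\<bar>(y - of_int c *\<^sub>R x) \<bullet> x\<bar> <= ?D / 2" by (rule round_lift)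
  let ?z = "y - of_int c *\<^sub>R x"
  let ?B = "norm (((?z \<bullet> x) / ?D) *\<^sub>R x)"
  have z: "?z \<in> M" using assms y by (intro sgrp_diff sgrp_int dsg_sgrp)
  have pz: "prj x ?z = w" using y by (simp add: linear_diff)
  have "norm ?z <= ?B + norm (prj x ?z)"
   by (subst (1) prj_decomp[of ?z x]) (rule norm_triangle_ineq)
  also have "?B <= 1 * norm x"
  proof -
   have "\<bar>?z \<bullet> x\<bar> / ?D <= 1"
   proof (cases "x = 0")
    case False
    hence "0 < ?D" by simp
    thus ?thesis using c by (simp add: divide_le_eq)
   qed simp
   thus ?thesis unfolding norm_scaleR by (intro mult_right_mono) auto
  qed
  finally have "?z \<in> cball 0 (r + norm x)" using w pz by simp
  thus "w \<in> ?C" using z pz by blast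
 qed
 thus "finite ?A"
  by (rule finite_subset) (use assms in \<open>simp add: dsg_def\<close>)
qed

lemma dim_prj:
 assumes "x \<in> M" "x \<noteq> (0::'a::euclidean_space)" shows "dim M = Suc (dim (prj x ` M))"
proof -
 let ?A = "prj x ` M"
 have "x \<notin> span ?A"
 proof
  assume "x \<in> span ?A"
  hence "x \<bullet> x = 0" by (rule orth_span[rotated]) auto
  thus False using assms by simp
 qed
 hence "dim (insert x ?A) = Suc (dim ?A)" by (simp add: dim_insert)
 moreover have "dim (insert x ?A) = dim (insert x M)" by (metis dim_span span_insert_prj)
 ultimately show ?thesis using assms by (simp add: insert_absorb)
qed

text \<open>Reducedness is reduced to two consequences: Gram--Schmidt norms shrink at most by the
  factor 2 from one vector to the next, and no basis vector is much longer than its Gram--Schmidt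
  norm.\<close>

definition red :: "'a::real_inner list => bool" where
 "red xs \<longleftrightarrow> bas xs \<and> (\<forall>i. Suc i < length xs --> gs xs ! i <= 2 * gs xs ! Suc i) \<and>
   (\<forall>i<length xs. norm (xs ! i) <= (\<Sum>j\<le>i. gs xs ! j))"

lemma red_bas: "red xs ==> bas xs" by (simp add: red_def)

text \<open>A shortest vector \<open>x\<close> comes first; the rest is a reduced basis of the
  projection, lifted with rounded coefficients. For a lift of \<open>w\<close> the squared norm lies
  between that of \<open>x\<close> and a quarter of it plus the squared norm of \<open>w\<close>,
  whence \<open>norm x <= 2 * norm w\<close>.\<close>

theorem ex_red: "dsg M ==> \<exists>xs. red xs \<and> zs xs = M"
proof (induction "dim M" arbitrary: M)
 case 0
 hence "M = {0}" using sgrp_0[OF dsg_sgrp[OF 0(2)]] by (auto simp: dim_eq_0)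
 thus ?case by (intro exI[of _ "[]"]) (auto simp: red_def)
next
 case (Suc d)
 let ?F = "\<lambda>x. (x \<bullet> x) / 2"
 note M = Suc.prems note Ms = dsg_sgrp[OF M]
 have "\<exists>y\<in>M. y \<noteq> 0" using Suc(2) by (metis dim_eq_0 insertCI subsetI nat.distinct(1))
 then obtain y where y: "y \<in> M" "y \<noteq> 0" by blast
 let ?S = "M \<inter> cball 0 (norm y) - {0}"
 have "finite ?S" "?S \<noteq> {}" using M y by (auto simp: dsg_def)
 hence fin: "finite (norm ` ?S)" and ne: "norm ` ?S \<noteq> {}" by auto
 obtain x where x: "x \<in> ?S" "norm x = Min (norm ` ?S)" using Min_in[OF fin ne] by (elim imageE) metis
 have xmin: "norm x <= norm z" if "z \<in> ?S" for z using Min_le[OF fin, of "norm z"] that x(2) by simp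
 from x(1)
 have xM: "x \<in> M" "x \<noteq> 0" by auto
 have short: "norm x <= norm z" if "z \<in> M" "z \<noteq> 0" for z
 proof (cases "norm z <= norm y")
  case True thus ?thesis using that by (intro xmin) auto
 next
  case False thus ?thesis using x(1) by auto
 qed
 \<comment> \<open>A shortest vector is primitive: otherwise subtracting the nearest integral
   multiple would leave a shorter nonzero vector.\<close>
 have Z: "t \<in> \<int>" if t: "t *\<^sub>R x \<in> M" for t
 proof -
  let ?B = "of_int (round t)"
  have "t *\<^sub>R x - ?B *\<^sub>R x \<in> M" using Ms t xM by (intro sgrp_diff sgrp_int)
  hence m: "(t - ?B) *\<^sub>R x \<in> M" by (simp add: scaleR_left_diff_distrib)
  have "\<bar>t - ?B\<bar> <= 1 / 2" using of_int_round_abs_le[of t] by (simp add: abs_minus_commute)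
  hence "norm ((t - ?B) *\<^sub>R x) <= 1 / 2 * norm x" unfolding norm_scaleR by (intro mult_right_mono) auto
  also have "\<dots> < norm x" using xM by simp
  finally have "(t - ?B) *\<^sub>R x = 0" using short[OF m] by force
  hence "t = ?B" using xM by simp
  thus ?thesis by (metis Ints_of_int)
 qed
 have "\<forall>w\<in>prj x ` M. \<exists>z. z \<in> M \<and> prj x z = w \<and> \<bar>z \<bullet> x\<bar> <= ?F x"
 proof
  fix w assume "w \<in> prj x ` M"
  then obtain u where u: "u \<in> M" "w = prj x u" by blast
  obtain c :: int where c: "\<bar>(u - of_int c *\<^sub>R x) \<bullet> x\<bar> <= ?F x" by (rule round_lift)
  have "u - of_int c *\<^sub>R x \<in> M" using Ms u xM by (intro sgrp_diff sgrp_int)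
  moreover have "prj x (u - of_int c *\<^sub>R x) = w" using u by (simp add: linear_diff)
  ultimately show "\<exists>z. z \<in> M \<and> prj x z = w \<and> \<bar>z \<bullet> x\<bar> <= ?F x" using c by blast
 qed
 then obtain f where f: "\<And>w. w \<in> prj x ` M ==> f w \<in> M \<and> prj x (f w) = w \<and> \<bar>f w \<bullet> x\<bar> <= ?F x" by metis
 let ?D = "(norm x / 2)\<^sup>2"
 let ?A = "(norm x)\<^sup>2"
 have fn: "(norm (f w))\<^sup>2 <= ?D + (norm w)\<^sup>2" if w: "w \<in> prj x ` M" for w
 proof -
  let ?E = "\<bar>f w \<bullet> x\<bar> / norm x"
  have "?E <= norm x / 2"
   using f[OF w] xM by (simp add: divide_le_eq dot_square_norm power2_eq_square)
  hence "?E\<^sup>2 <= ?D" by (intro power_mono) auto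
  thus ?thesis using norm_prj[of "f w" x] f[OF w] by (simp add: power_divide)
 qed
 have low: "norm x <= 2 * norm w" if w: "w \<in> prj x ` M" "w \<noteq> 0" for w
 proof -
  let ?G = "(norm w)\<^sup>2"
  have "f w \<noteq> 0" using f[OF w(1)] w(2) by (auto simp: linear_0)
  hence "?A <= (norm (f w))\<^sup>2" using short f[OF w(1)] by (intro power_mono) auto
  with fn[OF w(1)] have "?A <= ?D + ?G" by linarith
  hence "?A <= ?A / 4 + ?G" by (simp add: power_divide)
  hence "?A <= 4 * ?G" using zero_le_power2[of "norm w"] by linarith
  hence "?A <= (2 * norm w)\<^sup>2" by (simp add: power_mult_distrib)
  thus ?thesis by (rule power2_le_imp_le) simp
 qed
 have "dim (prj x ` M) = d" using dim_prj[OF xM] Suc(2) by simp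
 from Suc(1)[OF this[symmetric] dsg_prj[OF M xM(1)]] obtain ws where ws: "red ws" "zs ws = prj x ` M" by blast
 have wsM: "set ws \<subseteq> prj x ` M" using set_sub_zs ws by blast
 let ?ys = "map f ws"
 let ?C = "x # ?ys"
 have p: "map (prj x) ?ys = ws" using f wsM by (intro nth_equalityI) (auto simp: subset_iff)
 have z: "zs ?C = M"
  by (rule lift_zs[OF Ms xM Z]) (use f wsM p ws in auto)
 have g: "gs ?C = norm x # gs ws" using p by simp
 have "red ?C" unfolding red_def
 proof (intro conjI allI impI)
  show "bas ?C" using xM p ws by (auto simp: bas_Cons red_def comp_def)
  fix i assume i: "Suc i < length ?C"
  show "gs ?C ! i <= 2 * gs ?C ! Suc i"
  proof (cases i)
   case 0
   obtain w ws' where w: "ws = w # ws'" using i by (cases ws) auto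
   hence "w \<noteq> 0" using red_bas[OF ws(1)] by (auto simp: bas_Cons)
   thus ?thesis unfolding g using low[of w] wsM w 0 by simp
  qed (use ws i in \<open>auto simp: g red_def simp del: gs.simps\<close>)
 next
  fix i assume i: "i < length ?C"
  show "norm (?C ! i) <= (\<Sum>j\<le>i. gs ?C ! j)"
  proof (cases i)
   case (Suc k)
   let ?w = "ws ! k"
   have k: "k < length ws" using i Suc by simp
   hence "(norm (f ?w))\<^sup>2 <= ?D + (norm ?w)\<^sup>2" using wsM by (intro fn) auto
   also have "\<dots> <= (norm x / 2 + norm ?w)\<^sup>2" by (simp add: power2_sum)
   finally have "norm (f ?w) <= norm x / 2 + norm ?w" by (rule power2_le_imp_le) simp
   also have "\<dots> <= norm x + norm ?w" by simp
   also have "norm ?w <= (\<Sum>j\<le>k. gs ws ! j)" using ws k by (simp add: red_def)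
   finally show ?thesis unfolding g Suc using k by (subst sum.atMost_Suc_shift) simp
  qed simp
 qed
 thus ?case using z by blast
qed

lemma dsg_basis: assumes "dsg M" obtains xs where "bas xs" "zs xs = M" "length xs = dim M"
 using ex_red[OF assms] dim_zs red_bas by metis

lemma bas_Cons_notin_span: "bas (x # xs) ==> x \<notin> span (set (xs :: 'a::euclidean_space list))"
 using bas_indep[of "x # xs"] by (auto simp: dependent_def)

text \<open>Projection along the first vector of \<open>ps\<close> preserves the hypothesis that
  \<open>ps\<close> generates a saturated subgroup; once \<open>ps\<close> is used up, any basis of
  what is left will do.\<close>

theorem basis_extend:
 assumes "dsg A" "bas ps" "zs ps = A \<inter> span (set ps)"
 shows "\<exists>qs. bas (ps @ qs) \<and> zs (ps @ qs) = A"
 using assms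
proof (induction ps arbitrary: A rule: gs.induct)
 case 1
 thus ?case using dsg_basis by (metis append_Nil)
next
 case (2 x ps)
 let ?B = "map (prj x) ps"
 let ?A = "prj x ` A \<inter> span (set ?B)"
 note A = 2(2) and As = dsg_sgrp[OF 2(2)]
 have x: "x \<noteq> 0" "bas ?B" using 2 by (auto simp: bas_Cons)
 have xA: "set (x # ps) \<subseteq> A" using set_sub_zs 2(4) by blast
 have "zs ?B = ?A"
 proof
  show "zs ?B \<subseteq> ?A"
   using xA As by (intro zs_least sgrp_Int sgrp_image) (auto intro: span_base)
  show "?A \<subseteq> zs ?B"
  proof
   fix w assume w: "w \<in> ?A"
   then obtain y where y: "y \<in> A" "w = prj x y" by blast
   have "y = (y \<bullet> x / (x \<bullet> x)) *\<^sub>R x + w" unfolding y by (rule prj_decomp)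
   also have "\<dots> \<in> span (set (x # ps))"
    using w span_prj_sub[of w x ps] by (intro span_add span_scale) (auto intro: span_base)
   finally have "y \<in> zs (x # ps)" using 2(4) y by blast
   hence "w \<in> prj x ` zs (x # ps)" using y by blast
   hence "w \<in> zs (map (prj x) (x # ps))" by (simp only: zs_image[OF linear_prj])
   thus "w \<in> zs ?B" by simp
  qed
 qed
 from 2(1)[OF dsg_prj[OF A] x(2) this] xA
 obtain qs' where qs': "bas (map (prj x) ps @ qs')" "zs (map (prj x) ps @ qs') = prj x ` A" by auto
 have sub: "set qs' \<subseteq> prj x ` A" using set_sub_zs[of "map (prj x) ps @ qs'"] qs' by auto
 define f where "f w = (SOME z. z \<in> A \<and> prj x z = w)" for w
 have f: "f w \<in> A \<and> prj x (f w) = w" if "w \<in> set qs'" for w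
  unfolding f_def using that sub by (intro someI_ex[of "\<lambda>z. z \<in> A \<and> prj x z = w"]) blast
 have m: "map (prj x) (map f qs') = qs'" using f by (intro nth_equalityI) auto
 have "zs (x # (ps @ map f qs')) = A"
 proof (rule lift_zs[OF As _ x(1)])
  fix t assume t: "t *\<^sub>R x \<in> A"
  hence "t *\<^sub>R x \<in> zs (x # ps)" unfolding 2(4) by (auto intro: span_scale span_base)
  then obtain c y where c: "t *\<^sub>R x = of_int c *\<^sub>R x + y" "y \<in> zs ps" by (elim zs_ConsE)
  hence "(t - of_int c) *\<^sub>R x \<in> span (set ps)" using span_zs[of ps] span_base by (auto simp: scaleR_left_diff_distrib)
  from span_scale[OF this, of "1 / (t - of_int c)"]
  have "t = of_int c" using bas_Cons_notin_span[OF 2(3)] by (cases "t = of_int c") auto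
  thus "t \<in> \<int>" by simp
 qed (use xA f m qs' in auto)
 moreover have "bas (x # (ps @ map f qs'))" unfolding bas_Cons using x qs' m by simp
 ultimately show ?case by (intro exI[of _ "map f qs'"]) simp
qed

lemma ldet_pos: assumes "dsg M" shows "0 < ldet M"
 by (metis assms dsg_basis ldet_zs vol_pos)

section \<open>Counting sublattices by the profile of a reduced basis\<close>

lemma er_le_prod: "0 <= (R::real) ==> (\<And>g. g \<in> set ls ==> 0 <= g) ==> er R ls <= real (length ls) * (\<Prod>h\<leftarrow>ls. 1 + R * h)"
proof (induction ls)
 case (Cons g ls)
 let ?P = "\<Prod>h\<leftarrow>ls. 1 + R * h"
 have P: "1 <= ?P" by (rule prod_list_ge1) (use Cons.prems in auto)
 have g: "0 <= R * g" using Cons.prems by simp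
 have "(1 + R * g) * er R ls <= (1 + R * g) * (length ls * ?P)"
  using Cons g by (intro mult_left_mono) auto
 moreover have "1 * ?P <= (1 + R * g) * ?P" using P g by (intro mult_right_mono) auto
 ultimately show ?case by (simp add: algebra_simps)
qed simp

lemma DL_card_le:
 "\<exists>C\<ge>1. \<forall>(xs::'a::euclidean_space list) u R. length xs = d --> bas xs --> 0 <= R -->
   card (DL xs u R) <= C * (\<Prod>h\<leftarrow>gs xs. 1 + R * h)"
proof -
 let ?B = "real d + 1"
 let ?A = "unit_ball_vol d"
 obtain C where C1: "C \<ge> 1" and C: "\<And>(xs::'a list) u R. length xs = d ==> bas xs ==> 0 <= R ==>
   \<bar>card (DL xs u R) - ?A * R ^ d * vol xs\<bar> <= C * er R (gs xs)"
  using DL_count[of d] by blast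
 have "card (DL xs u R) <= (?A + C * ?B) * (\<Prod>h\<leftarrow>gs xs. 1 + R * h)"
  if h: "length xs = d" "bas xs" "0 <= R" for xs :: "'a list" and u R
 proof -
  let ?C = "er R (gs xs)"
  let ?P = "\<Prod>h\<leftarrow>gs xs. 1 + R * h"
  have P: "1 <= ?P" by (rule prod_list_ge1) (auto simp: h(3) gs_nonneg)
  have "?C <= real d * ?P" using er_le_prod[OF h(3), of "gs xs", OF gs_nonneg] h(1) by simp
  also have "\<dots> <= ?B * ?P" using P by (intro mult_right_mono) auto
  finally have 1: "C * ?C <= C * (?B * ?P)" using C1 by (intro mult_left_mono) auto
  have "R ^ d * vol xs <= ?P" using pow_prod_le[OF h(3), of "gs xs", OF gs_nonneg] h by (simp add: vol_def)
  hence "?A * (R ^ d * vol xs) <= ?A * ?P" by (intro mult_left_mono) auto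
  moreover have "card (DL xs u R) <= ?A * R ^ d * vol xs + C * ?C"
   using C[OF h, of u] by linarith
  ultimately have "card (DL xs u R) <= ?A * ?P + C * (?B * ?P)"
   using 1 by (simp only: mult.assoc)
  thus ?thesis by (simp add: distrib_right mult.assoc)
 qed
 moreover have "1 * 1 <= C * ?B" using C1 by (intro mult_mono) auto
 hence "1 <= ?A + C * ?B" using unit_ball_vol_nonneg[of "real d", OF of_nat_0_le_iff] by linarith
 ultimately show ?thesis by blast
qed

lemma zs_ball_DL:
 assumes b: "bas (xs :: 'a::euclidean_space list)"
 shows "zs xs \<inter> cball 0 R = DL (rev (du xs)) (\<lambda>_. 0) R"
 using zs_shift_DL[OF b, of 0 R] by (simp add: span_zero)

lemma prod_list_nth: "prod_list (ls :: real list) = (\<Prod>k<length ls. ls ! k)"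
proof (induction ls)
 case (Cons a ls)
 thus ?case by (simp only: length_Cons prod.lessThan_Suc_shift) simp
qed simp

lemma prod_list_rev: "prod_list (rev ls) = prod_list (ls :: real list)"
 by (induction ls) (auto simp: mult.commute)

text \<open>This is \<open>DL_card_le\<close> for the reversed dual basis, whose Gram--Schmidt norms
  are the inverses.\<close>

lemma zs_card_le:
 "\<exists>C\<ge>1. \<forall>(xs::'a::euclidean_space list) R. length xs = d --> bas xs --> 0 <= R -->
   card (zs xs \<inter> cball 0 R) <= C * (\<Prod>k<d. 1 + R / gs xs ! k)"
proof -
 obtain C where C1: "C \<ge> 1" and C: "\<And>(xs::'a list) A R. length xs = d ==> bas xs ==> 0 <= R ==>
   card (DL xs A R) <= C * (\<Prod>h\<leftarrow>gs xs. 1 + R * h)"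
  using DL_card_le[of d] by blast
 have "card (zs xs \<inter> cball 0 R) <= C * (\<Prod>k<d. 1 + R / gs xs ! k)"
  if h: "length xs = d" "bas xs" "0 <= R" for xs :: "'a list" and R
 proof -
  have "(\<Prod>h\<leftarrow>gs (rev (du xs)). 1 + R * h) = prod_list (map (\<lambda>h. 1 + R / h) (gs xs))"
   by (simp add: rev_du_gs[OF h(2)] rev_map[symmetric] prod_list_rev comp_def divide_inverse)
  also have "\<dots> = (\<Prod>k<d. 1 + R / gs xs ! k)" unfolding prod_list_nth using h(1) by simp
  finally show ?thesis using C[of "rev (du xs)" R "\<lambda>_. 0"] bas_rev_du[OF h(2)] h
   by (simp add: zs_ball_DL)
 qed
 thus ?thesis using C1 by blast
qed

text \<open>The combinations with coefficients in \<open>{0..<f i}\<close> are distinct and stay in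
  the ball.\<close>

lemma zs_card_ge:
 assumes b: "bas (xs :: 'a::euclidean_space list)"
  and R: "(\<Sum>i<length xs. real (f i) * norm (xs ! i)) <= R"
 shows "(\<Prod>i<length xs. f i) <= card (zs xs \<inter> cball 0 R)"
proof -
 let ?I = "{..<length xs}" and ?P = "PiE {..<length xs} (\<lambda>i. {0..<f i})"
 let ?g = "\<lambda>c. \<Sum>i<length xs. of_int (int (c i)) *\<^sub>R xs ! i"
 have co: "?g c \<bullet> du xs ! j = c j" if j: "j < length xs" for c j
 proof -
  have "?g c \<bullet> du xs ! j = (\<Sum>i<length xs. if i = j then real (c j) else 0)"
   unfolding inner_sum_left by (intro sum.cong) (auto simp: inner_commute[of "xs ! _"] du_inner b j)
  thus ?thesis using j by simp
 qed
 have inj: "inj_on ?g ?P"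
 proof
  fix c c' assume c: "c \<in> ?P" "c' \<in> ?P" "?g c = ?g c'"
  have "c j = c' j" if "j \<in> ?I" for j
   using co[of j c] co[of j c'] c(3) that by simp
  thus "c = c'" using c by (auto intro: PiE_ext)
 qed
 have "?g ` ?P \<subseteq> zs xs \<inter> cball 0 R"
 proof safe
  fix c assume c: "c \<in> ?P"
  show "?g c \<in> zs xs" unfolding zs_comb by (rule CollectI, rule exI[of _ "\<lambda>i. int (c i)"]) simp
  have "norm (?g c) <= (\<Sum>i<length xs. norm (of_int (int (c i)) *\<^sub>R xs ! i))" by (rule norm_sum)
  also have "\<dots> <= (\<Sum>i<length xs. real (f i) * norm (xs ! i))"
  proof (rule sum_mono)
   fix i assume "i \<in> ?I"
   hence "c i < f i" using PiE_mem[OF c, of i] by simp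
   thus "norm (of_int (int (c i)) *\<^sub>R xs ! i) <= real (f i) * norm (xs ! i)"
    by (simp add: mult_right_mono)
  qed
  finally show "?g c \<in> cball 0 R" using R by simp
 qed
 hence "card (?g ` ?P) <= card (zs xs \<inter> cball 0 R)" by (intro card_mono zs_finite b)
 moreover have "card (?g ` ?P) = card ?P" by (rule card_image[OF inj])
 ultimately show ?thesis by (simp add: card_PiE)
qed

section \<open>Counting sublattices by adjoining generators one at a time\<close>

text \<open>For a subgroup \<open>N\<close> this is the group generated by \<open>N\<close> and
  \<open>x\<close>. It depends only on \<open>x\<close> modulo \<open>N\<close>, so generators need
  to be counted up to \<open>N\<close> only.\<close>

definition adj :: "'a::real_vector set => 'a => 'a set" where
 "adj N x = {a + of_int k *\<^sub>R x |a k. a \<in> N}"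

lemma adj_cong:
 assumes N: "sgrp N" and d: "x - y \<in> N" shows "adj N x = adj N y"
proof -
 have "adj N x \<subseteq> adj N y" if "x - y \<in> N" for x y
 proof
  fix z assume "z \<in> adj N x"
  then obtain a k where z: "z = a + of_int k *\<^sub>R x" "a \<in> N" by (auto simp: adj_def)
  have "z = (a + of_int k *\<^sub>R (x - y)) + of_int k *\<^sub>R y" by (simp add: z algebra_simps)
  moreover have "a + of_int k *\<^sub>R (x - y) \<in> N" using N z that by (intro sgrp_add sgrp_int)
  ultimately show "z \<in> adj N y" unfolding adj_def by blast
 qed
 moreover have "y - x \<in> N" using sgrp_minus[OF N d] by simp
 ultimately show ?thesis using d by blast
qed

text \<open>Distinct values of \<open>adj N\<close> come from distinct cosets of \<open>N\<close>.
  Hence the translates of \<open>N \<inter> cball 0 s\<close> by representatives are disjoint, and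
  they all fit into the larger ball.\<close>

lemma coset_count:
 assumes L: "dsg L" and N: "sgrp N" "N \<subseteq> L"
 shows "card (adj N ` (L \<inter> cball 0 r)) * card (N \<inter> cball 0 s) <= card (L \<inter> cball 0 (r + s))"
proof -
 let ?A = "L \<inter> cball 0 (r + s)"
 let ?S = "L \<inter> cball 0 r" and ?B = "N \<inter> cball 0 s"
 have fS: "finite ?S" and fB: "finite ?B" and fL: "finite ?A"
  using L dsg_sub[OF L N] by (auto simp: dsg_def)
 define rep where "rep y = (SOME x. x \<in> ?S \<and> adj N x = y)" for y
 have rep: "rep y \<in> ?S \<and> adj N (rep y) = y" if "y \<in> adj N ` ?S" for y
  unfolding rep_def using that by (intro someI_ex[of "\<lambda>x. x \<in> ?S \<and> adj N x = y"]) blast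
 let ?U = "\<Union>y\<in>adj N ` ?S. (+) (rep y) ` ?B"
 have disj: "(+) (rep i) ` ?B \<inter> (+) (rep j) ` ?B = {}"
  if ij: "i \<in> adj N ` ?S" "j \<in> adj N ` ?S" "i \<noteq> j" for i j
  proof (rule ccontr)
   assume "\<not> ?thesis"
   then obtain b c where "rep i + b = rep j + c" "b \<in> N" "c \<in> N" by auto
   hence "rep i - rep j = c - b" by (simp add: algebra_simps)
   hence "rep i - rep j \<in> N" using \<open>b \<in> N\<close> \<open>c \<in> N\<close> N(1) by (simp add: sgrp_diff)
   from adj_cong[OF N(1) this] show False using rep[OF ij(1)] rep[OF ij(2)] ij(3) by simp
  qed
 have "card ?U = (\<Sum>y\<in>adj N ` ?S. card ((+) (rep y) ` ?B))"
  using disj fS fB by (intro card_UN_disjoint) auto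
 also have "\<dots> = (\<Sum>y\<in>adj N ` ?S. card ?B)" by (intro sum.cong refl card_image) auto
 finally have "card ?U = card (adj N ` ?S) * card ?B" by simp
 moreover have "?U \<subseteq> ?A"
 proof
  fix z assume "z \<in> ?U"
  then obtain y b where y: "y \<in> adj N ` ?S" "b \<in> ?B" "z = rep y + b" by blast
  have "norm z <= r + s" unfolding y(3) using rep[OF y(1)] y(2) norm_triangle_ineq[of "rep y" b] by auto
  moreover have "z \<in> L" unfolding y(3) using rep[OF y(1)] y(2) N L by (auto intro: sgrp_add dsg_sgrp)
  ultimately show "z \<in> ?A" by simp
 qed
 ultimately show ?thesis using card_mono[OF fL] by metis
qed

definition cls :: "'a::euclidean_space set => real => (nat => int) => nat => 'a set set" where
 "cls L B e j = {zs xs |xs. bas xs \<and> length xs = j \<and> set xs \<subseteq> L \<and> (\<forall>i<j. norm (xs ! i) <= B * 2 powr e i)}"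

text \<open>A lattice of rank \<open>j + 1\<close> arises from one of rank \<open>j\<close> by
  adjoining a vector, and \<open>coset_count\<close> bounds the choices of that vector. The division
  by the number of points of the smaller lattice in a comparable ball gives the product on the
  left.\<close>

lemma cls_step:
 assumes L: "dsg L" and B: "0 <= B" and mono: "\<And>i. i <= j ==> e i <= e j" and fin: "finite (cls L B e j)"
 shows "finite (cls L B e (Suc j))"
  "card (cls L B e (Suc j)) * (\<Prod>i<j. 2 powr real_of_int (e j - e i))
   <= card (cls L B e j) * real (card (L \<inter> cball 0 ((real j + 1) * B * 2 powr e j)))"
proof -
 let ?S = "L \<inter> cball 0 (B * 2 powr e j)"
 let ?E = "\<lambda>j. \<Union>N\<in>cls L B e j. adj N ` ?S"
 let ?D = "\<lambda>N. card (adj N ` ?S)"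
 let ?P = "\<Prod>i<j. (2::real) powr real_of_int (e j - e i)" and ?T = "card (L \<inter> cball 0 ((real j + 1) * B * 2 powr e j))"
 have sub: "cls L B e (Suc j) \<subseteq> (?E j)"
 proof
  fix Y assume "Y \<in> cls L B e (Suc j)"
  then obtain ys where ys: "Y = zs ys" "bas ys" "length ys = Suc j" "set ys \<subseteq> L" "\<forall>i<Suc j. norm (ys ! i) <= B * 2 powr e i"
   by (auto simp: cls_def)
  then obtain xs x where x: "ys = xs @ [x]" by (metis length_0_conv nat.distinct(1) rev_exhaust)
  have "zs xs \<in> cls L B e j" using ys unfolding cls_def x
   by (auto simp: bas_snoc nth_append intro!: exI[of _ xs] split: if_splits)
  moreover have "x \<in> ?S" using ys(3,4) ys(5)[rule_format, of j] unfolding x by (auto simp: nth_append)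
  moreover have "Y = adj (zs xs) x" unfolding ys(1) x zs_snoc adj_def by simp
  ultimately show "Y \<in> (?E j)" by blast
 qed
 have fS: "finite ?S" using L by (simp add: dsg_def)
 show f: "finite (cls L B e (Suc j))" by (rule finite_subset[OF sub]) (use fin fS in auto)
 have each: "?D N * ?P <= ?T" if N: "N \<in> cls L B e j" for N
 proof -
  obtain xs where xs: "N = zs xs" "bas xs" "length xs = j" "set xs \<subseteq> L" "\<forall>i<j. norm (xs ! i) <= B * 2 powr e i"
   using N by (auto simp: cls_def)
  let ?A = "B * 2 powr e j"
  let ?B = "card (N \<inter> cball 0 (j * ?A))"
  \<comment> \<open>So many multiples of the vector \<open>xs ! i\<close> may be used without its
    contribution exceeding \<open>B * 2 powr e j\<close>.\<close>
  define f where "f i = (2::nat) ^ nat (e j - e i)" for i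
  let ?G = "\<lambda>i. real (f i) * norm (xs ! i)"
  have fr: "real (f i) = 2 powr real_of_int (e j - e i)" if "i < j" for i
   using mono[of i] that unfolding f_def by (simp add: powr_realpow[symmetric])
  have "(\<Sum>i<length xs. ?G i) <= (\<Sum>i<j. ?A)"
   unfolding xs(3)
  proof (rule sum_mono)
   fix i assume i: "i \<in> {..<j}"
   hence "?G i <= 2 powr real_of_int (e j - e i) * (B * 2 powr e i)"
    unfolding fr[of i, OF lessThan_iff[THEN iffD1, OF i]] using xs(5) by (intro mult_left_mono) auto
   also have "\<dots> = ?A" by (simp add: powr_diff)
   finally show "?G i <= ?A" .
  qed
  also have "\<dots> = j * ?A" by simp
  finally have "(\<Prod>i<length xs. f i) <= card (zs xs \<inter> cball 0 (j * ?A))"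
   by (rule zs_card_ge[OF xs(2)])
  hence "real (\<Prod>i<j. f i) <= ?B" unfolding of_nat_le_iff using xs by simp
  moreover have "real (\<Prod>i<j. f i) = ?P" by (simp add: fr)
  ultimately have p: "?P <= ?B" by simp
  have sg: "sgrp N" "N \<subseteq> L" using xs zs_least[OF dsg_sgrp[OF L] xs(4)] by auto
  have "?D N * ?P <= ?D N * real ?B"
   using p by (intro mult_left_mono) auto
  also have "\<dots> <= card (L \<inter> cball 0 (?A + j * ?A))"
   using coset_count[OF L sg, of "?A" "j * ?A"] by (metis of_nat_le_iff of_nat_mult)
  also have "?A + j * ?A = (real j + 1) * B * 2 powr e j" by (simp add: algebra_simps)
  finally show ?thesis .
 qed
 let ?F = "\<Sum>N\<in>cls L B e j. real (?D N)"
 let ?C = "card (cls L B e (Suc j))"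
 have "?C <= card (?E j)"
  by (rule card_mono[OF _ sub]) (use fin fS in auto)
 also have "\<dots> <= (\<Sum>N\<in>cls L B e j. ?D N)" by (rule card_UN_le[OF fin])
 finally have "real ?C <= ?F"
  by (metis of_nat_le_iff of_nat_sum)
 hence "?C * ?P <= ?F * ?P"
  by (intro mult_right_mono prod_nonneg) auto
 also have "\<dots> = (\<Sum>N\<in>cls L B e j. ?D N * ?P)" by (simp add: sum_distrib_right)
 also have "\<dots> <= (\<Sum>N\<in>cls L B e j. real ?T)" by (intro sum_mono each)
 finally show "?C * ?P <= card (cls L B e j) * real ?T" by simp
qed

lemma cls_card:
 fixes G :: "nat => real"
 assumes L: "dsg L" and B: "0 <= B" and mono: "\<And>i j. i <= j ==> j < q ==> e i <= e j"
  and bd: "\<And>i. i < q ==> card (L \<inter> cball 0 ((real i + 1) * B * 2 powr e i)) <= G i"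
 shows "finite (cls L B e q) \<and> card (cls L B e q) <= (\<Prod>i<q. G i * (\<Prod>l<i. 2 powr real_of_int (e l - e i)))"
 using mono bd
proof (induction q)
 case 0
 have "cls L B e 0 = {{0}}" by (auto simp: cls_def)
 thus ?case by simp
next
 case (Suc j)
 let ?B = "real (card (L \<inter> cball 0 ((real j + 1) * B * 2 powr e j)))"
 let ?A = "\<Prod>i<j. G i * (\<Prod>l<i. 2 powr real_of_int (e l - e i))"
 have IH: "finite (cls L B e j)" "card (cls L B e j) <= ?A"
  using Suc by auto
 let ?P = "\<Prod>i<j. (2::real) powr real_of_int (e j - e i)"
 have inv: "(\<Prod>l<j. 2 powr real_of_int (e l - e j)) = 1 / ?P"
  unfolding prod_dividef[symmetric, of "\<lambda>_. 1", simplified] by (simp add: prod_inversef[symmetric] powr_minus[symmetric] inverse_eq_divide[symmetric])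
 have P: "0 < ?P" by (intro prod_pos) auto
 have mj: "e i <= e j" if "i <= j" for i using Suc.prems(1)[OF that lessI] .
 note st = cls_step[OF L B mj IH(1)]
 have G: "?B <= G j" using Suc.prems(2) by simp
 have "card (cls L B e (Suc j)) <= card (cls L B e j) * ?B / ?P"
  using st(2) P by (simp add: field_simps)
 also have "\<dots> <= ?A * G j / ?P"
  using IH(2) G P by (intro divide_right_mono mult_mono) (auto intro: order_trans[OF of_nat_0_le_iff])
 finally have "card (cls L B e (Suc j)) <= ?A * (G j * (1 / ?P))" by simp
 thus ?case using st(1) unfolding prod.lessThan_Suc inv by blast
qed

section \<open>Inequalities between profiles and Gram--Schmidt norms\<close>

text \<open>A product over a square is regrouped into its diagonal and the pairs
  \<open>(i, l)\<close>, \<open>(l, i)\<close>; in this form each pair can absorb one factor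
  \<open>S l / S i\<close>.\<close>

lemma prod_square_split:
 fixes g :: "nat => nat => 'a::comm_monoid_mult"
 shows "(\<Prod>i<q. \<Prod>k<q. g i k) = (\<Prod>i<q. g i i * (\<Prod>l<i. g i l * g l i))"
 by (induction q) (simp_all add: prod.distrib mult_ac)

lemma prod_square_split':
 fixes g d :: "nat => nat => 'a::comm_monoid_mult"
 shows "(\<Prod>i<q. (\<Prod>k<q. g i k) * h i * (\<Prod>l<i. d i l)) =
  (\<Prod>i<q. g i i * (\<Prod>l<i. g i l * g l i * d i l)) * (\<Prod>i<q. h i)"
 by (simp add: prod.distrib prod_square_split mult_ac)

text \<open>Up to constants this is the bound of \<open>cls_card\<close> for the sublattices whose
  basis vectors have norms about \<open>S\<close> in a lattice with Gram--Schmidt norms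
  \<open>a\<close>: the first product counts the choices of the \<open>i\<close>-th vector, the
  second divides by the number of choices that differ by earlier vectors.\<close>

definition pw :: "(nat => real) => (nat => real) => nat => nat => real" where
 "pw a S m q = (\<Prod>i<q. (\<Prod>k<m. max 1 (S i / a k)) * (\<Prod>l<i. S l / S i))"

context
 fixes a S :: "nat => real" and m q :: nat
 assumes am: "\<And>i j. i <= j ==> j < m ==> a i <= a j" and apos: "\<And>i. i < m ==> 0 < a i"
  and Sm: "\<And>i j. i <= j ==> j < q ==> S i <= S j" and aS: "\<And>i. i < q ==> a i <= S i"
  and qm: "q <= m"
begin

lemma profile_pos: "i < q ==> 0 < S i" "i < q ==> 1 <= S i / a i"
 using apos[of i] aS[of i] qm by (auto simp: divide_simps)

text \<open>From \<open>a l <= S l <= S i\<close> the first maximum is the quotient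
  \<open>S i / a l\<close>, and \<open>S i\<close> cancels.\<close>

lemma profile_pair:
 assumes "l < i" "i < q"
 shows "max 1 (S i / a l) * max 1 (S l / a i) * (S l / S i) = S l / a l * max 1 (S l / a i)"
proof -
 have "a l <= S i" using aS[of l] Sm[of l i] assms by simp
 hence "max 1 (S i / a l) = S i / a l" using apos[of l] assms qm by (simp add: divide_simps max_def)
 thus ?thesis using profile_pos(1)[of i] assms by (simp add: field_simps)
qed

lemma profile_max_le: "l < q ==> i < q ==> l <= i ==> max 1 (S l / a i) <= S i / a i"
 using profile_pos(2)[of i] Sm[of l i] apos[of i] qm by (auto intro!: divide_right_mono)

lemma profile_max_le': "i < q ==> i <= k ==> k < m ==> max 1 (S i / a k) <= S i / a i"
 using profile_pos[of i] am[of i k] apos[of i] by (auto intro!: divide_left_mono mult_pos_pos)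

lemma profile_split:
 assumes "q <= m'" "m' <= m"
 shows "(\<Prod>i<q. (\<Prod>k<m'. max 1 (S i / a k)) * (\<Prod>l<i. S l / S i))
  = (\<Prod>i<q. max 1 (S i / a i) * (\<Prod>l<i. max 1 (S i / a l) * max 1 (S l / a i) * (S l / S i)))
   * (\<Prod>i<q. \<Prod>k\<in>{q..<m'}. max 1 (S i / a k))"
proof -
 have "{..<m'} = {..<q} \<union> {q..<m'}" using assms by auto
 hence "(\<Prod>k<m'. max 1 (S i / a k)) = (\<Prod>k<q. max 1 (S i / a k)) * (\<Prod>k\<in>{q..<m'}. max 1 (S i / a k))" for i
  by (simp add: prod.union_disjoint ivl_disj_int)
 thus ?thesis by (simp only: prod_square_split')
qed

lemma profile_diag: "(\<Prod>i<q. S i / a i * (\<Prod>l<i. S i / a i * (S l / a l))) = (\<Prod>i<q. S i / a i) ^ q"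
proof -
 have "(\<Prod>i<q. S i / a i) ^ q = (\<Prod>i<q. \<Prod>k<q. S i / a i)" by (simp add: prod_power_distrib)
 thus ?thesis unfolding prod_square_split by simp
qed

lemma profile_tail:
 assumes "m' <= m" "q <= m'"
 shows "(\<Prod>i<q. \<Prod>k\<in>{q..<m'}. max 1 (S i / a k)) <= (\<Prod>i<q. S i / a i) ^ (m' - q)"
proof -
 have "(\<Prod>i<q. \<Prod>k\<in>{q..<m'}. max 1 (S i / a k)) <= (\<Prod>i<q. \<Prod>k\<in>{q..<m'}. S i / a i)"
 proof (intro prod_mono conjI prod_nonneg)
  fix i k assume ik: "i \<in> {..<q}" "k \<in> {q..<m'}"
  show "max 1 (S i / a k) <= S i / a i" using ik assms by (intro profile_max_le') auto
 qed (auto simp: le_max_iff_disj)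
 thus ?thesis by (simp add: prod_power_distrib)
qed

text \<open>Each quotient \<open>S i / a i\<close> is needed \<open>q\<close> times for the square
  of indices below \<open>q\<close> and \<open>m - q\<close> times for the remaining
  columns.\<close>

lemma profile_general: "pw a S m q <= (\<Prod>i<q. S i / a i) ^ m"
proof -
 let ?A = "\<lambda>i l. max 1 (S i / a l) * max 1 (S l / a i) * (S l / S i)"
 have "(\<Prod>i<q. max 1 (S i / a i) * (\<Prod>l<i. ?A i l))
   <= (\<Prod>i<q. S i / a i * (\<Prod>l<i. S i / a i * (S l / a l)))"
 proof (rule prod_mono)
  fix i assume i: "i \<in> {..<q}"
  hence i': "i < q" by simp
  let ?C = "\<Prod>l<i. ?A i l"
  let ?B = "S i / a i"
  have s: "0 <= ?B" using profile_pos(2)[OF i'] by linarith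
  have m: "max 1 ?B <= ?B" using profile_pos(2)[OF i'] by simp
  have l: "0 <= ?A i l \<and>
    ?A i l <= ?B * (S l / a l)" if l: "l < i" for l
  proof
   have l': "l < q" using l i' by simp
   have sl: "0 <= S l / a l" using profile_pos(2)[OF l'] by linarith
   show "0 <= ?A i l"
    unfolding profile_pair[OF l i'] using sl by (intro mult_nonneg_nonneg) auto
   have "S l / a l * max 1 (S l / a i) <= S l / a l * ?B"
    using profile_max_le[OF l' i'] l sl by (intro mult_left_mono) auto
   thus "?A i l <= ?B * (S l / a l)"
    unfolding profile_pair[OF l i'] by (simp add: mult.commute)
  qed
  have inner: "?C <= (\<Prod>l<i. ?B * (S l / a l))"
   by (rule prod_mono) (use l in auto)
  have p0: "0 <= ?C"
   by (rule prod_nonneg) (use l in auto)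
  show "0 <= max 1 ?B * ?C \<and>
   max 1 ?B * ?C
   <= ?B * (\<Prod>l<i. ?B * (S l / a l))"
   using mult_mono[OF m inner s p0] mult_nonneg_nonneg[OF _ p0, of "max 1 ?B"] by simp
 qed
 note 1 = this[unfolded profile_diag]
 have sn: "0 <= (\<Prod>i<q. S i / a i)" by (rule prod_nonneg) (use profile_pos(2) in force)
 have tn: "0 <= (\<Prod>i<q. \<Prod>k\<in>{q..<m}. max 1 (S i / a k))" by (intro prod_nonneg) auto
 have "pw a S m q <= (\<Prod>i<q. S i / a i) ^ q * (\<Prod>i<q. S i / a i) ^ (m - q)"
  unfolding pw_def profile_split[OF qm order_refl]
  by (rule mult_mono[OF 1 profile_tail[OF order_refl qm] zero_le_power[OF sn] tn])
 thus ?thesis using qm by (simp add: power_add[symmetric])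
qed

text \<open>A full power is saved over \<open>profile_general\<close>. The factor of the last column
  is trivial for \<open>i = 0\<close> by \<open>S0\<close>; for \<open>i > 0\<close> it is moved
  into the pair \<open>(i, 0)\<close>, where fact \<open>key\<close> shows that there is room for
  it.\<close>

lemma profile_small:
 assumes q0: "q < m" and S0: "S 0 <= a (m - 1)"
 shows "pw a S m q <= (\<Prod>i<q. S i / a i) ^ (m - 1)"
proof -
 let ?H = "\<lambda>i k. max 1 (S i / a k)"
 let ?F = "a (m - 1)"
 let ?D = "\<lambda>q. \<Prod>i<q. \<Prod>k\<in>{q..<m-1}. ?H i k"
 let ?C = "\<lambda>i. S i / a i"
 let ?G = "\<lambda>i. \<Prod>l<i. ?C i * (S l / a l)"
 let ?B = "\<lambda>q i. (\<Prod>k<q. ?H i k) * (\<Prod>k\<in>{q..<m-1}. ?H i k)"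
 \<comment> \<open>The factor contributed by the last column; \<open>T\<close> assigns it to the
   pair with \<open>l = 0\<close>.\<close>
 define M where "M i = max 1 (S i / ?F)" for i
 define T where "T i l = (if l = 0 then M i else 1)" for i and l :: nat
 let ?I = "\<lambda>i. \<Prod>l<i. S l / S i * T i l"
 let ?A = "\<lambda>i l. max 1 (S i / a l) * max 1 (S l / a i) * (S l / S i) * T i l"
 let ?E = "\<lambda>i. max 1 (?C i) * (\<Prod>l<i. ?A i l)"
 have M1: "1 <= M i" for i by (simp add: M_def)
 have a1: "0 < ?F" using apos q0 by simp
 have MT: "(\<Prod>l<i. T i l) = M i" if "i < q" for i
 proof (cases i)
  case 0 thus ?thesis using S0 a1 by (simp add: M_def)
 next
  case (Suc j) thus ?thesis by (simp add: prod.lessThan_Suc_shift T_def del: prod.lessThan_Suc)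
 qed
 have "{..<m} = {..<q} \<union> {q..<m-1} \<union> {m-1}" using q0 by auto
 hence "(\<Prod>k<m. ?H i k) = (\<Prod>k\<in>{..<q} \<union> {q..<m-1} \<union> {m-1}. ?H i k)" for i by simp
 also have "\<dots> i = ?B q i * M i" for i
  using q0 by (subst prod.union_disjoint; (subst prod.union_disjoint)?) (auto simp: M_def)
 finally have spl: "(\<Prod>k<m. ?H i k) = ?B q i * M i" for i .
 let ?J = "\<Prod>i<q. ?C i"
 have "pw a S m q = (\<Prod>i<q. ?B q i * (?I i))"
  unfolding pw_def spl
 proof (intro prod.cong refl)
  fix i assume "i \<in> {..<q}"
  hence "(?I i) = (\<Prod>l<i. S l / S i) * M i"
   by (subst prod.distrib) (simp add: MT)
  thus "?B q i * M i * (\<Prod>l<i. S l / S i)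
   = ?B q i * (?I i)"
   by (simp only: mult_ac)
 qed
 also have "\<dots> = (\<Prod>i<q. max 1 (?C i) * (\<Prod>l<i. max 1 (S i / a l) * max 1 (S l / a i) * (S l / S i * T i l)))
   * (?D q)"
  by (rule prod_square_split')
 finally have pw: "pw a S m q = (\<Prod>i<q. ?E i)
   * (?D q)"
  by (simp only: mult.assoc)
 have "(\<Prod>i<q. ?E i)
   <= (\<Prod>i<q. ?C i * (?G i))"
 proof (rule prod_mono)
  fix i assume i: "i \<in> {..<q}"
  hence i': "i < q" by simp
  have s: "0 <= ?C i" using profile_pos(2)[OF i'] by linarith
  have m: "max 1 (?C i) <= ?C i" using profile_pos(2)[OF i'] by simp
  have l: "0 <= ?A i l \<and>
    ?A i l <= ?C i * (S l / a l)" if l: "l < i" for l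
  proof
   have l': "l < q" using l i' by simp
   have sl: "0 <= S l / a l" using profile_pos(2)[OF l'] by linarith
   have T1: "1 <= T i l" using M1 by (simp add: T_def)
   show "0 <= ?A i l"
    unfolding profile_pair[OF l i'] using sl T1 by (intro mult_nonneg_nonneg) auto
   have key: "max 1 (S l / a i) * T i l <= ?C i"
   proof (cases "l = 0 \<and> ?F <= S i")
    case True
    hence T: "T i l = S i / ?F" using a1 by (simp add: T_def M_def max_def divide_simps)
    have ai: "0 < a i" "a i <= ?F" using apos[of i] am[of i "m - 1"] i' q0 by auto
    have Si: "0 < S i" by (rule profile_pos(1)[OF i'])
    have "1 * (S i / ?F) <= ?C i" using ai a1 Si by (simp add: divide_left_mono)
    moreover have "S l / a i * (S i / ?F) <= ?C i"
    proof -
     have "S l <= ?F" using S0 True by simp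
     hence "S l * S i <= ?F * S i" using Si by (intro mult_right_mono) auto
     thus ?thesis using ai a1 by (simp add: divide_simps mult_ac)
    qed
    ultimately show ?thesis unfolding T by (simp add: max_def)
   next
    case False
    hence "T i l = 1" using a1 by (auto simp: T_def M_def max_def divide_simps)
    thus ?thesis using profile_max_le[OF l' i'] l by simp
   qed
   have "S l / a l * (max 1 (S l / a i) * T i l) <= S l / a l * (?C i)"
    using key sl by (intro mult_left_mono) auto
   thus "?A i l <= ?C i * (S l / a l)"
    unfolding profile_pair[OF l i'] by (simp add: mult_ac)
  qed
  have inner: "(\<Prod>l<i. ?A i l) <= (?G i)"
   by (rule prod_mono) (use l in auto)
  have p0: "0 <= (\<Prod>l<i. ?A i l)"
   by (rule prod_nonneg) (use l in auto)
  show "0 <= ?E i \<and>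
   ?E i
   <= ?C i * (?G i)"
   using mult_mono[OF m inner s p0] mult_nonneg_nonneg[OF _ p0, of "max 1 (?C i)"] by simp
 qed
 note 1 = this[unfolded profile_diag]
 have sn: "0 <= ?J" by (rule prod_nonneg) (use profile_pos(2) in force)
 have tn: "0 <= (?D q)" by (intro prod_nonneg) auto
 have m1: "m - 1 <= m" "q <= m - 1" using q0 by auto
 have "pw a S m q <= ?J ^ q * ?J ^ (m - 1 - q)"
  unfolding pw by (rule mult_mono[OF 1 profile_tail[OF m1] zero_le_power[OF sn] tn])
 moreover have "q + (m - 1 - q) = m - 1" using m1 by simp
 ultimately show ?thesis by (simp only: power_add[symmetric])
qed

text \<open>All maxima are plain quotients here. Of the product of the \<open>S l / S i\<close> only
  the factor with \<open>l = 0\<close> is kept. The resulting \<open>S 0 ^ q\<close> over the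
  product of all \<open>S i\<close> is the gain: after division by \<open>S 0\<close> and summation
  over profiles it yields the saving \<open>1 / q\<close> in \<open>prof_sum\<close>.\<close>

lemma profile_large:
 assumes S0: "a (m - 1) <= S 0" and q: "0 < q"
 shows "pw a S m q <= S 0 ^ q * (\<Prod>i<q. S i) ^ m / ((\<Prod>i<q. S i) * (\<Prod>k<m. a k) ^ q)"
proof -
 let ?B = "\<lambda>i. \<Prod>k<m. S i / a k"
 have Sp: "0 < S i" if "i < q" for i using profile_pos(1) that .
 have "max 1 (S i / a k) = S i / a k" if "i < q" "k < m" for i k
 proof -
  have "a k <= S i" using am[of k "m - 1"] S0 Sm[of 0 i] that by force
  thus ?thesis using apos[OF that(2)] by (simp add: max_def divide_simps)
 qed
 hence "pw a S m q = (\<Prod>i<q. (?B i) * (\<Prod>l<i. S l / S i))"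
  unfolding pw_def by (intro prod.cong refl arg_cong2[where f="(*)"]) auto
 also have "\<dots> <= (\<Prod>i<q. (?B i) * (S 0 / S i))"
 proof (rule prod_mono)
  fix i assume "i \<in> {..<q}"
  hence i: "i < q" by simp
  have A: "0 <= (?B i)" using Sp[OF i] apos by (intro prod_nonneg) (auto intro!: divide_nonneg_pos)
  have L: "0 <= S l / S i \<and> S l / S i <= 1" if "l < i" for l using Sp[of l] Sp[OF i] Sm[of l i] that i by auto
  let ?A = "\<Prod>l<i. S l / S i"
  have A2: "0 <= ?A" by (rule prod_nonneg) (use L in auto)
  have A3: "?A <= S 0 / S i"
  proof (cases i)
   case 0 thus ?thesis using Sp[OF i] by simp
  next
   case (Suc j)
   have "?A = S 0 / S i * (\<Prod>l<j. S (Suc l) / S i)"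
    unfolding Suc by (rule prod.lessThan_Suc_shift)
   also have "\<dots> <= S 0 / S i * 1"
    using L[of 0] L Suc by (intro mult_left_mono prod_le_1) auto
   finally show ?thesis by simp
  qed
  show "0 <= (?B i) * ?A \<and>
   (?B i) * ?A <= (?B i) * (S 0 / S i)"
   using mult_nonneg_nonneg[OF A A2] mult_left_mono[OF A3 A] by blast
 qed
 also have "\<dots> = (\<Prod>i<q. S i ^ m / (\<Prod>k<m. a k) * (S 0 / S i))"
  by (simp add: prod_dividef)
 also have "\<dots> = S 0 ^ q * (\<Prod>i<q. S i) ^ m / ((\<Prod>i<q. S i) * (\<Prod>k<m. a k) ^ q)"
  by (simp add: prod.distrib prod_dividef prod_power_distrib[symmetric] mult_ac)
 finally show ?thesis .
qed

end

section \<open>Sums over dyadic profiles\<close>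

text \<open>The exponents are distinct integers, so counted down from the largest one the terms are
  dominated by a geometric series.\<close>

lemma geometric_int_sum:
 fixes I :: "int set"
 assumes T: "0 < T" and c: "0 < c" and I: "finite I" "\<And>e. e \<in> I ==> c * 2 powr e <= Y"
 shows "(\<Sum>e\<in>I. (c * 2 powr e) powr T) <= Y powr T / (1 - 2 powr (-T))"
proof (cases "I = {}")
 case True
 have "2 powr (-T) <= 2 powr 0" using T by (intro powr_mono) auto
 thus ?thesis using True by (auto intro!: divide_nonneg_nonneg)
next
 case False
 let ?E = "\<lambda>e. (c * 2 powr e) powr T"
 let ?C = "Y powr T"
 define M where "M = Max I"
 let ?A = "\<lambda>e. nat (M - e)"
 define r where "r = 2 powr (-T)"
 have MI: "M \<in> I" unfolding M_def using I False by simp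
 have le: "e <= M" if "e \<in> I" for e unfolding M_def using I that by simp
 let ?B = "\<Sum>j\<in>(\<lambda>e. ?A e) ` I. r ^ j"
 have r: "0 < r" "r < 1" using T powr_less_mono[of "-T" 0 2] by (auto simp: r_def)
 have t: "?E e <= ?C * r ^ ?A e" if "e \<in> I" for e
 proof -
  let ?D = "2 powr (- real (?A e))"
  have "(c * 2 powr e) = (c * 2 powr M) * ?D"
   using le[OF that] by (simp add: powr_add[symmetric])
  hence "?E e = (c * 2 powr M) powr T * ?D powr T"
   using c by (simp add: powr_mult)
  also have "?D powr T = r ^ ?A e"
   by (simp add: r_def powr_powr powr_realpow[symmetric] mult_ac)
  also have "(c * 2 powr M) powr T * r ^ ?A e <= ?C * r ^ ?A e"
   using I(2)[OF MI] c T r by (intro mult_right_mono powr_mono2) auto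
  finally show ?thesis .
 qed
 have inj: "inj_on (\<lambda>e. ?A e) I"
 proof (rule inj_onI)
  fix e e' assume "e \<in> I" "e' \<in> I" and eq: "?A e = nat (M - e')"
  hence "0 <= M - e" "0 <= M - e'" using le by auto
  thus "e = e'" using eq by (simp add: nat_eq_iff2)
 qed
 have "(\<Sum>e\<in>I. ?E e) <= (\<Sum>e\<in>I. ?C * r ^ ?A e)" by (intro sum_mono t)
 also have "\<dots> = ?C * ?B"
  by (simp add: sum_distrib_left sum.reindex[OF inj])
 also have "?B <= (\<Sum>j. r ^ j)"
  using r I by (intro sum_le_suminf summable_geometric) auto
 also have "\<dots> = 1 / (1 - r)" using r by (intro suminf_geometric) auto
 finally show ?thesis by (simp add: r_def mult_left_mono)
qed

lemma card_int_interval_le: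
 fixes x y :: real
 assumes "x <= y + 1"
 shows "finite {e::int. x <= e \<and> e <= y}" "card {e::int. x <= e \<and> e <= y} <= y - x + 1"
proof -
 have e: "{e::int. x <= e \<and> e <= y} = {\<lceil>x\<rceil>..\<lfloor>y\<rfloor>}" by (auto simp: ceiling_le_iff le_floor_iff)
 show "finite {e::int. x <= e \<and> e <= y}" unfolding e by simp
 show "card {e::int. x <= e \<and> e <= y} <= y - x + 1" unfolding e using assms by (simp add: of_nat_nat) linarith
qed

text \<open>The dyadic profiles open to a sublattice of bounded determinant. Extensionality outside
  \<open>{..<q}\<close> is what makes this set finite.\<close>

definition prof :: "nat => real => (nat => real) => real => (nat => int) set" where
 "prof q C a W = {e \<in> {..<q} \<rightarrow>\<^sub>E UNIV. (\<forall>i j. i <= j --> j < q --> e i <= e j) \<and>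
   (\<forall>i<q. a i <= C * 2 powr e i) \<and> (\<Prod>i<q. C * 2 powr e i) <= W}"

text \<open>Each \<open>e i\<close> ranges over an interval of length \<open>log 2 Q\<close>, where
  \<open>Q\<close> is \<open>W\<close> over the product of the \<open>a i\<close>, and any power of
  a logarithm is below an arbitrarily small power.\<close>

lemma prof_card:
 assumes d: "0 < d" and q: "0 < q"
 shows "\<exists>K\<ge>1. \<forall>C a W. 0 < C --> (\<forall>i<q. 0 < a i) --> 0 < W --> finite (prof q C a W) \<and>
   card (prof q C a W) <= K * (W / (\<Prod>i<q. a i)) powr d \<and> (prof q C a W \<noteq> {} --> 1 <= W / (\<Prod>i<q. a i))"
proof -
 \<comment> \<open>From \<open>ln Q <= Q powr x / x\<close> with \<open>x = d / q\<close>; the 1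
   accounts for the end point of the interval.\<close>
 define k where "k = (real q / (d * ln 2) + 1)"
 have k1: "1 <= k" using d q by (simp add: k_def)
 have "finite (prof q C a W) \<and> card (prof q C a W) <= k ^ q * (W / (\<Prod>i<q. a i)) powr d \<and> (prof q C a W \<noteq> {} --> 1 <= W / (\<Prod>i<q. a i))"
  if C: "0 < C" and a: "\<forall>i<q. 0 < a i" and W: "0 < W" for C a W
 proof (cases "prof q C a W = {}")
  case True
  have "0 <= k ^ q" using k1 by simp
  thus ?thesis unfolding True by (auto intro!: mult_nonneg_nonneg)
 next
  case False
  define Q where "Q = W / (\<Prod>i<q. a i)"
  let ?B = "log 2 Q + 1"
  let ?A = "\<lambda>q. Q powr (d / q)"
  have ap: "0 < (\<Prod>i<q. a i)" using a by (intro prod_pos) auto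
  \<comment> \<open>The quotients \<open>C * 2 powr e j / a j\<close> are all at least 1 and their
    product is at most \<open>Q\<close>, so each of them is at most \<open>Q\<close>.\<close>
  have up: "C * 2 powr e i <= Q * a i" if e: "e \<in> prof q C a W" and i: "i < q" for e i
  proof -
   have "(C * 2 powr e i) / a i * 1 <= (C * 2 powr e i) / a i * (\<Prod>j\<in>{..<q}-{i}. (C * 2 powr e j) / a j)"
   proof (intro mult_left_mono)
    have "(\<Prod>j\<in>{..<q}-{i}. 1) <= (\<Prod>j\<in>{..<q}-{i}. (C * 2 powr e j) / a j)"
     using e a by (intro prod_mono) (auto simp: prof_def divide_simps)
    thus "1 <= (\<Prod>j\<in>{..<q}-{i}. (C * 2 powr e j) / a j)" by simp
   qed (use C a i in \<open>auto intro!: divide_nonneg_pos\<close>)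
   also have "\<dots> = (\<Prod>j<q. (C * 2 powr e j) / a j)" using i by (subst prod.remove[of _ i]) auto
   also have "\<dots> <= Q" unfolding prod_dividef Q_def using e ap by (intro divide_right_mono) (auto simp: prof_def)
   finally show ?thesis using a i by (simp add: divide_simps mult_ac)
  qed
  obtain e where e: "e \<in> prof q C a W" using False by blast
  have "1 * a 0 <= Q * a 0" using up[OF e q] e q by (auto simp: prof_def)
  hence Q1: "1 <= Q" using a q by simp
  let ?J = "\<lambda>i. {e::int. log 2 (a i / C) <= e \<and> e <= log 2 (a i / C) + log 2 Q}"
  have lQ: "0 <= log 2 Q" using Q1 by simp
  have J: "finite (?J i)" "card (?J i) <= ?B" for i
   using card_int_interval_le[of "log 2 (a i / C)" "log 2 (a i / C) + log 2 Q"] lQ by auto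
  have sub: "prof q C a W \<subseteq> PiE {..<q} ?J"
  proof
   fix e assume e: "e \<in> prof q C a W"
   have "e i \<in> ?J i" if i: "i < q" for i
   proof -
    have ai: "0 < a i" using a i by blast
    have "a i / C <= 2 powr e i" using e i C by (auto simp: prof_def divide_simps mult_ac)
    hence "log 2 (a i / C) <= log 2 (2 powr e i)" using ai C by (intro log_mono) auto
    moreover have "2 powr e i <= a i / C * Q" using up[OF e i] C by (simp add: divide_simps mult_ac)
    hence "log 2 (2 powr e i) <= log 2 (a i / C * Q)" by (intro log_mono) auto
    moreover have "log 2 (a i / C * Q) = log 2 (a i / C) + log 2 Q" 
     using ai C Q1 ln_mult[of "a i / C" Q] by (simp add: log_def add_divide_distrib)
    ultimately show ?thesis by simp
   qed
   thus "e \<in> PiE {..<q} ?J" using e by (auto simp: prof_def)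
  qed
  have fP: "finite (PiE {..<q} ?J)" by (intro finite_PiE J) auto
  have "card (prof q C a W) <= card (PiE {..<q} ?J)" by (rule card_mono[OF fP sub])
  also have "\<dots> = (\<Prod>i<q. card (?J i))" by (rule card_PiE) simp
  finally have "real (card (prof q C a W)) <= real (\<Prod>i<q. card (?J i))" by (simp only: of_nat_le_iff)
  also have "\<dots> = (\<Prod>i<q. real (card (?J i)))" by (rule of_nat_prod)
  also have "\<dots> <= (\<Prod>i<q. ?B)"
  proof (rule prod_mono)
   fix i show "0 <= real (card (?J i)) \<and> real (card (?J i)) <= ?B" using J(2)[of i] by linarith
  qed
  also have "\<dots> = ?B ^ q" by simp
  also have "\<dots> <= (k * ?A q) ^ q"
  proof (rule power_mono)
   have "ln Q <= ?A q / (d / q)" using Q1 d q by (intro ln_powr_bound) auto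
   hence "ln Q / ln 2 <= (?A q / (d / q)) / ln 2" by (intro divide_right_mono) auto
   hence "log 2 Q <= real q / (d * ln 2) * ?A q" by (simp add: log_def mult_ac)
   moreover have "1 <= ?A q" using Q1 d q by (intro ge_one_powr_ge_zero) auto
   ultimately show "?B <= k * ?A q" unfolding k_def by (simp add: algebra_simps)
  qed (use lQ in simp)
  also have "\<dots> = k ^ q * Q powr d"
   using Q1 q by (simp add: power_mult_distrib powr_realpow[symmetric] powr_powr)
  finally show ?thesis using finite_subset[OF sub fP] Q1 unfolding Q_def by blast
 qed
 moreover have "1 <= k ^ q" using k1 by simp
 ultimately show ?thesis by blast
qed

text \<open>A profile is given by \<open>e 0\<close> and the differences \<open>e i - e 0\<close>.
  The product of the entries is the \<open>q\<close>-th power of the first entry times a factor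
  \<open>u\<close> that depends on the differences only. The sum over \<open>e 0\<close> is
  geometric with exponent \<open>T\<close> and ends at the \<open>q\<close>-th root of
  \<open>W / u\<close>; what it leaves of \<open>u\<close> is summable over the differences.\<close>

lemma prof_sum:
 assumes q: "0 < q" "q < m"
 shows "\<exists>K\<ge>0. \<forall>C a W. 0 < C --> 0 < W --> finite (prof q C a W) -->
  (\<Sum>e\<in>prof q C a W. (C * 2 powr e 0) ^ (q - 1) * (\<Prod>i<q. C * 2 powr e i) ^ (m - 1)) <= K * W powr (m - 1 / q)"
proof -
 let ?C = "m - 1 / q"
 let ?A = "\<lambda>C e. (C * 2 powr e 0) ^ (q - 1) * (\<Prod>i<q. C * 2 powr e i) ^ (m - 1)"
 define T where "T = real q * real m - 1"
 let ?B = "1 - 2 powr (-T)"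
 \<comment> \<open>The remaining exponent of \<open>u\<close> is
   \<open>m - 1 - (m - 1 / q) = - s\<close>. It vanishes for \<open>q = 1\<close>, but then there
   are no differences to sum over.\<close>
 define s where "s = 1 - 1 / real q"
 define v where "v = 2 powr (-s)"
 let ?J = "\<lambda>d. \<Prod>i\<in>{1..<q}. v ^ d i"
 let ?H = "(1 / (1 - v)) ^ (q - 1)"
 have "1 < real q * real m"
  using q mult_le_mono[of 1 q 2 m] by (metis One_nat_def Suc_1 Suc_leI le_trans less_eq_Suc_le mult_1 nat_less_real_le not_less_eq_eq of_nat_1 of_nat_less_iff of_nat_mult order_less_le_trans lessI Suc_lessI)
 hence T: "0 < T" by (simp add: T_def)
 have v0: "0 < v" by (simp add: v_def)
 define K where "K = ?H / ?B"
 have t1: "2 powr (-T) < 1" using T powr_less_mono[of "-T" 0 2] by simp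
 have v1: "v < 1" if "1 < q"
  using that powr_less_mono[of "-s" 0 2] by (simp add: v_def s_def)
 have vq: "0 <= ?H"
  using v1 by (cases "1 < q") auto
 have main: "(\<Sum>e\<in>prof q C a W. ?A C e) <= K * W powr ?C"
  if C: "0 < C" and W: "0 < W" and fin: "finite (prof q C a W)" for C a W
 proof -
  let ?K = "W powr ?C"
  let ?G = "\<lambda>e. C * 2 powr e 0"
  let ?E = "prof q C a W"
  define D where "D e = (\<lambda>i\<in>{1..<q}. nat (e i - e 0))" for e :: "nat => int"
  let ?P = "\<Union>d\<in>D ` ?E. d ` {1..<q}"
  let ?D = "\<Sum>d\<in>D ` ?E. \<Prod>i\<in>{1..<q}. v ^ d i"
  define u where "u d = (\<Prod>i\<in>{1..<q}. 2 ^ d i :: real)" for d :: "nat => nat"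
  have u0: "0 < u d" for d unfolding u_def by (intro prod_pos) auto
  have e0: "e i = e 0 + int (D e i)" if "e \<in> ?E" "i \<in> {1..<q}" for e i
   using that q unfolding D_def prof_def by auto
  have X: "(\<Prod>i<q. C * 2 powr e i) = (?G e) ^ q * u (D e)" if e: "e \<in> ?E" for e
  proof -
   let ?N = "\<Prod>i\<in>{1..<q}. C * 2 powr e i"
   have "{..<q} = insert 0 {1..<q}" using q by auto
   hence "(\<Prod>i<q. C * 2 powr e i) = (?G e) * ?N" by simp
   also have "?N = (\<Prod>i\<in>{1..<q}. (?G e) * 2 ^ D e i)"
   proof (rule prod.cong[OF refl])
    fix i assume i: "i \<in> {1..<q}"
    show "C * 2 powr e i = (?G e) * 2 ^ D e i"
     unfolding e0[OF e i] by (simp add: powr_add powr_realpow)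
   qed
   also have "\<dots> = (?G e) ^ (q - 1) * u (D e)" by (simp add: prod.distrib u_def)
   finally show ?thesis using q by (cases q) auto
  qed
  have inner: "(\<Sum>e\<in>{e\<in>?E. D e = d}. ?A C e)
    <= ?K / ?B * (?J d)" for d
  proof -
   let ?M = "u d powr (- ?C)"
   let ?L = "u d ^ (m - 1)"
   let ?I = "(W / u d) powr (1 / q)"
   let ?F = "{e\<in>?E. D e = d}"
   let ?O = "\<Sum>e\<in>?F. (?G e) powr T"
   have t: "?A C e = ?L * (?G e) powr T"
    if e: "e \<in> ?F" for e
   proof -
    have p: "0 < ?G e" using C by simp
    have "?A C e
      = ?L * (?G e) ^ (q - 1 + q * (m - 1))"
     using X e by (simp add: power_mult_distrib power_add power_mult)
    also have "q - 1 + q * (m - 1) = q * m - 1" using q by (cases q; cases m) (auto simp: algebra_simps)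
    also have "(?G e) ^ (q * m - 1) = (?G e) powr (real (q * m - 1))"
     using p by (simp add: powr_realpow)
    also have "real (q * m - 1) = T" using q by (simp add: T_def of_nat_diff)
    finally show ?thesis .
   qed
   have inj: "inj_on (\<lambda>e. e 0) ?F"
   proof (rule inj_onI)
    fix e e' assume e: "e \<in> ?F" "e' \<in> ?F" "e 0 = e' 0"
    show "e = e'"
    proof (rule PiE_ext[of e "{..<q}" "\<lambda>_. UNIV"])
     show "e \<in> {..<q} \<rightarrow>\<^sub>E UNIV" "e' \<in> {..<q} \<rightarrow>\<^sub>E UNIV" using e by (auto simp: prof_def)
     fix i assume i: "i \<in> {..<q}"
     show "e i = e' i"
     proof (cases "i = 0")
      case False
      hence "i \<in> {1..<q}" using i by auto
      thus ?thesis using e0[of e i] e0[of e' i] e by auto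
     qed (use e in simp)
    qed
   qed
   have le: "C * 2 powr z <= ?I" if z: "z \<in> (\<lambda>e. e 0) ` ?F" for z :: int
   proof -
    obtain e where e: "e \<in> ?F" "z = e 0" using z by blast
    have p: "0 < C * 2 powr z" using C by simp
    have "(C * 2 powr z) ^ q * u d <= W" using X[of e] e by (auto simp: prof_def)
    hence "(C * 2 powr z) powr q <= W / u d" using p u0[of d] by (simp add: powr_realpow pos_le_divide_eq)
    hence "((C * 2 powr z) powr q) powr (1 / q) <= ?I" by (intro powr_mono2) auto
    thus ?thesis using p q by (simp add: powr_powr)
   qed
   have "(\<Sum>e\<in>?F. ?A C e)
     = ?L * ?O"
    unfolding sum_distrib_left by (rule sum.cong[OF refl t])
   also have "?O = (\<Sum>z\<in>(\<lambda>e. e 0) ` ?F. (C * 2 powr z) powr T)"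
    by (simp add: sum.reindex[OF inj])
   also have "\<dots> <= ?I powr T / ?B"
    by (rule geometric_int_sum[OF T C]) (use fin le in auto)
   finally have "(\<Sum>e\<in>?F. ?A C e)
     <= ?L * (?I powr T / ?B)"
    using u0[of d] by (simp add: mult_left_mono)
   also have "?I powr T = ?K * ?M"
   proof -
    have "1 / real q * T = m - 1 / q" using q by (simp add: T_def field_simps)
    moreover have "(W / u d) powr ?C = ?K / u d powr ?C"
     by (rule powr_divide)
    ultimately show ?thesis by (simp only: powr_powr powr_minus_divide times_divide_eq_right mult_1_right)
   qed
   also have "?L * (?K * ?M / ?B)
     = ?K / ?B * (u d powr (m - 1) * ?M)"
    using u0[of d] by (simp add: powr_realpow)
   also have "u d powr (m - 1) * ?M = u d powr (-s)"
    using q by (simp add: powr_add[symmetric] s_def of_nat_diff algebra_simps)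
   also have "u d powr (-s) = (?J d)"
   proof -
    have "u d powr (-s) = (\<Prod>i\<in>{1..<q}. (2 ^ d i) powr (-s))" unfolding u_def by (rule prod_powr_distrib)
    also have "\<dots> = (?J d)"
     by (intro prod.cong refl) (simp add: v_def powr_realpow[symmetric] powr_powr mult.commute)
    finally show ?thesis .
   qed
   finally show ?thesis .
  qed
  have vD: "?D <= ?H"
  proof -
   define N where "N = Max (insert 0 ?P)"
   let ?Q = "\<lambda>_. {..N}"
   have "D ` ?E \<subseteq> PiE {1..<q} ?Q"
   proof
    fix d assume d: "d \<in> D ` ?E"
    have "d i <= N" if "i \<in> {1..<q}" for i
    proof -
     have "d i \<in> ?P" using d that by blast
     thus ?thesis unfolding N_def using fin by (intro Max_ge) auto
    qed
    moreover have "d \<in> extensional {1..<q}" using d by (auto simp: D_def)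
    ultimately show "d \<in> PiE {1..<q} ?Q" by (auto simp: PiE_def)
   qed
   hence "?D <= (\<Sum>d\<in>PiE {1..<q} ?Q. \<Prod>i\<in>{1..<q}. v ^ d i)"
    using v0 by (intro sum_mono2 finite_PiE prod_nonneg) auto
   also have "\<dots> = (\<Prod>i\<in>{1..<q}. \<Sum>j\<le>N. v ^ j)" by (rule prod_sum_PiE[symmetric]) auto
   also have "\<dots> = (\<Sum>j\<le>N. v ^ j) ^ (q - 1)" by simp
   also have "\<dots> <= ?H"
   proof (cases "1 < q")
    case True
    have "(\<Sum>j\<le>N. v ^ j) <= (\<Sum>j. v ^ j)" using v0 v1[OF True] by (intro sum_le_suminf summable_geometric) auto
    also have "\<dots> = 1 / (1 - v)" using v0 v1[OF True] by (intro suminf_geometric) auto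
    finally show ?thesis using v0 by (intro power_mono sum_nonneg) auto
   next
    case False
    hence "q = 1" using q by simp
    thus ?thesis by simp
   qed
   finally show ?thesis .
  qed
  have "(\<Sum>e\<in>?E. ?A C e)
    = (\<Sum>d\<in>D ` ?E. \<Sum>e\<in>{e\<in>?E. D e = d}. ?A C e)"
   by (rule sum.image_gen[OF fin])
  also have "\<dots> <= (\<Sum>d\<in>D ` ?E. ?K / ?B * (?J d))"
   by (rule sum_mono[OF inner])
  also have "\<dots> = ?K / ?B * ?D"
   by (simp add: sum_distrib_left)
  also have "\<dots> <= ?K / ?B * ?H"
   using vD t1 by (intro mult_left_mono) auto
  finally show ?thesis by (simp add: K_def mult.commute)
 qed
 moreover have "0 <= K" using vq t1 unfolding K_def by (intro divide_nonneg_nonneg) auto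
 ultimately show ?thesis by blast
qed

section \<open>Covering the sublattices of bounded determinant by profile classes\<close>

text \<open>Monotone up to the factor \<open>K\<close>: the form in which reducedness survives
  projection, restriction, duality and scaling with the same constant.\<close>

definition qm :: "real => real list => bool" where
 "qm K ls \<longleftrightarrow> (\<forall>i j. i <= j --> j < length ls --> ls ! i <= K * ls ! j)"

definition rb :: "'a::euclidean_space set => 'a list" where
 "rb G = (SOME xs. red xs \<and> zs xs = G)"

text \<open>The norm of the first vector of a reduced basis, which is the first minimum of
  \<open>G\<close> up to a factor depending on the rank.\<close>

definition s0 :: "'a::euclidean_space set => real" where "s0 G = gs (rb G) ! 0"

definition Gs :: "'a::euclidean_space set => nat => real => 'a set set" where
 "Gs L q U = {G. sgrp G \<and> G \<subseteq> L \<and> dim G = q \<and> ldet G <= U}"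

lemma rb: "dsg G ==> red (rb G) \<and> zs (rb G) = G"
 unfolding rb_def by (rule someI_ex[OF ex_red])

lemma rb_bas: "dsg G ==> bas (rb G)" using rb red_bas by blast
lemma rb_length: "dsg G ==> length (rb G) = dim G" using rb rb_bas dim_zs by metis
lemma ldet_rb: assumes "dsg G" shows "ldet G = (\<Prod>i<dim G. gs (rb G) ! i)"
proof -
 have "ldet G = vol (rb G)" using ldet_zs[OF rb_bas[OF assms]] rb[OF assms] by simp
 thus ?thesis by (simp add: vol_def prod_list_nth rb_length[OF assms])
qed

lemma Gs_dsg: "dsg L ==> G \<in> Gs L q U ==> dsg G"
 by (auto simp: Gs_def intro: dsg_sub)

lemma norm_prjs_le: "norm (prjs xs y) <= norm y"
proof (induction xs arbitrary: y rule: gs.induct)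
 case (2 x xs) thus ?case using norm_prj_le order_trans by fastforce
qed simp

text \<open>A nonzero coefficient at the last basis vector forces the norm to be at least the last
  Gram--Schmidt norm; so the basis vectors can be discarded from the end.\<close>

lemma short_in_prefix:
 assumes "bas bs" "v \<in> zs bs" "i <= length bs" "\<And>k. i <= k ==> k < length bs ==> norm v < gs bs ! k"
 shows "v \<in> span (set (take i bs))"
 using assms
proof (induction bs rule: rev_induct)
 case (snoc b bs)
 show ?case
 proof (cases "i = Suc (length bs)")
  case True
  thus ?thesis using snoc.prems(2) span_zs[of "bs @ [b]"] span_base by fastforce
 next
  case False
  hence i: "i <= length bs" using snoc.prems by simp
  obtain a k where v: "v = a + of_int k *\<^sub>R b" "a \<in> zs bs" using snoc.prems(2) zs_snoc by blast
  have "prjs bs v = of_int k *\<^sub>R prjs bs b"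
   using v span_zs[of bs] span_base[of a "zs bs"] by (simp add: linear_add linear_scale)
  hence "\<bar>real_of_int k\<bar> * norm (prjs bs b) <= norm v" using norm_prjs_le[of bs v] by simp
  also have "norm v < norm (prjs bs b)"
   using snoc.prems(4)[of "length bs"] i by (simp add: gs_snoc nth_append)
  finally have "k = 0" using norm_ge_zero[of "prjs bs b"] mult_right_mono[of 1 "\<bar>real_of_int k\<bar>" "norm (prjs bs b)"] by force
  hence vz: "v \<in> zs bs" using v by simp
  have "v \<in> span (set (take i bs))"
  proof (rule snoc.IH[OF _ vz i])
   show "bas bs" using snoc.prems by (simp add: bas_snoc)
   fix k assume "i <= k" "k < length bs"
   thus "norm v < gs bs ! k" using snoc.prems(4)[of k] by (simp add: gs_snoc nth_append)
  qed
  thus ?thesis using i by simp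
 qed
qed (simp add: span_zero)

text \<open>Turns a quasi-monotone sequence into a monotone one, as the profile inequalities
  require, at the cost of the factor \<open>K\<close> in \<open>rmax_qm\<close>.\<close>

definition rmax :: "(nat => real) => nat => real" where "rmax a k = Max (a ` {..k})"

lemma rmax_ge: "j <= k ==> a j <= rmax a k" unfolding rmax_def by (rule Max_ge) auto
lemma rmax_mono: "j <= k ==> rmax a j <= rmax a k" unfolding rmax_def by (rule Max_mono) auto
lemma rmax_ex: "\<exists>j\<le>k. rmax a k = a j"
proof -
 have "rmax a k \<in> a ` {..k}" unfolding rmax_def by (rule Max_in) auto
 thus ?thesis by auto
qed
lemma rmax_0 [simp]: "rmax a 0 = a 0" by (simp add: rmax_def)
lemma rmax_qm: "qm K ls ==> k < length ls ==> rmax ((!) ls) k <= K * ls ! k"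
 using rmax_ex[of k "(!) ls"] by (auto simp: qm_def)

lemma floor_log2:
 assumes "0 < r" shows "2 powr \<lfloor>log 2 r\<rfloor> <= r" "r <= 2 * 2 powr \<lfloor>log 2 r\<rfloor>"
proof -
 have "2 powr \<lfloor>log 2 r\<rfloor> <= 2 powr (log 2 r)" by (intro powr_mono) auto
 thus "2 powr \<lfloor>log 2 r\<rfloor> <= r" using assms by simp
 have "2 powr (log 2 r) <= 2 powr (1 + \<lfloor>log 2 r\<rfloor>)" by (intro powr_mono) linarith+
 thus "r <= 2 * 2 powr \<lfloor>log 2 r\<rfloor>" using assms by (simp add: powr_add)
qed

lemma red_chain:
 assumes "red xs" "j <= i" "i < length xs" shows "gs xs ! j <= 2 ^ (i - j) * gs xs ! i"
 using assms(2,3)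
proof (induction i rule: dec_induct)
 case (step i)
 have "gs xs ! i <= 2 * gs xs ! Suc i" using assms(1) step by (simp add: red_def)
 hence "2 ^ (i - j) * gs xs ! i <= 2 ^ (i - j) * (2 * gs xs ! Suc i)" by (intro mult_left_mono) auto
 also have "\<dots> = 2 ^ (Suc i - j) * gs xs ! Suc i" using step(1) by (simp add: Suc_diff_le)
 finally show ?case using step(3,4) by (meson Suc_lessD order_trans)
qed simp

lemma red_qm: assumes "red xs" shows "qm (2 ^ length xs) (gs xs)"
 unfolding qm_def
proof (intro allI impI)
 fix i j assume ij: "i <= j" "j < length (gs xs)"
 have g: "0 <= gs xs ! j" using ij gs_nonneg nth_mem by blast
 have "gs xs ! i <= 2 ^ (j - i) * gs xs ! j" using red_chain[OF assms ij(1)] ij by simp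
 also have "\<dots> <= 2 ^ length xs * gs xs ! j" using ij g by (intro mult_right_mono power_increasing) auto
 finally show "gs xs ! i <= 2 ^ length xs * gs xs ! j" .
qed

text \<open>The profile consists of the running maxima of the Gram--Schmidt norms of a reduced basis
  of \<open>G\<close>, rounded down to powers of 2. It is bounded below because the first
  \<open>i + 1\<close> vectors of that basis cannot all lie in the span of the first
  \<open>i\<close> vectors of \<open>bs\<close>; by \<open>short_in_prefix\<close> one of them is no
  shorter than some \<open>gs bs ! k\<close> with \<open>k >= i\<close>. In \<open>C\<close> the
  factor \<open>2 * q\<close> compares vectors with the profile, \<open>K\<close> pays for the
  running maxima of \<open>bs\<close>, and the second \<open>q\<close> is room for the ball radius
  in \<open>cls_bound\<close>.\<close>

theorem profile_cover:
 assumes b: "bas bs" and K: "qm K (gs bs)" "1 <= K" and q: "0 < q" "q <= length bs"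
  and G: "G \<in> Gs (zs bs) q U"
 defines "C \<equiv> 2 * real q * real q * K"
 shows "\<exists>e\<in>prof q C (rmax ((!) (gs bs))) (C ^ q * 2 ^ (q * q) * U). G \<in> cls (zs bs) (2 * real q) e q \<and> 2 powr e 0 <= s0 G"
proof -
 let ?C = "\<lambda>q. 2 * real q"
 define xs where "xs = rb G"
 define g where "g = (!) (gs xs)"
 have d: "dsg G" using Gs_dsg[OF dsg_zs[OF b] G] .
 have rx: "red xs" "zs xs = G" and len: "length xs = q" and bx: "bas xs"
  using rb[OF d] rb_length[OF d] rb_bas[OF d] G by (auto simp: xs_def Gs_def)
 have gp: "0 < g i" if "i < q" for i using bas_nth_pos[OF bx] len that by (simp add: g_def)
 define r where "r = rmax g"
 have r: "g i <= r i" "r i <= 2 ^ q * g i" "0 < r i" if "i < q" for i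
 proof -
  show 1: "g i <= r i" unfolding r_def by (rule rmax_ge) simp
  show "r i <= 2 ^ q * g i" unfolding r_def g_def using rmax_qm[OF red_qm[OF rx(1)]] that len by simp
  show "0 < r i" using gp[OF that] 1 by simp
 qed
 define e where "e = (\<lambda>i\<in>{..<q}. \<lfloor>log 2 (r i)\<rfloor>)"
 let ?B = "\<lambda>i. 2 powr e i"
 have e: "?B i <= r i" "r i <= 2 * ?B i" if "i < q" for i
  using floor_log2[OF r(3)[OF that]] that by (auto simp: e_def)
 have emono: "e i <= e j" if "i <= j" "j < q" for i j
  using that r(3)[of i] rmax_mono[OF that(1), of g] unfolding e_def r_def by (auto intro!: floor_mono)
 have nx: "norm (xs ! i) <= ?C q * ?B i" if i: "i < q" for i
 proof -
  have "norm (xs ! i) <= (\<Sum>j\<le>i. g j)" using rx(1) i len by (simp add: red_def g_def)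
  also have "\<dots> <= (\<Sum>j\<le>i. r i)" unfolding r_def by (intro sum_mono rmax_ge) auto
  also have "\<dots> = (real i + 1) * r i" by simp
  also have "\<dots> <= real q * (2 * ?B i)" using e(2)[OF i] r(3)[OF i] i by (intro mult_mono) auto
  finally show ?thesis by simp
 qed
 have C0: "0 < C" using q K by (simp add: C_def)
 have setL: "set xs \<subseteq> zs bs" using set_sub_zs[of xs] rx(2) G by (auto simp: Gs_def)
 have low: "rmax ((!) (gs bs)) i <= C * ?B i" if i: "i < q" for i
 proof -
  \<comment> \<open>Otherwise \<open>i + 1\<close> independent vectors would lie in a space spanned
    by \<open>i\<close> vectors.\<close>
  have "\<exists>l\<le>i. \<exists>k. i <= k \<and> k < length bs \<and> gs bs ! k <= norm (xs ! l)"
  proof (rule ccontr)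
   assume "\<not> ?thesis"
   hence n: "norm (xs ! l) < gs bs ! k" if "l <= i" "i <= k" "k < length bs" for l k
    using that by (metis not_le)
   let ?A = "take (Suc i) xs"
   have "set ?A \<subseteq> span (set (take i bs))"
   proof
    fix x assume "x \<in> set ?A"
    then obtain l where l: "l < Suc i" "l < length xs" "x = xs ! l" by (auto simp: in_set_conv_nth)
    have "x \<in> zs bs" using l setL nth_mem by blast
    thus "x \<in> span (set (take i bs))"
     by (rule short_in_prefix[OF b]) (use i q l n[of l] in auto)
   qed
   hence "dim (set ?A) <= dim (set (take i bs))"
    by (metis dim_span dim_subset span_minimal subspace_span)
   moreover have "bas ?A" using bx by (metis append_take_drop_id bas_append)
   hence "dim (set ?A) = Suc i" using i len by (simp add: bas_iff_dim)
   moreover have "dim (set (take i bs)) <= i" using dim_set_le[of "take i bs"] by simp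
   ultimately show False by simp
  qed
  then obtain l k where lk: "l <= i" "i <= k" "k < length bs" "gs bs ! k <= norm (xs ! l)" by blast
  obtain j where j: "j <= i" "rmax ((!) (gs bs)) i = gs bs ! j" using rmax_ex[of i "(!) (gs bs)"] by blast
  have "gs bs ! j <= K * gs bs ! k" using K(1) j lk by (simp add: qm_def)
  also have "\<dots> <= K * (?C q * ?B i)"
  proof (rule mult_left_mono)
   have "norm (xs ! l) <= ?C q * 2 powr e l" using nx[of l] lk(1) i by simp
   also have "\<dots> <= ?C q * ?B i" using emono[OF lk(1) i] by (intro mult_left_mono powr_mono) auto
   finally show "gs bs ! k <= ?C q * ?B i" using lk(4) by simp
  qed (use K in simp)
  also have "\<dots> = (?C q * K * ?B i) * 1" by simp
  also have "\<dots> <= (?C q * K * ?B i) * real q" using q K by (intro mult_left_mono) auto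
  finally show ?thesis unfolding j C_def by (simp add: mult_ac)
 qed
 have "(\<Prod>i<q. C * ?B i) <= (\<Prod>i<q. C * (2 ^ q * g i))"
  using C0 e(1) r(2) by (intro prod_mono) (auto intro!: mult_left_mono intro: order_trans)
 also have "\<dots> = C ^ q * 2 ^ (q * q) * ldet G"
  using G unfolding ldet_rb[OF d] by (simp add: prod.distrib power_mult g_def xs_def Gs_def)
 also have "\<dots> <= C ^ q * 2 ^ (q * q) * U" using G C0 by (intro mult_left_mono) (auto simp: Gs_def)
 finally have W: "(\<Prod>i<q. C * ?B i) <= C ^ q * 2 ^ (q * q) * U" .
 have "e \<in> prof q C (rmax ((!) (gs bs))) (C ^ q * 2 ^ (q * q) * U)"
  using emono low W unfolding prof_def by (auto simp: e_def)
 moreover have "G \<in> cls (zs bs) (?C q) e q"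
  unfolding cls_def using rx bx len setL nx by blast
 moreover have "2 powr e 0 <= s0 G" using e(1)[OF q(1)] by (simp add: r_def g_def s0_def xs_def)
 ultimately show ?thesis by blast
qed

text \<open>\<open>cls_card\<close> with the ball counts of \<open>zs_card_le\<close>; the constant
  \<open>C\<close> absorbs both the enlarged radius and the passage from Gram--Schmidt norms to
  running maxima.\<close>

theorem cls_bound:
 assumes q: "0 < q" and K: "1 <= K"
 defines "C \<equiv> 2 * real q * real q * K"
 shows "\<exists>c\<ge>1. \<forall>(bs::'a::euclidean_space list) W e. length bs = m --> bas bs --> qm K (gs bs) --> e \<in> prof q C (rmax ((!) (gs bs))) W -->
  finite (cls (zs bs) (2 * real q) e q) \<and> card (cls (zs bs) (2 * real q) e q) <= c * pw (rmax ((!) (gs bs))) (\<lambda>i. C * 2 powr e i) m q"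
proof -
 let ?C = "2 * real q"
 obtain c where c1: "c \<ge> 1" and c: "\<And>(xs::'a list) R. length xs = m ==> bas xs ==> 0 <= R ==>
   card (zs xs \<inter> cball 0 R) <= c * (\<Prod>k<m. 1 + R / gs xs ! k)" using zs_card_le[of m] by blast
 let ?E = "c * 2 ^ m"
 have C0: "0 < C" using q K by (simp add: C_def)
 have "finite (cls (zs bs) ?C e q) \<and> card (cls (zs bs) ?C e q) <= ?E ^ q * pw (rmax ((!) (gs bs))) (\<lambda>i. C * 2 powr e i) m q"
  if h: "length bs = m" "bas bs" "qm K (gs bs)" "e \<in> prof q C (rmax ((!) (gs bs))) W" for bs :: "'a list" and W e
 proof -
  let ?a = "rmax ((!) (gs bs))" and ?S = "\<lambda>i. C * 2 powr e i"
  let ?F = "\<lambda>i. \<Prod>k<m. max 1 (?S i / ?a k)"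
  let ?A = "\<Prod>i<q. (?E * (?F i)) * (\<Prod>l<i. 2 powr real_of_int (e l - e i))"
  have ap: "0 < gs bs ! k" if "k < m" for k using bas_nth_pos[OF h(2)] h(1) that by simp
  have a1: "0 < ?a k" if "k < m" for k
   using rmax_ge[of k k "(!) (gs bs)"] ap[OF that] by simp
  have G: "real (card (zs bs \<inter> cball 0 ((real i + 1) * ?C * 2 powr e i))) <= ?E * (?F i)"
   if i: "i < q" for i
  proof -
   let ?B = "real q * ?C * 2 powr e i"
   let ?R = "(real i + 1) * ?C * 2 powr e i"
   have "card (zs bs \<inter> cball 0 ?R) <= c * (\<Prod>k<m. 1 + ?R / gs bs ! k)" by (rule c[OF h(1,2)]) simp
   also have "\<dots> <= c * (\<Prod>k<m. 2 * max 1 (?S i / ?a k))"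
   proof (intro mult_left_mono prod_mono)
    fix k assume "k \<in> {..<m}"
    hence k: "k < m" by simp
    let ?D = "gs bs ! k"
    have "?R / ?D <= ?B / ?D"
     using i ap[OF k] by (intro divide_right_mono mult_right_mono) auto
    also have "\<dots> <= ?B * (K / ?a k)"
    proof -
     have "?a k <= K * ?D" using rmax_qm[OF h(3)] k h(1) by simp
     hence "1 / ?D <= K / ?a k" using ap[OF k] a1[OF k] by (simp add: field_simps)
     hence "?B * (1 / ?D) <= ?B * (K / ?a k)"
      by (intro mult_left_mono) auto
     thus ?thesis by simp
    qed
    also have "\<dots> = ?S i / ?a k" by (simp add: C_def)
    finally have le: "?R / ?D <= ?S i / ?a k" .
    have "0 <= ?R / ?D" using ap[OF k] by (intro divide_nonneg_pos) auto
    thus "0 <= 1 + ?R / ?D \<and> 1 + ?R / ?D <= 2 * max 1 (?S i / ?a k)" using le by linarith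
   qed (use c1 in simp)
   finally show ?thesis by (simp add: prod.distrib mult_ac)
  qed
  have mono: "e i <= e j" if "i <= j" "j < q" for i j using h(4) that by (simp add: prof_def)
  have fc: "finite (cls (zs bs) ?C e q)"
   "card (cls (zs bs) ?C e q) <= ?A"
   using cls_card[OF dsg_zs[OF h(2)] _ mono G] by auto
  have "(\<Prod>l<i. 2 powr real_of_int (e l - e i)) = (\<Prod>l<i. ?S l / ?S i)" for i
   using C0 by (intro prod.cong refl) (simp add: powr_diff)
  hence "?A
    = (\<Prod>i<q. ?E * ((?F i) * (\<Prod>l<i. ?S l / ?S i)))"
   by (simp only: mult.assoc)
  also have "\<dots> = ?E ^ q * pw ?a ?S m q"
   by (subst prod.distrib) (simp only: pw_def prod_constant card_lessThan)
  finally show ?thesis using fc by simp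
 qed
 moreover have "1 <= ?E ^ q"
 proof (rule one_le_power)
  have "1 * 1 <= ?E" using c1 by (intro mult_mono) auto
  thus "1 <= ?E" by simp
 qed
 ultimately show ?thesis by blast
qed


section \<open>Numbers of sublattices and sums of reciprocal first norms\<close>

context
 fixes m q :: nat and K d :: real
 assumes q0: "0 < q" and K1: "1 <= K" and \<delta>0: "0 < d"
begin

text \<open>Each sublattice is charged to one profile supplied by \<open>profile_cover\<close>, and
  a class contains all sublattices charged to its profile.\<close>

lemma Gs_sum_cls:
 fixes h :: "'a::euclidean_space set => real" and t :: "(nat => int) => real"
 assumes b: "bas (bs :: 'a list)" "length bs = m" "qm K (gs bs)" and qm: "q <= m" and U: "0 < U"
  and C: "C = 2 * real q * real q * K" and W: "W = C ^ q * 2 ^ (q * q) * U"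
  and t: "\<And>M e. M \<in> Gs (zs bs) q U ==> 2 powr e 0 <= s0 M ==> h M <= t e"
  and t0: "\<And>e. 0 <= t e"
 shows "finite (Gs (zs bs) q U) \<and> (\<Sum>M\<in>Gs (zs bs) q U. h M) <= (\<Sum>e\<in>prof q C (rmax ((!) (gs bs))) W. card (cls (zs bs) (2 * real q) e q) * t e)"
proof -
 let ?E = "prof q C (rmax ((!) (gs bs))) W" and ?G = "Gs (zs bs) q U" and ?cl = "\<lambda>e. cls (zs bs) (2 * real q) e q"
 let ?B = "\<lambda>e. card (?cl e) * t e"
 have C0: "0 < C" using q0 K1 by (simp add: C)
 have W0: "0 < W" using C0 U by (simp add: W)
 have ap: "0 < rmax ((!) (gs bs)) k" if "k < m" for k
  using rmax_ge[of k k "(!) (gs bs)"] bas_nth_pos[OF b(1), of k] b(2) that by simp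
 have fE: "finite ?E" using prof_card[OF \<delta>0 q0] C0 W0 ap qm by (meson less_le_trans)
 have fc: "finite (?cl e)" if "e \<in> ?E" for e using cls_bound[OF q0 K1, of m] b that unfolding C by blast
 have "\<forall>M\<in>?G. \<exists>e. e \<in> ?E \<and> M \<in> ?cl e \<and> 2 powr e 0 <= s0 M"
  using profile_cover[OF b(1,3) K1 q0, of _ U] b(2) qm unfolding C W by blast
 then obtain f where f: "\<And>M. M \<in> ?G ==> f M \<in> ?E \<and> M \<in> ?cl (f M) \<and> 2 powr f M 0 <= s0 M" by metis
 have "?G \<subseteq> (\<Union>e\<in>?E. ?cl e)" using f by blast
 hence fG: "finite ?G" by (rule finite_subset) (use fE fc in blast)
 have "(\<Sum>M\<in>?G. h M) <= (\<Sum>M\<in>?G. t (f M))" by (intro sum_mono t) (use f in auto)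
 also have "\<dots> = (\<Sum>e\<in>f ` ?G. \<Sum>M\<in>{M\<in>?G. f M = e}. t (f M))" by (rule sum.image_gen[OF fG])
 also have "\<dots> <= (\<Sum>e\<in>f ` ?G. ?B e)"
 proof (rule sum_mono)
  fix e assume e: "e \<in> f ` ?G"
  let ?A = "\<Sum>M\<in>{M\<in>?G. f M = e}. t (f M)"
  have "?A = card {M\<in>?G. f M = e} * t e" by simp
  also have "\<dots> <= ?B e"
  proof (intro mult_right_mono of_nat_mono card_mono t0)
   show "finite (?cl e)" using e f fc by blast
   show "{M\<in>?G. f M = e} \<subseteq> ?cl e" using f by blast
  qed
  finally show "?A <= ?B e" .
 qed
 also have "\<dots> <= (\<Sum>e\<in>?E. ?B e)"
  using f t0 by (intro sum_mono2 fE) auto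
 finally show ?thesis using fG by blast
qed

text \<open>By \<open>profile_general\<close> a class has at most about \<open>Q ^ m\<close>
  members, and by \<open>prof_card\<close> there are at most about \<open>Q powr d\<close> classes,
  where \<open>Q\<close> is the normalised determinant bound.\<close>

theorem Gs_card:
 assumes qm: "q <= m"
 shows "\<exists>c\<ge>0. \<forall>(bs::'a::euclidean_space list) U. bas bs --> length bs = m --> qm K (gs bs) --> 0 < U -->
   finite (Gs (zs bs) q U) \<and> card (Gs (zs bs) q U) <= c * (U / (\<Prod>i<q. gs bs ! i)) powr (m + d)"
proof -
 let ?C = "m + d"
 define C where "C = 2 * real q * real q * K"
 have C0: "0 < C" using q0 K1 by (simp add: C_def)
 obtain c1 where c1: "c1 \<ge> 1" "\<And>(bs::'a list) W e. length bs = m ==> bas bs ==> qm K (gs bs) ==> e \<in> prof q C (rmax ((!) (gs bs))) W ==>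
  card (cls (zs bs) (2 * real q) e q) <= c1 * pw (rmax ((!) (gs bs))) (\<lambda>i. C * 2 powr e i) m q"
  using cls_bound[OF q0 K1, of m] unfolding C_def by blast
 obtain c2 where c2: "c2 \<ge> 1" "\<And>C a W. 0 < C ==> (\<forall>i<q. 0 < a i) ==> 0 < W ==> finite (prof q C a W) \<and>
   card (prof q C a W) <= c2 * (W / (\<Prod>i<q. a i)) powr d" using prof_card[OF \<delta>0 q0] by blast
 define k where "k = C ^ q * 2 ^ (q * q)"
 let ?G = "c1 * c2 * k powr ?C"
 have k0: "0 < k" using C0 by (simp add: k_def)
 have "finite (Gs (zs bs) q U) \<and> card (Gs (zs bs) q U) <= ?G * (U / (\<Prod>i<q. gs bs ! i)) powr ?C"
  if b: "bas (bs :: 'a list)" "length bs = m" "qm K (gs bs)" and U: "0 < U" for bs U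
 proof -
  let ?B = "\<lambda>e. card (cls (zs bs) (2 * real q) e q)"
  let ?A = "\<Prod>i<q. gs bs ! i"
  define a where "a = rmax ((!) (gs bs))"
  let ?E = "\<Prod>i<q. a i"
  define W where "W = k * U"
  let ?H = "prof q C a W"
  let ?F = "\<Sum>e\<in>prof q C a W. real (?B e) * 1"
  have W0: "0 < W" using k0 U by (simp add: W_def)
  have gp: "0 < gs bs ! i" if "i < m" for i using bas_nth_pos[OF b(1)] b(2) that by simp
  have ga: "gs bs ! i <= a i" for i unfolding a_def by (rule rmax_ge) simp
  have ap: "0 < a i" if "i < m" for i using gp[OF that] ga[of i] by simp
  have am: "a i <= a j" if "i <= j" for i j unfolding a_def by (rule rmax_mono[OF that])
  have pa: "0 < ?E" "0 < ?A" "?A <= ?E"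
  proof -
   show "0 < ?E" "0 < ?A" using ap gp qm by (auto intro!: prod_pos)
   show "?A <= ?E"
    using ga qm gp by (intro prod_mono) (auto intro: less_imp_le)
  qed
  define Q where "Q = W / ?E"
  have Q0: "0 < Q" using W0 pa by (simp add: Q_def)
  have E: "finite ?H" "card ?H <= c2 * Q powr d"
   using c2(2)[OF C0 _ W0, of a] ap qm unfolding Q_def by auto
  have each: "real (?B e) * 1 <= c1 * Q ^ m" if e: "e \<in> ?H" for e
  proof -
   let ?D = "\<Prod>i<q. (C * 2 powr e i) / a i"
   have "?B e <= c1 * pw a (\<lambda>i. C * 2 powr e i) m q"
    using c1(2)[OF b(2,1,3)] e unfolding a_def by blast
   also have "\<dots> <= c1 * ?D ^ m"
    using am ap e C0 c1(1) qm by (intro mult_left_mono profile_general) (auto simp: prof_def intro!: mult_left_mono)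
   also have "\<dots> <= c1 * Q ^ m"
   proof (intro mult_left_mono power_mono)
    show "?D <= Q" unfolding prod_dividef Q_def
     using e pa by (intro divide_right_mono) (auto simp: prof_def)
    show "0 <= ?D" using C0 ap qm by (intro prod_nonneg) (auto intro!: divide_nonneg_pos)
   qed (use c1 in simp)
   finally show ?thesis by simp
  qed
  have G: "finite (Gs (zs bs) q U) \<and> (\<Sum>M\<in>Gs (zs bs) q U. 1::real) <= ?F"
   unfolding a_def by (rule Gs_sum_cls[OF b qm U C_def]) (auto simp: W_def k_def)
  have "?F <= (\<Sum>e\<in>prof q C a W. c1 * Q ^ m)"
   by (rule sum_mono[OF each])
  also have "\<dots> = card ?H * (c1 * Q ^ m)" by simp
  also have "\<dots> <= (c2 * Q powr d) * (c1 * Q ^ m)"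
   using E c1 Q0 by (intro mult_right_mono) auto
  also have "\<dots> = c1 * c2 * Q powr ?C" using Q0 by (simp add: powr_add powr_realpow)
  also have "\<dots> <= c1 * c2 * (k * (U / ?A)) powr ?C"
  proof (intro mult_left_mono powr_mono2)
   show "Q <= k * (U / ?A)" unfolding Q_def W_def times_divide_eq_right
    using pa k0 U by (intro divide_left_mono) auto
  qed (use Q0 c1 c2 \<delta>0 in auto)
  also have "\<dots> = ?G * (U / ?A) powr ?C"
   unfolding powr_mult by (simp only: mult.assoc)
  finally show ?thesis using G by simp
 qed
 moreover have "0 <= ?G" using c1 c2 by simp
 ultimately show ?thesis by blast
qed

text \<open>Profiles whose first entry reaches the last running maximum \<open>a (m - 1)\<close>
  fall under \<open>profile_large\<close> and are summed by \<open>prof_sum\<close>; they produce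
  the exponent \<open>m - 1 / q\<close>. For the others \<open>profile_small\<close> saves a full
  power, and it is enough that the first entry is at least \<open>gs bs ! 0\<close>.\<close>

theorem Gs_sum:
 assumes qm: "q < m"
 shows "\<exists>c\<ge>0. \<forall>(bs::'a::euclidean_space list) U. bas bs --> length bs = m --> qm K (gs bs) --> 0 < U -->
   finite (Gs (zs bs) q U) \<and> (\<Sum>u\<in>Gs (zs bs) q U. 1 / s0 u) <=
    c * (U powr (m - 1 / q) / (\<Prod>i<m. gs bs ! i) ^ q + (U / (\<Prod>i<q. gs bs ! i)) powr (m - 1 + d) / gs bs ! 0)"
proof -
 let ?B = "m - 1 + d"
 define C where "C = 2 * real q * real q * K"
 have C0: "0 < C" using q0 K1 by (simp add: C_def)
 have m0: "0 < m" using qm by simp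
 obtain c1 where c1: "c1 \<ge> 1" "\<And>(bs::'a list) W e. length bs = m ==> bas bs ==> qm K (gs bs) ==> e \<in> prof q C (rmax ((!) (gs bs))) W ==>
  card (cls (zs bs) (2 * real q) e q) <= c1 * pw (rmax ((!) (gs bs))) (\<lambda>i. C * 2 powr e i) m q"
  using cls_bound[OF q0 K1, of m] unfolding C_def by blast
 obtain c2 where c2: "c2 \<ge> 1" "\<And>C a W. 0 < C ==> (\<forall>i<q. 0 < a i) ==> 0 < W ==> finite (prof q C a W) \<and>
   card (prof q C a W) <= c2 * (W / (\<Prod>i<q. a i)) powr d" using prof_card[OF \<delta>0 q0] by blast
 let ?J = "\<lambda>C e. (C * 2 powr e 0) ^ (q - 1) * (\<Prod>i<q. C * 2 powr e i) ^ (m - 1)"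
 let ?E = "m - 1 / q"
 obtain c3 where c3: "c3 \<ge> 0" "\<And>C a W. 0 < C ==> 0 < W ==> finite (prof q C a W) ==>
  (\<Sum>e\<in>prof q C a W. ?J C e) <= c3 * W powr ?E"
  using prof_sum[OF q0 qm] by blast
 let ?K = "\<lambda>k. c1 * C * c3 * k powr ?E"
 define k where "k = C ^ q * 2 ^ (q * q)"
 have k0: "0 < k" using C0 by (simp add: k_def)
 define c where "c = ?K k + c1 * C * c2 * k powr ?B"
 have "finite (Gs (zs bs) q U) \<and> (\<Sum>u\<in>Gs (zs bs) q U. 1 / s0 u) <=
    c * (U powr ?E / (\<Prod>i<m. gs bs ! i) ^ q + (U / (\<Prod>i<q. gs bs ! i)) powr ?B / gs bs ! 0)"
  if b: "bas (bs :: 'a list)" "length bs = m" "qm K (gs bs)" and U: "0 < U" for bs U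
 proof -
  let ?T = "\<lambda>n. \<Prod>i<n. gs bs ! i"
  let ?D = "\<lambda>e. card (cls (zs bs) (2 * real q) e q) * (1 / 2 powr e 0)"
  let ?C = "U / (\<Prod>i<q. gs bs ! i)"
  define a where "a = rmax ((!) (gs bs))"
  define W where "W = k * U"
  let ?W = "\<Sum>e\<in>prof q C a W. ?D e"
  let ?O = "prof q C a W"
  have W0: "0 < W" using k0 U by (simp add: W_def)
  have gp: "0 < gs bs ! i" if "i < m" for i using bas_nth_pos[OF b(1)] b(2) that by simp
  have ga: "gs bs ! i <= a i" for i unfolding a_def by (rule rmax_ge) simp
  have ap: "0 < a i" if "i < m" for i using gp[OF that] ga[of i] by simp
  have am: "a i <= a j" if "i <= j" for i j unfolding a_def by (rule rmax_mono[OF that])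
  have pa: "0 < (\<Prod>i<n. a i)" "0 < (?T n)" "(?T n) <= (\<Prod>i<n. a i)" if "n <= m" for n
  proof -
   show "0 < (\<Prod>i<n. a i)" "0 < (?T n)" using ap gp that by (auto intro!: prod_pos)
   show "(?T n) <= (\<Prod>i<n. a i)"
    using ga that gp by (intro prod_mono) (auto intro: less_imp_le)
  qed
  have qm': "q <= m" using qm by simp
  define Q where "Q = W / (\<Prod>i<q. a i)"
  let ?Q = "Q powr d"
  let ?H = "Q ^ (m - 1)"
  have Q0: "0 < Q" using W0 pa[OF qm'] by (simp add: Q_def)
  have E: "finite ?O" "card ?O <= c2 * ?Q"
   using c2(2)[OF C0 _ W0, of a] ap qm unfolding Q_def by auto
  define A where "A e = ?J C e" for e :: "nat => int"
  have A0: "0 <= A e" for e using C0 by (simp add: A_def prod_nonneg)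
  let ?P = "(\<Prod>i<m. gs bs ! i) ^ q" and ?g = "gs bs ! 0"
  let ?V = "U powr ?E / ?P"
  let ?N = "c1 * C / ?P * (\<Sum>e\<in>prof q C a W. A e)"
  let ?A = "c1 * C * (?H / ?g)"
  have P0: "0 < ?P" using pa(2)[OF order_refl] by simp
  have g0: "0 < ?g" using gp m0 by simp
  have Qm: "0 <= ?H / ?g" using Q0 g0 by simp
  have eq: "(c1 * p) * (C / s) = (c1 * C) * (p * (1 / s))" for p s :: real by simp
  have each: "?D e <= c1 * C * (A e / ?P) + ?A"
   if e: "e \<in> ?O" for e
  proof -
   let ?S = "\<lambda>i. C * 2 powr e i"
   let ?M = "\<Prod>i<q. ?S i / a i"
   let ?G = "pw a ?S m q"
   let ?R = "(c1 * ?G) * (C / ?S 0)"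
   let ?I = "?G * (1 / ?S 0)"
   let ?F = "\<Prod>i<q. ?S i"
   let ?L = "?S 0 ^ q * ?F ^ m / (?F * (\<Prod>k<m. a k) ^ q)"
   have S0: "0 < ?S i" for i using C0 by simp
   have mono: "?S i <= ?S j" if "i <= j" "j < q" for i j
    using e C0 that by (auto simp: prof_def intro!: mult_left_mono powr_mono)
   have aS: "a i <= ?S i" if "i < q" for i using e that by (simp add: prof_def)
   let ?U = "(c1 * C) * (A e / ?P)"
   have XW: "?F <= W" using e by (simp add: prof_def)
   have X0: "0 < ?F" using S0 by (intro prod_pos) auto
   have "card (cls (zs bs) (2 * real q) e q) <= c1 * ?G"
    using c1(2)[OF b(2,1,3)] e unfolding a_def by blast
   hence 1: "?D e <= ?R"
    using C0 by (simp add: divide_right_mono)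
   also have "\<dots> <= c1 * C * (A e / ?P) + ?A"
   proof (cases "a (m - 1) <= ?S 0")
    case True
    have "?G <= ?L"
     by (rule profile_large) (use am ap mono aS qm' True q0 in auto)
    hence "?I <= ?L * (1 / ?S 0)"
     using S0[of 0] by (intro mult_right_mono) auto
    also have "\<dots> = A e / (\<Prod>k<m. a k) ^ q"
    proof -
     have e1: "?S 0 ^ q = ?S 0 * ?S 0 ^ (q - 1)" using q0 by (cases q) auto
     have e2: "?F ^ m = ?F * ?F ^ (m - 1)" using m0 by (cases m) auto
     have alg: "x * y * (z * w) / (z * v) * (1 / x) = y * w / v" if "x \<noteq> 0" "z \<noteq> 0" for x y z w v :: real
      using that by simp
     show ?thesis unfolding A_def e1 e2
      by (rule alg) (use S0[of 0] X0 in linarith)+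
    qed
    also have "\<dots> <= A e / ?P"
     using A0 P0 pa[OF order_refl] by (intro divide_left_mono power_mono mult_pos_pos) auto
    finally have "?I <= A e / ?P" .
    hence "(c1 * C) * ?I <= ?U"
     using c1(1) C0 by (intro mult_left_mono) auto
    hence "?R <= ?U" unfolding eq .
    moreover have "0 <= ?A" using c1(1) C0 by (intro mult_nonneg_nonneg[OF _ Qm]) simp
    ultimately show ?thesis by linarith
   next
    case False
    have "?G <= ?M ^ (m - 1)"
     by (rule profile_small) (use am ap mono aS qm' qm False in auto)
    also have "\<dots> <= ?H"
    proof (rule power_mono)
     show "?M <= Q" unfolding prod_dividef Q_def
      using XW pa(1)[OF qm'] by (intro divide_right_mono) auto
     show "0 <= ?M"
      by (intro prod_nonneg) (use S0 ap qm in \<open>auto intro!: divide_nonneg_pos less_imp_le\<close>)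
    qed
    finally have "?G <= ?H" .
    hence "?I <= ?H * (1 / ?g)"
    proof (rule mult_mono)
     have "?g <= ?S 0" using aS[OF q0] ga[of 0] by simp
     thus "1 / ?S 0 <= 1 / ?g" using g0 by (intro divide_left_mono) auto
    qed (use Q0 S0[of 0] in auto)
    hence "(c1 * C) * ?I <= (c1 * C) * (?H * (1 / ?g))"
     using c1(1) C0 by (intro mult_left_mono) auto
    moreover have "?H * (1 / ?g) = ?H / ?g" by simp
    ultimately have "?R <= ?A" unfolding eq by (simp only:)
    moreover have "0 <= ?U" using c1(1) C0 A0 P0 by simp
    ultimately show ?thesis by linarith
   qed
   finally show ?thesis .
  qed
  have G: "finite (Gs (zs bs) q U) \<and> (\<Sum>u\<in>Gs (zs bs) q U. 1 / s0 u) <= ?W"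
   unfolding a_def
  proof (rule Gs_sum_cls[OF b qm' U C_def])
   show "W = C ^ q * 2 ^ (q * q) * U" by (simp add: W_def k_def)
   show "1 / s0 u <= 1 / 2 powr e 0" if "2 powr e 0 <= s0 u" for u and e :: "nat => int"
    using that order_less_le_trans[OF _ that, of 0] by (intro divide_left_mono) auto
  qed auto
  have "?W
    <= (\<Sum>e\<in>prof q C a W. c1 * C * (A e / ?P) + ?A)"
   by (rule sum_mono[OF each])
  also have "\<dots> = ?N + card ?O * ?A"
   by (simp add: sum.distrib sum_distrib_left)
  also have "\<dots> <= c1 * C / ?P * (c3 * W powr ?E) + (c2 * ?Q) * ?A"
  proof (rule add_mono)
   show "?N <= c1 * C / ?P * (c3 * W powr ?E)"
    using c3(2)[OF C0 W0 E(1)] c1(1) C0 P0 unfolding A_def by (intro mult_left_mono) auto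
   have "0 <= ?A" using c1(1) C0 by (intro mult_nonneg_nonneg[OF _ Qm]) simp
   thus "card ?O * ?A <= (c2 * ?Q) * ?A"
    using E(2) by (intro mult_right_mono)
  qed
  also have "\<dots> = (?K k) * ?V + c1 * C * c2 * (Q powr ?B / ?g)"
  proof -
   have "W powr ?E = k powr ?E * U powr ?E"
    unfolding W_def by (rule powr_mult)
   moreover have "Q powr ?B = ?H * ?Q" using Q0 by (simp add: powr_add powr_realpow)
   ultimately show ?thesis by (simp add: mult_ac)
  qed
  also have "\<dots> <= (?K k) * ?V + c1 * C * c2 * ((k powr ?B * ?C powr ?B) / ?g)"
  proof (intro add_left_mono mult_left_mono divide_right_mono)
   have "Q powr ?B <= (k * ?C) powr ?B"
   proof (rule powr_mono2)
    show "Q <= k * ?C" unfolding Q_def W_def times_divide_eq_right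
     using pa[OF qm'] k0 U by (intro divide_left_mono) auto
   qed (use Q0 \<delta>0 m0 in auto)
   thus "Q powr ?B <= k powr ?B * ?C powr ?B"
    by (simp only: powr_mult)
  qed (use c1 c2 C0 g0 in auto)
  also have "\<dots> <= c * (?V + ?C powr ?B / ?g)"
  proof -
   have x: "0 <= ?V" "0 <= ?C powr ?B / ?g"
    using P0 g0 by auto
   have y: "0 <= ?K k" "0 <= c1 * C * c2 * k powr ?B"
    using c1(1) c2(1) c3(1) C0 by auto
   show ?thesis unfolding c_def distrib_left distrib_right
    using mult_nonneg_nonneg[OF y(1) x(2)] mult_nonneg_nonneg[OF y(2) x(1)] by (simp add: mult_ac)
  qed
  finally show ?thesis using G by linarith
 qed
 moreover have "0 <= c" using c1(1) c2(1) c3(1) C0 by (auto simp: c_def intro!: add_nonneg_nonneg mult_nonneg_nonneg)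
 ultimately show ?thesis by blast
qed

end

declare zs.simps(2) [simp del]

text \<open>A nonempty set of sublattices provides a profile, whose entries dominate the
  Gram--Schmidt norms while their product is bounded in terms of \<open>U\<close>.\<close>

lemma Gs_empty:
 assumes q0: "0 < q" and K1: "1 <= K" and qm: "q <= m"
 shows "\<exists>c>0. \<forall>(bs::'a::euclidean_space list) U. bas bs --> length bs = m --> qm K (gs bs) -->
   Gs (zs bs) q U \<noteq> {} --> c * (\<Prod>i<q. gs bs ! i) <= U"
proof -
 define C where "C = 2 * real q * real q * K"
 have C0: "0 < C" using q0 K1 by (simp add: C_def)
 define k where "k = C ^ q * 2 ^ (q * q)"
 have k0: "0 < k" using C0 by (simp add: k_def)
 have "(1 / k) * (\<Prod>i<q. gs bs ! i) <= U"
  if b: "bas (bs :: 'a list)" "length bs = m" "qm K (gs bs)" and ne: "Gs (zs bs) q U \<noteq> {}" for bs U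
 proof -
  obtain G where G: "G \<in> Gs (zs bs) q U" using ne by blast
  obtain e where e: "e \<in> prof q C (rmax ((!) (gs bs))) (k * U)"
   using profile_cover[OF b(1,3) K1 q0 _ G] b(2) qm unfolding C_def k_def by blast
  have "(\<Prod>i<q. gs bs ! i) <= (\<Prod>i<q. C * 2 powr e i)"
  proof (rule prod_mono)
   fix i assume i: "i \<in> {..<q}"
   have "gs bs ! i <= rmax ((!) (gs bs)) i" by (rule rmax_ge) simp
   also have "\<dots> <= C * 2 powr e i" using e i by (simp add: prof_def)
   finally show "0 <= gs bs ! i \<and> gs bs ! i <= C * 2 powr e i"
    using bas_nth_pos[OF b(1), of i] i b(2) qm by simp
  qed
  also have "\<dots> <= k * U" using e by (simp add: prof_def)
  finally show ?thesis using k0 by (simp add: field_simps)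
 qed
 thus ?thesis using k0 by (intro exI[of _ "1 / k"]) auto
qed

lemma dim_Gs: "G \<in> Gs L q U ==> dim G = q" by (simp add: Gs_def)

lemma first_coeff_int:
 assumes "bas (b # cs)" "t *\<^sub>R b \<in> zs (b # (cs :: 'a::euclidean_space list))"
 shows "t \<in> \<int>"
proof -
 obtain c y where c: "t *\<^sub>R b = of_int c *\<^sub>R b + y" "y \<in> zs cs" using assms(2) by (elim zs_ConsE)
 hence "(t - of_int c) *\<^sub>R b \<in> span (set cs)" using span_zs[of cs] span_base by (auto simp: scaleR_left_diff_distrib)
 from span_scale[OF this, of "1 / (t - of_int c)"]
 have "t = of_int c" using bas_Cons_notin_span[OF assms(1)] by (cases "t = of_int c") auto
 thus ?thesis by simp
qed

section \<open>Sublattices over their projection along the first basis vector\<close>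

definition gr :: "'a::euclidean_space => 'a set => 'a => 'a set" where
 "gr b M f = (\<lambda>z. z + (f \<bullet> z) *\<^sub>R b) ` M"

lemma linear_gr: "linear (\<lambda>z. z + (f \<bullet> z) *\<^sub>R b)"
 by (rule linearI) (auto simp: inner_add_right algebra_simps)

text \<open>The volume of \<open>ys\<close> together with \<open>b\<close> is computed twice, with
  \<open>b\<close> first and with \<open>b\<close> last. The second computation contains the
  distance of \<open>b\<close> from the span of the graph, which a normal vector of the graph
  provides.\<close>

lemma gr_vol:
 fixes b :: "'a::euclidean_space"
 assumes b: "b \<noteq> 0" and xs: "bas xs" "\<And>x. x \<in> set xs ==> x \<bullet> b = 0" and f: "f \<in> span (set xs)"
 defines "ys \<equiv> map (\<lambda>z. z + (f \<bullet> z) *\<^sub>R b) xs"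
 shows "bas ys" "vol ys = vol xs * sqrt (1 + (norm b)\<^sup>2 * (norm f)\<^sup>2)"
proof -
 let ?D = "\<lambda>z. z + (f \<bullet> z) *\<^sub>R b"
 let ?C = "f \<bullet> f"
 let ?A = "sqrt (1 + (norm b)\<^sup>2 * (norm f)\<^sup>2)"
 have px: "prj b (z + s *\<^sub>R b) = z" if "z \<bullet> b = 0" for z s using that by (simp add: prj_add prj_id)
 have m: "map (prj b) ys = xs" unfolding ys_def using xs(2) by (intro nth_equalityI) (auto simp: px)
 have 1: "bas (b # ys)" unfolding bas_Cons m using b xs by simp
 hence "dim (set (b # ys)) = length (b # ys)" by (simp only: bas_iff_dim)
 hence 2: "bas (ys @ [b])" by (simp add: bas_iff_dim)
 thus "bas ys" by (simp add: bas_snoc)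
 have v: "vol (ys @ [b]) = vol (b # ys)" by (rule vol_unique(1)[OF 2 1]) (rule zs_cong_set, simp)
 \<comment> \<open>A normal vector of the graph having inner product 1 with \<open>b\<close>, so
   that the projection of \<open>b\<close> is \<open>?n\<close> divided by its squared norm.\<close>
 let ?n = "(1 / (b \<bullet> b)) *\<^sub>R b - f"
 let ?B = "?n \<bullet> ?n"
 have \<phi>b: "f \<bullet> b = 0" using orth_span[OF _ f, of b] xs(2) by (simp add: inner_commute)
 have bb: "b \<bullet> b \<noteq> 0" using b by simp
 have nn: "?B = 1 / (b \<bullet> b) + ?C"
  using \<phi>b bb by (simp add: inner_diff_left inner_diff_right inner_commute)
 have np: "0 < ?B" unfolding nn using b by (simp add: add_pos_nonneg)
 have "prjs ys b = (1 / ?B) *\<^sub>R ?n"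
 proof (rule prjs_eqI)
  fix y assume "y \<in> set ys"
  then obtain z where z: "z \<in> set xs" "y = z + (f \<bullet> z) *\<^sub>R b" by (auto simp: ys_def)
  have zb: "z \<bullet> b = 0" using xs(2) z by simp
  have "?n \<bullet> y = 0"
   using zb \<phi>b bb unfolding z by (simp add: inner_diff_left inner_add_right inner_commute[of b z])
  thus "((1 / ?B) *\<^sub>R ?n) \<bullet> y = 0" by simp
 next
  have "f + ?C *\<^sub>R b \<in> ?D ` span (set xs)" using f by blast
  hence "f + ?C *\<^sub>R b \<in> span (?D ` set xs)"
   by (simp only: linear_span_image[OF linear_gr])
  hence m: "f + ?C *\<^sub>R b \<in> span (set ys)" by (simp add: ys_def)
  have "b - (1 / ?B) *\<^sub>R ?n = (1 / ?B) *\<^sub>R (?B *\<^sub>R b - ?n)"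
   using np by (simp add: scaleR_diff_right)
  also have "?B *\<^sub>R b - ?n = f + ?C *\<^sub>R b" unfolding nn by (simp add: algebra_simps)
  finally show "b - (1 / ?B) *\<^sub>R ?n \<in> span (set ys)" using m by (simp add: span_scale)
 qed
 hence "norm (prjs ys b) = 1 / norm ?n"
  using np by (simp add: power2_norm_eq_inner[symmetric] power2_eq_square)
 moreover have "norm ?n = ?A / norm b"
 proof -
  have "(norm ?n)\<^sup>2 = (?A / norm b)\<^sup>2"
   unfolding power2_norm_eq_inner nn using b
   by (simp add: power_divide add_nonneg_nonneg power2_norm_eq_inner field_simps)
  thus ?thesis by (rule power2_eq_imp_eq) auto
 qed
 moreover have "vol ys * norm (prjs ys b) = norm b * vol xs"
  using v m by (simp add: vol_Cons) (simp add: vol_def gs_snoc)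
 moreover have "0 < ?A" by (simp add: add_pos_nonneg)
 ultimately show "vol ys = vol xs * ?A"
  using b by (simp add: field_simps)
qed

context
 fixes b :: "'a::euclidean_space" and cs :: "'a list"
 assumes bas: "bas (b # cs)"
begin

definition "lft x = (SOME y. y \<in> zs (b # cs) \<and> prj b y = x)"
text \<open>The coordinate along \<open>b\<close> of a lift of the \<open>i\<close>-th basis vector.
  It is determined by the lattice modulo integers, which is all that a translate of the dual lattice
  depends on.\<close>

definition "gr_shift M i = (lft (rb M ! i) \<bullet> b) / (b \<bullet> b)"

lemma b0: "b \<noteq> 0" and bas': "bas (map (prj b) cs)"
 using bas by (auto simp: bas_Cons)

lemma prj_zs: "prj b ` zs (b # cs) = zs (map (prj b) cs)"
proof -
 have "prj b ` zs (b # cs) = zs (map (prj b) (b # cs))" by (rule zs_image[symmetric]) simp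
 also have "\<dots> = zs (map (prj b) cs)" by (simp add: zs.simps)
 finally show ?thesis .
qed

lemma lft: "x \<in> zs (map (prj b) cs) ==> lft x \<in> zs (b # cs) \<and> prj b (lft x) = x"
 unfolding lft_def prj_zs[symmetric] by (rule someI_ex[of "\<lambda>y. y \<in> zs (b # cs) \<and> prj b y = x"]) blast

lemma prj_lattice_orth: "x \<in> zs (map (prj b) cs) ==> x \<bullet> b = 0"
 unfolding prj_zs[symmetric] by auto

lemma decomp_b: "y = prj b y + ((y \<bullet> b) / (b \<bullet> b)) *\<^sub>R b"
 using prj_decomp[of y b] by (simp add: add.commute)

text \<open>If \<open>M\<close> meets the line of \<open>b\<close> trivially, then
  \<open>prj b\<close> is injective on \<open>M\<close>, so \<open>M\<close> is a graph over
  \<open>M'\<close>. A graph lies in the lattice if and only if its values at a basis of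
  \<open>M'\<close> agree with those of lattice lifts modulo integers.\<close>

lemma gr_fiber:
 assumes M': "sgrp M'" "M' \<subseteq> zs (map (prj b) cs)"
 shows "{M. sgrp M \<and> M \<subseteq> zs (b # cs) \<and> M \<inter> span {b} = {0} \<and> prj b ` M = M'}
  = gr b M' ` {f \<in> span M'. \<forall>i<dim M'. \<exists>c::int. f \<bullet> rb M' ! i = c + gr_shift M' i}" (is "?A = gr b M' ` ?F")
proof -
 let ?C = "zs (b # cs)"
 have d: "dsg M'" by (rule dsg_sub[OF dsg_zs[OF bas'] M'])
 define xs where "xs = rb M'"
 have xs: "bas xs" "zs xs = M'" "length xs = dim M'" using rb[OF d] rb_bas[OF d] rb_length[OF d] by (auto simp: xs_def)
 have sp: "span M' = span (set xs)" using span_zs[of xs] xs by simp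
 have orth: "z \<bullet> b = 0" if "z \<in> M'" for z using prj_lattice_orth M' that by blast
 have xi: "xs ! i \<in> M'" if "i < dim M'" for i using set_sub_zs[of xs] xs that by (metis nth_mem subsetD)
 let ?E = "\<lambda>i. lft (xs ! i)"
 let ?B = "\<lambda>f. map (\<lambda>z. z + (f \<bullet> z) *\<^sub>R b) xs"
 have lf: "?E i = xs ! i + gr_shift M' i *\<^sub>R b" "?E i \<in> ?C" if "i < dim M'" for i
  using lft[of "xs ! i"] xi[OF that] M'(2) decomp_b[of "?E i"] by (auto simp: gr_shift_def xs_def)
 have pg: "prj b (z + (f \<bullet> z) *\<^sub>R b) = z" if "z \<in> M'" for z f
  using orth[OF that] by (simp add: prj_add prj_id)
 have pgr: "prj b ` gr b M' f = M'" for f unfolding gr_def image_image using pg by simp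
 have grz: "gr b M' f = zs (?B f)" for f
  unfolding gr_def by (simp only: zs_image[OF linear_gr] xs)
 show ?thesis
 proof (intro equalityI subsetI)
  fix M assume "M \<in> gr b M' ` ?F"
  then obtain f where f: "f \<in> ?F" "M = gr b M' f" by blast
  have "sgrp M" unfolding f gr_def by (rule sgrp_image[OF linear_gr M'(1)])
  moreover have "M \<subseteq> ?C" unfolding f grz
  proof (rule zs_least[OF sgrp_zs])
   show "set (?B f) \<subseteq> ?C"
   proof
    fix y assume "y \<in> set (?B f)"
    then obtain i where i: "i < dim M'" "y = xs ! i + (f \<bullet> xs ! i) *\<^sub>R b" by (auto simp: in_set_conv_nth xs)
    obtain c :: int where "f \<bullet> xs ! i = c + gr_shift M' i" using f(1) i(1) unfolding xs_def by blast
    hence "y = ?E i + of_int c *\<^sub>R b" unfolding i(2) lf(1)[OF i(1)] by (simp add: algebra_simps)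
    moreover have "b \<in> ?C" using set_sub_zs[of "b # cs"] by simp
    ultimately show "y \<in> ?C" using lf(2)[OF i(1)] by (simp only: sgrp_add[OF sgrp_zs] sgrp_int[OF sgrp_zs])
   qed
  qed
  moreover have "M \<inter> span {b} = {0}"
  proof -
   have "y = 0" if y: "y \<in> M" "y \<in> span {b}" for y
   proof -
    obtain z where z: "z \<in> M'" "y = z + (f \<bullet> z) *\<^sub>R b" using y(1) unfolding f gr_def by blast
    obtain t where "y = t *\<^sub>R b" using y(2) by (auto simp: span_singleton)
    hence "prj b y = 0" by simp
    hence "z = 0" using pg[OF z(1)] z(2) by simp
    thus "y = 0" using z(2) by simp
   qed
   moreover have "0 \<in> M" using \<open>sgrp M\<close> by (rule sgrp_0)
   ultimately show ?thesis by (auto simp: span_zero)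
  qed
  ultimately show "M \<in> ?A" using pgr f(2) by blast
 next
  fix M assume "M \<in> ?A"
  hence M: "sgrp M" "M \<subseteq> ?C" "M \<inter> span {b} = {0}" "prj b ` M = M'" by auto
  define g where "g i = (SOME y. y \<in> M \<and> prj b y = xs ! i)" for i
  have g: "g i \<in> M \<and> prj b (g i) = xs ! i" if i: "i < dim M'" for i
  proof -
   have "xs ! i \<in> prj b ` M" unfolding M(4) by (rule xi[OF i])
   hence "\<exists>y. y \<in> M \<and> prj b y = xs ! i" by (elim imageE) auto
   thus ?thesis unfolding g_def by (rule someI_ex)
  qed
  define T where "T i = (g i \<bullet> b) / (b \<bullet> b)" for i
  have ge: "g i = xs ! i + T i *\<^sub>R b" if "i < dim M'" for i
   using decomp_b[of "g i"] g[OF that] by (simp add: T_def)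
  define f where "f = (\<Sum>i<length xs. T i *\<^sub>R du xs ! i)"
  have \<phi>s: "f \<in> span M'" unfolding sp f_def using du_span[of xs] by (intro span_sum span_scale) (auto simp: subset_iff)
  have \<phi>x: "f \<bullet> xs ! j = T j" if j: "j < dim M'" for j
  proof -
   have "f \<bullet> xs ! j = (\<Sum>i<length xs. if i = j then T j else 0)"
    unfolding f_def inner_sum_left by (intro sum.cong) (use j in \<open>auto simp: du_inner xs\<close>)
   thus ?thesis using j by (simp add: xs)
  qed
  have "\<exists>c::int. f \<bullet> rb M' ! i = c + gr_shift M' i" if i: "i < dim M'" for i
  proof -
   let ?D = "\<lambda>M'. T i - gr_shift M' i"
   have "g i - ?E i \<in> ?C" using g[OF i] M(2) lf(2)[OF i] sgrp_diff[OF sgrp_zs] by blast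
   moreover have "g i - ?E i = (?D M') *\<^sub>R b"
    unfolding ge[OF i] lf(1)[OF i] by (simp add: scaleR_left_diff_distrib)
   ultimately have "(?D M') *\<^sub>R b \<in> ?C" by (simp only:)
   hence "?D M' \<in> \<int>" by (rule first_coeff_int[OF bas])
   then obtain c :: int where "?D M' = c" by (auto elim: Ints_cases)
   thus ?thesis using \<phi>x[OF i] unfolding xs_def by (intro exI[of _ c]) simp
  qed
  hence F: "f \<in> ?F" using \<phi>s by blast
  have sub: "gr b M' f \<subseteq> M" unfolding grz
  proof (rule zs_least[OF M(1)])
   show "set (?B f) \<subseteq> M"
    using ge g \<phi>x by (auto simp: in_set_conv_nth xs)
  qed
  have "M \<subseteq> gr b M' f"
  proof
   fix y assume y: "y \<in> M"
   hence "prj b y \<in> prj b ` gr b M' f" using M(4) pgr by blast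
   then obtain w where w: "w \<in> gr b M' f" "prj b y = prj b w" by blast
   hence "y - w \<in> M" using y sub M(1) by (auto intro: sgrp_diff)
   moreover have "y - w \<in> span {b}"
    using decomp_b[of "y - w"] w(2) by (auto simp: linear_diff span_singleton)
   ultimately have "y - w = 0" using M(3) by blast
   thus "y \<in> gr b M' f" using w by simp
  qed
  thus "M \<in> gr b M' ` ?F" using sub F by blast
 qed
qed

lemma gr_ldet:
 assumes M': "sgrp M'" "M' \<subseteq> zs (map (prj b) cs)" and f: "f \<in> span M'"
 shows "dim (gr b M' f) = dim M'" "ldet (gr b M' f) = ldet M' * sqrt (1 + (norm b)\<^sup>2 * (norm f)\<^sup>2)"
proof -
 let ?B = "gr b M' f"
 have d: "dsg M'" by (rule dsg_sub[OF dsg_zs[OF bas'] M'])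
 define xs where "xs = rb M'"
 let ?A = "map (\<lambda>z. z + (f \<bullet> z) *\<^sub>R b) xs"
 have xs: "bas xs" "zs xs = M'" "length xs = dim M'" using rb[OF d] rb_bas[OF d] rb_length[OF d] by (auto simp: xs_def)
 have sp: "span M' = span (set xs)" using span_zs[of xs] xs by simp
 have orth: "z \<bullet> b = 0" if "z \<in> set xs" for z
  using prj_lattice_orth M' that set_sub_zs[of xs] xs(2) by blast
 have grz: "?B = zs ?A"
  unfolding gr_def by (simp only: zs_image[OF linear_gr] xs)
 note v = gr_vol[OF b0 xs(1) orth f[unfolded sp]]
 show "dim ?B = dim M'" unfolding grz using dim_zs[OF v(1)] xs by simp
 show "ldet ?B = ldet M' * sqrt (1 + (norm b)\<^sup>2 * (norm f)\<^sup>2)"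
 proof -
  have "ldet ?B = vol ?A" unfolding grz by (rule ldet_zs[OF v(1)])
  thus ?thesis using v(2) ldet_zs[OF xs(1)] xs(2) by simp
 qed
qed

lemma gr_inj:
 assumes "M' \<subseteq> zs (map (prj b) cs)" "f \<in> span M'" "g \<in> span M'" "gr b M' f = gr b M' g"
 shows "f = g"
proof -
 have "(f - g) \<bullet> z = 0" if z: "z \<in> M'" for z
 proof -
  let ?A = "f \<bullet> z"
  have "z + ?A *\<^sub>R b \<in> gr b M' g" using assms(4) z unfolding gr_def by blast
  then obtain w where w: "w \<in> M'" "z + ?A *\<^sub>R b = w + (g \<bullet> w) *\<^sub>R b" unfolding gr_def by blast
  have "z \<bullet> b = 0" "w \<bullet> b = 0" using z w assms(1) prj_lattice_orth by blast+
  hence "prj b (z + ?A *\<^sub>R b) = z" "prj b (w + (g \<bullet> w) *\<^sub>R b) = w" by (auto simp: prj_add prj_id)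
  hence "z = w" using w(2) by simp
  thus ?thesis using w(2) b0 by (simp add: inner_diff_left)
 qed
 hence "f - g = 0" using assms by (intro span_orth_0[of _ M']) (auto intro: span_diff)
 thus ?thesis by simp
qed

text \<open>The norm of the functional at which the determinant formula of \<open>gr_ldet\<close>
  reaches \<open>H\<close>.\<close>

definition "gr_rad M H = sqrt ((H / ldet M)\<^sup>2 - 1) / norm b"

theorem gr_count:
 assumes fin: "finite (Gs (zs (map (prj b) cs)) d H)" and H: "0 < H"
 shows "finite {M \<in> Gs (zs (b # cs)) d H. M \<inter> span {b} = {0}} \<and>
  card {M \<in> Gs (zs (b # cs)) d H. M \<inter> span {b} = {0}} =
  (\<Sum>M\<in>Gs (zs (map (prj b) cs)) d H. card (DL (rb M) (gr_shift M) (gr_rad M H)))"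
proof -
 let ?H = "zs (map (prj b) cs)"
 let ?F = "zs (b # cs)"
 let ?E = "\<lambda>M. M \<inter> span {b}"
 let ?A = "\<lambda>f. 1 + (norm b)\<^sup>2 * (norm f)\<^sup>2"
 let ?G = "Gs ?H d H" and ?D = "\<lambda>M. DL (rb M) (gr_shift M) (gr_rad M H)"
 let ?B = "\<Union>M\<in>?G. gr b M ` ?D M"
 have G: "sgrp M" "M \<subseteq> ?H" "dim M = d" "ldet M <= H" "dsg M" "0 < ldet M" if "M \<in> ?G" for M
  using that Gs_dsg[OF dsg_zs[OF bas'] that] ldet_pos by (auto simp: Gs_def)
 have le: "ldet M * sqrt (?A f) <= H \<longleftrightarrow> norm f <= gr_rad M H" if M: "M \<in> ?G" for M f
 proof -
  let ?C = "(H / ldet M)\<^sup>2"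
  have h1: "1 <= H / ldet M" using G[OF M] by (simp add: divide_simps)
  hence h2: "1 <= ?C" by (simp add: one_le_power)
  have "ldet M * sqrt (?A f) <= H \<longleftrightarrow> sqrt (?A f) <= H / ldet M"
   using G(6)[OF M] by (simp add: pos_le_divide_eq mult.commute)
  also have "\<dots> \<longleftrightarrow> ?A f <= ?C"
   using h1 by (simp add: real_sqrt_le_iff' add_nonneg_nonneg)
  also have "\<dots> \<longleftrightarrow> (norm b * norm f)\<^sup>2 <= (sqrt (?C - 1))\<^sup>2"
   using h2 by (simp add: power_mult_distrib) linarith
  also have "\<dots> \<longleftrightarrow> norm b * norm f <= sqrt (?C - 1)"
   unfolding abs_le_square_iff[symmetric] using h2 by (simp add: abs_mult)
  also have "\<dots> \<longleftrightarrow> norm f <= gr_rad M H" using b0 by (simp add: gr_rad_def pos_le_divide_eq mult.commute)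
  finally show ?thesis .
 qed
 have DLe: "?D M = {f \<in> span M. (\<forall>i<dim M. \<exists>c::int. f \<bullet> rb M ! i = c + gr_shift M i) \<and> norm f <= gr_rad M H}" if "M \<in> ?G" for M
  unfolding DL_def using rb[OF G(5)[OF that]] rb_length[OF G(5)[OF that]] span_zs[of "rb M"] by simp
 have eq: "{M \<in> Gs ?F d H. ?E M = {0}} = ?B"
 proof (intro equalityI subsetI)
  fix N assume N: "N \<in> {M \<in> Gs ?F d H. ?E M = {0}}"
  let ?M = "prj b ` N"
  have M: "sgrp ?M" "?M \<subseteq> ?H" using N unfolding prj_zs[symmetric] by (auto simp: Gs_def sgrp_image)
  have "N \<in> {M. sgrp M \<and> M \<subseteq> ?F \<and> ?E M = {0} \<and> prj b ` M = ?M}" using N by (simp add: Gs_def)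
  then obtain f where f: "f \<in> span ?M" "\<forall>i<dim ?M. \<exists>c::int. f \<bullet> rb ?M ! i = c + gr_shift ?M i" "N = gr b ?M f"
   unfolding gr_fiber[OF M] by blast
  note gl = gr_ldet[OF M f(1), folded f(3)]
  have dM: "dsg ?M" by (rule dsg_sub[OF dsg_zs[OF bas'] M])
  have "ldet ?M * 1 <= ldet ?M * sqrt (?A f)"
   using ldet_pos[OF dM] by (intro mult_left_mono) auto
  also have "\<dots> <= H" using N gl by (simp add: Gs_def)
  finally have G: "?M \<in> ?G" using M gl N by (simp add: Gs_def)
  have "norm f <= gr_rad ?M H" using le[OF G, of f] gl N by (simp add: Gs_def)
  hence "f \<in> ?D ?M" unfolding DLe[OF G] using f by blast
  thus "N \<in> ?B" using G f(3) by blast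
 next
  fix N assume "N \<in> ?B"
  then obtain M f where M: "M \<in> ?G" and f: "f \<in> ?D M" "N = gr b M f" by blast
  have F: "f \<in> {f \<in> span M. \<forall>i<dim M. \<exists>c::int. f \<bullet> rb M ! i = c + gr_shift M i}" using f(1) unfolding DLe[OF M] by blast
  hence "N \<in> {N. sgrp N \<and> N \<subseteq> ?F \<and> N \<inter> span {b} = {0} \<and> prj b ` N = M}"
   unfolding gr_fiber[OF G(1,2)[OF M]] f(2) by (rule imageI)
  moreover have "dim N = d" "ldet N <= H"
   using gr_ldet[OF G(1,2)[OF M], of f] F G(3)[OF M] le[OF M, of f] f unfolding DLe[OF M] by auto
  ultimately show "N \<in> {M \<in> Gs ?F d H. ?E M = {0}}" by (simp add: Gs_def)
 qed
 have rad: "0 <= gr_rad M H" if M: "M \<in> ?G" for M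
 proof -
  have "1 <= H / ldet M" using G[OF M] by (simp add: divide_simps)
  thus ?thesis unfolding gr_rad_def by (intro divide_nonneg_nonneg real_sqrt_ge_zero) (auto simp: one_le_power)
 qed
 have finD: "finite (?D M)" if M: "M \<in> ?G" for M
  using DL_count[where ?'a = 'a and d = "length (rb M)"] rb_bas[OF G(5)[OF M]] rad[OF M] by blast
 have inj: "inj_on (gr b M) (?D M)" if M: "M \<in> ?G" for M
  using gr_inj[OF G(2)[OF M]] unfolding DLe[OF M] by (intro inj_onI) blast
 have prjgr: "prj b ` gr b M f = M" if M: "M \<in> ?G" for M f
 proof -
  have "prj b (z + (f \<bullet> z) *\<^sub>R b) = z" if "z \<in> M" for z
   using prj_lattice_orth[of z] G(2)[OF M] that by (auto simp: prj_add prj_id)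
  thus ?thesis unfolding gr_def image_image by simp
 qed
 have disj: "gr b M ` ?D M \<inter> gr b M' ` ?D M' = {}" if "M \<in> ?G" "M' \<in> ?G" "M \<noteq> M'" for M M'
 proof (rule ccontr)
  assume "\<not> ?thesis"
  then obtain f g where "gr b M f = gr b M' g" by blast
  hence "prj b ` gr b M f = prj b ` gr b M' g" by simp
  thus False unfolding prjgr[OF that(1)] prjgr[OF that(2)] using that(3) by simp
 qed
 have "card {M \<in> Gs ?F d H. ?E M = {0}} = (\<Sum>M\<in>?G. card (gr b M ` ?D M))"
  unfolding eq using disj finD by (intro card_UN_disjoint fin) auto
 also have "\<dots> = (\<Sum>M\<in>?G. card (?D M))" by (intro sum.cong refl card_image inj)
 finally show ?thesis unfolding eq using fin finD by auto
qed

end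

context
 fixes b :: "'a::euclidean_space" and cs :: "'a list"
 assumes bas: "bas (b # cs)"
begin

lemma prj_scaled: "k \<noteq> 0 ==> prj (k *\<^sub>R b) y = prj b y"
 by (simp add: prj_def)

text \<open>Let \<open>k\<close> be least positive with \<open>k\<close> times \<open>b\<close> in
  \<open>M\<close>. Then \<open>M\<close> is determined by \<open>k\<close>, by its projection of
  rank \<open>d - 1\<close>, and by the coefficients of \<open>b\<close> modulo \<open>k\<close> in
  lifts of a basis of the projection; this accounts for \<open>k ^ (d - 1)\<close>. The determinant
  of \<open>M\<close> is that of the projection times \<open>k * norm b\<close>.\<close>

theorem gr_meet:
 assumes fin: "\<And>k. 0 < k ==> finite (Gs (zs (map (prj b) cs)) (d - 1) (H / (real k * norm b)))"
  and emp: "\<And>k. K < k ==> Gs (zs (map (prj b) cs)) (d - 1) (H / (real k * norm b)) = {}"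
 shows "finite {M \<in> Gs (zs (b # cs)) d H. M \<inter> span {b} \<noteq> {0}} \<and>
  card {M \<in> Gs (zs (b # cs)) d H. M \<inter> span {b} \<noteq> {0}} <=
  (\<Sum>k\<in>{1..K}. k ^ (d - 1) * card (Gs (zs (map (prj b) cs)) (d - 1) (H / (real k * norm b))))"
proof -
 let ?H = "\<lambda>M. M \<inter> span {b}"
 let ?E = "map (prj b) cs"
 let ?L = "zs (b # cs)" and ?G = "\<lambda>k. Gs (zs ?E) (d - 1) (H / (real k * norm b))"
 have bn: "b \<noteq> 0" and bas': "bas ?E" using bas by (auto simp: bas_Cons)
 define l where "l = lft b cs"
 have l: "l x \<in> ?L \<and> prj b (l x) = x" if "x \<in> zs ?E" for x
  unfolding l_def by (rule lft[OF bas that])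
 define F where "F k M f = zs ((real k *\<^sub>R b) # map (\<lambda>i. l (rb M ! i) + of_int (f i) *\<^sub>R b) [0..<d - 1])"
  for k M and f :: "nat => int"
 let ?P = "\<lambda>k. PiE {..<d - 1} (\<lambda>_. {0..<int k})"
 let ?F = "\<lambda>k. card (\<Union>M\<in>?G k. F k M ` ?P k)"
 let ?A = "\<Union>k\<in>{1..K}. \<Union>M\<in>?G k. F k M ` ?P k"
 have sub: "{M \<in> Gs ?L d H. ?H M \<noteq> {0}} \<subseteq> ?A"
 proof
  fix M assume "M \<in> {M \<in> Gs ?L d H. ?H M \<noteq> {0}}"
  hence M: "sgrp M" "M \<subseteq> ?L" "dim M = d" "ldet M <= H" "?H M \<noteq> {0}" by (auto simp: Gs_def)
  have dM: "dsg M" by (rule dsg_sub[OF dsg_zs[OF bas] M(1,2)])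
  have "0 \<in> ?H M" using sgrp_0[OF M(1)] by (simp add: span_zero)
  then obtain y where y: "y \<in> M" "y \<in> span {b}" "y \<noteq> 0" using M(5) by blast
  obtain t where t: "y = t *\<^sub>R b" using y(2) by (auto simp: span_singleton)
  have tint: "s \<in> \<int>" if "s *\<^sub>R b \<in> M" for s using first_coeff_int[OF bas] M(2) that by blast
  obtain c :: int where c: "t = of_int c" using tint y t by (metis Ints_cases)
  have ex: "\<exists>k::nat. 0 < k \<and> real k *\<^sub>R b \<in> M"
  proof (cases "0 < c")
   case True thus ?thesis using y t c by (intro exI[of _ "nat c"]) auto
  next
   case False
   hence "c < 0" using y t c by (cases "c = 0") auto
   moreover have "- y \<in> M" using sgrp_minus[OF M(1) y(1)] .
   ultimately show ?thesis using t c by (intro exI[of _ "nat (- c)"]) auto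
  qed
  define k where "k = (LEAST k::nat. 0 < k \<and> real k *\<^sub>R b \<in> M)"
  have k: "0 < k" "real k *\<^sub>R b \<in> M" using LeastI_ex[OF ex] by (auto simp: k_def)
  have kmin: "j = 0" if "j < k" "real j *\<^sub>R b \<in> M" for j
   using not_less_Least[of j "\<lambda>k. 0 < k \<and> real k *\<^sub>R b \<in> M"] that by (auto simp: k_def)
  let ?x = "real k *\<^sub>R b"
  have x0: "?x \<noteq> 0" using k bn by simp
  have px: "prj ?x y = prj b y" for y using k by (intro prj_scaled) simp
  let ?C = "\<lambda>j. of_int (j div int k)"
  have Z: "s \<in> \<int>" if s: "s *\<^sub>R ?x \<in> M" for s
  proof -
   have "(s * k) *\<^sub>R b \<in> M" using s by simp
   then obtain j :: int where j: "s * k = j" using tint by (metis Ints_cases)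
   have "of_int j *\<^sub>R b - ?C j *\<^sub>R ?x \<in> M"
   proof (rule sgrp_diff[OF M(1) _ sgrp_int[OF M(1) k(2)]])
    show "of_int j *\<^sub>R b \<in> M" using s unfolding scaleR_scaleR j .
   qed
   moreover have "of_int j *\<^sub>R b - ?C j *\<^sub>R ?x = real (nat (j mod int k)) *\<^sub>R b"
   proof -
    have "j = (j div int k) * int k + j mod int k" by simp
    hence "real_of_int j = ?C j * real k + of_int (j mod int k)" by (metis of_int_add of_int_mult of_int_of_nat_eq)
    thus ?thesis using k by (simp add: scaleR_left_diff_distrib[symmetric])
   qed
   ultimately have "nat (j mod int k) = 0" using k by (intro kmin) (auto simp: nat_less_iff)
   hence "j mod int k = 0" using k pos_mod_sign[of "int k" j] by linarith
   then obtain i where "j = int k * i" by auto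
   hence "s = of_int i" using j k by simp
   thus ?thesis by simp
  qed
  let ?M = "prj b ` M"
  have M': "sgrp ?M" "?M \<subseteq> zs ?E"
   using M unfolding prj_zs[OF bas, symmetric] by (auto simp: sgrp_image)
  have dM': "dsg ?M" by (rule dsg_sub[OF dsg_zs[OF bas'] M'])
  have pim: "prj ?x ` M = ?M" using px by (intro image_cong) auto
  have dim': "dim ?M = d - 1" using dim_prj[OF k(2) x0] M(3) pim by simp
  define xs where "xs = rb ?M"
  have xs: "bas xs" "zs xs = ?M" "length xs = d - 1" using rb[OF dM'] rb_bas[OF dM'] rb_length[OF dM'] dim' by (auto simp: xs_def)
  have "\<exists>c. 0 <= c \<and> c < int k \<and> l (xs ! i) + of_int c *\<^sub>R b \<in> M" if i: "i < d - 1" for i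
  proof -
   let ?D = "l (xs ! i)"
   have xi: "xs ! i \<in> ?M" using set_sub_zs[of xs] xs i by (metis nth_mem subsetD)
   then obtain y where y: "y \<in> M" "xs ! i = prj b y" by blast
   let ?B = "((y - ?D) \<bullet> b) / (b \<bullet> b)"
   have li: "?D \<in> ?L" "prj b ?D = xs ! i" using l xi M'(2) by auto
   have "prj b (y - ?D) = 0" using y li by (simp add: linear_diff)
   hence yl: "y - ?D = ?B *\<^sub>R b" using prj_decomp[of "y - ?D" b] by simp
   have "y - ?D \<in> ?L" using y M(2) li sgrp_diff[OF sgrp_zs] by blast
   hence "?B \<in> \<int>" using first_coeff_int[OF bas] yl by simp
   then obtain j :: int where j: "?B = j" by (auto elim: Ints_cases)
   have "y - ?C j *\<^sub>R ?x \<in> M" using y k M by (intro sgrp_diff sgrp_int)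
   moreover have "y - ?C j *\<^sub>R ?x = ?D + of_int (j mod int k) *\<^sub>R b"
   proof -
    have "j = (j div int k) * int k + j mod int k" by simp
    hence e: "real_of_int j = ?C j * real k + of_int (j mod int k)" by (metis of_int_add of_int_mult of_int_of_nat_eq)
    have "y = ?D + of_int j *\<^sub>R b" using yl j by (simp add: algebra_simps)
    thus ?thesis unfolding e by (simp add: algebra_simps)
   qed
   ultimately show ?thesis using k by (intro exI[of _ "j mod int k"]) auto
  qed
  then obtain f0 where f0: "\<And>i. i < d - 1 ==> 0 <= f0 i \<and> f0 i < int k \<and> l (xs ! i) + of_int (f0 i) *\<^sub>R b \<in> M" by metis
  define f where "f = restrict f0 {..<d - 1}"
  have f: "f \<in> ?P k" "\<And>i. i < d - 1 ==> l (xs ! i) + of_int (f i) *\<^sub>R b \<in> M" using f0 by (auto simp: f_def)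
  let ?ys = "map (\<lambda>i. l (xs ! i) + of_int (f i) *\<^sub>R b) [0..<d - 1]"
  have py: "map (prj ?x) ?ys = xs"
  proof (rule nth_equalityI)
   fix i assume "i < length (map (prj ?x) ?ys)"
   hence i: "i < d - 1" by simp
   have "xs ! i \<in> zs ?E" using set_sub_zs[of xs] xs i M'(2) by (metis nth_mem subsetD)
   thus "map (prj ?x) ?ys ! i = xs ! i" using l[of "xs ! i"] i by (simp add: px prj_add)
  qed (simp add: xs)
  have Mz: "zs (?x # ?ys) = M"
   by (rule lift_zs[OF M(1) k(2) x0 Z]) (use f py xs pim in auto)
  hence MF: "M = F k ?M f" by (simp add: F_def xs_def)
  have bxy: "bas (?x # ?ys)" unfolding bas_Cons py using x0 xs by simp
  have "ldet M = norm ?x * ldet ?M"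
   using ldet_zs[OF bxy] ldet_zs[OF xs(1)] Mz xs(2) py by (simp add: vol_Cons)
  hence "(k * norm b) * ldet ?M <= H" using M(4) by simp
  hence "ldet ?M <= H / (k * norm b)" using k bn by (simp add: field_simps)
  hence G: "?M \<in> ?G k" using M' dim' by (simp add: Gs_def)
  hence "k <= K" using emp[of k] by fastforce
  thus "M \<in> ?A" using k(1) G by (intro UN_I[of k] UN_I[of "?M"] image_eqI[where f = "F k ?M" and x = f, OF MF f(1)]) auto
 qed
 have fP: "finite (?P k)" and cP: "card (?P k) = k ^ (d - 1)" for k by (auto intro!: finite_PiE simp: card_PiE)
 have fG: "finite (?G k)" if "k \<in> {1..K}" for k using fin[of k] that by auto
 have fU: "finite ?A" using fP fG by blast
 have "card {M \<in> Gs ?L d H. ?H M \<noteq> {0}} <= card ?A"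
  by (rule card_mono[OF fU sub])
 also have "\<dots> <= (\<Sum>k\<in>{1..K}. ?F k)" by (rule card_UN_le) simp
 also have "\<dots> <= (\<Sum>k\<in>{1..K}. k ^ (d - 1) * card (?G k))"
 proof (rule sum_mono)
  fix k assume k: "k \<in> {1..K}"
  have "?F k <= (\<Sum>M\<in>?G k. card (F k M ` ?P k))" by (rule card_UN_le[OF fG[OF k]])
  also have "\<dots> <= (\<Sum>M\<in>?G k. k ^ (d - 1))" by (intro sum_mono order_trans[OF card_image_le[OF fP]]) (simp only: cP order_refl)
  finally show "?F k <= k ^ (d - 1) * card (?G k)" by (simp add: mult.commute)
 qed
 finally show ?thesis using finite_subset[OF sub fU] by blast
qed

end

section \<open>Index and duality\<close>

text \<open>Every coset of \<open>M\<close> in \<open>P\<close> has the density of \<open>M\<close>,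
  and the cosets partition \<open>P\<close>. Comparing densities for finite families of cosets
  bounds their number; once finiteness is known, the comparison for all cosets gives
  equality.\<close>

lemma index_count:
 assumes P: "dsg P" and M: "sgrp M" "M \<subseteq> P" "dim M = dim P"
 shows "finite {(+) p ` M |p. p \<in> P} \<and> card {(+) p ` M |p. p \<in> P} = ldet M / ldet P"
proof -
 let ?D = "\<lambda>P (R::real). P \<inter> cball 0 R"
 let ?A = "\<lambda>X (R::real). X \<inter> cball 0 R"
 let ?E = "\<lambda>F (R::real). \<Sum>X\<in>F. card (?A X R)"
 let ?Q = "{(+) p ` M |p. p \<in> P}" and ?r = "dim P"
 let ?C = "unit_ball_vol ?r"
 define ps where "ps = rb P"
 define xs where "xs = rb M"
 have dM: "dsg M" by (rule dsg_sub[OF P M(1,2)])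
 have ps: "bas ps" "zs ps = P" "length ps = ?r" using rb[OF P] rb_bas[OF P] rb_length[OF P] by (auto simp: ps_def)
 have xs: "bas xs" "zs xs = M" "length xs = ?r" using rb[OF dM] rb_bas[OF dM] rb_length[OF dM] M(3) by (auto simp: xs_def)
 have "span M = span P"
  by (rule subspace_dim_equal) (use M in \<open>auto simp: span_mono\<close>)
 hence sp: "span (set xs) = span P" using span_zs[of xs] xs by simp
 have V: "0 < ?C" by simp
 have lim: "((\<lambda>R. card (?A X R) / R ^ ?r) \<longlongrightarrow> unit_ball_vol ?r / ldet M) at_top" if XQ: "X \<in> ?Q" for X
 proof -
  obtain p where p: "p \<in> P" "X = (+) p ` M" using XQ by blast
  hence "p \<in> span (set xs)" unfolding sp by (simp add: span_base)
  from zs_shift_lim[OF xs(1) this] show ?thesis using p xs ldet_zs[OF xs(1)] by simp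
 qed
 have limP: "((\<lambda>R. card (?D P R) / R ^ ?r) \<longlongrightarrow> unit_ball_vol ?r / ldet P) at_top"
  using zs_lim[OF ps(1)] ps ldet_zs[OF ps(1)] by simp
 have disj: "X \<inter> Y = {}" if XY: "X \<in> ?Q" "Y \<in> ?Q" "X \<noteq> Y" for X Y
 proof (rule ccontr)
  assume ne: "X \<inter> Y \<noteq> {}"
  obtain p q where pq: "X = (+) p ` M" "Y = (+) q ` M" using XY by blast
  from ne obtain u v where uv: "u \<in> M" "v \<in> M" "p + u = q + v" unfolding pq by auto
  have "p - q = v - u" using uv(3) by (simp add: algebra_simps)
  hence pq': "p - q \<in> M" using sgrp_diff[OF M(1) uv(2,1)] by simp
  have "(+) p ` M = (+) q ` M"
  proof (intro equalityI subsetI)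
   fix z assume "z \<in> (+) p ` M"
   then obtain w where "w \<in> M" "z = p + w" by blast
   hence "z = q + ((p - q) + w)" "(p - q) + w \<in> M" using pq' M(1) by (auto intro: sgrp_add)
   thus "z \<in> (+) q ` M" by blast
  next
   fix z assume "z \<in> (+) q ` M"
   then obtain w where "w \<in> M" "z = q + w" by blast
   hence "z = p + (w - (p - q))" "w - (p - q) \<in> M" using pq' M(1) by (auto intro: sgrp_diff)
   thus "z \<in> (+) p ` M" by blast
  qed
  thus False using XY pq by simp
 qed
 have QP: "X \<subseteq> P" if "X \<in> ?Q" for X using that M(2) sgrp_add[OF dsg_sgrp[OF P]] by auto
 have cards: "card (\<Union>X\<in>F. ?A X R) = (?E F R)" if F: "F \<subseteq> ?Q" "finite F" for F R
 proof (rule card_UN_disjoint[OF F(2)])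
  have "finite (?D P R)" using P by (simp add: dsg_def)
  thus "\<forall>X\<in>F. finite (?A X R)"
   using QP[OF subsetD[OF F(1)]] by (intro ballI) (erule finite_subset[rotated], blast)
  show "\<forall>X\<in>F. \<forall>Y\<in>F. X \<noteq> Y --> (?A X R) \<inter> (Y \<inter> cball 0 R) = {}"
   using disj[OF subsetD[OF F(1)] subsetD[OF F(1)]] by blast
 qed
 have limF: "((\<lambda>R. (?E F R) / R ^ ?r) \<longlongrightarrow> card F * (?C / ldet M)) at_top"
  if F: "F \<subseteq> ?Q" "finite F" for F
 proof -
  have "((\<lambda>R. \<Sum>X\<in>F. card (?A X R) / R ^ ?r) \<longlongrightarrow> (\<Sum>X\<in>F. ?C / ldet M)) at_top"
   by (intro tendsto_sum lim) (use F in blast)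
  thus ?thesis by (simp add: sum_divide_distrib)
 qed
 have bound: "card F <= ldet M / ldet P" if F: "F \<subseteq> ?Q" "finite F" for F
 proof -
  have "card F * (?C / ldet M) <= ?C / ldet P"
  proof (rule tendsto_le[OF _ limP limF[OF F]])
   show "\<forall>\<^sub>F R in at_top. (?E F R) / R ^ ?r <= card (?D P R) / R ^ ?r"
    using eventually_gt_at_top[of 0]
   proof eventually_elim
    case (elim R)
    have "(\<Union>X\<in>F. ?A X R) \<subseteq> ?D P R" using QP F(1) by blast
    hence "card (\<Union>X\<in>F. ?A X R) <= card (?D P R)" using P by (intro card_mono) (auto simp: dsg_def)
    hence "(?E F R) <= card (?D P R)" unfolding cards[OF F] .
    thus ?case using elim by (intro divide_right_mono) (auto simp flip: of_nat_sum)
   qed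
  qed simp
  thus ?thesis using V ldet_pos[OF P] ldet_pos[OF dM] by (simp add: field_simps)
 qed
 let ?F = "ldet M / ldet P"
 have fQ: "finite ?Q"
 proof (rule ccontr)
  assume inf: "infinite ?Q"
  obtain n :: nat where n: "?F < n" using reals_Archimedean2 by blast
  obtain F where F: "finite F \<and> card F = n \<and> F \<subseteq> ?Q" using infinite_arbitrarily_large[OF inf] ..
  have "card F <= ?F" by (rule bound) (simp_all only: F)
  moreover have "card F = n" using F by blast
  ultimately show False using n by linarith
 qed
 have "(\<Union>X\<in>?Q. X \<inter> cball 0 R) = P \<inter> cball 0 R" for R
 proof
  let ?B = "cball 0 R"
  show "(\<Union>X\<in>?Q. X \<inter> ?B) \<subseteq> P \<inter> ?B" by (intro UN_least Int_mono order_refl QP)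
  show "P \<inter> ?B \<subseteq> (\<Union>X\<in>?Q. X \<inter> ?B)"
  proof
   fix z assume z: "z \<in> P \<inter> ?B"
   have "z + 0 \<in> (+) z ` M" using sgrp_0[OF M(1)] by blast
   hence "z \<in> (+) z ` M" by simp
   thus "z \<in> (\<Union>X\<in>?Q. X \<inter> ?B)" using z by (intro UN_I[of "(+) z ` M"]) auto
  qed
 qed
 hence "real (card (P \<inter> cball 0 R)) = (\<Sum>X\<in>?Q. card (X \<inter> cball 0 R))" for R using cards[OF order_refl fQ, of R] by simp
 hence "((\<lambda>R. card (P \<inter> cball 0 R) / R ^ ?r) \<longlongrightarrow> card ?Q * (unit_ball_vol ?r / ldet M)) at_top"
  using limF[OF order_refl fQ] by simp
 from tendsto_unique[OF _ this limP] have "card ?Q * (unit_ball_vol ?r / ldet M) = unit_ball_vol ?r / ldet P" by simp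
 hence "card ?Q = ?F" using V ldet_pos[OF P] ldet_pos[OF dM] by (simp add: field_simps)
 thus ?thesis using fQ by blast
qed

text \<open>The intersection of the dual lattice of \<open>zs cs\<close> with the orthogonal
  complement of \<open>M\<close>.\<close>

definition cmp :: "'a::euclidean_space list => 'a set => 'a set" where
 "cmp cs M = {v \<in> span (set cs). (\<forall>z\<in>M. v \<bullet> z = 0) \<and> (\<forall>a\<in>zs cs. \<exists>c::int. v \<bullet> a = c)}"

text \<open>A basis \<open>ps\<close> of the saturation \<open>P\<close> extends to a basis
  \<open>ps @ qs\<close> of the lattice, and the dual vectors belonging to \<open>qs\<close> form a
  basis of \<open>N\<close>. By \<open>rev_du_gs\<close> its determinant is the inverse of the
  product of the Gram--Schmidt norms of the \<open>qs\<close> part. The last claim says that the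
  lattice maps onto the dual of \<open>N\<close>.\<close>

theorem dual_complement:
 assumes cs: "bas cs" and M: "sgrp M" "M \<subseteq> zs cs"
 defines "P \<equiv> zs cs \<inter> span M" and "N \<equiv> cmp cs M"
 shows "dsg P" "dim P = dim M" "sgrp N" "N \<subseteq> zs (rev (du cs))" "dim N + dim M = length cs" "ldet N = ldet P / vol cs"
  "span N = {v \<in> span (set cs). \<forall>z\<in>M. v \<bullet> z = 0}"
  "\<exists>a\<in>zs cs. \<forall>i<dim N. a \<bullet> rb N ! i = of_int (c i)"
proof -
 show \<Gamma>s: "sgrp N" unfolding sgrp_def
 proof (intro conjI ballI)
  show "0 \<in> N" by (auto simp: N_def cmp_def span_zero intro: exI[of _ "0::int"])
  fix x y assume xy: "x \<in> N" "y \<in> N"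
  have "\<exists>c::int. (x - y) \<bullet> a = c" if a: "a \<in> zs cs" for a
  proof -
   have "\<exists>c::int. x \<bullet> a = c" "\<exists>c::int. y \<bullet> a = c" using xy a by (auto simp: N_def cmp_def)
   then obtain c1 c2 :: int where "x \<bullet> a = c1" "y \<bullet> a = c2" by blast
   thus ?thesis by (intro exI[of _ "c1 - c2"]) (simp add: inner_diff_left)
  qed
  thus "x - y \<in> N" using xy by (auto simp: N_def cmp_def inner_diff_left intro: span_diff)
 qed
 show dP: "dsg P" by (rule dsg_sub[OF dsg_zs[OF cs]]) (auto simp: P_def sgrp_Int)
 have MP: "M \<subseteq> P" using M by (auto simp: P_def span_base)
 have spP: "span P = span M"
 proof
  show "span P \<subseteq> span M" by (rule span_minimal) (auto simp: P_def)
 qed (rule span_mono[OF MP])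
 show dimP: "dim P = dim M" by (metis dim_span spP)
 define ps where "ps = rb P"
 have ps: "bas ps" "zs ps = P" "length ps = dim M" using rb[OF dP] rb_bas[OF dP] rb_length[OF dP] dimP by (auto simp: ps_def)
 have sps: "span (set ps) = span M" using span_zs[of ps] ps spP by simp
 obtain qs where qs: "bas (ps @ qs)" "zs (ps @ qs) = zs cs"
  using basis_extend[OF dsg_zs[OF cs] ps(1)] ps(2) sps by (auto simp: P_def)
 let ?E = "ps @ qs"
 let ?C = "\<lambda>v i. v \<bullet> ?E ! i"
 have lenE: "length ?E = length cs" and volE: "vol ?E = vol cs" using vol_unique[OF qs(1) cs qs(2)] by auto
 have spE: "span (set ?E) = span (set cs)" using span_zs[of ?E] span_zs[of cs] qs by simp
 define D where "D = du ?E"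
 define r where "r = length ps"
 define qd where "qd = drop r D"
 let ?D = "rev qd"
 let ?A = "\<lambda>length v. \<Sum>j<length qs. (v \<bullet> qs ! j) *\<^sub>R qd ! j"
 have lenD: "length D = r + length qs" by (simp add: D_def r_def)
 have lqd: "length qd = length qs" by (simp add: qd_def lenD)
 have qdn: "qd ! j = D ! (r + j)" if "j < length qs" for j using that by (simp add: qd_def lenD)
 have Din: "D ! i \<bullet> ?E ! j = (if i = j then 1 else 0)" if "i < length ?E" "j < length ?E" for i j
  unfolding D_def by (rule du_inner[OF qs(1) that])
 have qdps: "qd ! j \<bullet> ps ! i = 0" if "j < length qs" "i < r" for i j
  using Din[of "r + j" i] that by (simp add: qdn nth_append r_def)
 have qdqs: "qd ! j \<bullet> qs ! i = (if i = j then 1 else 0)" if "j < length qs" "i < length qs" for i j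
  using Din[of "r + j" "r + i"] that by (simp add: qdn nth_append r_def)
 have setqd: "set qd \<subseteq> span (set cs)" using du_span[of ?E] set_drop_subset[of r D] unfolding qd_def D_def spE by blast
 have qdM: "v \<bullet> z = 0" if v: "v \<in> set qd" and z: "z \<in> M" for v z
 proof -
  obtain j where j: "j < length qs" "v = qd ! j" using v by (auto simp: in_set_conv_nth lqd)
  have "z \<in> span (set ps)" unfolding sps using z by (rule span_base)
  thus ?thesis by (rule orth_span[rotated]) (use j qdps in \<open>auto simp: in_set_conv_nth r_def\<close>)
 qed
 have expd: "v = (?A length v)"
  if v: "v \<in> span (set cs)" and o: "\<And>z. z \<in> M ==> v \<bullet> z = 0" for v
 proof -
  let ?F = "\<Sum>i<r. (?C v i) *\<^sub>R D ! i"
  let ?B = "\<Sum>i\<in>(+) r ` {..<length qs}. (?C v i) *\<^sub>R D ! i"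
  have vps: "v \<bullet> ps ! i = 0" if "i < r" for i
  proof -
   have "ps ! i \<in> span M" unfolding sps[symmetric] using that by (intro span_base) (simp add: r_def)
   thus ?thesis by (rule orth_span[rotated]) (rule o)
  qed
  have "v = (\<Sum>i<length ?E. (?C v i) *\<^sub>R D ! i)" unfolding D_def using du_expand[OF qs(1), of v] v spE by simp
  also have "{..<length ?E} = {..<r} \<union> (+) r ` {..<length qs}"
   by (auto simp: r_def lessThan_atLeast0)
  also have "(\<Sum>i\<in>\<dots>. (?C v i) *\<^sub>R D ! i) = ?F + ?B"
   by (rule sum.union_disjoint) auto
  also have "?F = 0" using vps by (intro sum.neutral) (auto simp: nth_append r_def)
  also have "?B = (?A length v)"
   by (subst sum.reindex) (auto simp: nth_append r_def qdn[unfolded r_def])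
  finally show ?thesis by simp
 qed
 have \<Gamma>z: "N = zs qd"
 proof
  show "N \<subseteq> zs qd"
  proof
   fix v assume v: "v \<in> N"
   have e: "v = (?A length v)" using v by (intro expd) (auto simp: N_def cmp_def)
   have "(v \<bullet> qs ! j) *\<^sub>R qd ! j \<in> zs qd" if j: "j < length qs" for j
   proof -
    have "qs ! j \<in> zs cs" using set_sub_zs[of ?E] qs(2) j by (auto simp: subset_iff)
    then obtain c :: int where "v \<bullet> qs ! j = c" using v by (auto simp: N_def cmp_def)
    moreover have "qd ! j \<in> zs qd" using set_sub_zs[of qd] j lqd by (metis nth_mem subsetD)
    ultimately show ?thesis using sgrp_int[OF sgrp_zs] by metis
   qed
   thus "v \<in> zs qd" by (subst e) (intro sgrp_sum[OF sgrp_zs], simp)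
  qed
  show "zs qd \<subseteq> N"
  proof (rule zs_least[OF \<Gamma>s])
   show "set qd \<subseteq> N"
   proof
    fix v assume v: "v \<in> set qd"
    hence "v \<in> zs D" using set_sub_zs[of D] set_drop_subset[of r D] unfolding qd_def by blast
    hence i: "\<forall>i<length ?E. \<exists>c::int. ?C v i = c" unfolding D_def zs_du_iff[OF qs(1)] by blast
    have "\<exists>c::int. v \<bullet> a = c" if a: "a \<in> zs cs" for a
    proof -
     obtain k :: "nat => int" where k: "a = (\<Sum>i<length ?E. of_int (k i) *\<^sub>R ?E ! i)" using a zs_comb[of ?E] qs(2) by auto
     obtain c :: "nat => int" where c: "\<And>i. i < length ?E ==> ?C v i = c i" using i by metis
     have "v \<bullet> a = (\<Sum>i<length ?E. of_int (k i * c i))" unfolding k inner_sum_right using c by (intro sum.cong) auto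
     thus ?thesis by (metis of_int_sum)
    qed
    thus "v \<in> N" using v setqd qdM by (auto simp: N_def cmp_def)
   qed
  qed
 qed
 show "N \<subseteq> zs (rev (du cs))"
 proof
  fix v assume v: "v \<in> N"
  have "\<exists>c::int. v \<bullet> cs ! i = c" if "i < length cs" for i
   using v that set_sub_zs[of cs] by (auto simp: N_def cmp_def subset_iff)
  hence "v \<in> zs (du cs)" unfolding zs_du_iff[OF cs] using v by (auto simp: N_def cmp_def)
  thus "v \<in> zs (rev (du cs))" using zs_cong_set[of "du cs" "rev (du cs)"] by simp
 qed
 have rD: "rev D = rev qd @ rev (take r D)" unfolding qd_def by (metis append_take_drop_id rev_append)
 have bqd: "bas ?D" using bas_rev_du[OF qs(1)] unfolding D_def[symmetric] rD bas_append by blast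
 have zqd: "zs ?D = N" unfolding \<Gamma>z by (rule zs_cong_set) simp
 show "dim N + dim M = length cs" using dim_zs[OF bqd] zqd lqd ps(3) lenE by simp
 let ?G = "gs (map (prjs ps) qs)"
 have "gs ?D @ gs (map (prjs ?D) (rev (take r D))) = rev (map inverse (gs ps @ ?G))"
  using rev_du_gs[OF qs(1)] unfolding D_def[symmetric] rD gs_append .
 also have "\<dots> = rev (map inverse ?G) @ rev (map inverse (gs ps))" by simp
 finally have "gs ?D = rev (map inverse ?G)" using lqd by (subst (asm) append_eq_append_conv) auto
 hence "vol ?D = prod_list (map inverse ?G)" by (simp add: vol_def prod_list_rev)
 also have "prod_list (map inverse l) = 1 / prod_list l" for l :: "real list"
  by (induction l) (auto simp: divide_inverse mult.commute)
 finally have "vol ?D = 1 / prod_list ?G" .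
 moreover have "vol ?E = vol ps * prod_list ?G" by (simp add: vol_def gs_append)
 moreover have "0 < vol ps" "0 < vol ?E" using vol_pos ps qs by auto
 ultimately have "vol ?D = vol ps / vol cs" using volE by (auto simp: field_simps)
 thus "ldet N = ldet P / vol cs" using ldet_zs[OF bqd] ldet_zs[OF ps(1)] zqd ps(2) by simp
 show sp\<Gamma>: "span N = {v \<in> span (set cs). \<forall>z\<in>M. v \<bullet> z = 0}"
 proof
  have "subspace {v \<in> span (set cs). \<forall>z\<in>M. v \<bullet> z = 0}"
   by (auto simp: subspace_def span_zero span_add span_scale inner_add_left)
  thus "span N \<subseteq> {v \<in> span (set cs). \<forall>z\<in>M. v \<bullet> z = 0}" by (intro span_minimal) (auto simp: N_def cmp_def)
  show "{v \<in> span (set cs). \<forall>z\<in>M. v \<bullet> z = 0} \<subseteq> span N"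
  proof safe
   fix v assume v: "v \<in> span (set cs)" "\<forall>z\<in>M. v \<bullet> z = 0"
   have "(?A length v) \<in> span N"
    unfolding \<Gamma>z span_zs by (intro span_sum span_scale span_base) (simp add: lqd)
   thus "v \<in> span N" using expd[OF v(1)] v(2) by metis
  qed
 qed
 have d\<Gamma>: "dsg N" using dsg_zs[OF bqd] zqd by simp
 define y where "y = rb N"
 have y: "bas y" "zs y = N" "length y = dim N" using rb[OF d\<Gamma>] rb_bas[OF d\<Gamma>] rb_length[OF d\<Gamma>] by (auto simp: y_def)
 \<comment> \<open>The vector in the span of \<open>N\<close> with the prescribed values;
   \<open>a\<close> below has the same inner products with \<open>N\<close> and lies in the
   lattice.\<close>
 define z where "z = (\<Sum>i<length y. of_int (c i) *\<^sub>R du y ! i)"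
 have zy: "z \<bullet> y ! j = c j" if j: "j < length y" for j
 proof -
  have "z \<bullet> y ! j = (\<Sum>i<length y. if i = j then of_int (c j) else 0)"
   unfolding z_def inner_sum_left by (intro sum.cong) (auto simp: du_inner[OF y(1)] j)
  thus ?thesis using j by simp
 qed
 have zint: "\<exists>k::int. z \<bullet> v = k" if v: "v \<in> N" for v
 proof -
  obtain k :: "nat => int" where k: "v = (\<Sum>i<length y. of_int (k i) *\<^sub>R y ! i)" using v zs_comb[of y] y(2) by auto
  have "z \<bullet> v = (\<Sum>i<length y. of_int (k i * c i))" unfolding k inner_sum_right using zy by (intro sum.cong) auto
  thus ?thesis by (metis of_int_sum)
 qed
 define a where "a = (\<Sum>j<length qs. (z \<bullet> qd ! j) *\<^sub>R qs ! j)"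
 have aA: "a \<in> zs cs" unfolding a_def
 proof (rule sgrp_sum[OF sgrp_zs])
  fix j assume "j \<in> {..<length qs}"
  hence j: "j < length qs" by simp
  have "qd ! j \<in> N" unfolding \<Gamma>z using set_sub_zs[of qd] j lqd by (metis nth_mem subsetD)
  then obtain k :: int where k: "z \<bullet> qd ! j = k" using zint by blast
  have "qs ! j \<in> zs cs" using set_sub_zs[of ?E] qs(2) j by (auto simp: subset_iff)
  thus "(z \<bullet> qd ! j) *\<^sub>R qs ! j \<in> zs cs" unfolding k by (rule sgrp_int[OF sgrp_zs])
 qed
 have "(a - z) \<bullet> v = 0" if vq: "v \<in> set qd" for v
 proof -
  obtain l where l: "l < length qs" "v = qd ! l" using vq by (auto simp: in_set_conv_nth lqd)
  have "a \<bullet> qd ! l = (\<Sum>j<length qs. if j = l then z \<bullet> qd ! l else 0)"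
   unfolding a_def inner_sum_left by (intro sum.cong) (use l in \<open>auto simp: inner_commute[of "qs ! _"] qdqs\<close>)
  thus ?thesis using l by (simp add: inner_diff_left)
 qed
 hence o: "(a - z) \<bullet> v = 0" if "v \<in> N" for v
  using orth_span[of "set qd" "a - z" v] that span_base[of v "zs qd"] unfolding \<Gamma>z span_zs by blast
 show "\<exists>a\<in>zs cs. \<forall>i<dim N. a \<bullet> rb N ! i = of_int (c i)"
 proof (rule bexI[OF _ aA], intro allI impI)
  fix i assume i: "i < dim N"
  have "y ! i \<in> N" using set_sub_zs[of y] y i by (metis nth_mem subsetD)
  thus "a \<bullet> rb N ! i = of_int (c i)" using o[of "y ! i"] zy[of i] i y(3) by (simp add: y_def inner_diff_left)
 qed
qed

lemma adj_zs: "adj (zs xs) x = zs (xs @ [x])"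
 by (auto simp: adj_def zs_snoc)

context
 fixes b :: "'a::euclidean_space" and cs :: "'a list"
 assumes bas: "bas (cs @ [b])"
begin

text \<open>The coefficient of \<open>b\<close> modulo the span of \<open>cs\<close>: an integer on
  the lattice, and zero exactly on the part lying in the hyperplane.\<close>

definition "ht x = (x \<bullet> prjs cs b) / (prjs cs b \<bullet> prjs cs b)"

lemma cs_bas: "bas cs" and b_notin: "b \<notin> span (set cs)" and e0: "prjs cs b \<noteq> 0"
 using bas by (auto simp: bas_snoc prjs_0_iff)

lemma e_orth: "v \<in> span (set cs) ==> prjs cs b \<bullet> v = 0" "v \<in> span (set cs) ==> v \<bullet> prjs cs b = 0"
 using prjs_orth[of v cs b] by (auto simp: inner_commute)

lemma ht_add: "ht (x + y) = ht x + ht y" and ht_scale: "ht (c *\<^sub>R x) = c * ht x" and ht_diff: "ht (x - y) = ht x - ht y"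
 by (auto simp: ht_def inner_add_left inner_diff_left add_divide_distrib diff_divide_distrib)

lemma ht_span: "v \<in> span (set cs) ==> ht v = 0"
 by (simp add: ht_def e_orth)

lemma zs_in_span: "a \<in> zs cs ==> a \<in> span (set cs)"
 using span_zs[of cs] span_base by blast

lemma ht_b: "ht b = 1"
proof -
 have "(b - prjs cs b) \<bullet> prjs cs b = 0" by (rule e_orth) (rule prjs_diff)
 thus ?thesis using e0 by (simp add: ht_def inner_diff_left)
qed

lemma ht_lattice:
 assumes "x \<in> zs (cs @ [b])"
 obtains j :: int and a where "ht x = j" "a \<in> zs cs" "x = a + of_int j *\<^sub>R b"
 using assms by (auto simp: zs_snoc ht_add ht_scale ht_b ht_span[OF zs_in_span])

lemma ht_0: "x \<in> zs (cs @ [b]) ==> ht x = 0 ==> x \<in> zs cs"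
 by (erule ht_lattice) simp

lemma A_sub_L: "zs cs \<subseteq> zs (cs @ [b])"
 using zs_mono[of cs "cs @ [b]"] set_sub_zs[of "cs @ [b]"] by auto

lemma adj_Int:
 assumes M: "M \<subseteq> zs cs" and x: "ht x = real k" "0 < k"
 shows "adj M x \<inter> zs cs = M"
proof
 let ?A = "adj M x \<inter> zs cs"
 show "?A \<subseteq> M"
 proof
  fix z assume "z \<in> ?A"
  then obtain m j where z: "z = m + of_int j *\<^sub>R x" "m \<in> M" "z \<in> zs cs" by (auto simp: adj_def)
  have "ht z = 0" using z by (intro ht_span zs_in_span)
  moreover have "ht m = 0" using z M by (intro ht_span zs_in_span) auto
  ultimately have "of_int j * real k = 0" using z x by (simp add: ht_add ht_scale)
  thus "z \<in> M" using x z by auto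
 qed
 have "m = m + of_int 0 *\<^sub>R x" for m by simp
 hence "M \<subseteq> adj M x" unfolding adj_def by blast
 thus "M \<subseteq> ?A" using M by blast
qed

text \<open>Euclidean division by the least positive height that occurs in \<open>M\<close>.\<close>

lemma adj_exists:
 assumes M: "sgrp M" "M \<subseteq> zs (cs @ [b])" "\<not> M \<subseteq> zs cs"
 shows "\<exists>k>0. \<exists>x\<in>M. ht x = real k \<and> M = adj (M \<inter> zs cs) x"
proof -
 let ?B = "\<lambda>M k. \<exists>x\<in>M. ht x = real k"
 obtain y where y: "y \<in> M" "y \<notin> zs cs" using M by blast
 then obtain j :: int where j: "ht y = j" using M ht_lattice by blast
 have j0: "j \<noteq> 0" using j y ht_0 M(2) by force
 have ex: "\<exists>k::nat. 0 < k \<and> (?B M k)"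
 proof (cases "0 < j")
  case True thus ?thesis using y j by (intro exI[of _ "nat j"]) auto
 next
  case False
  moreover have "ht (- y) = - ht y" using ht_scale[of "-1" y] by simp
  ultimately show ?thesis using y j j0 sgrp_minus[OF M(1) y(1)] by (intro exI[of _ "nat (- j)"]) auto
 qed
 define k where "k = (LEAST k::nat. 0 < k \<and> (?B M k))"
 have k: "0 < k" "\<exists>x\<in>M. ht x = real k" using LeastI_ex[OF ex] by (auto simp: k_def)
 have kmin: "i = 0" if "i < k" "z \<in> M" "ht z = real i" for i z
  using not_less_Least[of i "\<lambda>k. 0 < k \<and> (?B M k)"] that by (auto simp: k_def)
 obtain x where x: "x \<in> M" "ht x = real k" using k by blast
 let ?D = "\<lambda>M. adj (M \<inter> zs cs) x"
 have "M \<subseteq> ?D M"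
 proof
  fix z assume z: "z \<in> M"
  then obtain j :: int where j: "ht z = j" using M(2) ht_lattice by blast
  let ?C = "j mod int k"
  let ?A = "of_int (j div int k)"
  let ?w = "z - ?A *\<^sub>R x"
  have w: "?w \<in> M" by (rule sgrp_diff[OF M(1) z sgrp_int[OF M(1) x(1)]])
  have "j = (j div int k) * int k + j mod int k" by simp
  hence je: "real_of_int j = ?A * real k + of_int ?C" by (metis of_int_add of_int_mult of_int_of_nat_eq)
  have m: "0 <= j mod int k" "j mod int k < int k" using k(1) by auto
  have "ht ?w = of_int ?C" using je j x by (simp add: ht_diff ht_scale)
  hence hw: "ht ?w = real (nat ?C)" using m by simp
  have "nat ?C < k" using m by linarith
  from kmin[OF this w hw] hw have "ht ?w = 0" by simp
  hence "?w \<in> M \<inter> zs cs" using w M(2) ht_0 by blast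
  moreover have "z = ?w + ?A *\<^sub>R x" by simp
  ultimately show "z \<in> ?D M" unfolding adj_def by blast
 qed
 moreover have "?D M \<subseteq> M" using M(1) x(1) by (auto simp: adj_def intro!: sgrp_add sgrp_int)
 ultimately show ?thesis using k x by blast
qed

lemma adj_inj:
 assumes M: "sgrp M1" "M1 \<subseteq> zs cs" "sgrp M2" "M2 \<subseteq> zs cs" and x: "ht x1 = real k1" "ht x2 = real k2" "0 < k1" "0 < k2"
  and e: "adj M1 x1 = adj M2 x2"
 shows "M1 = M2 \<and> k1 = k2 \<and> x1 - x2 \<in> M1"
proof -
 have M12: "M1 = M2" using adj_Int[OF M(2) x(1,3)] adj_Int[OF M(4) x(2,4)] e by simp
 have hM: "ht m = 0" if "m \<in> M1" for m using that M(2) by (intro ht_span zs_in_span) auto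
 have self: "x \<in> adj N x" if "sgrp N" for x and N :: "'a set" using sgrp_0[OF that] by (auto simp: adj_def intro!: exI[of _ 0] exI[of _ "1::int"])
 have "x1 \<in> adj M1 x2" "x2 \<in> adj M1 x1" using self[OF M(1), of x1] self[OF M(3), of x2] e M12 by auto
 then obtain m1 m2 and j1 j2 :: int where
  m: "x1 = m1 + of_int j1 *\<^sub>R x2" "m1 \<in> M1" "x2 = m2 + of_int j2 *\<^sub>R x1" "m2 \<in> M1" unfolding adj_def by blast
 have h1: "real k1 = of_int j1 * real k2" using arg_cong[OF m(1), of ht] x hM[OF m(2)] by (simp add: ht_add ht_scale)
 have h2: "real k2 = of_int j2 * real k1" using arg_cong[OF m(3), of ht] x hM[OF m(4)] by (simp add: ht_add ht_scale)
 have h1': "int k1 = j1 * int k2" using h1 by (metis of_int_eq_iff of_int_mult of_int_of_nat_eq)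
 have h2': "int k2 = j2 * int k1" using h2 by (metis of_int_eq_iff of_int_mult of_int_of_nat_eq)
 have "int k2 dvd int k1" "int k1 dvd int k2" by (simp add: h1', simp add: h2')
 hence "k1 dvd k2" "k2 dvd k1" by (simp_all only: of_nat_dvd_iff)
 hence kk: "k1 = k2" by (rule dvd_antisym)
 hence "j1 = 1" using h1' x by simp
 hence "x1 - x2 = m1" using m(1) by simp
 thus ?thesis using M12 kk m(2) by simp
qed

text \<open>The cosets \<open>x + M\<close> at height \<open>k\<close> for which
  \<open>adj M x\<close> has determinant at most \<open>H\<close>. Triples of \<open>k\<close>,
  \<open>M\<close> and such a coset parametrise the sublattices not contained in the
  hyperplane.\<close>

definition cst :: "real => nat => 'a set => 'a set set" where
 "cst H k M = {(+) x ` M |x. x \<in> zs (cs @ [b]) \<and> ht x = real k \<and> norm (prjs (rb M) x) * ldet M <= H}"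

text \<open>The vector \<open>prjs cs b\<close> is orthogonal to the span of \<open>M\<close>, so
  projecting away from \<open>M\<close> leaves this component of \<open>x\<close> untouched and acts
  on the component in the span of \<open>cs\<close> only.\<close>

lemma norm_prjs_ht:
 assumes M: "sgrp M" "M \<subseteq> zs cs"
 shows "(norm (prjs (rb M) x))\<^sup>2 = (ht x * norm (prjs cs b))\<^sup>2 + (norm (prjs (rb M) (x - ht x *\<^sub>R prjs cs b)))\<^sup>2"
  "prjs (rb M) x = ht x *\<^sub>R prjs cs b + prjs (rb M) (x - ht x *\<^sub>R prjs cs b)"
  "x \<in> zs (cs @ [b]) ==> prjs (rb M) (x - ht x *\<^sub>R prjs cs b) \<in> span (set cs)"
proof -
 let ?B = "span (set cs)"
 let ?e = "prjs cs b" and ?xs = "rb M"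
 have dM: "dsg M" by (rule dsg_sub[OF dsg_zs[OF cs_bas] M])
 have sp: "span (set ?xs) \<subseteq> ?B" using rb[OF dM] span_zs[of ?xs] span_zs[of cs] span_mono[OF M(2)] by simp
 have pe: "prjs ?xs ?e = ?e"
  by (rule prjs_eqI) (use e_orth(1)[OF subsetD[OF sp span_base]] in \<open>auto simp: span_zero\<close>)
 show 2: "prjs ?xs x = ht x *\<^sub>R ?e + prjs ?xs (x - ht x *\<^sub>R ?e)"
  by (simp add: linear_diff linear_scale pe)
 let ?y = "x - ht x *\<^sub>R ?e"
 let ?A = "prjs ?xs ?y"
 have "?y \<bullet> ?e = 0" using e0 by (simp add: inner_diff_left ht_def)
 moreover have "?y - ?A \<in> ?B" using sp prjs_diff by blast
 hence "(?y - ?A) \<bullet> ?e = 0" by (rule e_orth)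
 ultimately have "?A \<bullet> ?e = 0" by (simp add: inner_diff_left)
 hence "(ht x *\<^sub>R ?e) \<bullet> ?A = 0" by (simp add: inner_commute)
 from norm_orth_add[OF this] show "(norm (prjs ?xs x))\<^sup>2 = (ht x * norm ?e)\<^sup>2 + (norm ?A)\<^sup>2"
  unfolding 2[symmetric] by (simp add: power_mult_distrib)
 assume "x \<in> zs (cs @ [b])"
 then obtain j :: int and a where ja: "ht x = j" "a \<in> zs cs" "x = a + of_int j *\<^sub>R b" by (rule ht_lattice)
 have "?y = a + of_int j *\<^sub>R (b - ?e)" unfolding ja(1) by (subst ja(3)) (simp add: algebra_simps)
 hence "?y \<in> ?B" using zs_in_span[OF ja(2)] prjs_diff[of b cs] by (auto intro!: span_add span_scale)
 moreover have "?A = ?y - (?y - ?A)" by simp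
 moreover have "?y - ?A \<in> ?B" using sp prjs_diff by blast
 ultimately show "?A \<in> ?B" using span_diff by metis
qed

lemma ldet_adj:
 assumes M: "sgrp M" "M \<subseteq> zs cs" and x: "x \<in> zs (cs @ [b])" "ht x = real k" "0 < k"
 shows "sgrp (adj M x)" "adj M x \<subseteq> zs (cs @ [b])" "\<not> adj M x \<subseteq> zs cs"
  "dim (adj M x) = Suc (dim M)" "ldet (adj M x) = norm (prjs (rb M) x) * ldet M"
proof -
 have dM: "dsg M" by (rule dsg_sub[OF dsg_zs[OF cs_bas] M])
 have xs: "bas (rb M)" "zs (rb M) = M" "length (rb M) = dim M" using rb[OF dM] rb_bas[OF dM] rb_length[OF dM] by auto
 have a: "adj M x = zs (rb M @ [x])" using adj_zs[of "rb M" x] xs by simp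
 have "span (set (rb M)) \<subseteq> span (set cs)" using xs(2) span_zs[of "rb M"] span_zs[of cs] span_mono[OF M(2)] by simp
 moreover have "x \<notin> span (set cs)" using ht_span[of x] x by auto
 ultimately have bx: "bas (rb M @ [x])" using xs by (auto simp: bas_snoc)
 show "sgrp (adj M x)" unfolding a by simp
 show "adj M x \<subseteq> zs (cs @ [b])" using M(2) A_sub_L x(1) by (auto simp: adj_def intro!: sgrp_add[OF sgrp_zs] sgrp_int[OF sgrp_zs])
 have "x \<in> adj M x" unfolding a using set_sub_zs[of "rb M @ [x]"] by auto
 moreover have "x \<notin> zs cs" using \<open>x \<notin> span (set cs)\<close> zs_in_span by blast
 ultimately show "\<not> adj M x \<subseteq> zs cs" by blast
 show "dim (adj M x) = Suc (dim M)" unfolding a using dim_zs[OF bx] xs by simp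
 show "ldet (adj M x) = norm (prjs (rb M) x) * ldet M"
  unfolding a ldet_zs[OF bx] using ldet_zs[OF xs(1)] xs(2) by (simp add: vol_def gs_snoc)
qed

text \<open>Bring \<open>x\<close> to height zero along \<open>prjs cs b\<close> and project it away
  from \<open>M\<close>. The images are exactly the points, in a ball, of a translate of the dual of
  \<open>cmp cs M\<close>; that all of them occur is the last claim of
  \<open>dual_complement\<close>. Each point comes from one coset of the saturation of
  \<open>M\<close>, hence from as many cosets of \<open>M\<close> as its index there.\<close>

theorem cst_card:
 assumes M: "sgrp M" "M \<subseteq> zs cs" and H: "real k * norm (prjs cs b) * ldet M <= H" and k: "0 < k"
 shows "finite (cst H k M) \<and> real (card (cst H k M)) = ldet M / ldet (zs cs \<inter> span M) *
  card (DL (rb (cmp cs M)) (\<lambda>i. real k * (b \<bullet> rb (cmp cs M) ! i)) (sqrt ((H / ldet M)\<^sup>2 - (real k * norm (prjs cs b))\<^sup>2)))"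
proof -
 let ?H = "span (set cs)"
 let ?G = "\<lambda>M. (H / ldet M)\<^sup>2"
 let ?F = "\<lambda>M x. norm (prjs (rb M) x)"
 let ?B = "\<lambda>y i. real k * (b \<bullet> y ! i)"
 let ?e = "prjs cs b" and ?L = "zs (cs @ [b])"
 let ?D = "real k * norm ?e"
 define P where "P = zs cs \<inter> span M"
 define N where "N = cmp cs M"
 define y where "y = rb N"
 define r where "r = sqrt (?G M - ?D\<^sup>2)"
 define D where "D = DL y (\<lambda>i. ?B y i) r"
 define ps where "ps x = prjs (rb M) (x - ht x *\<^sub>R ?e)" for x
 note dc = dual_complement[OF cs_bas M, folded P_def N_def]
 have dM: "dsg M" by (rule dsg_sub[OF dsg_zs[OF cs_bas] M])
 have t0: "0 < ldet M" by (rule ldet_pos[OF dM])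
 have xs: "span (set (rb M)) = span M" using rb[OF dM] span_zs[of "rb M"] by simp
 have d\<Gamma>: "dsg N" by (rule dsg_sub[OF dsg_zs[OF bas_rev_du[OF cs_bas]] dc(3,4)])
 have y: "bas y" "zs y = N" "length y = dim N" using rb[OF d\<Gamma>] rb_bas[OF d\<Gamma>] rb_length[OF d\<Gamma>] by (auto simp: y_def)
 have spy: "span (set y) = {v \<in> span (set cs). \<forall>z\<in>M. v \<bullet> z = 0}" using dc(7) span_zs[of y] y by simp
 have yi: "y ! i \<in> N" if "i < length y" for i using set_sub_zs[of y] y(2) that by (metis nth_mem subsetD)
 have fD: "finite D" unfolding D_def
 proof -
  have "0 <= r"
  proof -
   have "?D <= H / ldet M" using H t0 by (simp add: field_simps)
   hence "?D\<^sup>2 <= ?G M" by (intro power_mono) auto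
   thus ?thesis by (simp add: r_def)
  qed
  thus "finite (DL y (\<lambda>i. ?B y i) r)" using DL_count[of "length y"] y(1) by blast
 qed
 have psD: "ps x \<in> D \<longleftrightarrow> ?F M x * ldet M <= H" if x: "x \<in> ?L" "ht x = real k" for x
 proof -
  have 1: "ps x \<in> span (set y)"
  proof -
   have "ps x \<in> ?H" unfolding ps_def by (rule norm_prjs_ht(3)[OF M x(1)])
   moreover have "ps x \<bullet> z = 0" if "z \<in> M" for z unfolding ps_def
    by (rule prjs_orth) (use that xs span_base in auto)
   ultimately show ?thesis unfolding spy by blast
  qed
  have 2: "\<exists>c::int. ps x \<bullet> y ! i = c + ?B y i" if i: "i < length y" for i
  proof -
   obtain j :: int and a where ja: "ht x = j" "a \<in> zs cs" "x = a + of_int j *\<^sub>R b" by (rule ht_lattice[OF x(1)])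
   have j: "real_of_int j = real k" using ja x by simp
   let ?z = "x - ht x *\<^sub>R ?e"
   have yc: "y ! i \<in> ?H" "\<forall>z\<in>M. y ! i \<bullet> z = 0" using yi[OF i] by (auto simp: N_def cmp_def)
   have "?z - ps x \<in> span M" unfolding ps_def xs[symmetric] by (rule prjs_diff)
   hence "y ! i \<bullet> (?z - ps x) = 0" by (rule orth_span[rotated]) (use yc in auto)
   hence "ps x \<bullet> y ! i = ?z \<bullet> y ! i" by (simp add: inner_diff_left inner_diff_right inner_commute)
   also have "\<dots> = x \<bullet> y ! i" using e_orth(1)[OF yc(1)] by (simp add: inner_diff_left)
   also have "\<dots> = a \<bullet> y ! i + ?B y i" using j by (subst ja(3)) (simp add: inner_add_left)
   finally have "ps x \<bullet> y ! i = a \<bullet> y ! i + ?B y i" .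
   moreover obtain c :: int where "y ! i \<bullet> a = c" using yi[OF i] ja(2) by (auto simp: N_def cmp_def)
   ultimately show ?thesis by (metis inner_commute)
  qed
  have "norm (ps x) <= r \<longleftrightarrow> (norm (ps x))\<^sup>2 <= ?G M - ?D\<^sup>2"
   unfolding r_def using real_le_rsqrt[of "norm (ps x)"] sqrt_ge_absD[of "norm (ps x)"] by (simp only: abs_norm_cancel) blast
  also have "\<dots> \<longleftrightarrow> (?F M x)\<^sup>2 <= ?G M"
   unfolding norm_prjs_ht(1)[OF M, of x] x(2) ps_def by auto
  also have "\<dots> \<longleftrightarrow> ?F M x <= H / ldet M"
  proof -
   have "0 <= ?D * ldet M" using t0 by simp
   hence "0 <= H / ldet M" using H t0 by (intro divide_nonneg_pos) linarith+
   thus ?thesis by (metis norm_ge_zero power2_le_imp_le power_mono)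
  qed
  also have "\<dots> \<longleftrightarrow> ?F M x * ldet M <= H" using t0 by (simp add: field_simps)
  finally show ?thesis using 1 2 unfolding D_def DL_def by blast
 qed
 have surj: "\<exists>x\<in>?L. ht x = real k \<and> ps x = f" if f: "f \<in> D" for f
 proof -
  have \<phi>s: "f \<in> span (set y)" and "\<forall>i<length y. \<exists>c::int. f \<bullet> y ! i = c + ?B y i" using f by (auto simp: D_def DL_def)
  then obtain c :: "nat => int" where c: "\<And>i. i < length y ==> f \<bullet> y ! i = c i + ?B y i" by metis
  obtain a where a: "a \<in> zs cs" "\<forall>i<dim N. a \<bullet> rb N ! i = of_int (c i)" using dc(8)[of c] by blast
  let ?x = "a + of_int (int k) *\<^sub>R b"
  have x: "?x \<in> ?L" using a(1) unfolding zs_snoc by blast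
  have hx: "ht ?x = real k" using a(1) by (simp add: ht_add ht_scale ht_b ht_span[OF zs_in_span])
  let ?z = "?x - ht ?x *\<^sub>R ?e"
  have p1: "ps ?x \<in> span (set y)"
  proof -
   have "ps ?x \<in> ?H" unfolding ps_def by (rule norm_prjs_ht(3)[OF M x])
   moreover have "ps ?x \<bullet> z = 0" if "z \<in> M" for z unfolding ps_def
    by (rule prjs_orth) (use that xs span_base in auto)
   ultimately show ?thesis unfolding spy by blast
  qed
  have "(ps ?x - f) \<bullet> v = 0" if v: "v \<in> set y" for v
  proof -
   obtain i where i: "i < length y" "v = y ! i" using v by (auto simp: in_set_conv_nth)
   have yc: "y ! i \<in> ?H" "\<forall>z\<in>M. y ! i \<bullet> z = 0" using yi[OF i(1)] by (auto simp: N_def cmp_def)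
   have "?z - ps ?x \<in> span M" unfolding ps_def xs[symmetric] by (rule prjs_diff)
   hence "y ! i \<bullet> (?z - ps ?x) = 0" by (rule orth_span[rotated]) (use yc in auto)
   hence "ps ?x \<bullet> y ! i = ?z \<bullet> y ! i" by (simp add: inner_diff_left inner_diff_right inner_commute)
   also have "\<dots> = ?x \<bullet> y ! i" using e_orth(1)[OF yc(1)] by (simp add: inner_diff_left)
   also have "\<dots> = f \<bullet> y ! i" using c[OF i(1)] a(2) i y(3) by (simp add: inner_add_left y_def)
   finally show ?thesis using i by (simp add: inner_diff_left)
  qed
  moreover have "ps ?x - f \<in> span (set y)" using p1 \<phi>s by (rule span_diff)
  ultimately have "ps ?x - f = 0" using span_orth_0 by blast
  thus ?thesis using x hx by (intro bexI[of _ ?x]) auto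
 qed
 then obtain x0 where x0: "\<And>f. f \<in> D ==> x0 f \<in> ?L \<and> ht (x0 f) = real k \<and> ps (x0 f) = f" by metis
 let ?E = "cst H k M"
 let ?Q = "{(+) p ` M |p. p \<in> P}"
 define S where "S f = (\<lambda>X. (+) (x0 f) ` X) ` ?Q" for f
 let ?A = "\<Union>f\<in>D. S f"
 have MP: "M \<subseteq> P" using M by (auto simp: P_def span_base)
 have iQ: "finite ?Q \<and> card ?Q = ldet M / ldet P"
  by (rule index_count) (use dc(1,2) M MP in auto)
 have tr: "(+) x ` (+) p ` M = (+) (x + p) ` M" for x p by (auto simp: image_image add.assoc)
 have psadd: "ps (x + p) = ps x" if "p \<in> P" "ht x = real k" for x p
 proof -
  have p: "p \<in> span (set (rb M))" "p \<in> zs cs" using that xs by (auto simp: P_def)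
  have "ht (x + p) = ht x" using ht_span[OF zs_in_span[OF p(2)]] by (simp add: ht_add)
  hence "ps (x + p) = prjs (rb M) ((x - ht x *\<^sub>R ?e) + p)" unfolding ps_def by (simp add: algebra_simps)
  also have "\<dots> = ps x" unfolding ps_def linear_add[OF linear_prjs] using p by simp
  finally show ?thesis .
 qed
 have coset_sub: "x - x' \<in> M" if cc: "(+) x ` M = (+) x' ` M" for x x'
 proof -
  have "x + 0 \<in> (+) x' ` M" unfolding cc[symmetric] using sgrp_0[OF M(1)] by blast
  then obtain m where "m \<in> M" "x = x' + m" by auto
  thus ?thesis by simp
 qed
 have cardS: "finite (S f) \<and> card (S f) = card ?Q" for f
 proof -
  have "inj ((+) (x0 f))" by (simp add: inj_def)
  hence "inj_on (\<lambda>X. (+) (x0 f) ` X) ?Q" by (intro inj_onI) (simp only: inj_image_eq_iff)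
  from card_image[OF this] show ?thesis unfolding S_def using iQ by blast
 qed
 have cstU: "?E = ?A"
 proof
  show "?E \<subseteq> ?A"
  proof
   fix X assume "X \<in> ?E"
   then obtain x where x: "X = (+) x ` M" "x \<in> ?L" "ht x = real k" "?F M x * ldet M <= H" by (auto simp: cst_def)
   hence D: "ps x \<in> D" using psD by blast
   note x0' = x0[OF D]
   let ?p = "x - x0 (ps x)"
   have "?p \<in> zs cs" by (rule ht_0) (use x x0' in \<open>auto simp: ht_diff intro: sgrp_diff[OF sgrp_zs]\<close>)
   moreover have "?p \<in> span M"
   proof -
    have "ps z = prjs (rb M) z - prjs (rb M) (real k *\<^sub>R ?e)" if "ht z = real k" for z
     unfolding ps_def using that by (simp add: linear_diff)
    from this[OF x(3)] this[OF x0'[THEN conjunct2, THEN conjunct1]]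
    have "prjs (rb M) ?p = ps x - ps (x0 (ps x))" unfolding linear_diff[OF linear_prjs] by (simp only: diff_diff_eq2 diff_add_cancel)
    thus ?thesis using x0' xs by (simp add: prjs_0_iff)
   qed
   ultimately have "?p \<in> P" by (simp add: P_def)
   moreover have "X = (+) (x0 (ps x)) ` (+) ?p ` M" unfolding tr x(1) by simp
   ultimately show "X \<in> ?A" using D unfolding S_def by blast
  qed
  show "?A \<subseteq> ?E"
  proof
   fix X assume "X \<in> ?A"
   then obtain f p where f: "f \<in> D" "p \<in> P" "X = (+) (x0 f) ` (+) p ` M" by (auto simp: S_def)
   let ?x = "x0 f + p"
   have x: "?x \<in> ?L" "ht ?x = real k" using x0[OF f(1)] f(2) A_sub_L
    by (auto simp: P_def ht_add ht_span[OF zs_in_span] intro!: sgrp_add[OF sgrp_zs])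
   have "ps ?x = f" using psadd[OF f(2)] x0[OF f(1)] by simp
   hence "norm (prjs (rb M) ?x) * ldet M <= H" using psD[OF x] f(1) by simp
   thus "X \<in> ?E" unfolding f(3) tr cst_def using x by blast
  qed
 qed
 have disj: "S f \<inter> S \<phi>' = {}" if f: "f \<in> D" "\<phi>' \<in> D" "f \<noteq> \<phi>'" for f \<phi>'
 proof (rule ccontr)
  assume "S f \<inter> S \<phi>' \<noteq> {}"
  then obtain p p' where p: "p \<in> P" "p' \<in> P" "(+) (x0 f) ` (+) p ` M = (+) (x0 \<phi>') ` (+) p' ` M" unfolding S_def by blast
  let ?C = "x0 \<phi>' + p'"
  have "(x0 f + p) - ?C \<in> P" using coset_sub p(3) MP unfolding tr by blast
  hence "ps (?C + ((x0 f + p) - ?C)) = ps ?C"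
   using x0[OF f(2)] p(2) by (intro psadd) (auto simp: ht_add ht_span[OF zs_in_span] P_def)
  hence "ps (x0 f + p) = ps ?C" by simp
  thus False using psadd p x0 f by metis
 qed
 have "card ?A = (\<Sum>f\<in>D. card (S f))"
  by (rule card_UN_disjoint[OF fD]) (use cardS disj in blast)+
 also have "\<dots> = card D * card ?Q" using cardS by simp
 finally have "real (card ?E) = ldet M / ldet P * card D" using cstU iQ by simp
 moreover have "finite ?E" unfolding cstU using fD cardS by blast
 ultimately show ?thesis by (simp add: P_def D_def y_def N_def r_def)
qed

definition "cst_wt H k M = ldet M / ldet (zs cs \<inter> span M) *
  card (DL (rb (cmp cs M)) (\<lambda>i. real k * (b \<bullet> rb (cmp cs M) ! i)) (sqrt ((H / ldet M)\<^sup>2 - (real k * norm (prjs cs b))\<^sup>2)))"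

text \<open>\<open>adj_exists\<close> and \<open>adj_inj\<close> make the triples of height,
  intersection and coset a bijective parametrisation, and \<open>ldet_adj\<close> translates the
  bound on the determinant.\<close>

theorem snoc_count:
 assumes d: "0 < d"
  and fin: "\<And>k. 0 < k ==> finite (Gs (zs cs) (d - 1) (H / (real k * norm (prjs cs b))))"
  and emp: "\<And>k. K < k ==> Gs (zs cs) (d - 1) (H / (real k * norm (prjs cs b))) = {}"
 shows "finite {M \<in> Gs (zs (cs @ [b])) d H. \<not> M \<subseteq> zs cs} \<and>
  real (card {M \<in> Gs (zs (cs @ [b])) d H. \<not> M \<subseteq> zs cs}) =
  (\<Sum>k\<in>{1..K}. \<Sum>M\<in>Gs (zs cs) (d - 1) (H / (real k * norm (prjs cs b))). cst_wt H k M)"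
proof -
 let ?L = "zs (cs @ [b])" and ?G = "\<lambda>k. Gs (zs cs) (d - 1) (H / (real k * norm (prjs cs b)))"
 let ?e = "prjs cs b"
 have e: "0 < norm ?e" using e0 by simp
 define I where "I = Sigma {1..K} (\<lambda>k. Sigma (?G k) (cst H k))"
 define F where "F = (\<lambda>(k::nat, M, X). adj M (SOME x. x \<in> X) :: 'a set)"
 have c: "finite (cst H k M) \<and> real (card (cst H k M)) = cst_wt H k M" if "k \<in> {1..K}" "M \<in> ?G k" for k M
  unfolding cst_wt_def by (rule cst_card) (use that e in \<open>auto simp: Gs_def field_simps\<close>)
 have fG: "finite (?G k)" if "k \<in> {1..K}" for k using fin that by simp
 have fI: "finite I" unfolding I_def using fG c by (intro finite_SigmaI) auto
 have cI: "real (card I) = (\<Sum>k\<in>{1..K}. \<Sum>M\<in>?G k. cst_wt H k M)"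
 proof -
  have "card I = (\<Sum>k\<in>{1..K}. \<Sum>M\<in>?G k. card (cst H k M))"
   unfolding I_def using fG c by (subst card_SigmaI) (auto intro!: sum.cong card_SigmaI finite_SigmaI)
  thus ?thesis using c by (simp add: of_nat_sum)
 qed
 have FI: "F (k, M, X) = adj M x"
  if sM: "sgrp M" "X = (+) x ` M" for k M X x
 proof -
  let ?C = "SOME x. x \<in> X"
  have "x \<in> X" using sgrp_0[OF sM(1)] sM(2) by force
  hence "?C \<in> X" by (rule someI)
  then obtain m where "m \<in> M" "?C = x + m" using sM(2) by blast
  hence "?C - x \<in> M" by simp
  thus ?thesis unfolding F_def using adj_cong[OF sM(1)] by simp
 qed
 have "bij_betw F I {M \<in> Gs ?L d H. \<not> M \<subseteq> zs cs}"
 proof (intro bij_betw_imageI inj_onI equalityI subsetI)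
  fix i i' assume i: "i \<in> I" "i' \<in> I" "F i = F i'"
  obtain k M X where kX: "i = (k, M, X)" "0 < k" "M \<in> ?G k" "X \<in> cst H k M" using i(1) by (auto simp: I_def)
  obtain k' M' X' where kX': "i' = (k', M', X')" "0 < k'" "M' \<in> ?G k'" "X' \<in> cst H k' M'" using i(2) by (auto simp: I_def)
  obtain x where x: "X = (+) x ` M" "ht x = real k" using kX by (auto simp: cst_def)
  obtain x' where x': "X' = (+) x' ` M'" "ht x' = real k'" using kX' by (auto simp: cst_def)
  have M: "sgrp M" "M \<subseteq> zs cs" "sgrp M'" "M' \<subseteq> zs cs" using kX kX' by (auto simp: Gs_def)
  have "adj M x = adj M' x'" using i(3) FI[OF M(1) x(1)] FI[OF M(3) x'(1)] kX kX' by simp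
  hence r: "M = M'" "k = k'" "x - x' \<in> M" using adj_inj[OF M x(2) x'(2) kX(2) kX'(2)] by auto
  have "X = X'"
  proof (intro equalityI subsetI)
   fix z assume "z \<in> X"
   then obtain m where "m \<in> M" "z = x + m" using x by blast
   hence "z = x' + ((x - x') + m)" "(x - x') + m \<in> M" using r M by (auto intro: sgrp_add)
   thus "z \<in> X'" unfolding x' r(1)[symmetric] by blast
  next
   fix z assume "z \<in> X'"
   then obtain m where "m \<in> M" "z = x' + m" using x' r by blast
   hence "z = x + (m - (x - x'))" "m - (x - x') \<in> M" using r M by (auto intro: sgrp_diff)
   thus "z \<in> X" unfolding x by blast
  qed
  thus "i = i'" using r kX kX' by simp
 next
  fix N assume "N \<in> F ` I"
  then obtain k M X where kX: "N = F (k, M, X)" "0 < k" "M \<in> ?G k" "X \<in> cst H k M" by (auto simp: I_def)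
  obtain x where x: "X = (+) x ` M" "x \<in> ?L" "ht x = real k" "norm (prjs (rb M) x) * ldet M <= H" using kX by (auto simp: cst_def)
  have M: "sgrp M" "M \<subseteq> zs cs" "dim M = d - 1" using kX by (auto simp: Gs_def)
  have "N = adj M x" using kX FI[OF M(1) x(1)] by simp
  thus "N \<in> {M \<in> Gs ?L d H. \<not> M \<subseteq> zs cs}"
   using ldet_adj[OF M(1,2) x(2,3) kX(2)] x(4) M(3) d by (simp add: Gs_def)
 next
  fix N assume "N \<in> {M \<in> Gs ?L d H. \<not> M \<subseteq> zs cs}"
  hence N: "sgrp N" "N \<subseteq> ?L" "\<not> N \<subseteq> zs cs" "dim N = d" "ldet N <= H" by (auto simp: Gs_def)
  then obtain k x where k: "0 < k" "x \<in> N" "ht x = real k" "N = adj (N \<inter> zs cs) x" using adj_exists by blast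
  let ?B = "real k * norm ?e"
  let ?M = "N \<inter> zs cs"
  let ?A = "norm (prjs (rb ?M) x)"
  have M: "sgrp ?M" "?M \<subseteq> zs cs" using sgrp_Int[OF N(1) sgrp_zs] by auto
  have xL: "x \<in> ?L" using k N by blast
  note la = ldet_adj[OF M xL k(3) k(1), folded k(4)]
  have dM: "dim ?M = d - 1" using la(4) N by simp
  have le: "?A * ldet ?M <= H" using la(5) N by simp
  have l0: "0 < ldet ?M" by (rule ldet_pos[OF dsg_sub[OF dsg_zs[OF cs_bas] M]])
  have "?B\<^sup>2 <= ?A\<^sup>2" using norm_prjs_ht(1)[OF M, of x] k(3) by simp
  hence "?B <= ?A" using power2_le_imp_le norm_ge_zero by blast
  hence "?B * ldet ?M <= H" using le l0 mult_right_mono[of "?B" "?A" "ldet ?M"] by linarith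
  hence "ldet ?M <= H / ?B" using k(1) e by (simp add: field_simps)
  hence G: "?M \<in> ?G k" using M dM by (simp add: Gs_def)
  hence "k <= K" using emp[of k] by fastforce
  moreover have "(+) x ` ?M \<in> cst H k ?M" using le xL k(3) unfolding cst_def by blast
  ultimately have "(k, ?M, (+) x ` ?M) \<in> I" using G k(1) by (auto simp: I_def)
  moreover have "F (k, ?M, (+) x ` ?M) = N" using FI[OF M(1) refl, of k x] k(4) by simp
  ultimately show "N \<in> F ` I" by (metis image_eqI)
 qed
 from bij_betw_same_card[OF this] bij_betw_finite[OF this] show ?thesis using fI cI by simp
qed

end

section \<open>Weighted sums over counting functions\<close>

definition hf :: "real => real => real => real" where
 "hf s r w = w powr (- s) * (1 - w) powr r"

text \<open>Minus the derivative of \<open>hf s r\<close> on the open unit interval, the density for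
  partial summation.\<close>

definition hk' :: "real => real => real => real" where
 "hk' s r w = s * w powr (- s - 1) * (1 - w) powr r + r * w powr (- s) * (1 - w) powr (r - 1)"

lemma powr_beta_continuous:
 fixes c r :: real
 assumes "0 < r" "0 < x \<or> 0 < c" "0 <= x"
 shows "continuous_on {x..1} (\<lambda>w. w powr c * (1 - w) powr r)"
 using assms by (intro continuous_on_mult continuous_on_powr' continuous_intros) auto

lemma powr_beta_deriv:
 fixes c r :: real
 assumes "0 < w" "w < 1"
 shows "((\<lambda>w. w powr c * (1 - w) powr r) has_vector_derivative
  (c * w powr (c - 1) * (1 - w) powr r - r * w powr c * (1 - w) powr (r - 1))) (at w)"
 unfolding has_real_derivative_iff_has_vector_derivative[symmetric]
 using assms by (auto intro!: derivative_eq_intros)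

lemma hk'_integral:
 fixes s r t :: real
 assumes r: "0 < r" and t: "0 < t" "t <= 1"
 shows "(hk' s r has_integral hf s r t) {t..1}"
proof -
 have "((\<lambda>w. - (- s * w powr (- s - 1) * (1 - w) powr r - r * w powr (- s) * (1 - w) powr (r - 1))) has_integral
   (- (1 powr (- s) * (1 - 1) powr r)) - (- (t powr (- s) * (1 - t) powr r))) {t..1}"
  using t r by (intro fundamental_theorem_of_calculus_interior continuous_on_minus powr_beta_continuous
    has_vector_derivative_minus powr_beta_deriv) auto
 thus ?thesis using r by (simp add: hk'_def[abs_def] hf_def add.commute)
qed

lemma hk'_power_integral:
 fixes s r a :: real
 assumes r: "0 < r" and a: "s < a"
 shows "((\<lambda>w. hk' s r w * w powr a) has_integral a * Beta (a - s) (r + 1)) {0..1}"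
proof -
 let ?D = "\<lambda>w. w powr (a - s - 1)"
 let ?C = "Beta (a - s) (r + 1)"
 let ?B = "\<lambda>w. a * (?D w * (1 - w) powr (r + 1 - 1))"
 let ?A = "\<lambda>w. (a - s) * ?D w * (1 - w) powr r - r * w powr (a - s) * (1 - w) powr (r - 1)"
 have "((\<lambda>w. ?A w) has_integral
   (1 powr (a - s) * (1 - 1) powr r) - (0 powr (a - s) * (1 - 0) powr r)) {0..1}"
  using r a by (intro fundamental_theorem_of_calculus_interior powr_beta_continuous powr_beta_deriv) auto
 hence "((\<lambda>w. ?A w) has_integral 0) {0..1}"
  using r by simp
 moreover have "((\<lambda>w. ?B w) has_integral a * ?C) {0..1}"
  by (rule has_integral_mult_right, rule has_integral_Beta_real) (use a r in auto)
 ultimately have "((\<lambda>w. ?B w -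
   (?A w)) has_integral a * ?C - 0) {0..1}"
  by (intro has_integral_diff)
 hence "((\<lambda>w. ?B w -
   (?A w)) has_integral a * ?C) {0..1}"
  by simp
 thus ?thesis
 proof (rule has_integral_eq[rotated])
  fix w :: real assume "w \<in> {0..1}"
  have "w powr (- s - 1) * w powr a = ?D w" "w powr (- s) * w powr a = w powr (a - s)"
   by (simp_all add: powr_add[symmetric] algebra_simps)
  hence e: "s * w powr (- s - 1) * (1 - w) powr r * w powr a = s * ?D w * (1 - w) powr r"
   "r * w powr (- s) * (1 - w) powr (r - 1) * w powr a = r * w powr (a - s) * (1 - w) powr (r - 1)" by (simp_all add: mult_ac)
  show "?B w -
   (?A w) = hk' s r w * w powr a"
   unfolding hk'_def distrib_right e by (simp add: algebra_simps)
 qed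
qed

lemma hk'_nonneg: "0 <= s ==> 0 < r ==> 0 <= hk' s r w"
 by (simp add: hk'_def)

text \<open>Partial summation: \<open>hf s r (x i)\<close> is the integral of \<open>hk' s r\<close>
  from \<open>x i\<close> to 1, so the sum is the integral of \<open>hk' s r\<close> against the
  counting function, into which the hypothesis \<open>N\<close> is inserted.\<close>

lemma hf_sum:
 fixes x :: "'i => real"
 assumes I: "finite I" "\<And>i. i \<in> I ==> 0 < x i \<and> x i <= 1"
  and s: "0 <= s" "0 < r" "s < m" "s < a1" "s < a2"
  and N: "\<And>w. 0 < w ==> w <= 1 ==> \<bar>real (card {i \<in> I. x i <= w}) - A * w powr m\<bar> <= E1 * w powr a1 + E2 * w powr a2"
 shows "\<bar>(\<Sum>i\<in>I. hf s r (x i)) - A * (m * Beta (m - s) (r + 1))\<bar> <=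
  E1 * (a1 * Beta (a1 - s) (r + 1)) + E2 * (a2 * Beta (a2 - s) (r + 1))"
proof -
 let ?B = "\<lambda>x. \<Sum>i\<in>I. hf s r (x i)"
 let ?N = "\<lambda>w. real (card {i \<in> I. x i <= w})" and ?k = "hk' s r"
 let ?D = "\<lambda>w. E1 * (?k w * w powr a1) + E2 * (?k w * w powr a2)"
 let ?A = "\<lambda>w. ?k w * ?N w - A * (?k w * w powr m)"
 have "((\<lambda>w. if w \<in> {x i..1} then ?k w else 0) has_integral hf s r (x i)) {0..1}" if "i \<in> I" for i
  by (subst has_integral_restrict) (use I(2)[OF that] hk'_integral[OF s(2)] in auto)
 hence "((\<lambda>w. \<Sum>i\<in>I. if w \<in> {x i..1} then ?k w else 0) has_integral (?B x)) {0..1}"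
  by (intro has_integral_sum I(1))
 hence "((\<lambda>w. ?k w * ?N w) has_integral (?B x)) {0..1}"
 proof (rule has_integral_eq[rotated])
  fix w :: real assume w: "w \<in> {0..1}"
  let ?C = "\<lambda>x. \<Sum>i\<in>I. if w \<in> {x i..1} then ?k w else 0"
  have "(?C x) = (\<Sum>i\<in>{i \<in> I. x i <= w}. ?k w)"
   using w I(1) by (subst sum.inter_filter) (auto intro!: sum.cong)
  thus "(?C x) = ?k w * ?N w" by simp
 qed
 hence L: "((\<lambda>w. ?A w) has_integral
   (?B x) - A * (m * Beta (m - s) (r + 1))) {0..1}"
  by (intro has_integral_diff has_integral_mult_right hk'_power_integral s)
 have R: "((\<lambda>w. ?D w) has_integral
   E1 * (a1 * Beta (a1 - s) (r + 1)) + E2 * (a2 * Beta (a2 - s) (r + 1))) {0..1}"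
  by (intro has_integral_add has_integral_mult_right hk'_power_integral s)
 have "norm (?A w) <= ?D w"
  if w: "w \<in> {0..1}" for w
 proof (cases "w = 0")
  case True thus ?thesis by (simp add: hk'_def)
 next
  case False
  have "?A w = ?k w * (?N w - A * w powr m)" by (simp add: algebra_simps)
  hence "\<bar>?A w\<bar> = ?k w * \<bar>?N w - A * w powr m\<bar>"
   using hk'_nonneg[OF s(1,2)] by (simp add: abs_mult)
  also have "\<dots> <= ?k w * (E1 * w powr a1 + E2 * w powr a2)"
   using N[of w] w False hk'_nonneg[OF s(1,2)] by (intro mult_left_mono) auto
  finally show ?thesis by (simp add: algebra_simps)
 qed
 from integral_norm_bound_integral[OF has_integral_integrable[OF L] has_integral_integrable[OF R] this]
 show ?thesis unfolding integral_unique[OF L] integral_unique[OF R] by simp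
qed

text \<open>The integral of \<open>u powr (m - q) * (1 - u ^ 2) powr (q / 2)\<close> over the unit
  interval.\<close>

definition Jc :: "real => nat => real" where
 "Jc m q = Beta ((m - q + 1) / 2) (q / 2 + 1) / 2"

lemma Jc_nonneg: "real q - 1 < m ==> 0 <= Jc m q"
proof -
 assume m: "real q - 1 < m"
 have "0 < (m - q + 1) / 2" "0 < real q / 2 + 1" using m by auto
 moreover have "0 < Beta x y" if "0 < x" "0 < y" for x y :: real
  using that unfolding Beta_def by (intro divide_pos_pos mult_pos_pos Gamma_real_pos add_pos_pos)
 ultimately have "0 < Beta ((m - q + 1) / 2) (real q / 2 + 1)" by blast
 thus ?thesis by (simp add: Jc_def)
qed

text \<open>The Beta function against the Gamma form of ball volumes; this identity makes the
  leading constants match in both inductions.\<close>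

lemma Jc_vol:
 assumes "q <= m"
 shows "Jc (real m) q * (real (m + 1 - q) * unit_ball_vol (real (m + 1 - q)) * unit_ball_vol (real q)) = unit_ball_vol (real (m + 1))"
proof -
 define p where "p = m + 1 - q"
 let ?B = "real p + real q"
 let ?A = "real p / 2"
 have m: "real m = ?B - 1" "real (m + 1) = ?B" "0 < p" using assms by (auto simp: p_def)
 have "Gamma (?A + 1) = ?A * Gamma ?A"
  using m Gamma_plus1[of "?A"] by (auto simp: nonpos_Ints_def)
 moreover have "Gamma ?A \<noteq> 0" "Gamma (real q / 2 + 1) \<noteq> 0" "Gamma (?B / 2 + 1) \<noteq> 0"
  using m(3) by (intro less_imp_neq[THEN not_sym] Gamma_real_pos add_nonneg_pos; simp)+
 moreover have "pi powr ?A * pi powr (real q / 2) = pi powr (?B / 2)"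
  by (simp add: powr_add[symmetric] add_divide_distrib)
 ultimately show ?thesis using m(3)
  unfolding p_def[symmetric] m(2) Jc_def m(1) Beta_def unit_ball_vol_def by (simp add: field_simps)
qed

text \<open>The summand is, up to constants, the volume that governs the number of sublattices lying
  over one of determinant \<open>t i\<close>. Substituting the square of \<open>t i / X\<close>
  turns it into \<open>X\<close> times a value of \<open>hf\<close> with exponents
  \<open>(q - 1) / 2\<close> and \<open>q / 2\<close>, and \<open>hf_sum\<close> applies.\<close>

theorem weighted_sum:
 fixes t :: "'i => real"
 assumes fin: "finite {i \<in> I. t i <= X}" and t: "\<And>i. i \<in> I ==> 0 < t i" and X: "0 < X"
  and q: "1 <= q" "real q - 1 < m" "real q - 1 < a1" "real q - 1 < a2"
  and N: "\<And>U. 0 < U ==> U <= X ==> \<bar>real (card {i \<in> I. t i <= U}) - a * U powr m\<bar> <= e1 * U powr a1 + e2 * U powr a2"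
 shows "\<bar>(\<Sum>i\<in>{i \<in> I. t i <= X}. t i * sqrt ((X / t i)\<^sup>2 - 1) ^ q) - a * (m * Jc m q) * X powr (m + 1)\<bar> <=
  e1 * (a1 * Jc a1 q) * X powr (a1 + 1) + e2 * (a2 * Jc a2 q) * X powr (a2 + 1)"
proof -
 let ?E = "\<lambda>X. e1 * X powr a1 * (a1 * Jc a1 q) + e2 * X powr a2 * (a2 * Jc a2 q)"
 let ?C = "\<lambda>X i. sqrt ((X / t i)\<^sup>2 - 1) ^ q"
 let ?I = "{i \<in> I. t i <= X}"
 define x where "x i = (t i / X)\<^sup>2" for i
 define s where "s = (real q - 1) / 2"
 let ?A = "\<Sum>i\<in>?I. hf s (q / 2) (x i)"
 let ?D = "\<lambda>X. ?A - a * X powr m * (m * Jc m q)"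
 have x: "0 < x i \<and> x i <= 1" if "i \<in> ?I" for i
  using that t[of i] X by (auto simp: x_def divide_simps power_mono abs_square_le_1)
 have h: "t i * ?C X i = X * hf s (q / 2) (x i)" if "i \<in> ?I" for i
 proof -
  define u where "u = t i / X"
  let ?B = "u\<^sup>2"
  let ?F = "(1 - ?B) powr (q / 2)"
  have u: "0 < u" "u <= 1" "t i = u * X" "X / t i = 1 / u" "x i = ?B" using that t[of i] X by (auto simp: u_def x_def)
  have "(1 / u)\<^sup>2 - 1 = (1 - ?B) / ?B" using u by (simp add: field_simps)
  hence 1: "sqrt ((1 / u)\<^sup>2 - 1) = sqrt (1 - ?B) / u" using u by (simp add: real_sqrt_divide)
  have uu: "?B <= 1" using u by (simp add: abs_square_le_1)
  have 2: "sqrt (1 - ?B) ^ q = ?F"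
  proof (cases "?B = 1")
   case True thus ?thesis using q by simp
  next
   case False
   hence "0 < 1 - ?B" using uu by simp
   thus ?thesis by (simp add: powr_half_sqrt[symmetric] powr_powr powr_realpow[symmetric])
  qed
  have "?B powr (- s) = (u powr 2) powr (- s)" using u by (simp add: powr_numeral)
  also have "\<dots> = u powr (1 - real q)" unfolding powr_powr by (rule arg_cong[of _ _ "(powr) u"]) (simp add: s_def field_simps)
  also have "\<dots> = u / u ^ q" using u by (simp add: powr_diff powr_realpow)
  finally have "hf s (q / 2) (x i) = u / u ^ q * ?F" by (simp only: hf_def u(5))
  moreover have "?C X i = ?F / u ^ q" unfolding u(4) 1 unfolding power_divide 2 ..
  ultimately show ?thesis using u(3) by simp
 qed
 have "\<bar>?A - a * X powr m * (m / 2 * Beta (m / 2 - s) (q / 2 + 1))\<bar> <=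
  e1 * X powr a1 * (a1 / 2 * Beta (a1 / 2 - s) (q / 2 + 1)) + e2 * X powr a2 * (a2 / 2 * Beta (a2 / 2 - s) (q / 2 + 1))"
 proof (rule hf_sum[OF fin x])
  fix w :: real assume w: "0 < w" "w <= 1"
  have U: "0 < X * sqrt w" "X * sqrt w <= X" using w X by (auto simp: mult_le_cancel_left1)
  have "{i \<in> ?I. x i <= w} = {i \<in> I. t i <= X * sqrt w}"
  proof -
   have "x i <= w \<longleftrightarrow> t i <= X * sqrt w" if "i \<in> I" for i
   proof -
    have "x i <= w \<longleftrightarrow> t i / X <= sqrt w" unfolding x_def using w t[OF that] X
     by (metis abs_of_pos divide_pos_pos real_le_rsqrt sqrt_ge_absD)
    thus ?thesis using X by (simp add: field_simps)
   qed
   thus ?thesis using U by force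
  qed
  moreover have "(X * sqrt w) powr c = X powr c * w powr (c / 2)" for c
   using w by (simp add: powr_mult powr_half_sqrt[symmetric] powr_powr)
  ultimately show "\<bar>real (card {i \<in> ?I. x i <= w}) - a * X powr m * w powr (m / 2)\<bar> <=
   e1 * X powr a1 * w powr (a1 / 2) + e2 * X powr a2 * w powr (a2 / 2)"
   using N[OF U] by (simp add: mult_ac)
 qed (use q in \<open>auto simp: s_def\<close>)
 moreover have "c / 2 * Beta (c / 2 - s) (q / 2 + 1) = c * Jc c q" for c
  by (simp add: Jc_def s_def diff_divide_distrib add_divide_distrib algebra_simps)
 ultimately have "\<bar>?D X\<bar> <=
  ?E X" by (simp only:)
 from mult_left_mono[OF this, of X] have "X * \<bar>?D X\<bar> <=
  X * (?E X)" using X by simp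
 moreover have "X * \<bar>?D X\<bar> =
  \<bar>(\<Sum>i\<in>?I. t i * ?C X i) - a * (m * Jc m q) * X powr (m + 1)\<bar>"
 proof -
  have "(\<Sum>i\<in>?I. t i * ?C X i) = X * ?A"
   unfolding sum_distrib_left using h by (intro sum.cong) auto
  moreover have "X * \<bar>y\<bar> = \<bar>X * y\<bar>" for y using X by (simp add: abs_mult)
  ultimately show ?thesis using X by (simp add: powr_add algebra_simps)
 qed
 ultimately show ?thesis using X by (simp add: powr_add algebra_simps)
qed

text \<open>The indices are sorted by \<open>t i\<close> into dyadic blocks below \<open>X\<close>.
  On each block the weight is nearly constant, and since \<open>e\<close> is smaller than both
  exponents the partial sums form convergent geometric series.\<close>

theorem dyadic_sum:
 fixes t w :: "'i => real"
 assumes fin: "finite {i \<in> I. t i <= X}" and t: "\<And>i. i \<in> I ==> 0 < t i \<and> 0 <= w i" and X: "0 < X"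
  and e: "0 <= e" "e < \<beta>1" "e < \<beta>2" and B: "0 <= B1" "0 <= B2"
  and W: "\<And>U. 0 < U ==> U <= X ==> (\<Sum>i\<in>{i \<in> I. t i <= U}. w i) <= B1 * U powr \<beta>1 + B2 * U powr \<beta>2"
 shows "(\<Sum>i\<in>{i \<in> I. t i <= X}. w i * t i powr (- e)) <=
  2 powr e / (1 - 2 powr (e - \<beta>1)) * B1 * X powr (\<beta>1 - e) + 2 powr e / (1 - 2 powr (e - \<beta>2)) * B2 * X powr (\<beta>2 - e)"
proof -
 let ?N = "\<lambda>i. t i powr (- e)"
 let ?M = "2 powr (e - \<beta>2)"
 let ?L = "2 powr (e - \<beta>1)"
 let ?G = "2 powr e * B2 * X powr (\<beta>2 - e)"
 let ?F = "2 powr e * B1 * X powr (\<beta>1 - e)"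
 let ?E = "\<lambda>l. X * 2 powr (- real l)"
 let ?B = "\<lambda>l. ?F * ?L ^ l + ?G * ?M ^ l"
 let ?A = "\<lambda>l. (X * 2 powr (- real l - 1)) powr (- e)"
 let ?I = "{i \<in> I. t i <= X}"
 define j where "j i = nat \<lfloor>log 2 (X / t i)\<rfloor>" for i
 let ?D = "\<lambda>i. (X * 2 powr (- real (j i) - 1)) powr (- e)"
 have j: "t i <= X * 2 powr (- real (j i))" "?N i <= ?D i" if i: "i \<in> ?I" for i
 proof -
  let ?K = "real (j i)"
  have ti: "0 < t i" "1 <= X / t i" using i t by (auto simp: field_simps)
  have "0 <= log 2 (X / t i)" using ti by simp
  hence "?K = \<lfloor>log 2 (X / t i)\<rfloor>" by (simp add: j_def)
  hence l: "?K <= log 2 (X / t i)" "log 2 (X / t i) < ?K + 1" by linarith+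
  have "0 < X / t i" using ti by linarith
  hence b: "2 powr ?K <= X / t i" "X / t i < 2 powr (?K + 1)"
   using l le_log_iff[of 2 "X / t i", THEN iffD1] log_less_iff[of 2 "X / t i", THEN iffD1] one_less_numeral_iff[of num.One] by fastforce+
  show "t i <= X * 2 powr (- ?K)" using b(1) ti(1) unfolding powr_minus by (simp add: field_simps)
  have "X * 2 powr (- ?K - 1) <= t i" using b(2) ti(1) unfolding powr_diff powr_add powr_minus by (simp add: field_simps)
  thus "?N i <= ?D i"
   using X e ti by (intro powr_mono2') auto
 qed
 define J where "J = Suc (Max (insert 0 (j ` ?I)))"
 have jJ: "j i < J" if "i \<in> ?I" for i
  unfolding J_def using fin that by (intro le_imp_less_Suc Max_ge) auto
 have "(\<Sum>i\<in>?I. w i * ?N i) <= (\<Sum>i\<in>?I. \<Sum>l<J. if t i <= ?E l then w i * ?A l else 0)"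
 proof (rule sum_mono)
  fix i assume i: "i \<in> ?I"
  let ?J = "\<Sum>l<J. if t i <= ?E l then w i * ?A l else 0"
  have "w i * ?N i <= w i * ?D i"
   using j(2)[OF i] t i by (intro mult_left_mono) auto
  also have "\<dots> = (if t i <= X * 2 powr (- real (j i)) then w i * ?D i else 0)" using j(1)[OF i] by simp
  also have "\<dots> <= ?J"
   by (rule member_le_sum[where f = "\<lambda>l. if t i <= ?E l then w i * ?A l else 0"]) (use jJ[OF i] t i in auto)
  finally show "w i * ?N i <= ?J" .
 qed
 also have "\<dots> = (\<Sum>l<J. \<Sum>i\<in>?I. if t i <= ?E l then w i * ?A l else 0)" by (rule sum.swap)
 also have "\<dots> <= (\<Sum>l<J. ?B l)"
 proof (rule sum_mono)
  fix l assume "l \<in> {..<J}"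
  let ?U = "?E l"
  let ?H = "\<Sum>i\<in>?I. if t i <= ?U then w i * ?A l else 0"
  have "2 powr (- real l) <= 2 powr (0::real)" by (intro powr_mono) auto
  hence U: "0 < ?U" "?U <= X" using X by (auto simp: mult_le_cancel_left1)
  have "?H = (\<Sum>i\<in>{i \<in> ?I. t i <= ?U}. w i * ?A l)"
   by (rule sum.inter_filter[OF fin, symmetric])
  also have "{i \<in> ?I. t i <= ?U} = {i \<in> I. t i <= ?U}" using U by auto
  also have "(\<Sum>i\<in>{i \<in> I. t i <= ?U}. w i * ?A l) = ?A l * (\<Sum>i\<in>{i \<in> I. t i <= ?U}. w i)"
   by (simp add: sum_distrib_left mult.commute)
  also have "\<dots> <= ?A l * (B1 * ?U powr \<beta>1 + B2 * ?U powr \<beta>2)"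
   by (intro mult_left_mono W U) auto
  also have "\<dots> = ?B l"
  proof -
   have "?A l * (B * ?U powr h) = 2 powr e * B * X powr (h - e) * (2 powr (e - h)) ^ l" for B h
   proof -
    have "?A l = X powr (- e) * 2 powr (real l * e + e)"
     by (simp add: powr_mult powr_powr algebra_simps)
    moreover have "?U powr h = X powr h * 2 powr (- real l * h)" by (simp add: powr_mult powr_powr)
    moreover have "X powr (h - e) = X powr (- e) * X powr h" by (simp add: powr_add[symmetric])
    moreover have "(2 powr (e - h)) ^ l = 2 powr (real l * e) * 2 powr (- real l * h)"
     by (simp add: powr_realpow[symmetric] powr_powr powr_add[symmetric] algebra_simps)
    ultimately show ?thesis by (simp add: powr_add)
   qed
   thus ?thesis by (simp only: distrib_left)
  qed
  finally show "?H <= \<dots>" .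
 qed
 also have "\<dots> = ?F * (\<Sum>l<J. ?L ^ l) + ?G * (\<Sum>l<J. ?M ^ l)"
  by (simp add: sum.distrib sum_distrib_left)
 also have "\<dots> <= ?F * (1 / (1 - ?L)) + ?G * (1 / (1 - ?M))"
 proof -
  have "(\<Sum>l<J. (2 powr (e - h)) ^ l) <= 1 / (1 - 2 powr (e - h))" if "e < h" for h :: real
  proof -
   let ?C = "2 powr (e - h)"
   have "?C < 2 powr (0::real)" using that by (intro powr_less_mono) auto
   hence z: "0 <= ?C" "?C < 1" by auto
   have "(\<Sum>l<J. ?C ^ l) = (1 - ?C ^ J) / (1 - ?C)" using z that by (simp only: sum_gp_strict) simp
   also have "\<dots> <= 1 / (1 - ?C)" using z by (intro divide_right_mono) auto
   finally show ?thesis .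
  qed
  thus ?thesis using e B by (intro add_mono mult_left_mono) auto
 qed
 finally show ?thesis by (simp add: mult_ac)
qed

section \<open>Rank one\<close>

lemma er_eq: "er R ls = (\<Sum>i<length ls. \<Prod>l\<in>{..<length ls} - {i}. 1 + R * ls ! l)"
proof (induction ls)
 case (Cons g ls)
 let ?n = "length ls"
 have A: "{..<Suc ?n} - {0} = Suc ` {..<?n}" unfolding lessThan_Suc_eq_insert_0 by auto
 have B: "{..<Suc ?n} - {Suc i} = insert 0 (Suc ` ({..<?n} - {i}))" for i unfolding lessThan_Suc_eq_insert_0 by auto
 have P0: "(\<Prod>l\<in>{..<Suc ?n} - {0}. 1 + R * (g # ls) ! l) = (\<Prod>h\<leftarrow>ls. 1 + R * h)"
  unfolding A by (simp add: prod.reindex prod_list_nth[of "map (\<lambda>h. 1 + R * h) ls"])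
 have PS: "(\<Prod>l\<in>{..<Suc ?n} - {Suc i}. 1 + R * (g # ls) ! l) = (1 + R * g) * (\<Prod>l\<in>{..<?n} - {i}. 1 + R * ls ! l)" for i
  unfolding B by (subst prod.insert) (auto simp: prod.reindex)
 have "{..<Suc ?n} = insert 0 (Suc ` {..<?n})" using lessThan_Suc_eq_insert_0 by blast
 hence S: "(\<Sum>i<Suc ?n. f i) = f 0 + (\<Sum>i<?n. f (Suc i))" for f :: "nat => real"
  by (simp add: sum.reindex del: sum.lessThan_Suc)
 show ?case unfolding length_Cons S P0 PS by (simp add: Cons.IH sum_distrib_left)
qed simp

text \<open>The bound \<open>c\<close> lets each factor \<open>1 + r * g\<close> be replaced by a
  multiple of \<open>R * g\<close>. The largest product then omits the smallest entry, which is
  \<open>ls ! 0\<close> up to the factor \<open>K\<close>.\<close>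

lemma er_qm:
 assumes r: "0 <= r" "r <= R" and ls: "0 < length ls" "\<And>g. g \<in> set ls ==> 0 < g" "qm K ls" and c: "0 < c" "\<And>g. g \<in> set ls ==> c <= R * g"
 shows "er r ls <= real (length ls) * (1 + 1 / c) ^ (length ls - 1) * K * (R ^ (length ls - 1) * prod_list ls / ls ! 0)"
proof -
 let ?n = "length ls" and ?c = "1 + 1 / c"
 let ?B = "?n - 1"
 have pos: "0 < ls ! i" if "i < ?n" for i using ls(2) that by simp
 let ?E = "\<lambda>i. \<Prod>l\<in>{..<?n} - {i}. 1 + r * ls ! l"
 let ?A = "prod_list ls"
 let ?C = "?c ^ ?B * K * (R ^ ?B * ?A / ls ! 0)"
 have R: "0 <= R" using r by simp
 have "(?E i) <= ?C" if i: "i < ?n" for i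
 proof -
  let ?D = "\<Prod>l\<in>{..<?n} - {i}. ls ! l"
  have "1 + r * ls ! l <= ?c * (R * ls ! l)" if "l < ?n" for l
  proof -
   have "r * ls ! l <= R * ls ! l" using r pos[OF that] by (intro mult_right_mono) auto
   moreover have "1 <= 1 / c * (R * ls ! l)" using c(1) c(2)[of "ls ! l"] that by (simp add: field_simps)
   ultimately show ?thesis by (simp add: algebra_simps)
  qed
  hence "(?E i) <= (\<Prod>l\<in>{..<?n} - {i}. ?c * (R * ls ! l))"
   using r(1) pos by (intro prod_mono) (simp add: less_imp_le)
  also have "\<dots> = ?c ^ ?B * (R ^ ?B * ?D)"
   using i by (simp add: prod.distrib)
  also have "?D = ?A / ls ! i"
   using prod.remove[of "{..<?n}" i "(!) ls"] i pos[OF i] by (simp add: prod_list_nth)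
  also have "?c ^ ?B * (R ^ ?B * (?A / ls ! i)) <= ?c ^ ?B * (R ^ ?B * (?A * (K / ls ! 0)))"
  proof (intro mult_left_mono)
   have "ls ! 0 <= K * ls ! i" using ls(3) i by (auto simp: qm_def)
   hence "1 / ls ! i <= K / ls ! 0" using pos[OF i] pos[of 0] ls(1) by (simp add: field_simps)
   moreover have "0 < ?A" using ls(2) by (rule prod_list_pos)
   ultimately show "?A / ls ! i <= ?A * (K / ls ! 0)" using mult_left_mono[of "1 / ls ! i" "K / ls ! 0" "?A"] by simp
  qed (use R c in auto)
  finally show ?thesis by (simp add: mult_ac)
 qed
 hence "er r ls <= (\<Sum>i<?n. ?C)"
  unfolding er_eq by (intro sum_mono) auto
 thus ?thesis by (simp add: mult_ac)
qed

lemma zs_single: "zs [v] = {of_int c *\<^sub>R v |c. True}"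
 by (auto simp: zs.simps(2))

lemma zs_single_eq: "zs [x] = zs [y] ==> x = y \<or> x = - (y :: 'a::real_vector)"
proof -
 assume e: "zs [x] = zs [y]"
 have "x \<in> zs [y]" "y \<in> zs [x]" using set_sub_zs[of "[x]"] set_sub_zs[of "[y]"] e by auto
 then obtain c d :: int where cd: "x = of_int c *\<^sub>R y" "y = of_int d *\<^sub>R x" unfolding zs_single by blast
 show ?thesis
 proof (cases "y = 0")
  case False
  have "y = of_int (d * c) *\<^sub>R y" using cd by (metis of_int_mult scaleR_scaleR)
  hence "(of_int (d * c) - 1) *\<^sub>R y = 0" by (simp add: scaleR_left_diff_distrib)
  hence "real_of_int (d * c) = 1" using False by simp
  hence "d * c = 1" by linarith
  hence "c = 1 \<or> c = - 1" by (metis zmult_eq_1_iff)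
  thus ?thesis using cd(1) by auto
 qed (use cd(1) in simp)
qed

text \<open>A sublattice of rank one has exactly two generators, whose norm is its determinant; the
  vector 0 accounts for the remaining unit.\<close>

theorem rank_one_count:
 assumes L: "dsg (L :: 'a::euclidean_space set)" and H: "0 < H"
 shows "finite (Gs L 1 H) \<and> card (L \<inter> cball 0 H) = 2 * card (Gs L 1 H) + 1"
proof -
 let ?A = "\<lambda>L H. L \<inter> cball 0 H"
 define g where "g M = rb M ! 0" for M :: "'a set"
 have g: "M = zs [g M]" "g M \<noteq> 0" "norm (g M) = ldet M" if "M \<in> Gs L 1 H" for M
 proof -
  have dM: "dsg M" by (rule Gs_dsg[OF L that])
  have "length (rb M) = 1" using rb_length[OF dM] dim_Gs[OF that] by simp
  hence r: "rb M = [g M]" by (cases "rb M") (auto simp: g_def)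
  show "M = zs [g M]" using rb[OF dM] r by simp
  show "g M \<noteq> 0" using rb_bas[OF dM] r by (simp add: bas_Cons)
  show "norm (g M) = ldet M" using ldet_zs[OF rb_bas[OF dM]] rb[OF dM] r by (simp add: vol_Cons)
 qed
 have U: "?A L H - {0} = (\<Union>M\<in>Gs L 1 H. {g M, - g M})"
 proof
  let ?C = "?A L H - {0}"
  let ?B = "\<lambda>g. \<Union>M\<in>Gs L 1 H. {g M, - g M}"
  show "?C \<subseteq> (?B g)"
  proof
   fix x assume x: "x \<in> ?C"
   have b: "bas [x]" using x by (simp add: bas_Cons)
   have "zs [x] \<in> Gs L 1 H"
    using x dim_zs[OF b] ldet_zs[OF b] zs_least[OF dsg_sgrp[OF L], of "[x]"] by (auto simp: Gs_def vol_Cons)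
   moreover from g(1)[OF this] have "x = g (zs [x]) \<or> x = - g (zs [x])" by (rule zs_single_eq)
   ultimately show "x \<in> (?B g)" by blast
  qed
  show "(?B g) \<subseteq> ?C"
  proof
   fix x assume "x \<in> (?B g)"
   then obtain M where M: "M \<in> Gs L 1 H" "x = g M \<or> x = - g M" by blast
   have "g M \<in> M" using g(1)[OF M(1)] set_sub_zs[of "[g M]"] by auto
   hence "g M \<in> L" using M(1) by (auto simp: Gs_def)
   thus "x \<in> ?C" using M(2) g(2,3)[OF M(1)] M(1) sgrp_minus[OF dsg_sgrp[OF L]] by (auto simp: Gs_def)
  qed
 qed
 have fL: "finite (?A L H)" using L by (simp add: dsg_def)
 have inj: "inj_on g (Gs L 1 H)" using g(1) by (intro inj_onI) metis
 have "finite (g ` Gs L 1 H)" by (rule finite_subset[OF _ fL]) (use U in auto)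
 hence fin: "finite (Gs L 1 H)" using inj by (rule finite_imageD)
 have "card (\<Union>M\<in>Gs L 1 H. {g M, - g M}) = (\<Sum>M\<in>Gs L 1 H. card {g M, - g M})"
 proof (rule card_UN_disjoint[OF fin])
  show "\<forall>M\<in>Gs L 1 H. \<forall>N\<in>Gs L 1 H. M \<noteq> N --> {g M, - g M} \<inter> {g N, - g N} = {}"
  proof (intro ballI impI)
   fix M N assume MN: "M \<in> Gs L 1 H" "N \<in> Gs L 1 H" "M \<noteq> N"
   have m: "zs [- g N] = zs [g N]"
   proof
    show "zs [- g N] \<subseteq> zs [g N]" by (rule zs_least) (use set_sub_zs[of "[g N]"] in \<open>auto intro: sgrp_minus[OF sgrp_zs]\<close>)
    have "- (- g N) \<in> zs [- g N]" by (rule sgrp_minus[OF sgrp_zs]) (use set_sub_zs[of "[- g N]"] in auto)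
    thus "zs [g N] \<subseteq> zs [- g N]" by (intro zs_least) auto
   qed
   have "g M \<noteq> g N" "g M \<noteq> - g N" using g(1)[OF MN(1)] g(1)[OF MN(2)] m MN(3) by metis+
   thus "{g M, - g M} \<inter> {g N, - g N} = {}" by (auto simp: minus_equation_iff)
  qed
 qed simp
 also have "\<dots> = (\<Sum>M\<in>Gs L 1 H. 2)"
 proof (rule sum.cong[OF refl])
  fix M assume "M \<in> Gs L 1 H"
  from g(2)[OF this] have "g M + g M \<noteq> 0" by (simp add: scaleR_2[symmetric])
  hence "g M \<noteq> - g M" by (metis add.left_inverse)
  thus "card {g M, - g M} = 2" by simp
 qed
 finally have "card (?A L H - {0}) = 2 * card (Gs L 1 H)" unfolding U by simp
 moreover have "0 \<in> ?A L H" using sgrp_0[OF dsg_sgrp[OF L]] H by simp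
 ultimately have "card (?A L H) = 2 * card (Gs L 1 H) + 1" using fL card_Suc_Diff1 by fastforce
 thus ?thesis using fin by blast
qed

lemma zs_norm_ge1:
 assumes "bas (bs :: 'a::euclidean_space list)" "\<And>g. g \<in> set (gs bs) ==> 1 <= g" "v \<in> zs bs" "v \<noteq> 0"
 shows "1 <= norm v"
proof (rule ccontr)
 assume "\<not> 1 <= norm v"
 hence "norm v < gs bs ! k" if "k < length bs" for k using assms(2)[of "gs bs ! k"] that by simp
 hence "v \<in> span (set (take 0 bs))" by (intro short_in_prefix[OF assms(1,3)]) auto
 thus False using assms(4) by simp
qed

lemma Gs_1_empty:
 assumes bs: "bas (bs :: 'a::euclidean_space list)" "\<And>g. g \<in> set (gs bs) ==> 1 <= g" and H: "0 < H" "H < 1"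
 shows "Gs (zs bs) 1 H = {}"
proof -
 have "zs bs \<inter> cball 0 H = {0}"
  using zs_norm_ge1[OF bs] H sgrp_0[OF sgrp_zs[of bs]] by fastforce
 hence "card (zs bs \<inter> cball 0 H) = 1" by simp
 thus ?thesis using rank_one_count[OF dsg_zs[OF bs(1)] H(1)] by (metis add_cancel_left_left card_0_eq mult_eq_0_iff zero_neq_numeral)
qed

lemma zeta_conv_pos: "0 < s ==> 0 < zeta_conv s"
proof (cases "s = 1")
 case False
 assume "0 < s"
 hence "summable (\<lambda>m. 1 / real (Suc m) ^ s)" using False inverse_power_summable[of s, where 'a = real]
  by (subst summable_Suc_iff[of "\<lambda>m. 1 / real m ^ s"]) (simp add: inverse_eq_divide)
 hence "0 < (\<Sum>m. 1 / real (Suc m) ^ s)" by (intro suminf_pos) auto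
 thus ?thesis using False by (simp add: zeta_conv_def)
qed (simp add: zeta_conv_def)

lemma c_const_1: "0 < n ==> c_const n 1 = unit_ball_vol (real n) / 2"
 using zeta_conv_pos[of n] by (simp add: c_const_def a_const_def zeta_conv_def[of "Suc 0"])

text \<open>In each product of \<open>er\<close>, either all factors are comparable to
  \<open>H * ls ! l\<close>, which gives the first error term, or one factor is at most 2 and the
  other \<open>n - 2\<close> are at most \<open>2 * H\<close>, as the dual Gram--Schmidt norms are
  at most 1.\<close>

theorem rank_one_asymptotic:
 assumes n: "2 <= n" and K: "1 <= K"
 shows "\<exists>C\<ge>0. \<forall>(bs::'a::euclidean_space list) H. length bs = n --> bas bs --> qm K (gs bs) --> (\<forall>g\<in>set (gs bs). 1 <= g) --> 0 < H -->
  \<bar>real (card (Gs (zs bs) 1 H)) - c_const n 1 * (H ^ n / vol bs)\<bar> <= C * (H ^ (n - 1) * gs bs ! (n - 1) / vol bs + H ^ (n - 2))"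
proof -
 let ?D = "\<lambda>n. unit_ball_vol n"
 let ?B = "\<lambda>n. real n * 2 ^ n * K"
 obtain c where c: "1 <= c" "\<And>(xs::'a list) u R. length xs = n ==> bas xs ==> 0 <= R ==>
   \<bar>card (DL xs u R) - ?D n * R ^ n * vol xs\<bar> <= c * er R (gs xs)"
  using DL_count[of n, where 'a = 'a] by blast
 define C where "C = ?D n + 1 + c * (?B n)"
 have C0: "?D n <= C" "0 <= C" "1 + c * (?B n) <= C" using c K by (auto simp: C_def)
 have "\<bar>real (card (Gs (zs bs) 1 H)) - c_const n 1 * (H ^ n / vol bs)\<bar> <= C * (H ^ (n - 1) * gs bs ! (n - 1) / vol bs + H ^ (n - 2))"
  if bs: "length bs = n" "bas bs" "qm K (gs bs)" "\<forall>g\<in>set (gs bs). 1 <= g" and H: "0 < H" for bs :: "'a list" and H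
 proof -
  let ?E = "\<lambda>n. \<bar>real (card (Gs (zs bs) 1 H)) - c_const n 1 * (H ^ n / vol bs)\<bar>"
  let ?g = "gs bs ! (n - 1)"
  let ?C = "\<lambda>n. H ^ (n - 1) * ?g / vol bs"
  have g1: "1 <= ?g" using bs(1,4) n by simp
  have v0: "0 < vol bs" using bs vol_pos by blast
  have Hn: "H ^ n = H * H ^ (n - 1)" using n by (metis Suc_diff_1 less_le_trans pos2 power_Suc)
  have cc: "c_const n 1 = ?D n / 2" using n by (intro c_const_1) auto
  show ?thesis
  proof (cases "H < 1")
   \<comment> \<open>Nothing is counted below determinant 1, so the main term itself has to be
     absorbed by the error.\<close>
   case True
   have "Gs (zs bs) 1 H = {}"
    using Gs_1_empty bs(2,4) H True by blast
   hence "?E n = ?D n / 2 * (H ^ n / vol bs)"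
    unfolding cc using H v0 by simp
   also have "\<dots> <= C * (?C n)"
   proof (intro mult_mono divide_right_mono)
    have "0 <= ?D n" by simp
    thus "?D n / 2 <= C" using C0 by linarith
    show "H ^ n <= H ^ (n - 1) * ?g" unfolding Hn using True g1 H by (simp add: mult.commute mult_left_mono)
   qed (use C0 v0 H in auto)
   also have "\<dots> <= C * (?C n + H ^ (n - 2))" using C0 H by (intro mult_left_mono) auto
   finally show ?thesis .
  next
   case False
   define ls where "ls = rev (map inverse (gs bs))"
   let ?F = "\<lambda>n i. \<Prod>l\<in>{..<n} - {i}. 1 + H * ls ! l"
   have ls: "length ls = n" "gs (rev (du bs)) = ls" using bs rev_du_gs[OF bs(2)] by (auto simp: ls_def)
   have lsb: "0 < ls ! i" "ls ! i <= 1" "1 / ls ! i <= K * ?g" if "i < n" for i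
   proof -
    have e: "ls ! i = inverse (gs bs ! (n - 1 - i))" using that bs(1) by (simp add: ls_def rev_nth)
    have "1 <= gs bs ! (n - 1 - i)" using bs(1,4) that by simp
    thus "0 < ls ! i" "ls ! i <= 1" unfolding e by (auto simp: field_simps)
    show "1 / ls ! i <= K * ?g" unfolding e using bs(1,3) that by (simp add: qm_def divide_inverse)
   qed
   have pl: "prod_list ls = 1 / vol bs" using vol_rev_du[OF bs(2)] ls(2) by (simp add: vol_def)
   define E where "E = ?C n + H ^ (n - 2)"
   have E: "?C n <= E" "H ^ (n - 2) <= E" using H v0 g1 by (auto simp: E_def)
   have "(?F n i) <= 2 ^ n * K * E" if i: "i < n" for i
   proof (cases "\<forall>l<n. l \<noteq> i --> 1 <= H * ls ! l")
    case True
    let ?H = "\<Prod>l\<in>{..<n} - {i}. ls ! l"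
    have "(?F n i) <= (\<Prod>l\<in>{..<n} - {i}. 2 * (H * ls ! l))"
     using True lsb H by (intro prod_mono) force
    also have "\<dots> = 2 ^ (n - 1) * (H ^ (n - 1) * ?H)" using i by (simp add: prod.distrib)
    also have "?H = prod_list ls * (1 / ls ! i)"
     using prod.remove[of "{..<n}" i "(!) ls"] i lsb(1)[OF i] ls(1) by (simp add: prod_list_nth)
    also have "2 ^ (n - 1) * (H ^ (n - 1) * (prod_list ls * (1 / ls ! i))) <= 2 ^ n * (H ^ (n - 1) * (prod_list ls * (K * ?g)))"
     unfolding pl using lsb(3)[OF i] lsb(1)[OF i] H v0 by (intro mult_mono mult_left_mono power_increasing) auto
    also have "\<dots> = 2 ^ n * K * (?C n)" unfolding pl by simp
    also have "\<dots> <= 2 ^ n * K * E" using E K by (intro mult_left_mono) auto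
    finally show ?thesis .
   next
    case F: False
    then obtain l0 where l0: "l0 < n" "l0 \<noteq> i" "H * ls ! l0 < 1" by (auto simp: not_le)
    have "(?F n i) = (1 + H * ls ! l0) * (\<Prod>l\<in>{..<n} - {i} - {l0}. 1 + H * ls ! l)"
     using l0 by (intro prod.remove) auto
    also have "\<dots> <= 2 * (\<Prod>l\<in>{..<n} - {i} - {l0}. 2 * H)"
    proof (intro mult_mono prod_mono)
     fix l assume "l \<in> {..<n} - {i} - {l0}"
     hence "0 < ls ! l" "ls ! l <= 1" using lsb by auto
     hence "0 <= H * ls ! l" "H * ls ! l <= H" using H by (auto simp: mult_left_le)
     thus "0 <= 1 + H * ls ! l \<and> 1 + H * ls ! l <= 2 * H" using False by linarith
    qed (use l0 H lsb(1)[THEN less_imp_le] in \<open>auto intro!: prod_nonneg add_nonneg_nonneg mult_nonneg_nonneg\<close>)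
    also have "\<dots> = 2 * 2 ^ (n - 2) * H ^ (n - 2)"
     using i l0 by (simp add: card_Diff_subset power_mult_distrib numeral_2_eq_2)
    also have "\<dots> <= (2 ^ n * K) * E"
    proof (rule mult_mono)
     have "(2::real) * 2 ^ (n - 2) = 2 ^ (n - 1)" using n by (simp flip: power_Suc add: Suc_diff_Suc numeral_2_eq_2)
     also have "\<dots> <= 2 ^ n" by (intro power_increasing) auto
     also have "\<dots> <= 2 ^ n * K" using K by simp
     finally show "(2::real) * 2 ^ (n - 2) <= 2 ^ n * K" .
    qed (use E H K in auto)
    finally show ?thesis .
   qed
   hence "er H ls <= (\<Sum>i<n. 2 ^ n * K * E)" unfolding er_eq ls(1) by (intro sum_mono) auto
   hence er: "er H ls <= ?B n * E" by (simp add: mult_ac)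
   let ?G = "c * (?B n * E)"
   let ?A = "\<bar>real (card (zs bs \<inter> cball 0 H)) - ?D n * H ^ n * (1 / vol bs)\<bar>"
   have "?A <= c * er H ls"
    using c(2)[of "rev (du bs)" H "\<lambda>_. 0"] bs H bas_rev_du[OF bs(2)] vol_rev_du[OF bs(2)]
    unfolding zs_ball_DL[OF bs(2)] ls(2) by simp
   also have "\<dots> <= ?G" using er c by (intro mult_left_mono) auto
   finally have "?A <= ?G" .
   hence 1: "\<bar>2 * real (card (Gs (zs bs) 1 H)) + 1 - 2 * (c_const n 1 * (H ^ n / vol bs))\<bar> <= ?G"
    unfolding cc using rank_one_count[OF dsg_zs[OF bs(2)] H] by (simp add: add.commute)
   have "1 <= H ^ (n - 2)" using False by simp
   hence "1 <= E" using E by simp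
   have "?E n <= E + ?G"
    using 1 \<open>1 <= E\<close> by linarith
   also have "\<dots> = (1 + c * (?B n)) * E" by (simp add: algebra_simps)
   also have "\<dots> <= C * E" using C0 \<open>1 <= E\<close> by (intro mult_right_mono) auto
   finally show ?thesis by (simp add: E_def)
  qed
 qed
 thus ?thesis using C0 by blast
qed

section \<open>Normalised bases and the form of the estimates\<close>

definition nb :: "nat => real => 'a::euclidean_space list => bool" where
 "nb n K bs \<longleftrightarrow> length bs = n \<and> bas bs \<and> qm K (gs bs) \<and> (\<forall>g\<in>set (gs bs). 1 <= g)"

abbreviation cnt_err where
 "cnt_err n d bs H \<equiv> \<bar>real (card (Gs (zs bs) d H)) - c_const n d * (H ^ n / vol bs ^ d)\<bar>"

abbreviation top_err where
 "top_err n d b bs H \<equiv> H powr (real n - b) * prod_list (drop (n - d) (gs bs)) powr b / vol bs ^ d"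

text \<open>The product of the last \<open>d\<close> Gram--Schmidt norms in \<open>top_err\<close>
  is \<open>vol bs\<close> divided by the product of the first \<open>n - d\<close>, so the first
  term has the shape of the leading error term with \<open>b\<close> in place of
  \<open>b_exp\<close>. The parameter \<open>b\<close> is free because the induction has to start in
  rank one with the value it needs at the end.\<close>

definition Est :: "'a::euclidean_space itself => nat => nat => real => bool" where
 "Est T n d b \<longleftrightarrow> (\<forall>D>0. \<forall>K\<ge>1. \<exists>C\<ge>0. \<forall>(bs::'a list) H. nb n K bs --> 0 < H -->
  cnt_err n d bs H <=
   C * (top_err n d b bs H + H powr (real n - 1 + D)))"

text \<open>The rank one error has the shape of the case \<open>b = 1\<close>. For smaller
  \<open>b\<close> let \<open>g\<close> be the last Gram--Schmidt norm. If \<open>g <= H\<close>,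
  then \<open>g <= H powr (1 - b) * g powr b\<close>; if not, \<open>g <= vol bs\<close> bounds the
  error by \<open>H ^ (n - 1)\<close>, which the secondary term absorbs.\<close>

theorem Est_1:
 assumes n: "2 <= n" and b: "0 < b" "b <= 1"
 shows "Est TYPE('a::euclidean_space) n 1 b"
 unfolding Est_def
proof (intro allI impI)
 let ?J = "\<lambda>gs bs. prod_list (drop (n - 1) (gs bs))"
 let ?F = "unit_ball_vol n"
 let ?E = "\<lambda>H. H powr (real n - b)"
 let ?C = "\<lambda>bs H. \<bar>real (card (Gs (zs bs) 1 H)) - c_const n 1 * (H ^ n / vol bs)\<bar>"
 fix d K :: real assume d: "0 < d" and K: "1 <= K"
 let ?G = "real n - 1 + d"
 obtain C where C: "0 <= C" "\<And>(bs::'a list) H. length bs = n ==> bas bs ==> qm K (gs bs) ==> (\<forall>g\<in>set (gs bs). 1 <= g) ==> 0 < H ==>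
   ?C bs H <= C * (H ^ (n - 1) * gs bs ! (n - 1) / vol bs + H ^ (n - 2))"
  using rank_one_asymptotic[OF n K, where 'a = 'a] by blast
 define C' where "C' = 2 * C + ?F"
 have C': "2 * C <= C'" "?F <= C'" "0 <= C'" using C by (auto simp: C'_def)
 have "cnt_err n 1 bs H <=
   C' * (?E H * ?J gs bs powr b / vol bs ^ 1 + H powr ?G)"
  if bs: "length bs = n" "bas bs" "qm K (gs bs)" "\<forall>g\<in>set (gs bs). 1 <= g" and H: "0 < H" for bs :: "'a list" and H
 proof -
  let ?g = "gs bs ! (n - 1)"
  let ?I = "?g powr b"
  have D: "?J gs bs = ?g" using bs(1) n
   by (subst Cons_nth_drop_Suc[symmetric]) auto
  have g1: "1 <= ?g" using bs(1,4) n by simp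
  have v0: "0 < vol bs" using bs vol_pos by blast
  have gv: "?g <= vol bs"
  proof -
   have "gs bs = take (n - 1) (gs bs) @ drop (n - 1) (gs bs)" by simp
   hence "vol bs = prod_list (take (n - 1) (gs bs)) * ?g" unfolding vol_def D[symmetric] by (metis prod_list.append)
   moreover have "1 <= prod_list (take (n - 1) (gs bs))" by (rule prod_list_ge1) (use bs(4) in_set_takeD in metis)
   ultimately show ?thesis using g1 by simp
  qed
  have pw: "H powr real m = H ^ m" for m using H by (rule powr_realpow)
  let ?D = "H ^ (n - 1) * ?g / vol bs"
  let ?A = "?E H * ?I / vol bs" and ?B = "H powr ?G"
  let ?H = "?A + ?B"
  have AB: "0 <= ?A" "0 <= ?B" using v0 by auto
  have "?C bs H <= C' * ?H"
  proof (cases "H < 1")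
   case True
   have "Gs (zs bs) 1 H = {}"
    using Gs_1_empty bs(2,4) H True by blast
   hence "?C bs H = ?F / 2 * (H ^ n / vol bs)"
    using n H v0 by (subst c_const_1) auto
   also have "\<dots> <= C' * ?A"
   proof -
    have "0 <= ?F" by simp
    hence 1: "?F / 2 <= C'" using C' by linarith
    have "H ^ n = ?E H * H powr b" unfolding powr_add[symmetric] using pw by simp
    also have "\<dots> <= ?E H * ?I" using True g1 H b by (intro mult_left_mono powr_mono2) auto
    finally have "H ^ n / vol bs <= ?A" using v0 by (simp add: divide_right_mono)
    thus ?thesis using 1 C' H v0 by (intro mult_mono) auto
   qed
   also have "\<dots> <= C' * ?H" using C' by (intro mult_left_mono) auto
   finally show ?thesis .
  next
   case False
   have "H ^ (n - 2) <= ?B" unfolding pw[symmetric] using False d n by (intro powr_mono) (auto simp: of_nat_diff)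
   moreover have "?D <= ?A + ?B"
   proof (cases "?g <= H")
    case True
    have "?g = ?g powr (1 - b) * ?I" unfolding powr_add[symmetric] using g1 by simp
    also have "\<dots> <= H powr (1 - b) * ?I" using True g1 b by (intro mult_right_mono powr_mono2) auto
    finally have "H ^ (n - 1) * ?g <= H ^ (n - 1) * (H powr (1 - b) * ?I)" using H by (intro mult_left_mono) auto
    also have "\<dots> = ?E H * ?I" unfolding pw[symmetric] mult.assoc[symmetric] powr_add[symmetric] using n by (simp add: of_nat_diff)
    finally have "?D <= ?A" using v0 by (simp add: divide_right_mono)
    thus ?thesis using AB by linarith
   next
    case gH: False
    have "?D <= H ^ (n - 1)" using gv v0 H by (simp add: divide_le_eq mult_left_mono)
    also have "\<dots> <= ?B" unfolding pw[symmetric] using False d n by (intro powr_mono) (auto simp: of_nat_diff)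
    finally show ?thesis using AB by linarith
   qed
   moreover have "y + x <= 2 * (A + B)" if "x <= B" "y <= A + B" "0 <= A" "0 <= B" for x y A B :: real
    using that by (simp add: algebra_simps)
   ultimately have "?D + H ^ (n - 2) <= 2 * ?H" using AB by blast
   hence "C * (?D + H ^ (n - 2)) <= C * (2 * ?H)" using C(1) by (rule mult_left_mono)
   also have "\<dots> = 2 * C * ?H" by (simp only: mult_ac)
   also have "\<dots> <= C' * ?H" by (intro mult_right_mono add_nonneg_nonneg AB C')
   finally show ?thesis by (rule order_trans[OF C(2)[OF bs H]])
  qed
  thus ?thesis unfolding D by simp
 qed
 thus "\<exists>C\<ge>0. \<forall>(bs::'a list) H. nb n K bs --> 0 < H -->
  cnt_err n 1 bs H <=
   C * (?E H * ?J gs bs powr b / vol bs ^ 1 + H powr ?G)"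
  using C'(3) unfolding nb_def by blast
qed

section \<open>Induction by projecting along the first basis vector\<close>

lemma nb_pos: "nb n K bs ==> 0 < vol bs" "nb n K bs ==> bas bs" "nb n K bs ==> length bs = n"
 by (auto simp: nb_def vol_pos)

lemma nb_nth: "nb n K bs ==> i < n ==> 1 <= gs bs ! i"
 by (auto simp: nb_def)

lemma nb_prod: "nb n K bs ==> q <= n ==> 1 <= (\<Prod>i<q. gs bs ! i)"
 by (intro prod_ge_1) (auto simp: nb_nth)

lemma nb_Cons:
 assumes "nb (Suc m) K (b # cs)"
 shows "nb m K (map (prj b) cs)" "bas (b # cs)" "1 <= norm b" "\<And>i. i < m ==> norm b <= K * gs (map (prj b) cs) ! i"
proof -
 have *: "length cs = m" "bas (b # cs)" "qm K (gs (b # cs))" "1 <= norm b" "\<forall>g\<in>set (gs (map (prj b) cs)). 1 <= g"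
  using assms by (auto simp: nb_def)
 let ?A = "map (prj b) cs"
 have q: "gs (b # cs) ! i <= K * gs (b # cs) ! j" if "i <= j" "j < Suc m" for i j using *(1,3) that by (auto simp: qm_def)
 have "qm K (gs ?A)"
  unfolding qm_def using q[of "Suc i" "Suc j" for i j] *(1) by auto
 thus "nb m K ?A" using * by (auto simp: nb_def bas_Cons)
 show "bas (b # cs)" "1 <= norm b" using * by auto
 show "norm b <= K * gs ?A ! i" if "i < m" for i using q[of 0 "Suc i"] that by simp
qed

lemma nb_snoc:
 assumes "nb (Suc m) K (cs @ [b])"
 shows "nb m K cs" "bas (cs @ [b])" "1 <= norm (prjs cs b)" "\<And>i. i < m ==> gs cs ! i <= K * norm (prjs cs b)"
  "vol (cs @ [b]) = vol cs * norm (prjs cs b)"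
proof -
 have *: "length cs = m" "bas (cs @ [b])" "qm K (gs (cs @ [b]))" "1 <= norm (prjs cs b)" "\<forall>g\<in>set (gs cs). 1 <= g"
  using assms by (auto simp: nb_def gs_snoc)
 let ?B = "cs @ [b]"
 let ?A = "norm (prjs cs b)"
 have q: "gs ?B ! i <= K * gs ?B ! j" if "i <= j" "j < Suc m" for i j using *(1,3) that by (auto simp: qm_def)
 have "gs cs ! i <= K * gs cs ! j" if "i <= j" "j < m" for i j
  using q[of i j] that *(1) by (simp add: gs_snoc nth_append)
 hence "qm K (gs cs)" using *(1) by (auto simp: qm_def)
 thus "nb m K cs" using * by (auto simp: nb_def bas_snoc)
 show "bas ?B" "1 <= ?A" using * by auto
 show "gs cs ! i <= K * ?A" if "i < m" for i
  using q[of i m] that *(1) by (simp add: gs_snoc nth_append)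
 show "vol ?B = vol cs * ?A" by (simp add: vol_def gs_snoc)
qed

lemma nb_card:
 assumes "0 < q" "q <= m" "1 <= K" "0 < d"
 shows "\<exists>c\<ge>0. \<forall>(bs::'a::euclidean_space list) U. nb m K bs --> 0 < U -->
  finite (Gs (zs bs) q U) \<and> card (Gs (zs bs) q U) <= c * U powr (m + d)"
proof -
 let ?B = "m + d"
 let ?A = "\<lambda>U bs. (U / (\<Prod>i<q. gs bs ! i)) powr ?B"
 obtain c where c: "0 <= c" "\<And>(bs::'a list) U. bas bs ==> length bs = m ==> qm K (gs bs) ==> 0 < U ==>
   finite (Gs (zs bs) q U) \<and> card (Gs (zs bs) q U) <= c * ?A U bs"
  using Gs_card[OF assms(1,3,4,2), where 'a = 'a] by blast
 have "finite (Gs (zs bs) q U) \<and> card (Gs (zs bs) q U) <= c * U powr ?B" if b: "nb m K bs" and U: "0 < U" for bs :: "'a list" and U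
 proof -
  have p: "1 <= (\<Prod>i<q. gs bs ! i)" by (rule nb_prod[OF b assms(2)])
  have "U / (\<Prod>i<q. gs bs ! i) <= U" using p U by (simp add: divide_le_eq)
  hence "?A U bs <= U powr ?B" using p U assms by (intro powr_mono2) auto
  hence "c * ?A U bs <= c * U powr ?B" using c(1) by (rule mult_left_mono)
  thus ?thesis using c(2)[of bs U] b U unfolding nb_def by force
 qed
 thus ?thesis using c(1) by blast
qed

lemma nb_empty:
 assumes "0 < q" "q <= m" "1 <= K"
 shows "\<exists>c>0. \<forall>(bs::'a::euclidean_space list) U. nb m K bs --> Gs (zs bs) q U \<noteq> {} --> c <= U"
proof -
 obtain c where c: "0 < c" "\<And>(bs::'a list) U. bas bs ==> length bs = m ==> qm K (gs bs) ==>
   Gs (zs bs) q U \<noteq> {} ==> c * (\<Prod>i<q. gs bs ! i) <= U"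
  using Gs_empty[OF assms(1,3,2), where 'a = 'a] by blast
 have "c <= U" if b: "nb m K bs" and U: "Gs (zs bs) q U \<noteq> {}" for bs :: "'a list" and U
 proof -
  have "c * 1 <= c * (\<Prod>i<q. gs bs ! i)" using nb_prod[OF b assms(2)] c(1) by (intro mult_left_mono) auto
  thus ?thesis using c(2)[of bs U] b U unfolding nb_def by force
 qed
 thus ?thesis using c(1) by blast
qed

lemma powr_sum_bound:
 assumes "1 < s"
 shows "\<exists>Z\<ge>0. \<forall>K. (\<Sum>k\<in>{1..K}. real k powr (- s)) <= Z"
proof -
 have sm: "summable (\<lambda>k. real k powr (- s))" using assms by (simp add: summable_real_powr_iff)
 have "(\<Sum>k\<in>{1..K}. real k powr (- s)) <= (\<Sum>k. real k powr (- s))" for K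
  by (rule sum_le_suminf[OF sm]) auto
 moreover have "0 <= (\<Sum>k. real k powr (- s))" by (rule suminf_nonneg[OF sm]) auto
 ultimately show ?thesis by blast
qed

text \<open>The zeta values in the denominators of \<open>a_const\<close> cancel against the product
  in \<open>c_const\<close>.\<close>

lemma c_const_alt: "c_const n d = 1 / n * (n choose d) * (\<Prod>i=1..d. unit_ball_vol (real (n - i + 1)) * zeta_conv i / unit_ball_vol i)"
proof -
 let ?C = "\<lambda>i. zeta_conv (n - i + 1)"
 let ?B = "\<lambda>i. unit_ball_vol (real (n - i + 1)) * zeta_conv i / unit_ball_vol i"
 let ?A = "\<lambda>i. unit_ball_vol (real (n - i + 1)) / unit_ball_vol (real i) * (zeta_conv i / ?C i)"
 have "(\<Prod>i=1..d. ?A i) * (\<Prod>i=1..d. ?C i) =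
   (\<Prod>i=1..d. ?B i)"
  unfolding prod.distrib[symmetric]
 proof (rule prod.cong[OF refl])
  fix i
  have "?C i \<noteq> 0" using zeta_conv_pos[of "n - i + 1"] by simp
  thus "?A i * ?C i =
   ?B i" by simp
 qed
 thus ?thesis unfolding c_const_def a_const_def by (simp only: mult.assoc)
qed

text \<open>Between \<open>m\<close> and \<open>Suc m\<close> the product of ball volumes
  telescopes, and \<open>Jc_vol\<close> supplies the quotient that is left.\<close>

lemma c_const_Suc:
 assumes "d <= m" "0 < m"
 shows "unit_ball_vol d * c_const m d * (m * Jc m d) = c_const (Suc m) d"
proof -
 let ?V = "\<lambda>k::nat. unit_ball_vol (real k)"
 have V: "?V k \<noteq> 0" for k using unit_ball_vol_pos[OF of_nat_0_le_iff, of k] by (metis less_irrefl)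
 define P where "P m = (\<Prod>i=1..d. ?V (m - i + 1) * zeta_conv i / ?V i)" for m
 have P: "P (Suc m) * ?V (m + 1 - d) = P m * ?V (Suc m)"
 proof -
  have "(\<Prod>i=1..d. F (Suc m - i + 1)) * F (m + 1 - d) = (\<Prod>i=1..d. F (m - i + 1)) * F (Suc m)" for F :: "nat => real"
   using assms(1)
  proof (induction d)
   case (Suc d)
   have "Suc m - Suc d + 1 = m + 1 - d" "m - Suc d + 1 = m + 1 - Suc d" using Suc.prems by auto
   thus ?case using Suc by (simp add: mult_ac)
  qed simp
  from this[of ?V] have tel: "(\<Prod>i=1..d. ?V (Suc m - i + 1)) * ?V (m + 1 - d) = (\<Prod>i=1..d. ?V (m - i + 1)) * ?V (Suc m)" .
  have "P m' = (\<Prod>i=1..d. ?V (m' - i + 1)) * (\<Prod>i=1..d. zeta_conv i / ?V i)" for m'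
   unfolding P_def prod.distrib[symmetric] by simp
  from this[of m] this[of "Suc m"] show ?thesis using arg_cong[OF tel, of "\<lambda>x. x * (\<Prod>i=1..d. zeta_conv i / ?V i)"]
   by (simp only: mult_ac)
 qed
 let ?D = "real (Suc m) * real (m choose d)"
 let ?B = "m + 1 - d"
 let ?A = "real ?B * ?V ?B"
 let ?C = "?V d * c_const m d * (m * Jc m d) * ?A"
 have ch: "real (Suc m choose d) * real ?B = ?D"
  using arg_cong[OF binomial_absorb_comp[of "Suc m" d], of real] unfolding of_nat_mult by (simp only: mult.commute Suc_eq_plus1 diff_Suc_1 add_diff_cancel_right')
 have J: "Jc m d * (?A * ?V d) = ?V (m + 1)" by (rule Jc_vol[OF assms(1)])
 have md: "real ?B \<noteq> 0" using assms by simp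
 have "?C = c_const m d * m * (Jc m d * (?A * ?V d))"
  by (simp only: mult_ac)
 also have "\<dots> = (m choose d) * (P m * ?V (Suc m))" unfolding J c_const_alt P_def using assms(2) by simp
 also have "\<dots> = 1 / Suc m * ?D * (P (Suc m) * ?V ?B)" unfolding P by simp
 also have "\<dots> = c_const (Suc m) d * ?A" unfolding ch[symmetric] c_const_alt P_def by simp
 finally have "?C = c_const (Suc m) d * ?A" .
 moreover have "?A \<noteq> 0" unfolding mult_eq_0_iff using md V by blast
 ultimately show ?thesis using mult_right_cancel by blast
qed

text \<open>The first vector of the reduced basis of \<open>G\<close> is a nonzero element of
  \<open>zs bs\<close>, so by \<open>short_in_prefix\<close> it is not shorter than all
  Gram--Schmidt norms of \<open>bs\<close>.\<close>

lemma s0_bound: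
 assumes bs: "bas bs" and G: "sgrp G" "G \<subseteq> zs bs" "0 < dim G"
 shows "\<exists>k<length bs. gs bs ! k <= s0 G" "dsg G" "\<And>g. g \<in> set (gs (rb G)) ==> s0 G <= 2 ^ dim G * g" "0 < s0 G"
proof -
 let ?A = "rb G"
 show d: "dsg G" by (rule dsg_sub[OF dsg_zs[OF bs] G(1,2)])
 have r: "red ?A" "zs ?A = G" "length ?A = dim G" using rb[OF d] rb_length[OF d] by auto
 have "?A \<noteq> []" using r(3) G(3) by (metis length_0_conv less_irrefl)
 then obtain x xs where x: "?A = x # xs" by (meson neq_Nil_conv)
 have xn: "x \<in> zs bs" "x \<noteq> 0" "s0 G = norm x"
  using set_sub_zs[of "?A"] r G(2) red_bas[OF r(1)] by (auto simp: x bas_Cons s0_def)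
 show "0 < s0 G" using xn by simp
 show "\<exists>k<length bs. gs bs ! k <= s0 G"
 proof (rule ccontr)
  assume "\<not> ?thesis"
  hence "norm x < gs bs ! k" if "k < length bs" for k using that xn(3) by (auto simp: not_le)
  hence "x \<in> span (set (take 0 bs))" by (intro short_in_prefix[OF bs xn(1)]) auto
  thus False using xn by simp
 qed
 show "s0 G <= 2 ^ dim G * g" if g: "g \<in> set (gs ?A)" for g
 proof -
  obtain i where i: "i < length ?A" "g = gs ?A ! i" using g by (auto simp: in_set_conv_nth)
  thus ?thesis using red_qm[OF r(1)] r(3) by (auto simp: qm_def s0_def)
 qed
qed

text \<open>A reduced basis is quasi-monotone with constant \<open>2 ^ d\<close>. The condition
  \<open>1 <= c * (R * s0 G)\<close> says that \<open>R\<close> is not small against the inverse of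
  any of its Gram--Schmidt norms, as \<open>er_qm\<close> requires.\<close>

lemma Gs_er_bound:
 assumes G: "dsg G" "dim G = d" "0 < d" "\<And>g. g \<in> set (gs (rb G)) ==> s0 G <= 2 ^ d * g" and P: "0 <= P" "P <= R" and c: "1 <= c" "1 <= c * (R * s0 G)"
 shows "er P (gs (rb G)) <= real d * (1 + c * 2 ^ d) ^ (d - 1) * 2 ^ d * (R ^ (d - 1) * ldet G / s0 G)"
proof -
 let ?B = "rb G"
 let ?A = "gs ?B"
 have r: "red ?B" "length ?B = d" "bas ?B" using rb[OF G(1)] rb_length[OF G(1)] rb_bas[OF G(1)] G(2) by auto
 have "er P ?A <= real (length ?A) * (1 + 1 / (1 / (c * 2 ^ d))) ^ (length ?A - 1) * 2 ^ d *
   (R ^ (length ?A - 1) * prod_list ?A / gs ?B ! 0)"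
 proof (rule er_qm[OF P])
  show "0 < length ?A" using r G(3) by simp
  show "\<And>g. g \<in> set ?A ==> 0 < g" using bas_pos[OF r(3)] .
  show "qm (2 ^ d) ?A" using red_qm[OF r(1)] r(2) by simp
  show "0 < 1 / (c * 2 ^ d)" using c by simp
  show "1 / (c * 2 ^ d) <= R * g" if "g \<in> set ?A" for g
  proof -
   have "0 <= R" "0 <= c" using P c by auto
   from mult_left_mono[OF mult_left_mono[OF G(4)[OF that] this(1)] this(2)]
   have "c * (R * s0 G) <= c * (R * (2 ^ d * g))" .
   hence "1 <= c * (R * (2 ^ d * g))" using c by linarith
   thus ?thesis using c by (simp add: divide_le_eq mult_ac)
  qed
 qed
 also have "prod_list ?A = ldet G" using ldet_zs[OF r(3)] rb[OF G(1)] by (simp add: vol_def)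
 finally show ?thesis using r(2) by (simp add: s0_def)
qed

text \<open>Origin of the weight: for a radius proportional to \<open>1 / ldet M\<close> the bound
  of \<open>Gs_er_bound\<close> contains \<open>ldet M / ldet M ^ (q - 1)\<close>.\<close>

lemma sum_ldet_weight:
 assumes q: "2 <= q" "q < m" and K: "1 <= K" and d: "0 < d"
 shows "\<exists>c\<ge>0. \<forall>(bs::'a::euclidean_space list) X. nb m K bs --> 0 < X -->
   (\<Sum>M\<in>Gs (zs bs) q X. 1 / s0 M * ldet M powr (- (real q - 2))) <=
    c * (X powr (m - 1 / q - (real q - 2)) / vol bs ^ q + X powr (real m - 1 + d - (real q - 2)))"
proof -
 have "0 < q" using q by simp
 from Gs_sum[OF this K d q(2), where 'a = 'a]
 obtain c where c: "0 <= c" "\<And>(bs::'a list) U. bas bs ==> length bs = m ==> qm K (gs bs) ==> 0 < U ==>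
   finite (Gs (zs bs) q U) \<and> (\<Sum>N\<in>Gs (zs bs) q U. 1 / s0 N) <=
    c * (U powr (m - 1 / q) / (\<Prod>i<m. gs bs ! i) ^ q + (U / (\<Prod>i<q. gs bs ! i)) powr (real (m - 1) + d) / gs bs ! 0)"
  by blast
 define e where "e = real q - 2"
 define G where "G h = 2 powr e / (1 - 2 powr (e - h))" for h :: real
 let ?b1 = "m - 1 / q" and ?b2 = "real m - 1 + d"
 let ?D = "G ?b1 + G ?b2"
 have b: "0 <= e" "e < ?b1" "e < ?b2"
 proof -
  have "1 / real q < 1" using q by simp
  thus "e < ?b1" "e < ?b2" "0 <= e" using q d unfolding e_def by linarith+
 qed
 have G0: "0 <= G h" if "e < h" for h
 proof -
  have "2 powr (e - h) < 2 powr (0::real)" using that by (intro powr_less_mono) auto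
  thus ?thesis by (simp add: G_def)
 qed
 have "(\<Sum>M\<in>Gs (zs bs) q X. 1 / s0 M * ldet M powr (- e)) <= ?D * c * (X powr (?b1 - e) / vol bs ^ q + X powr (?b2 - e))"
  if bs: "nb m K bs" and X: "0 < X" for bs :: "'a list" and X
 proof -
  let ?G = "X powr (?b2 - e)"
  let ?F = "X powr (?b1 - e)"
  let ?B = "vol bs ^ q"
  let ?A = "\<Prod>i<q. gs bs ! i"
  let ?I = "{M. sgrp M \<and> M \<subseteq> zs bs \<and> dim M = q}"
  let ?E = "\<lambda>U. \<Sum>M\<in>{M \<in> ?I. ldet M <= U}. 1 / s0 M"
  have GI: "Gs (zs bs) q U = {M \<in> ?I. ldet M <= U}" for U by (auto simp: Gs_def)
  have v: "vol bs = (\<Prod>i<m. gs bs ! i)" using nb_pos(3)[OF bs] by (simp add: vol_def prod_list_nth)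
  have "(\<Sum>M\<in>{M \<in> ?I. ldet M <= X}. 1 / s0 M * ldet M powr (- e)) <=
   2 powr e / (1 - 2 powr (e - ?b1)) * (c / ?B) * ?F + 2 powr e / (1 - 2 powr (e - ?b2)) * c * ?G"
  proof (rule dyadic_sum[OF _ _ X b])
   show "finite {M \<in> ?I. ldet M <= X}" unfolding GI[symmetric] using c(2)[of bs X] bs X by (simp add: nb_def)
   show "0 < ldet M \<and> 0 <= 1 / s0 M" if "M \<in> ?I" for M
   proof -
    have "0 < dim M" using that q by simp
    hence "dsg M" "0 < s0 M" using s0_bound(2,4)[OF nb_pos(2)[OF bs]] that by blast+
    thus ?thesis using ldet_pos by (simp add: less_imp_le)
   qed
   show "0 <= c / ?B" "0 <= c" using c nb_pos(1)[OF bs] by auto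
   show "(?E U) <= c / ?B * U powr ?b1 + c * U powr ?b2" if U: "0 < U" for U
   proof -
    let ?C = "(U / ?A) powr ?b2 / gs bs ! 0"
    have p: "1 <= ?A" "1 <= gs bs ! 0" using nb_prod[OF bs, of q] nb_nth[OF bs, of 0] q by auto
    have m1: "real (m - 1) + d = ?b2" using q by (simp add: of_nat_diff)
    have "U / ?A <= U" using p U by (simp add: divide_le_eq)
    hence "(U / ?A) powr ?b2 <= U powr ?b2" using p U q d by (intro powr_mono2) auto
    hence "?C <= U powr ?b2 / 1" using p by (intro frac_le) auto
    hence "c * (U powr ?b1 / ?B + ?C) <= c * (U powr ?b1 / ?B + U powr ?b2)"
     using c(1) by (intro mult_left_mono) auto
    moreover have "(?E U) <= c * (U powr ?b1 / ?B + ?C)"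
     unfolding GI[symmetric] v m1[symmetric] using c(2)[of bs U] bs U by (simp add: nb_def)
    ultimately show ?thesis by (simp add: distrib_left)
   qed
  qed
  also have "\<dots> = G ?b1 * (c * (?F / ?B)) + G ?b2 * (c * ?G)" by (simp add: G_def)
  also have "\<dots> <= ?D * (c * (?F / ?B)) + ?D * (c * ?G)"
   using G0[OF b(2)] G0[OF b(3)] c(1) nb_pos(1)[OF bs] by (intro add_mono mult_right_mono) auto
  finally show ?thesis unfolding GI by (simp add: distrib_left mult.assoc)
 qed
 moreover have "0 <= ?D * c" using G0[OF b(2)] G0[OF b(3)] c(1) by simp
 ultimately show ?thesis unfolding e_def by blast
qed

text \<open>The volumes of the fibres are summed by \<open>weighted_sum\<close>, their counting
  errors by \<open>sum_ldet_weight\<close>, and the sublattices meeting the line of \<open>b\<close>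
  go into the secondary term by \<open>gr_meet\<close>. The value \<open>1 / d\<close> is the saving
  in \<open>Gs_sum\<close> for rank \<open>d\<close>.\<close>

theorem Est_Cons:
 assumes d: "2 <= d" "d < m" and E: "Est TYPE('a::euclidean_space) m d (1 / d)"
 shows "Est TYPE('a) (Suc m) d (1 / d)"
 unfolding Est_def
proof (intro allI impI)
 let ?g = "\<lambda>k. real k powr (- 2)"
 let ?N = "real d - 2"
 let ?h = "\<lambda>M. 1 / s0 M * ldet M powr (- ?N)"
 let ?d = "m - 1 / d - ?N"
 let ?K = "\<lambda>M H. ldet M * sqrt ((H / ldet M)\<^sup>2 - 1) ^ d"
 fix y K :: real assume y: "0 < y" and K: "1 <= K"
 let ?f = "real m - 1 + y"
 let ?M = "m + y"
 let ?H = "?f - ?N"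
 let ?n = "Suc m" and ?V = "unit_ball_vol (real d)"
 let ?X = "real ?n - 1 / d"
 let ?U = "real ?n - 1 + y"
 have d0: "0 < d" "0 < d - 1" "d - 1 <= m" "d <= m" "0 < m" using d by auto
 have V: "0 < ?V" by simp
 obtain C1 where C1: "0 <= C1" "\<And>(bs::'a list) H. nb m K bs ==> 0 < H ==>
  cnt_err m d bs H <=
   C1 * (top_err m d (1 / d) bs H + H powr ?f)"
  using E y K unfolding Est_def by blast
 obtain c2 where c2: "0 <= c2" "\<And>(bs::'a list) U. nb m K bs ==> 0 < U ==>
  finite (Gs (zs bs) (d - 1) U) \<and> card (Gs (zs bs) (d - 1) U) <= c2 * U powr ?M"
  using nb_card[OF d0(2,3) K y, where 'a = 'a] by blast
 obtain c3 where c3: "0 < c3" "\<And>(bs::'a list) U. nb m K bs ==> Gs (zs bs) (d - 1) U \<noteq> {} ==> c3 <= U"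
  using nb_empty[OF d0(2,3) K, where 'a = 'a] by blast
 obtain c2' where c2': "\<And>(bs::'a list) U. nb m K bs ==> 0 < U ==> finite (Gs (zs bs) d U) \<and> card (Gs (zs bs) d U) <= c2' * U powr ?M"
  using nb_card[OF d0(1,4) K y, where 'a = 'a] by blast
 obtain c4 where c4: "0 <= c4" "\<And>(bs::'a list) X. nb m K bs ==> 0 < X ==>
   (\<Sum>M\<in>Gs (zs bs) d X. ?h M) <=
    c4 * (X powr ?d / vol bs ^ d + X powr ?H)"
  using sum_ldet_weight[OF d K y, where 'a = 'a] by blast
 obtain c0 where c0: "1 <= c0" "\<And>(xs::'a list) u z. length xs = d ==> bas xs ==> 0 <= z ==>
   \<bar>card (DL xs u z) - ?V * z ^ d * vol xs\<bar> <= c0 * er z (gs xs)"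
  using DL_count[of d, where 'a = 'a] by blast
 obtain Z where Z: "0 <= Z" "\<And>N. (\<Sum>k\<in>{1..N}. ?g k) <= Z"
  using powr_sum_bound[of 2] by auto
 define c5 where "c5 = real d * (1 + K * 2 ^ d) ^ (d - 1) * 2 ^ d"
 let ?T = "c0 * c5 * c4"
 have c5: "0 <= c5" using K by (simp add: c5_def)
 let ?a1 = "real m - 1 / d" and ?a2 = "?f"
 define A1 where "A1 = ?a1 * Jc ?a1 d"
 define A2 where "A2 = ?a2 * Jc ?a2 d"
 have d1: "1 / real d < 1" using d by simp
 have rdm: "real d + 1 <= real m" using d by simp
 have a: "real d - 1 < real m" "real d - 1 < ?a1" "real d - 1 < ?a2" using d1 rdm y by linarith+
 have A: "0 <= A1" "0 <= A2" using Jc_nonneg[OF a(2)] Jc_nonneg[OF a(3)] a d unfolding A1_def A2_def by auto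
 define C where "C = ?V * C1 * (A1 + A2) + ?T * K + c2 * Z"
 have C0: "0 <= C" unfolding C_def using V C1 A c0 c5 c4 K c2 Z by (intro add_nonneg_nonneg mult_nonneg_nonneg) auto
 have "cnt_err ?n d bs H <=
   C * (top_err ?n d (1 / d) bs H + H powr ?U)"
  if bs: "nb ?n K bs" and H: "0 < H" for bs :: "'a list" and H
 proof -
  let ?i = "vol bs ^ d"
  let ?O = "\<lambda>H. c_const ?n d * (H ^ ?n / ?i)"
  have "length bs = ?n" using nb_pos(3)[OF bs] .
  then obtain b cs where bc: "bs = b # cs" by (cases bs) auto
  let ?j = "\<lambda>M. M \<inter> span {b}"
  let ?c = "\<lambda>H. finite {M \<in> Gs (zs bs) d H. ?j M \<noteq> {0}}"
  let ?F = "\<lambda>M H. real (card (DL (rb M) (gr_shift b cs M) (gr_rad b M H)))"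
  let ?E = "\<lambda>H. real (card {M \<in> Gs (zs bs) d H. ?j M \<noteq> {0}})"
  define ys where "ys = map (prj b) cs"
  let ?m = "\<Prod>i<d. gs ys ! (m - d + i)"
  note nC = nb_Cons[OF bs[unfolded bc], folded ys_def]
  let ?l = "norm b" and ?v = "vol ys"
  let ?b = "?l ^ (d - 1)"
  let ?P = "?V / ?l ^ d"
  have vb: "vol bs = ?l * ?v" by (simp add: bc vol_Cons ys_def)
  have pos: "0 < ?v" "0 < ?l" "0 < vol bs" using nb_pos(1)[OF nC(1)] nC(3) nb_pos(1)[OF bs] by auto
  define D where "D = prod_list (drop (m - d) (gs ys))"
  let ?W = "D powr (1 / d)"
  have D: "prod_list (drop (?n - d) (gs bs)) = D"
   using d by (simp add: D_def bc ys_def Suc_diff_le)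
  \<comment> \<open>The first norm is at most \<open>K\<close> times each of the last
    \<open>d\<close> Gram--Schmidt norms, hence at most \<open>K\<close> times their geometric mean.
    This converts the surplus factor \<open>?l\<close> of the fibre errors into the factor
    \<open>D powr (1 / d)\<close> of the leading error term.\<close>
  have lD: "?l <= K * ?W"
  proof -
   have ly: "length (gs ys) = m" using nb_pos(3)[OF nC(1)] by simp
   have "D = ?m" unfolding D_def prod_list_nth using ly d by simp
   moreover have "(\<Prod>i<d. ?l / K) <= ?m"
    using nC(4) d K pos by (intro prod_mono) (auto simp: divide_le_eq mult.commute)
   ultimately have "(?l / K) ^ d <= D" by simp
   hence "((?l / K) powr d) powr (1 / d) <= ?W" using pos K d0 by (intro powr_mono2) (auto simp: powr_realpow)
   hence "?l / K <= ?W" unfolding powr_powr using pos K d0 by simp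
   thus ?thesis using K by (simp add: divide_le_eq mult.commute)
  qed
  define X1 where "X1 = H powr ?X * ?W / ?i"
  define X2 where "X2 = H powr ?U"
  let ?o = "?T * (K * X1 + X2)"
  let ?k = "X1 + X2"
  have X0: "0 <= X1" "0 <= X2" using pos by (auto simp: X1_def X2_def)
  let ?G = "Gs (zs ys) d H"
  have fG: "finite ?G" using c2'[OF nC(1) H] by blast
  have Mp: "0 < ldet M \<and> ldet M <= H \<and> sgrp M \<and> M \<subseteq> zs ys \<and> dim M = d \<and> dsg M" if "M \<in> ?G" for M
   using that Gs_dsg[OF dsg_zs[OF nb_pos(2)[OF nC(1)]] that] ldet_pos by (auto simp: Gs_def)

  let ?S = "\<Sum>M\<in>?G. ?K M H"
  \<comment> \<open>The asymptotic formula in dimension \<open>m\<close> is integrated against the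
    fibre volumes.\<close>
  have main: "\<bar>?P * ?S - ?O H\<bar> <= ?V * C1 * (A1 * X1 + A2 * X2)"
  proof -
   let ?I = "{M. sgrp M \<and> M \<subseteq> zs ys \<and> dim M = d}"
   have GI: "Gs (zs ys) d U = {M \<in> ?I. ldet M <= U}" for U by (auto simp: Gs_def)
   let ?u = "c_const m d / ?v ^ d" and ?e1 = "C1 * (?W / ?v ^ d)"
   let ?L = "?u * (real m * Jc m d) * H powr (real m + 1)"
   let ?Y = "?e1 * A1 * H powr (?a1 + 1) + C1 * A2 * H powr (?a2 + 1)"
   have "\<bar>(\<Sum>M\<in>{M \<in> ?I. ldet M <= H}. ?K M H) - ?L\<bar> <=
    ?e1 * (?a1 * Jc ?a1 d) * H powr (?a1 + 1) + C1 * (?a2 * Jc ?a2 d) * H powr (?a2 + 1)"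
   proof (rule weighted_sum[OF _ _ H _ a])
    show "finite {M \<in> ?I. ldet M <= H}" using fG unfolding GI .
    show "0 < ldet M" if "M \<in> ?I" for M using that ldet_pos[OF dsg_sub[OF dsg_zs[OF nb_pos(2)[OF nC(1)]]]] by blast
    show "1 <= d" using d by simp
    show "\<bar>real (card {M \<in> ?I. ldet M <= U}) - ?u * U powr real m\<bar> <= ?e1 * U powr ?a1 + C1 * U powr ?a2" if U: "0 < U" for U
     using C1(2)[OF nC(1) U] unfolding GI[symmetric] D_def[symmetric] powr_realpow[OF U] by (simp add: algebra_simps)
   qed
   hence S: "\<bar>?S - ?L\<bar> <= ?Y"
    unfolding GI A1_def A2_def .
   have HH: "H powr (real m + 1) = H ^ ?n" using powr_realpow[OF H, of ?n] by (simp add: add.commute)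
   have "?P * ?L = (?V * c_const m d * (real m * Jc m d)) * (H ^ ?n / ?i)"
    unfolding HH vb power_mult_distrib using pos by (simp add: field_simps)
   also have "\<dots> = ?O H" by (subst c_const_Suc) (use d0 in auto)
   finally have me: "?P * ?L = ?O H" .
   have "\<bar>?P * ?S - ?O H\<bar> = ?P * \<bar>?S - ?L\<bar>"
    unfolding me[symmetric] right_diff_distrib[symmetric] abs_mult using V pos by simp
   also have "\<dots> <= ?P * ?Y"
    using V pos by (intro mult_left_mono[OF S]) auto
   also have "\<dots> = ?V * C1 * A1 * X1 + ?V * C1 * A2 * (X2 / ?l ^ d)"
   proof -
    have "?a1 + 1 = ?X" "?a2 + 1 = ?U" by auto
    thus ?thesis unfolding X1_def X2_def vb power_mult_distrib using pos by (simp only:) (simp add: field_simps)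
   qed
   also have "\<dots> <= ?V * C1 * A1 * X1 + ?V * C1 * A2 * X2"
   proof -
    have "1 <= ?l ^ d" using nC(3) by simp
    hence "X2 / ?l ^ d <= X2 / 1" using X0 by (intro divide_left_mono) auto
    thus ?thesis using V C1 A by (intro add_left_mono mult_left_mono) auto
   qed
   finally show ?thesis by (simp add: algebra_simps)
  qed

  \<comment> \<open>For the counting errors the radius is replaced by the simpler upper bound
    \<open>?R M\<close>.\<close>
  have err: "\<bar>(\<Sum>M\<in>?G. ?F M H) - ?P * ?S\<bar> <= ?o"
  proof -
   let ?p = "(H / ?l) ^ (d - 1)"
   let ?e = "H ^ (d - 1)"
   let ?J = "?e * H powr ?d / (?b * ?v ^ d)"
   let ?D = "\<lambda>M. ?p * (?h M)"
   let ?R = "\<lambda>M. H / (ldet M * ?l)"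
   have "\<bar>?F M H - ?P * (?K M H)\<bar> <=
    c0 * (c5 * (?D M))" if M: "M \<in> ?G" for M
   proof -
    let ?a = "(H / ldet M)\<^sup>2"
    let ?Q = "gr_rad b M H"
    note Mp = Mp[OF M]
    have dd: "0 < dim M" using Mp d by simp
    note sb = s0_bound[OF nb_pos(2)[OF nC(1)] _ _ dd]
    have r: "bas (rb M)" "length (rb M) = d" "vol (rb M) = ldet M"
     using rb_bas[of M] rb_length[of M] Mp ldet_zs[OF rb_bas[of M]] rb[of M] by auto
    have q1: "1 <= ?a" using Mp by simp
    have z: "?Q = sqrt (?a - 1) / ?l" by (rule gr_rad_def[OF nC(2)])
    have \<rho>0: "0 <= ?Q" unfolding z using q1 by simp
    have \<rho>R: "?Q <= ?R M"
    proof -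
     have "sqrt (?a - 1) <= sqrt ?a" by (intro real_sqrt_le_mono) simp
     also have "\<dots> = H / ldet M" using Mp H by simp
     finally show ?thesis unfolding z using pos by (simp add: divide_right_mono flip: divide_divide_eq_left)
    qed
    have c1: "1 <= K * (?R M * s0 M)"
    proof -
     obtain k where k: "k < m" "gs ys ! k <= s0 M" using sb(1) Mp nb_pos(3)[OF nC(1)] by auto
     have "?l <= K * s0 M" using nC(4)[OF k(1)] k(2) K by (meson mult_left_mono order_trans zero_le_one)
     moreover have "ldet M * ?l <= H * (K * s0 M)" using Mp calculation pos H by (intro mult_mono) auto
     ultimately show ?thesis using Mp pos by (simp add: field_simps)
    qed
    have "er ?Q (gs (rb M)) <= c5 * (?R M ^ (d - 1) * ldet M / s0 M)"
     unfolding c5_def by (rule Gs_er_bound[OF _ _ d0(1) _ \<rho>0 \<rho>R K c1]) (use Mp sb(3) in auto)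
    also have "?R M ^ (d - 1) * ldet M / s0 M = ?D M"
    proof -
     have "ldet M powr (- ?N) = ldet M powr (1 - real (d - 1))" using d0 by (simp add: of_nat_diff)
     also have "\<dots> = ldet M / ldet M ^ (d - 1)" using Mp by (simp add: powr_diff powr_realpow)
     finally show ?thesis by (simp add: power_divide power_mult_distrib)
    qed
    finally have er: "er ?Q (gs (rb M)) <= c5 * (?D M)" .
    have "\<bar>?F M H - ?V * ?Q ^ d * vol (rb M)\<bar> <= c0 * er ?Q (gs (rb M))"
     by (rule c0(2)[OF r(2,1) \<rho>0])
    also have "\<dots> <= c0 * (c5 * (?D M))"
     using er c0 by (intro mult_left_mono) auto
    also have "?V * ?Q ^ d * vol (rb M) = ?P * (?K M H)"
     unfolding r(3) z power_divide by simp
    finally show ?thesis .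
   qed
   hence "\<bar>\<Sum>M\<in>?G. ?F M H - ?P * (?K M H)\<bar> <=
    (\<Sum>M\<in>?G. c0 * (c5 * (?D M)))"
    by (intro order_trans[OF sum_abs] sum_mono)
   also have "\<dots> = c0 * c5 * ?p * (\<Sum>M\<in>?G. ?h M)"
    by (simp add: sum_distrib_left mult.assoc)
   also have "\<dots> <= c0 * c5 * ?p * (c4 * (H powr ?d / ?v ^ d + H powr ?H))"
    using c4(2)[OF nC(1) H] c0 c5 H pos by (intro mult_left_mono) auto
   also have "\<dots> = ?T * (?J + ?e * H powr ?H / ?b)"
   proof -
    have "c0 * c5 * (h / l) * (c4 * (p / v + q)) = ?T * (h * p / (l * v) + h * q / l)" if "l \<noteq> 0" "v \<noteq> 0" for h l p v q :: real
     using that by (simp add: field_simps)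
    thus ?thesis unfolding power_divide using pos by simp
   qed
   also have "\<dots> <= ?o"
   proof (intro mult_left_mono add_mono)
    have hd: "?e = H powr (real d - 1)" using powr_realpow[OF H, of "d - 1"] d0 by (simp add: of_nat_diff)
    have h1: "?e * H powr ?d = H powr ?X"
     unfolding hd powr_add[symmetric] by (simp add: algebra_simps)
    have h2: "?e * H powr ?H = X2"
     unfolding X2_def hd powr_add[symmetric] by (simp add: algebra_simps)
    have "?l ^ d = ?l * ?b" using d0 by (metis Suc_diff_1 power_Suc)
    hence "?J = ?l * (H powr ?X / ?i)"
     unfolding h1 vb power_mult_distrib using pos by simp
    also have "\<dots> <= (K * ?W) * (H powr ?X / ?i)"
     using lD pos by (intro mult_right_mono) auto
    also have "\<dots> = K * X1" by (simp add: X1_def)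
    finally show "?J <= K * X1" .
    have "1 <= ?b" using nC(3) by simp
    hence "X2 / ?b <= X2 / 1" using X0 by (intro divide_left_mono) auto
    thus "?e * H powr ?H / ?b <= X2" unfolding h2 by simp
   qed (use c0 c5 c4 in auto)
   finally show ?thesis by (simp add: sum_subtractf sum_distrib_left)
  qed

  have meet: "?c H"
   "?E H <= c2 * Z * X2"
  proof -
   \<comment> \<open>For larger \<open>k\<close> the determinant bound falls below
     \<open>c3\<close>, where no sublattices are left.\<close>
   define N where "N = nat \<lceil>H / c3\<rceil>"
   have U: "0 < H / (real k * ?l)" if "0 < k" for k using that H pos by simp
   let ?C = "\<lambda>k. Gs (zs ys) (d - 1) (H / (real k * ?l))"
   have emp: "?C k = {}" if k: "N < k" for k
   proof (rule ccontr)
    assume "?C k \<noteq> {}"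
    hence "c3 <= H / (real k * ?l)" using c3(2)[OF nC(1)] by blast
    also have "\<dots> <= H / real k" using k nC(3) H by (intro frac_le) (auto simp: mult_le_cancel_left1)
    finally have "real k <= H / c3" using k c3 by (simp add: field_simps)
    thus False using k by (simp add: N_def) linarith
   qed
   note gm = gr_meet[OF nC(2), folded ys_def, of d H N, OF _ emp]
   have fin: "finite (?C k)" if "0 < k" for k using c2(2)[OF nC(1) U[OF that]] by blast
   show "?c H" unfolding bc using gm fin by blast
   have "?E H <= real (\<Sum>k\<in>{1..N}. k ^ (d - 1) * card (?C k))"
    unfolding bc of_nat_le_iff using gm fin by blast
   also have "\<dots> = (\<Sum>k\<in>{1..N}. real k ^ (d - 1) * real (card (?C k)))" by simp
   \<comment> \<open>The resulting exponent \<open>d - 1 - (m + y)\<close> of \<open>k\<close> is at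
     most -2 because \<open>d < m\<close>.\<close>
   also have "\<dots> <= (\<Sum>k\<in>{1..N}. c2 * X2 * ?g k)"
   proof (rule sum_mono)
    fix k assume "k \<in> {1..N}"
    hence k: "0 < k" "1 <= real k" by auto
    let ?q = "real (card (?C k))"
    let ?Z = "real k ^ (d - 1)"
    have "?q <= c2 * (H / (real k * ?l)) powr ?M" using c2(2)[OF nC(1) U[OF k(1)]] by blast
    also have "\<dots> <= c2 * (H / real k) powr ?M"
     using k nC(3) H y c2(1) by (intro mult_left_mono powr_mono2 frac_le) (auto simp: mult_le_cancel_left1)
    also have "\<dots> = c2 * (X2 / real k powr ?M)" by (simp add: powr_divide X2_def)
    finally have "?Z * ?q <= ?Z * (c2 * (X2 / real k powr ?M))"
     by (intro mult_left_mono) auto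
    also have "\<dots> = c2 * X2 * (?Z * real k powr (- ?M))" by (simp only: powr_minus divide_inverse mult_ac)
    also have "?Z * real k powr (- ?M) = real k powr (real (d - 1) + - ?M)"
     unfolding powr_add using k powr_realpow[of "real k" "d - 1"] by (simp only: of_nat_0_less_iff)
    also have "c2 * X2 * real k powr (real (d - 1) + - ?M) <= c2 * X2 * ?g k"
     using k rdm y d0 c2(1) X0 by (intro mult_left_mono powr_mono) (auto simp: of_nat_diff)
    finally show "?Z * ?q <= c2 * X2 * ?g k" .
   qed
   also have "\<dots> = c2 * X2 * (\<Sum>k\<in>{1..N}. ?g k)" by (simp add: sum_distrib_left)
   also have "\<dots> <= c2 * X2 * Z" using c2(1) X0 Z by (intro mult_left_mono) auto
   finally show "?E H <= c2 * Z * X2" by (simp add: mult_ac)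
  qed

  note gc = gr_count[OF nC(2), folded ys_def, OF fG H, folded bc]
  let ?A = "{M \<in> Gs (zs bs) d H. ?j M = {0}}" and ?B = "{M \<in> Gs (zs bs) d H. ?j M \<noteq> {0}}"
  have "card (?A \<union> ?B) = card ?A + card ?B"
   by (rule card_Un_disjoint[OF conjunct1[OF gc] meet(1)]) blast
  moreover have "?A \<union> ?B = Gs (zs bs) d H" by blast
  ultimately have "card (Gs (zs bs) d H) = card ?A + card ?B" by (simp only:)
  hence split: "real (card (Gs (zs bs) d H)) = (\<Sum>M\<in>?G. ?F M H) + ?E H"
   using conjunct2[OF gc] by simp
  have tri: "\<bar>N - T\<bar> <= e1 + e2 + e3" if "N = S1 + x" "\<bar>S1 - S2\<bar> <= e2" "\<bar>S2 - T\<bar> <= e1" "0 <= x" "x <= e3" for N T S1 S2 x e1 e2 e3 :: real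
   using that by (simp add: abs_le_iff)
  have "cnt_err ?n d bs H <= ?V * C1 * (A1 * X1 + A2 * X2) + ?o + c2 * Z * X2"
   by (rule tri[OF split err main _ meet(2)]) simp
  also have "\<dots> <= ?V * C1 * ((A1 + A2) * ?k) + ?T * (K * ?k) + c2 * Z * ?k"
  proof -
   have "A1 * X1 + A2 * X2 <= (A1 + A2) * ?k" using A X0 by (simp add: algebra_simps)
   moreover have "K * X1 + X2 <= K * ?k" using K X0 mult_right_mono[OF K X0(2)] by (simp add: algebra_simps)
   ultimately show ?thesis using V C1 c0 c5 c4 c2 Z X0 by (intro add_mono mult_left_mono) auto
  qed
  also have "\<dots> = C * ?k" by (simp add: C_def algebra_simps)
  finally show ?thesis unfolding D X1_def X2_def .
 qed
 thus "\<exists>C\<ge>0. \<forall>(bs::'a list) H. nb ?n K bs --> 0 < H -->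
  cnt_err ?n d bs H <=
   C * (top_err ?n d (1 / d) bs H + H powr ?U)"
  using C0 by blast
qed

section \<open>Sums over orthogonal complements\<close>

lemma zs_span_sub: "bas (cs :: 'a::euclidean_space list) ==> M \<subseteq> zs cs ==> span M \<subseteq> span (set cs)"
 using span_zs[of cs] span_mono[of M "zs cs"] by simp

lemma cmp_sat: "M \<subseteq> zs cs ==> cmp cs (zs cs \<inter> span M) = cmp cs M"
proof -
 assume M: "M \<subseteq> zs cs"
 have "(\<forall>z\<in>zs cs \<inter> span M. v \<bullet> z = 0) \<longleftrightarrow> (\<forall>z\<in>M. v \<bullet> z = 0)" for v :: 'a
  using M orth_span[of M v] span_base[of _ M] by blast
 thus ?thesis by (simp add: cmp_def)
qed

text \<open>The component of \<open>v\<close> orthogonal to \<open>P\<close> lies in the span of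
  \<open>cmp cs P\<close>, which is also the span of \<open>cmp cs Q\<close>. So it is orthogonal to
  \<open>v\<close> and therefore zero, and \<open>P\<close> is saturated.\<close>

lemma cmp_inj_sub:
 assumes cs: "bas (cs :: 'a::euclidean_space list)" and P: "sgrp P" "P \<subseteq> zs cs" "zs cs \<inter> span P = P" and Q: "sgrp Q" "Q \<subseteq> zs cs"
  and e: "cmp cs P = cmp cs Q"
 shows "Q \<subseteq> P"
proof
 fix v assume v: "v \<in> Q"
 have dP: "dsg P" by (rule dsg_sub[OF dsg_zs[OF cs] P(1,2)])
 let ?w = "prjs (rb P) v"
 have sp: "span (set (rb P)) = span P" using rb[OF dP] span_zs[of "rb P"] by simp
 have vs: "v \<in> span (set cs)" using v Q span_zs[of cs] span_base by blast
 have vw: "v - ?w \<in> span P" using prjs_diff[of v "rb P"] sp by simp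
 hence "v - ?w \<in> span (set cs)" using zs_span_sub[OF cs P(2)] by blast
 from span_diff[OF vs this] have "?w \<in> span (set cs)" by simp
 moreover have o: "?w \<bullet> z = 0" if "z \<in> span P" for z using prjs_orth[of z "rb P" v] sp that by simp
 ultimately have "?w \<in> span (cmp cs P)" unfolding dual_complement(7)[OF cs P(1,2)] using span_base by blast
 hence "?w \<bullet> v = 0" unfolding e dual_complement(7)[OF cs Q] using v by blast
 hence "?w \<bullet> ?w = 0" using o[OF vw] by (simp add: inner_diff_right)
 hence "v \<in> span (set (rb P))" by (simp add: prjs_0_iff[symmetric])
 thus "v \<in> P" using P(3) v Q(2) sp by blast
qed

text \<open>The primitive sublattices. Among these a sublattice is determined by its complement
  \<open>cmp cs\<close>.\<close>

definition Prim :: "'a::euclidean_space list => nat => real => 'a set set" where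
 "Prim cs q U = {P \<in> Gs (zs cs) q U. zs cs \<inter> span P = P}"

lemma sat_Prim:
 assumes cs: "bas (cs :: 'a::euclidean_space list)" and M: "M \<in> Gs (zs cs) q U"
 shows "zs cs \<inter> span M \<in> Prim cs q U" "M \<subseteq> zs cs \<inter> span M"
proof -
 let ?P = "zs cs \<inter> span M"
 have m: "sgrp M" "M \<subseteq> zs cs" "dim M = q" "ldet M <= U" using M by (auto simp: Gs_def)
 note dc = dual_complement[OF cs m(1,2)]
 show MP: "M \<subseteq> ?P" using m(2) span_base by blast
 have i: "finite {(+) p ` M |p. p \<in> ?P} \<and> card {(+) p ` M |p. p \<in> ?P} = ldet M / ldet ?P"
  by (rule index_count[OF dc(1) m(1) MP]) (simp add: dc(2))
 have "0 \<in> ?P" using sgrp_0[OF dsg_sgrp[OF dc(1)]] .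
 hence "{(+) p ` M |p. p \<in> ?P} \<noteq> {}" by blast
 hence "0 < card {(+) p ` M |p. p \<in> ?P}" using i by (simp add: card_gt_0_iff)
 hence "1 <= ldet M / ldet ?P" using i by linarith
 hence "ldet ?P <= ldet M" using ldet_pos[OF dc(1)] by (simp add: le_divide_eq)
 moreover have "span ?P = span M"
  by (rule subset_antisym[OF span_minimal span_mono[OF MP]]) auto
 ultimately show "?P \<in> Prim cs q U" using dc(1,2) m by (auto simp: Prim_def Gs_def dsg_sgrp)
qed

lemma dual_basis_gs:
 assumes "nb m K (cs :: 'a::euclidean_space list)" "1 <= K"
 defines "g \<equiv> gs (rev (du cs))"
 shows "length g = m" "qm K g" "\<And>i. i < m ==> 0 < g ! i \<and> g ! i <= 1 \<and> g ! i = inverse (gs cs ! (m - 1 - i))" "(\<Prod>i<m. g ! i) = 1 / vol cs"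
proof -
 have cs: "length cs = m" "bas cs" "qm K (gs cs)" "\<forall>g\<in>set (gs cs). 1 <= g" using assms(1) by (auto simp: nb_def)
 let ?A = "\<lambda>i. gs cs ! (m - 1 - i)"
 have g: "g = rev (map inverse (gs cs))" unfolding g_def by (rule rev_du_gs[OF cs(2)])
 show l: "length g = m" using cs by (simp add: g)
 show gi: "0 < g ! i \<and> g ! i <= 1 \<and> g ! i = inverse (?A i)" if "i < m" for i
 proof -
  have e: "g ! i = inverse (?A i)" using that cs(1) by (simp add: g rev_nth)
  have "1 <= ?A i" using cs(1,4) that by simp
  thus ?thesis unfolding e by (simp add: inverse_le_1_iff)
 qed
 show "qm K g" unfolding qm_def
 proof (intro allI impI)
  fix i j assume ij: "i <= j" "j < length g"
  hence "gs cs ! (m - 1 - j) <= K * ?A i" using cs(1,3) l by (simp add: qm_def)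
  moreover have "0 < gs cs ! (m - 1 - j)" "0 < ?A i" using cs(1,4) ij l by (auto intro!: less_le_trans[OF zero_less_one])
  moreover have "inverse x <= K * inverse y" if "y <= K * x" "0 < y" "0 < x" for x y using that by (simp add: field_simps)
  ultimately have "inverse (?A i) <= K * inverse (gs cs ! (m - 1 - j))" by blast
  moreover have "i < m" "j < m" using ij l by auto
  ultimately show "g ! i <= K * g ! j" using gi by metis
 qed
 have "(\<Prod>i<m. g ! i) = vol (rev (du cs))" using l by (simp add: vol_def prod_list_nth g_def)
 thus "(\<Prod>i<m. g ! i) = 1 / vol cs" using vol_rev_du[OF cs(2)] by simp
qed

text \<open>Taking complements turns the sum into one over sublattices of rank \<open>p\<close> in
  the dual lattice with determinant at most \<open>U / vol cs\<close>, where \<open>Gs_sum\<close>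
  gives the exponent \<open>m - 1 / p\<close>. Smaller savings \<open>b\<close> follow on
  multiplying by a power of a quantity that is at least 1: by \<open>Gs_empty\<close>, and because
  the dual Gram--Schmidt norms are at least \<open>1 / u\<close>, the number
  \<open>?Y * u ^ p / c'\<close> is of this kind.\<close>

lemma prim_sum:
 fixes b :: real
 assumes q: "0 < q" "q < m" and p: "p = m - q" and K: "1 <= K" and d: "0 < d" and b: "0 < b" "real p * b <= 1"
 shows "\<exists>c\<ge>0. \<forall>(cs::'a::euclidean_space list) U u. nb m K cs --> 0 < U --> (\<forall>i<m. gs cs ! i <= u) -->
  finite (Prim cs q U) \<and> (\<Sum>P\<in>Prim cs q U. 1 / s0 (cmp cs P)) <=
   c * (U powr (m - b) * (vol cs powr (b - q) * u powr (1 - p * b)) + u * U powr (real m - 1 + d))"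
proof -
 let ?L = "\<lambda>cs m. vol cs powr (b - m)"
 let ?I = "\<lambda>m. real (m - 1) + d"
 let ?G = "\<lambda>U m. U powr (m - b)"
 let ?F = "\<lambda>u p. u powr (1 - p * b)"
 let ?E = "\<lambda>cs. vol cs powr (b - q)"
 let ?B = "\<lambda>m. real m - 1 + d"
 have pm: "0 < p" "p < m" "p <= m" "real m = real p + real q" using p q by auto
 obtain c where c: "0 <= c" "\<And>(bs::'a list) U. bas bs ==> length bs = m ==> qm K (gs bs) ==> 0 < U ==>
   finite (Gs (zs bs) p U) \<and> (\<Sum>M\<in>Gs (zs bs) p U. 1 / s0 M) <=
    c * (U powr (m - 1 / p) / (\<Prod>i<m. gs bs ! i) ^ p + (U / (\<Prod>i<p. gs bs ! i)) powr (?I m) / gs bs ! 0)"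
  using Gs_sum[OF pm(1) K d pm(2), where 'a = 'a] by blast
 obtain c' where c': "0 < c'" "\<And>(bs::'a list) U. bas bs ==> length bs = m ==> qm K (gs bs) ==>
   Gs (zs bs) p U \<noteq> {} ==> c' * (\<Prod>i<p. gs bs ! i) <= U"
  using Gs_empty[OF pm(1) K pm(3), where 'a = 'a] by blast
 \<comment> \<open>The slack between the saving of \<open>Gs_sum\<close> and the prescribed
   one.\<close>
 define r where "r = 1 / real p - b"
 let ?C = "c' powr (- r)"
 have r0: "0 <= r" using b pm by (simp add: r_def field_simps)
 define C where "C = c * (1 + ?C)"
 have C: "c <= C" "c * ?C <= C" "0 <= C" using c by (auto simp: C_def algebra_simps)
 have "finite (Prim cs q U) \<and> (\<Sum>P\<in>Prim cs q U. 1 / s0 (cmp cs P)) <=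
   C * (?G U m * (?E cs * ?F u p) + u * U powr (?B m))"
  if nb: "nb m K cs" and U: "0 < U" and u: "\<forall>i<m. gs cs ! i <= u" for cs :: "'a list" and U u
 proof (cases "Prim cs q U = {}")
  case True
  have "1 <= u" using u nb_nth[OF nb, of 0] q by force
  thus ?thesis using True C by simp
 next
  case False
  have cs: "bas cs" "length cs = m" using nb_pos[OF nb] by auto
  define ds where "ds = rev (du cs)"
  let ?A = "\<lambda>p. \<Prod>i<p. gs ds ! i"
  note dg = dual_basis_gs[OF nb K, folded ds_def]
  have ds: "bas ds" "length ds = m" using bas_rev_du[OF cs(1)] cs by (auto simp: ds_def)
  have v: "0 < vol cs" by (rule nb_pos(1)[OF nb])
  have g01: "0 <= gs ds ! i" "gs ds ! i <= 1" if "i < m" for i using dg(3)[OF that] by linarith+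
  let ?Y = "U / vol cs"
  let ?K = "?Y powr r"
  let ?H = "\<lambda>u p. (?Y * u ^ p / c') powr r"
  let ?D = "\<lambda>m p. ?Y powr (m - 1 / p)"
  have Y: "0 < ?Y" using U v by simp
  have l1: "1 <= u" using u nb_nth[OF nb, of 0] q by force
  have map: "cmp cs P \<in> Gs (zs ds) p ?Y" if P: "P \<in> Prim cs q U" for P
  proof -
   have "sgrp P" "P \<subseteq> zs cs" "dim P = q" "ldet P <= U" "zs cs \<inter> span P = P" using P by (auto simp: Prim_def Gs_def)
   with dual_complement[OF cs(1), of P] cs(2) p v show ?thesis by (auto simp: Gs_def ds_def divide_right_mono)
  qed
  have inj: "inj_on (cmp cs) (Prim cs q U)"
  proof (rule inj_onI)
   fix P Q assume PQ: "P \<in> Prim cs q U" "Q \<in> Prim cs q U" "cmp cs P = cmp cs Q"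
   thus "P = Q" using cmp_inj_sub[OF cs(1), of P Q] cmp_inj_sub[OF cs(1), of Q P] by (simp add: Prim_def Gs_def)
  qed
  note cc = c(2)[OF ds dg(2) Y]
  have fin: "finite (Prim cs q U)" using inj map cc by (meson finite_imageD finite_subset image_subsetI)
  have "(\<Sum>P\<in>Prim cs q U. 1 / s0 (cmp cs P)) = (\<Sum>M\<in>cmp cs ` Prim cs q U. 1 / s0 M)" by (simp add: sum.reindex[OF inj])
  also have "\<dots> <= (\<Sum>M\<in>Gs (zs ds) p ?Y. 1 / s0 M)"
  proof (rule sum_mono2)
   show "finite (Gs (zs ds) p ?Y)" using cc by blast
   show "cmp cs ` Prim cs q U \<subseteq> Gs (zs ds) p ?Y" using map by blast
   show "0 <= 1 / s0 M" if "M \<in> Gs (zs ds) p ?Y - cmp cs ` Prim cs q U" for M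
    using s0_bound(4)[OF ds(1), of M] that pm(1) by (simp add: Gs_def less_imp_le)
  qed
  also have "\<dots> <= c * (?D m p / (1 / vol cs) ^ p + (?Y / (?A p)) powr (?I m) / gs ds ! 0)"
   using cc unfolding dg(4) by blast
  also have "\<dots> <= c * (?C * (?G U m * (?E cs * ?F u p)) + u * U powr (?B m))"
  proof (intro mult_left_mono add_mono c(1))
   have "c' * (?A p) <= ?Y" by (rule c'(2)[OF ds dg(2)]) (use False map in blast)
   moreover have "(1 / u) ^ p <= (?A p)"
   proof -
    have "1 / u <= gs ds ! i" if "i < p" for i
    proof -
     have im: "i < m" "m - 1 - i < m" using that pm by auto
     have "1 / u <= 1 / gs cs ! (m - 1 - i)" using u im nb_nth[OF nb im(2)] l1 by (intro divide_left_mono mult_pos_pos) auto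
     thus ?thesis using dg(3)[OF im(1)] by (simp add: inverse_eq_divide)
    qed
    hence "(\<Prod>i<p. 1 / u) <= (?A p)" using l1 by (intro prod_mono) auto
    thus ?thesis by simp
   qed
   ultimately have "c' * (1 / u) ^ p <= ?Y" using c'(1) by (meson less_imp_le mult_left_mono order_trans)
   moreover have "1 <= y * u ^ p / c'" if "c' * (1 / u) ^ p <= y" for y
    using that l1 c'(1) by (simp add: power_divide field_simps)
   ultimately have "1 <= ?Y * u ^ p / c'" by blast
   hence "1 <= ?H u p" using r0 by (rule ge_one_powr_ge_zero)
   hence "?D m p * vol cs ^ p * 1 <= ?D m p * vol cs ^ p * ?H u p"
    using v by (intro mult_left_mono) auto
   also have "\<dots> = ?C * (?G U m * (?E cs * ?F u p))"
   proof -
    have "?H u p = ?K * ?F u p * ?C"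
    proof -
     have "u ^ p = u powr real p" using l1 by (simp add: powr_realpow)
     moreover have "real p * r = 1 - p * b" using pm by (simp add: r_def field_simps)
     moreover have "(y * z / c') powr r = y powr r * z powr r * ?C" for y z
      unfolding powr_divide[of "y * z" c'] powr_mult[of y z] by (simp add: powr_minus_divide)
     ultimately show ?thesis by (simp only: powr_powr)
    qed
    moreover have "?D m p * ?K = ?G U m * ?L cs m"
    proof -
     have "?D m p * ?K = ?Y powr (m - b)" unfolding powr_add[symmetric] by (simp add: r_def)
     also have "\<dots> = ?G U m / vol cs powr (m - b)" by (simp add: powr_divide)
     also have "\<dots> = ?G U m * vol cs powr (- (m - b))" by (simp only: powr_minus divide_inverse)
     finally show ?thesis by simp
    qed
    moreover have "?L cs m * vol cs ^ p = ?E cs"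
     unfolding powr_realpow[OF v, symmetric] powr_add[symmetric] by (simp add: pm)
    ultimately have e: "?H u p = ?K * ?F u p * ?C"
     "?D m p * ?K = ?G U m * ?L cs m" "?L cs m * vol cs ^ p = ?E cs" by auto
    have "?D m p * vol cs ^ p * ?H u p =
     (?D m p * ?K) * vol cs ^ p * ?F u p * ?C" unfolding e(1) by (simp only: mult_ac)
    also have "\<dots> = ?G U m * (?L cs m * vol cs ^ p) * ?F u p * ?C" unfolding e(2) by (simp only: mult_ac)
    finally show ?thesis unfolding e(3) by (simp only: mult_ac)
   qed
   finally show "?D m p / (1 / vol cs) ^ p <= ?C * (?G U m * (?E cs * ?F u p))"
    by (simp add: power_divide)
   have m1: "?I m = ?B m" using pm by (simp add: of_nat_diff)
   have "(\<Prod>i<m. gs ds ! i) = (?A p) * (\<Prod>i\<in>{p..<m}. gs ds ! i)"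
    using pm by (subst prod.union_disjoint[symmetric]) (auto intro!: prod.cong)
   also have "\<dots> <= (?A p) * 1"
   proof (rule mult_left_mono)
    show "(\<Prod>i\<in>{p..<m}. gs ds ! i) <= 1" by (rule prod_le_1) (use g01 in auto)
    show "0 <= (?A p)" by (rule prod_nonneg) (use g01 pm in auto)
   qed
   finally have pp: "1 / vol cs <= (?A p)" unfolding dg(4) by simp
   hence p0: "0 < (?A p)" using v by (meson divide_pos_pos less_le_trans zero_less_one)
   let ?J = "?Y / (?A p)"
   have "U * (1 / vol cs) <= U * (?A p)" by (rule mult_left_mono[OF pp]) (use U in simp)
   hence "?Y <= U * (?A p)" by (simp only: times_divide_eq_right mult_1_right)
   hence "?J <= U" by (rule pos_divide_le_eq[OF p0, THEN iffD2])
   hence 1: "?J powr (?B m) <= U powr (?B m)"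
   proof (rule powr_mono2[rotated 2])
    show "0 <= ?J" by (rule divide_nonneg_nonneg) (use Y p0 in linarith)+
    show "0 <= ?B m" using pm d by linarith
   qed
   have "1 / gs ds ! 0 = gs cs ! (m - 1)" using dg(3)[of 0] pm by (simp add: inverse_eq_divide)
   also have "\<dots> <= u" using u pm by simp
   finally have 2: "1 / gs ds ! 0 <= u" .
   have "?J powr (?B m) * (1 / gs ds ! 0) <= U powr (?B m) * u"
    using 1 2 dg(3)[of 0] pm by (intro mult_mono) (auto simp: less_imp_le)
   thus "?J powr (?I m) / gs ds ! 0 <= u * U powr (?B m)"
    unfolding m1 by (simp add: mult.commute)
  qed
  also have "\<dots> = c * ?C * (?G U m * (?E cs * ?F u p)) + c * (u * U powr (?B m))"
   by (simp add: distrib_left mult.assoc)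
  also have "\<dots> <= C * (?G U m * (?E cs * ?F u p)) + C * (u * U powr (?B m))"
   using C l1 by (intro add_mono mult_right_mono) auto
  finally show ?thesis using fin by (simp add: distrib_left)
 qed
 thus ?thesis using C(3) by blast
qed

text \<open>The complement of \<open>M\<close> depends on its saturation \<open>P\<close> only, and
  the number of sublattices with saturation \<open>P\<close> is bounded by \<open>Gs_card\<close>
  inside \<open>P\<close>. A first use of \<open>dyadic_sum\<close> removes the resulting power of
  \<open>ldet P\<close>, a second one inserts the weight
  \<open>ldet M powr (- (real p - 1))\<close>.\<close>

theorem cmp_sum:
 fixes b :: real
 assumes q: "0 < q" "q < m" and p: "p = m - q" and K: "1 <= K" and d: "0 < d" and b: "0 < b" "b < 1" "real p * b <= 1"
 shows "\<exists>c\<ge>0. \<forall>(cs::'a::euclidean_space list) X u. nb m K cs --> 0 < X --> (\<forall>i<m. gs cs ! i <= u) -->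
  (\<Sum>M\<in>Gs (zs cs) q X. 1 / s0 (cmp cs M) * ldet M powr (- (real p - 1))) <=
   c * (vol cs powr (b - q) * u powr (1 - p * b) * X powr (m - b - (real p - 1)) + u * X powr (real m - 1 + d - (real p - 1)))"
proof -
 let ?K = "\<lambda>cs u. vol cs powr (b - q) * u powr (1 - p * b)"
 let ?D = "real p - 1"
 have pm: "0 < p" "p < m" "real m = real p + real q" "1 <= real p" "1 <= real q" using p q by auto
 obtain c1 where c1: "0 <= c1" "\<And>(cs::'a list) U u. nb m K cs ==> 0 < U ==> (\<forall>i<m. gs cs ! i <= u) ==>
  finite (Prim cs q U) \<and> (\<Sum>P\<in>Prim cs q U. 1 / s0 (cmp cs P)) <=
   c1 * (U powr (m - b) * (?K cs u) + u * U powr (real m - 1 + d))"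
  using prim_sum[OF q p K d b(1,3), where 'a = 'a] by blast
 \<comment> \<open>Small enough for \<open>q + \<delta>'\<close> to stay below both exponents
   \<open>m - b\<close> and \<open>m - 1 + d\<close>, as \<open>dyadic_sum\<close> demands; it is
   positive because \<open>b < 1\<close>.\<close>
 define \<delta>' where "\<delta>' = min (1 - b) d / 2"
 have \<delta>': "0 < \<delta>'" "\<delta>' < 1 - b" "\<delta>' < d" using b d by (auto simp: \<delta>'_def)
 obtain c2 where c2: "0 <= c2" "\<And>(bs::'a list) U. bas bs ==> length bs = q ==> qm (2 ^ q) (gs bs) ==> 0 < U ==>
   finite (Gs (zs bs) q U) \<and> card (Gs (zs bs) q U) <= c2 * (U / (\<Prod>i<q. gs bs ! i)) powr (q + \<delta>')"
  using Gs_card[OF q(1) _ \<delta>'(1) order_refl, of "2 ^ q", where 'a = 'a] by auto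
 obtain c3 where c3: "\<And>(cs::'a list) U. nb m K cs ==> 0 < U ==> finite (Gs (zs cs) q U) \<and> card (Gs (zs cs) q U) <= c3 * U powr (m + d)"
  using nb_card[OF q(1) less_imp_le[OF q(2)] K d, where 'a = 'a] by blast
 let ?b1 = "m - b" and ?b2 = "real m - 1 + d"
 define e where "e = real q + \<delta>'"
 have e: "0 <= e" "e < ?b1" "e < ?b2" using \<delta>' pm unfolding e_def by linarith+
 have f: "0 <= ?D" "?D < ?b1" "?D < ?b2" using d b pm by linarith+
 define G where "G x h = 2 powr x / (1 - 2 powr (x - h))" for x h :: real
 let ?L = "G e ?b1 + G e ?b2"
 have G0: "0 <= G x h" if "x < h" for x h
 proof -
  have "2 powr (x - h) < 2 powr (0::real)" using that by (intro powr_less_mono) auto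
  thus ?thesis by (simp add: G_def)
 qed
 define C1 where "C1 = c2 * ?L * c1"
 define C where "C = C1 * (G ?D ?b1 + G ?D ?b2)"
 have C0: "0 <= C1" "0 <= C" using G0 e f c1(1) c2(1) by (auto simp: C1_def C_def)
 have "(\<Sum>M\<in>Gs (zs cs) q X. 1 / s0 (cmp cs M) * ldet M powr (- ?D)) <=
   C * (?K cs u * X powr (m - b - ?D) + u * X powr (real m - 1 + d - ?D))"
  if nb: "nb m K cs" and X: "0 < X" and u: "\<forall>i<m. gs cs ! i <= u" for cs :: "'a list" and X u
 proof -
  have cs: "bas cs" "length cs = m" using nb_pos[OF nb] by auto
  have l1: "1 <= u" using u nb_nth[OF nb, of 0] q by force
  have v: "0 < vol cs" by (rule nb_pos(1)[OF nb])
  define B1 where "B1 = ?K cs u"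
  let ?C = "\<lambda>U. C1 * B1 * U powr ?b1 + C1 * u * U powr ?b2"
  have B: "0 <= B1" "0 <= u" using l1 by (auto simp: B1_def)
  let ?w = "\<lambda>M. 1 / s0 (cmp cs M)"
  have pos: "0 < ldet M \<and> 0 <= ?w M" if M: "sgrp M" "M \<subseteq> zs cs" "dim M = q" for M
  proof -
   have dM: "dsg M" by (rule dsg_sub[OF dsg_zs[OF cs(1)] M(1,2)])
   note dc = dual_complement[OF cs(1) M(1,2)]
   have "0 < dim (cmp cs M)" using dc(5) M(3) cs(2) q by simp
   from s0_bound(4)[OF bas_rev_du[OF cs(1)] dc(3,4) this] ldet_pos[OF dM] show ?thesis by simp
  qed
  have W: "(\<Sum>M\<in>Gs (zs cs) q U. ?w M) <= ?C U" if U: "0 < U" for U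
  proof -
   let ?M = "U powr e"
   let ?E = "\<Sum>P\<in>Prim cs q U. ?w P * ldet P powr (- e)"
   let ?B = "G e ?b1 * (c1 * B1) * U powr (?b1 - e) + G e ?b2 * (c1 * u) * U powr (?b2 - e)"
   let ?A = "\<lambda>P. c2 * ?M * (?w P * ldet P powr (- e))"
   let ?G = "Gs (zs cs) q U" and ?s = "\<lambda>M. zs cs \<inter> span M"
   have fG: "finite ?G" using c3[OF nb U] by blast
   have fP: "finite (Prim cs q U)" using c1(2)[OF nb U u] by blast
   have "(\<Sum>M\<in>?G. ?w M) = (\<Sum>P\<in>?s ` ?G. \<Sum>M\<in>{M. M \<in> ?G \<and> ?s M = P}. ?w M)" by (rule sum.image_gen[OF fG])
   also have "\<dots> <= (\<Sum>P\<in>?s ` ?G. ?A P)"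
   proof (rule sum_mono)
    fix P assume "P \<in> ?s ` ?G"
    hence P: "P \<in> Prim cs q U" using sat_Prim(1)[OF cs(1)] by blast
    hence P': "sgrp P" "P \<subseteq> zs cs" "dim P = q" "zs cs \<inter> span P = P" by (auto simp: Prim_def Gs_def)
    let ?F = "\<Sum>M\<in>{M. M \<in> ?G \<and> ?s M = P}. ?w M"
    have dP: "dsg P" by (rule dsg_sub[OF dsg_zs[OF cs(1)] P'(1,2)])
    have rP: "bas (rb P)" "length (rb P) = q" "qm (2 ^ q) (gs (rb P))" "zs (rb P) = P" "ldet P = (\<Prod>i<q. gs (rb P) ! i)"
     using rb[OF dP] rb_bas[OF dP] rb_length[OF dP] red_qm[of "rb P"] P'(3) ldet_rb[OF dP] by auto
    have wM: "?w M = ?w P" if "M \<in> {M. M \<in> ?G \<and> ?s M = P}" for M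
     using cmp_sat[of M cs] that by (auto simp: Gs_def)
    have sub: "{M. M \<in> ?G \<and> ?s M = P} \<subseteq> Gs P q U"
    proof
     fix M assume M: "M \<in> {M. M \<in> ?G \<and> ?s M = P}"
     hence "M \<subseteq> P" using sat_Prim(2)[OF cs(1), of M q U] by blast
     thus "M \<in> Gs P q U" using M by (simp add: Gs_def)
    qed
    note cc = c2(2)[OF rP(1,2,3) U, unfolded rP(4) rP(5)[symmetric]]
    have "?F = card {M. M \<in> ?G \<and> ?s M = P} * ?w P" using wM by simp
    also have "\<dots> <= card (Gs P q U) * ?w P"
     using pos[OF P'(1,2,3)] card_mono[OF conjunct1[OF cc] sub] by (intro mult_right_mono) auto
    also have "\<dots> <= (c2 * (U / ldet P) powr (q + \<delta>')) * ?w P" using cc pos[OF P'(1,2,3)] by (intro mult_right_mono) auto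
    also have "(U / ldet P) powr (q + \<delta>') = ?M * ldet P powr (- e)" unfolding e_def powr_divide by (simp only: powr_minus divide_inverse)
    finally show "?F <= ?A P" by (simp only: mult_ac)
   qed
   also have "\<dots> <= (\<Sum>P\<in>Prim cs q U. ?A P)"
   proof (rule sum_mono2[OF fP])
    show "?s ` ?G \<subseteq> Prim cs q U" using sat_Prim(1)[OF cs(1)] by blast
    show "0 <= ?A P" if "P \<in> Prim cs q U - ?s ` ?G" for P
     using pos[of P] that c2(1) by (intro mult_nonneg_nonneg) (auto simp: Prim_def Gs_def)
   qed
   also have "\<dots> = c2 * ?M * ?E" by (simp add: sum_distrib_left)
   also have "\<dots> <= c2 * ?M * ?B"
   proof (rule mult_left_mono)
    let ?I = "{P. sgrp P \<and> P \<subseteq> zs cs \<and> dim P = q \<and> zs cs \<inter> span P = P}"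
    have PI: "Prim cs q Y = {P \<in> ?I. ldet P <= Y}" for Y by (auto simp: Prim_def Gs_def)
    show "?E <= ?B"
     unfolding PI G_def
    proof (rule dyadic_sum[OF _ _ U e])
     show "finite {P \<in> ?I. ldet P <= U}" using fP unfolding PI .
     show "0 < ldet P \<and> 0 <= ?w P" if "P \<in> ?I" for P using pos[of P] that by blast
     show "0 <= c1 * B1" "0 <= c1 * u" using c1(1) B by auto
     show "(\<Sum>P\<in>{P \<in> ?I. ldet P <= Y}. ?w P) <= c1 * B1 * Y powr ?b1 + c1 * u * Y powr ?b2" if "0 < Y" for Y
      using c1(2)[OF nb that u] unfolding PI[symmetric] B1_def by (simp add: distrib_left mult_ac)
    qed
   qed (use c2 in auto)
   also have "\<dots> = c2 * c1 * (G e ?b1 * B1 * (?M * U powr (?b1 - e)) + G e ?b2 * u * (?M * U powr (?b2 - e)))"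
    by (simp add: distrib_left mult_ac)
   also have "\<dots> = c2 * c1 * (G e ?b1 * (B1 * U powr ?b1) + G e ?b2 * (u * U powr ?b2))"
   proof -
    have "?M * U powr (h - e) = U powr h" for h unfolding powr_add[symmetric] by simp
    thus ?thesis by (simp only: mult.assoc)
   qed
   also have "\<dots> <= c2 * c1 * (?L * (B1 * U powr ?b1) + ?L * (u * U powr ?b2))"
    using G0 e B c1(1) c2(1) by (intro mult_left_mono add_mono mult_right_mono) auto
   also have "\<dots> = ?C U" by (simp add: C1_def algebra_simps)
   finally show ?thesis .
  qed
  let ?I = "{M. sgrp M \<and> M \<subseteq> zs cs \<and> dim M = q}"
  have GI: "Gs (zs cs) q U = {M \<in> ?I. ldet M <= U}" for U by (auto simp: Gs_def)
  let ?f = "?D"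
  let ?J = "X powr (?b1 - ?f)"
  let ?H = "u * X powr (?b2 - ?f)"
  have "(\<Sum>M\<in>{M \<in> ?I. ldet M <= X}. ?w M * ldet M powr (- ?f)) <= G ?f ?b1 * (C1 * B1) * ?J + G ?f ?b2 * (C1 * u) * X powr (?b2 - ?f)"
   unfolding G_def
  proof (rule dyadic_sum[OF _ _ X f])
   show "finite {M \<in> ?I. ldet M <= X}" using c3[OF nb X] unfolding GI by blast
   show "0 < ldet M \<and> 0 <= ?w M" if "M \<in> ?I" for M using pos[of M] that by blast
   show "0 <= C1 * B1" "0 <= C1 * u" using C0 B by auto
   show "(\<Sum>M\<in>{M \<in> ?I. ldet M <= U}. ?w M) <= ?C U" if "0 < U" for U
    using W[OF that] unfolding GI .
  qed
  also have "\<dots> = C1 * (G ?f ?b1 * (B1 * ?J) + G ?f ?b2 * ?H)" by (simp add: algebra_simps)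
  also have "\<dots> <= C1 * ((G ?f ?b1 + G ?f ?b2) * (B1 * ?J) + (G ?f ?b1 + G ?f ?b2) * ?H)"
   using G0 f B C0 by (intro mult_left_mono add_mono mult_right_mono) auto
  also have "\<dots> = C * (B1 * ?J + ?H)" by (simp add: C_def algebra_simps)
  finally show ?thesis unfolding GI B1_def .
 qed
 thus ?thesis using C0(2) by blast
qed

text \<open>As in \<open>c_const_Suc\<close>, with rank and dimension growing together; the new zeta
  value comes from the sum over the heights \<open>k\<close>.\<close>

lemma c_const_Suc_Suc:
 assumes "0 < q" "q < m"
 shows "unit_ball_vol (real (m - q)) * c_const m q * (m * Jc m (m - q)) * zeta_conv (Suc q) = c_const (Suc m) (Suc q)"
proof -
 let ?D = "real (Suc m) * real (m choose q)"
 let ?C = "zeta_conv (Suc q)"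
 let ?V = "\<lambda>k::nat. unit_ball_vol (real k)"
 let ?A = "real (Suc q) * ?V (Suc q)"
 let ?E = "Jc m (m - q) * (?A * ?V (m - q))"
 let ?B = "?V (m - q) * c_const m q * (m * Jc m (m - q)) * ?C * ?A"
 have V: "?V k \<noteq> 0" for k using unit_ball_vol_pos[OF of_nat_0_le_iff, of k] by (metis less_irrefl)
 define P where "P n d = (\<Prod>i=1..d. ?V (n - i + 1) * zeta_conv i / ?V i)" for n d
 have P: "P (Suc m) (Suc q) * ?V (Suc q) = P m q * (?V (Suc m) * ?C)"
 proof -
  have tel: "(\<Prod>i=1..Suc q. ?V (Suc m - i + 1)) = ?V (Suc m) * (\<Prod>i=1..q. ?V (m - i + 1))"
  proof -
   have "(\<Prod>i=1..Suc q. F (Suc m - i + 1)) = F (Suc m) * (\<Prod>i=1..q. F (m - i + 1))" for F :: "nat => real"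
    by (induction q) (simp_all add: mult.assoc)
   thus ?thesis .
  qed
  have "P n d = (\<Prod>i=1..d. ?V (n - i + 1)) * ((\<Prod>i=1..d. zeta_conv i) / (\<Prod>i=1..d. ?V i))" for n d
   unfolding P_def by (simp add: prod.distrib prod_dividef)
  thus ?thesis using tel V[of "Suc q"] by (simp add: field_simps del: of_nat_Suc)
 qed
 have ch: "real (Suc q) * real (Suc m choose Suc q) = ?D"
  using Suc_times_binomial_eq[of m q] by (metis of_nat_mult mult.commute)
 have e: "m + 1 - (m - q) = Suc q" using assms by simp
 have J: "?E = ?V (m + 1)" using Jc_vol[of "m - q" m] unfolding e by simp
 have "?B =
  c_const m q * m * ?E * ?C" by (simp only: mult_ac)
 also have "\<dots> = (m choose q) * (P m q * (?V (Suc m) * ?C))" unfolding J c_const_alt P_def using assms by simp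
 also have "\<dots> = 1 / Suc m * ?D * (P (Suc m) (Suc q) * ?V (Suc q))" unfolding P by simp
 also have "\<dots> = c_const (Suc m) (Suc q) * ?A" unfolding ch[symmetric] c_const_alt P_def by simp
 finally have "?B = c_const (Suc m) (Suc q) * ?A" .
 moreover have "?A \<noteq> 0" unfolding mult_eq_0_iff using V[of "Suc q"] by (simp del: of_nat_Suc)
 ultimately show ?thesis using mult_right_cancel by blast
qed

section \<open>Induction by intersecting with the span of all but the last basis vector\<close>

lemma zeta_conv_lim:
 assumes "2 <= s"
 shows "(\<lambda>N. \<Sum>k\<in>{1..N}. 1 / real k ^ s) \<longlonglongrightarrow> zeta_conv s"
proof -
 let ?A = "\<lambda>m. 1 / real (Suc m) ^ s"
 have "summable ?A" using assms inverse_power_summable[of s, where 'a = real]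
  by (subst summable_Suc_iff[of "\<lambda>m. 1 / real m ^ s"]) (simp add: inverse_eq_divide)
 hence "?A sums zeta_conv s" using assms by (auto simp: zeta_conv_def intro: summable_sums)
 thus ?thesis unfolding sums_def using sum.atLeast1_atMost_eq[of "\<lambda>k. 1 / real k ^ s"] by simp
qed

text \<open>Reduces identities between products of real powers to linear identities between
  logarithms.\<close>

lemma ln_eqI: "0 < a ==> 0 < b ==> ln a = ln b ==> a = (b::real)"
 by simp

text \<open>The index in \<open>cst_wt\<close> times \<open>ldet (cmp cs M)\<close> equals
  \<open>ldet M / vol cs\<close>, so the saturation of \<open>M\<close> drops out of both the main
  term and the error.\<close>

lemma cst_wt_approx:
 fixes cs :: "'a::euclidean_space list"
 assumes nb: "nb (Suc m) K (cs @ [v])" and K: "1 <= K" and p: "0 < p"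
  and c0: "1 <= c0" "\<And>(xs::'a list) u r. length xs = p ==> bas xs ==> 0 <= r ==>
   \<bar>card (DL xs u r) - unit_ball_vol p * r ^ p * vol xs\<bar> <= c0 * er r (gs xs)"
  and H: "0 < H" and k: "0 < k" and M: "M \<in> Gs (zs cs) q (H / (real k * norm (prjs cs v)))" and q: "p + q = m"
 shows "\<bar>cst_wt v cs H k M - unit_ball_vol p / vol cs * (real k * norm (prjs cs v)) ^ p * (ldet M * sqrt ((H / (real k * norm (prjs cs v)) / ldet M)\<^sup>2 - 1) ^ p)\<bar> <=
  c0 * (real p * (1 + K * 2 ^ p) ^ (p - 1) * 2 ^ p) / vol cs * H ^ (p - 1) * (1 / s0 (cmp cs M) * ldet M powr (2 - real p))"
proof -
 let ?E = "H / ldet M"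
 let ?I = "?E\<^sup>2"
 note nC = nb_snoc[OF nb]
 let ?l = "norm (prjs cs v)" and ?V = "vol cs" and ?P = "zs cs \<inter> span M" and ?N = "cmp cs M"
 let ?H = "s0 ?N"
 let ?G = "ldet M / ldet ?P"
 let ?C = "real k * ?l"
 let ?J = "?C\<^sup>2"
 let ?F = "(H / ?C / ldet M)\<^sup>2"
 let ?c5 = "real p * (1 + K * 2 ^ p) ^ (p - 1) * 2 ^ p"
 let ?D = "?c5 * (?E ^ (p - 1) * ldet ?N / ?H)"
 have cs: "bas cs" "length cs = m" "0 < ?V" using nb_pos[OF nC(1)] by auto
 have l: "1 <= ?l" "0 < ?l" using nC(3) by auto
 have kl: "0 < ?C" "?l <= ?C" using k l by (auto simp: mult_le_cancel_right1)
 have Mp: "sgrp M" "M \<subseteq> zs cs" "dim M = q" "ldet M <= H / ?C" using M by (auto simp: Gs_def)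
 have t0: "0 < ldet M" by (rule ldet_pos[OF dsg_sub[OF dsg_zs[OF cs(1)] Mp(1,2)]])
 note dc = dual_complement[OF cs(1) Mp(1,2)]
 have dG: "dim ?N = p" using dc(5) Mp(3) cs(2) q by simp
 have T0: "0 < ldet ?P" by (rule ldet_pos[OF dc(1)])
 note sb = s0_bound[OF bas_rev_du[OF cs(1)] dc(3,4), unfolded dG, OF p]
 define y where "y = rb ?N"
 have y: "bas y" "length y = p" "vol y = ldet ?P / ?V"
  using rb_bas[OF sb(2)] rb_length[OF sb(2)] dG ldet_zs[OF rb_bas[OF sb(2)]] rb[OF sb(2)] dc(6) by (auto simp: y_def)
 define r where "r = sqrt (?I - ?J)"
 let ?B = "unit_ball_vol p * r ^ p * vol y"
 let ?A = "card (DL y (\<lambda>i. real k * (v \<bullet> y ! i)) r)"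
 have R: "?C <= ?E" using Mp(4) t0 kl by (simp add: field_simps)
 have R0: "0 <= ?E" using H t0 by simp
 have "?J <= ?I" using R kl by (intro power_mono) auto
 hence \<rho>0: "0 <= r" by (simp add: r_def)
 have "r <= sqrt ?I" unfolding r_def by (intro real_sqrt_le_mono) simp
 hence \<rho>R: "r <= ?E" using R0 by simp
 have \<rho>e: "r = ?C * sqrt (?F - 1)"
 proof -
  have "?J * ?F = ?I"
   by (subst power_mult_distrib[symmetric]) (use k l in simp)
  hence "?I - ?J = ?J * (?F - 1)"
   by (simp add: right_diff_distrib)
  thus ?thesis unfolding r_def using kl by (simp add: real_sqrt_mult)
 qed
 \<comment> \<open>\<open>s0\<close> of the complement is at least some dual Gram--Schmidt norm, the
   inverse of an entry of \<open>gs cs\<close>, and these entries are at most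
   \<open>K * ?l\<close>.\<close>
 have c1: "1 <= K * (?E * ?H)"
 proof -
  obtain i where i: "i < m" "gs (rev (du cs)) ! i <= ?H" using sb(1) cs(2) by auto
  have j: "m - 1 - i < m" using i by simp
  have "1 / (K * ?l) <= 1 / gs cs ! (m - 1 - i)" using nC(4)[OF j] nb_nth[OF nC(1) j] K l by (intro divide_left_mono mult_pos_pos) auto
  also have "\<dots> <= ?H" using dual_basis_gs(3)[OF nC(1) K i(1)] i(2) by (simp add: inverse_eq_divide)
  finally have "1 <= K * (?l * ?H)" using K l by (simp add: divide_le_eq mult_ac)
  also have "\<dots> <= K * (?E * ?H)" using R kl sb(4) K by (intro mult_left_mono mult_right_mono) auto
  finally show ?thesis .
 qed
 have "er r (gs y) <= ?D"
  unfolding y_def by (rule Gs_er_bound[OF sb(2) dG p sb(3) \<rho>0 \<rho>R K c1])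
 moreover have "\<bar>?A - ?B\<bar> <= c0 * er r (gs y)"
  by (rule c0(2)[OF y(2,1) \<rho>0])
 ultimately have a: "\<bar>?A - ?B\<bar> <= c0 * ?D"
  using c0(1) by (meson less_le_trans mult_left_mono order_trans zero_less_one less_imp_le)
 have w: "cst_wt v cs H k M = ?G * ?A"
  unfolding cst_wt_def[OF nC(2)] y_def r_def ..
 have m: "unit_ball_vol p / ?V * ?C ^ p * (ldet M * sqrt (?F - 1) ^ p) =
  ?G * ?B"
  unfolding y(3) \<rho>e power_mult_distrib using T0 by simp
 have "\<bar>?G * ?A - ?G * ?B\<bar> =
  ?G * \<bar>?A - ?B\<bar>"
  unfolding right_diff_distrib[symmetric] abs_mult using t0 T0 by simp
 also have "\<dots> <= ?G * (c0 * ?D)"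
  using t0 T0 by (intro mult_left_mono[OF a]) auto
 also have "\<dots> = c0 * ?c5 / ?V * H ^ (p - 1) * (1 / ?H * ldet M powr (2 - real p))"
 proof -
  have "ldet M powr (2 - real p) = ldet M powr (1 - real (p - 1))" using p by (simp add: of_nat_diff)
  also have "\<dots> = ldet M / ldet M ^ (p - 1)" using t0 by (simp add: powr_diff powr_realpow)
  finally show ?thesis unfolding dc(6) power_divide using T0 by (simp add: mult_ac)
 qed
 finally show ?thesis unfolding w m .
qed

text \<open>Sublattices in the hyperplane are counted crudely by \<open>nb_card\<close>. For the
  others the fibre volumes at height \<open>k\<close> are summed by \<open>weighted_sum\<close>, and
  the sum over \<open>k\<close> becomes a zeta value. The counting errors are summed over
  \<open>k\<close> first: for given \<open>M\<close> there are at most \<open>X / ldet M\<close>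
  heights, which turns the weight exponent \<open>2 - p\<close> into the \<open>1 - p\<close> of
  \<open>cmp_sum\<close>.\<close>

theorem Est_snoc:
 fixes b :: real
 assumes q: "0 < q" "q < m" and b: "0 < b" "b < 1" "real (m - q) * b <= 1" and E: "Est TYPE('a::euclidean_space) m q b"
 shows "Est TYPE('a) (Suc m) (Suc q) b"
 unfolding Est_def
proof (intro allI impI)
 let ?h = "\<lambda>k M. real k * ldet M"
 fix \<delta> K :: real assume \<delta>: "0 < \<delta>" and K: "1 <= K"
 let ?u = "\<lambda>m. real m - 1 + \<delta>"
 let ?B = "- (real q + \<delta>)"
 let ?W = "\<lambda>k. real k powr ?B"
 let ?n = "Suc m" and ?d = "Suc q"
 let ?o = "real ?n - 1 + \<delta>"
 let ?F = "\<lambda>k. real k powr (- (real ?d - b))"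
 define p where "p = m - q"
 let ?e = "real p - 1"
 let ?M = "\<lambda>cs M. 1 / s0 (cmp cs M) * ldet M powr (- ?e)"
 have p: "0 < p" "p + q = m" "p + ?d = ?n" using q by (auto simp: p_def)
 have rp: "real m = real p + real q" "1 <= real p" "1 <= real q" using p q by auto
 let ?Vp = "unit_ball_vol (real p)"
 have V: "0 < ?Vp" by simp
 have qm: "q <= m" "0 < Suc q" "Suc q <= m" using q by auto
 obtain C1 where C1: "0 <= C1" "\<And>(bs::'a list) H. nb m K bs ==> 0 < H ==>
  cnt_err m q bs H <=
   C1 * (H powr (real m - b) * prod_list (drop (m - q) (gs bs)) powr b / vol bs ^ q + H powr (?u m))"
  using E \<delta> K unfolding Est_def by blast
 let ?X = "?Vp * C1"
 obtain c2 where c2: "0 <= c2" "\<And>(bs::'a list) U. nb m K bs ==> 0 < U ==>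
  finite (Gs (zs bs) (Suc q) U) \<and> card (Gs (zs bs) (Suc q) U) <= c2 * U powr (m + \<delta>)"
  using nb_card[OF qm(2,3) K \<delta>, where 'a = 'a] by blast
 obtain c3 where c3: "0 < c3" "\<And>(bs::'a list) U. nb m K bs ==> Gs (zs bs) q U \<noteq> {} ==> c3 <= U"
  using nb_empty[OF q(1) qm(1) K, where 'a = 'a] by blast
 obtain c2' where c2': "\<And>(bs::'a list) U. nb m K bs ==> 0 < U ==> finite (Gs (zs bs) q U) \<and> card (Gs (zs bs) q U) <= c2' * U powr (m + \<delta>)"
  using nb_card[OF q(1) qm(1) K \<delta>, where 'a = 'a] by blast
 obtain c4 where c4: "0 <= c4" "\<And>(cs::'a list) X \<mu>. nb m K cs ==> 0 < X ==> (\<forall>i<m. gs cs ! i <= \<mu>) ==>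
  (\<Sum>M\<in>Gs (zs cs) q X. ?M cs M) <=
   c4 * (vol cs powr (b - q) * \<mu> powr (1 - p * b) * X powr (m - b - ?e) + \<mu> * X powr (?u m - ?e))"
  using cmp_sum[OF q p_def K \<delta> b(1,2), where 'a = 'a] b(3) unfolding p_def[symmetric] by blast
 obtain c0 where c0: "1 <= c0" "\<And>(xs::'a list) \<alpha> \<rho>. length xs = p ==> bas xs ==> 0 <= \<rho> ==>
   \<bar>card (DL xs \<alpha> \<rho>) - ?Vp * \<rho> ^ p * vol xs\<bar> <= c0 * er \<rho> (gs xs)"
  using DL_count[of p, where 'a = 'a] by blast
 have "1 < real ?d - b" using rp b by simp
 then obtain Z1 where Z1: "0 <= Z1" "\<And>N. (\<Sum>k\<in>{1..N}. ?F k) <= Z1" using powr_sum_bound by blast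
 have "1 < real q + \<delta>" using rp \<delta> by simp
 then obtain Z2 where Z2: "0 <= Z2" "\<And>N. (\<Sum>k\<in>{1..N}. ?W k) <= Z2" using powr_sum_bound by blast
 define c5 where "c5 = real p * (1 + K * 2 ^ p) ^ (p - 1) * 2 ^ p"
 let ?r = "c0 * c5 * c4"
 have c5: "0 <= c5" using K by (simp add: c5_def)
 let ?a1 = "real m - b" and ?a2 = "?u m"
 define A1 where "A1 = ?a1 * Jc ?a1 p"
 define A2 where "A2 = ?a2 * Jc ?a2 p"
 let ?w = "A1 * Z1 + A2 * Z2"
 have a: "?e < real m" "?e < ?a1" "?e < ?a2" using rp \<delta> b by linarith+
 have A: "0 <= A1" "0 <= A2" using Jc_nonneg[OF a(2)] Jc_nonneg[OF a(3)] a rp unfolding A1_def A2_def by auto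
 define C where "C = c2 + ?X * ?w + ?r * K"
 have C0: "0 <= C" unfolding C_def using V C1 A c0 c5 c4 K c2 Z1 Z2 by (intro add_nonneg_nonneg mult_nonneg_nonneg) auto
 have "cnt_err ?n ?d bs H <=
   C * (top_err ?n ?d b bs H + H powr ?o)"
  if bs: "nb ?n K bs" and H: "0 < H" for bs :: "'a list" and H
 proof -
  have "length bs = ?n" using nb_pos(3)[OF bs] .
  then obtain cs v where bc: "bs = cs @ [v]" by (cases bs rule: rev_cases) auto
  note nC = nb_snoc[OF bs[unfolded bc]]
  let ?l = "norm (prjs cs v)" and ?V = "vol cs"
  let ?x = "vol bs / (K * ?l) ^ p"
  let ?s = "\<lambda>k. real k * ?l"
  let ?b = "?Vp / ?V"
  let ?a = "?l powr ?B"
  have cs: "bas cs" "length cs = m" "0 < ?V" using nb_pos[OF nC(1)] by auto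
  have l: "1 <= ?l" "0 < ?l" using nC(3) by auto
  have vb: "vol bs = ?V * ?l" by (simp add: bc nC(5))
  have V1: "1 <= ?V" using nb_prod[OF nC(1) order_refl] cs(2) by (simp add: vol_def prod_list_nth)
  have v0: "0 < vol bs" using vb cs l by simp
  define DA where "DA = prod_list (drop p (gs cs))"
  define D where "D = prod_list (drop (?n - ?d) (gs bs))"
  have DD: "D = DA * ?l" using cs(2) by (simp add: D_def DA_def bc gs_snoc p_def)
  have DA0: "0 < DA" unfolding DA_def by (rule prod_list_pos) (use bas_pos[OF cs(1)] in_set_dropD in metis)
  have D0: "0 < D" using DD DA0 l by simp
  \<comment> \<open>Besides \<open>D\<close>, the volume has \<open>p\<close> factors, each at most
    \<open>K * ?l\<close>. This converts the powers of \<open>vol bs\<close> and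
    \<open>K * ?l\<close> left over from \<open>cmp_sum\<close> into
    \<open>D powr b\<close>.\<close>
  have vD: "vol bs <= (K * ?l) ^ p * D"
  proof -
   let ?p = "prod_list (take p (gs cs))"
   have "?V = ?p * DA" unfolding DA_def vol_def by (simp flip: prod_list.append)
   hence "vol bs = ?p * DA * ?l" using vb by simp
   moreover have "?p = (\<Prod>i<p. gs cs ! i)" unfolding prod_list_nth using cs(2) p by simp
   moreover have "(\<Prod>i<p. gs cs ! i) <= (\<Prod>i<p. K * ?l)" using nC(4) nb_nth[OF nC(1)] p by (intro prod_mono) (auto intro: order_trans[OF zero_le_one])
   ultimately show ?thesis using DA0 l unfolding DD by (simp add: mult_right_mono)
  qed
  define X1 where "X1 = H powr (real ?n - b) * D powr b / vol bs ^ ?d"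
  define X2 where "X2 = H powr ?o"
  let ?z = "K * (X2 * (?a / ?V))"
  let ?q = "X1 + X2"
  let ?c = "A1 * X1 * Z1 + A2 * X2 * Z2"
  let ?T = "?r * K * ?q"
  let ?L = "c2 * X2 + ?X * ?c + ?T"
  have X0: "0 <= X1" "0 <= X2" using v0 by (auto simp: X1_def X2_def)
  define X where "X = H / ?l"
  let ?C = "(K * ?l) * X powr (?u m - ?e)"
  let ?A = "?V powr (b - q) * (K * ?l) powr (1 - p * b) * X powr (m - b - ?e)"
  let ?y = "X * (c4 * (?A + ?C))"
  have X: "0 < X" using H l by (simp add: X_def)
  let ?G = "\<lambda>k::nat. Gs (zs cs) q (H / (?s k))"
  let ?t = "\<lambda>k M. ldet M * sqrt ((H / (?s k) / ldet M)\<^sup>2 - 1) ^ p"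
  let ?D = "\<lambda>k. ?b * (?s k) ^ p * (\<Sum>M\<in>?G k. ?t k M)"
  \<comment> \<open>Height \<open>k\<close> contributes \<open>M0 / k ^ ?d\<close> to the main
    term.\<close>
  define M0 where "M0 = ?Vp * c_const m q * (real m * Jc m p) * (H ^ ?n / vol bs ^ ?d)"
  let ?i = "\<lambda>k. M0 * (1 / real k ^ ?d)"
  let ?U = "\<lambda>N. M0 * (\<Sum>k\<in>{1..N}. 1 / real k ^ ?d)"
  define N0 where "N0 = nat \<lceil>H / c3\<rceil>"
  have Xk: "0 < H / (?s k)" if "0 < k" for k using that H l by simp
  let ?f = "c0 * c5 / ?V * H ^ (p - 1)"
  let ?S = "real (card (Gs (zs bs) ?d H))"
  let ?N = "K * (H powr (real ?n - b) * ?x powr b / vol bs ^ ?d)"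
  let ?K = "H ^ (p - 1) * X / ?V"
  have finG: "finite (?G k)" if "0 < k" for k using c2'[OF nC(1) Xk[OF that]] by blast
  have emp: "?G k = {}" if k: "N0 < k" for k
  proof (rule ccontr)
   assume "?G k \<noteq> {}"
   hence "c3 <= H / (?s k)" using c3(2)[OF nC(1)] by blast
   also have "\<dots> <= H / real k" using k l H by (intro frac_le) (auto simp: mult_le_cancel_left1)
   finally have "real k <= H / c3" using k c3 by (simp add: field_simps)
   thus False using k by (simp add: N0_def) linarith
  qed

  have main: "\<bar>?D k - ?i k\<bar> <=
   ?X * (A1 * X1 * ?F k + A2 * X2 * ?W k)" if k: "0 < k" for k
  proof -
   let ?A1 = "X2 * ?W k"
   let ?I = "{M. sgrp M \<and> M \<subseteq> zs cs \<and> dim M = q}"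
   have GI: "Gs (zs cs) q U = {M \<in> ?I. ldet M <= U}" for U by (auto simp: Gs_def)
   let ?\<alpha> = "c_const m q / ?V ^ q" and ?e1 = "C1 * (DA powr b / ?V ^ q)"
   define \<kappa> where "\<kappa> = ?s k"
   let ?H = "\<kappa> ^ p"
   have \<kappa>: "0 < \<kappa>" using k l by (simp add: \<kappa>_def)
   define Y where "Y = H / \<kappa>"
   let ?m = "Y powr (real m + 1)"
   let ?j = "Y powr (?a1 + 1)"
   let ?R = "Y powr (?a2 + 1)"
   let ?P = "?H * ?j * (DA powr b / ?V ^ ?d)"
   let ?O = "\<lambda>\<alpha>. ?\<alpha> * (real m * Jc m p) * ?m"
   have Y: "0 < Y" using H \<kappa> by (simp add: Y_def)
   define S where "S = (\<Sum>M\<in>?G k. ?t k M)"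
   have "\<bar>(\<Sum>M\<in>{M \<in> ?I. ldet M <= Y}. ldet M * sqrt ((Y / ldet M)\<^sup>2 - 1) ^ p) - ?O \<alpha>\<bar> <=
    ?e1 * (?a1 * Jc ?a1 p) * ?j + C1 * (?a2 * Jc ?a2 p) * ?R"
   proof (rule weighted_sum[OF _ _ Y _ a])
    show "finite {M \<in> ?I. ldet M <= Y}" using finG[OF k] unfolding GI Y_def \<kappa>_def .
    show "0 < ldet M" if "M \<in> ?I" for M using that ldet_pos[OF dsg_sub[OF dsg_zs[OF cs(1)]]] by blast
    show "1 <= p" using p by simp
    show "\<bar>real (card {M \<in> ?I. ldet M <= U}) - ?\<alpha> * U powr real m\<bar> <= ?e1 * U powr ?a1 + C1 * U powr ?a2" if U: "0 < U" for U
     using C1(2)[OF nC(1) U] unfolding GI[symmetric] p_def[symmetric] DA_def[symmetric] powr_realpow[OF U] by (simp add: algebra_simps)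
   qed
   hence S: "\<bar>S - ?O \<alpha>\<bar> <= ?e1 * A1 * ?j + C1 * A2 * ?R"
    unfolding S_def GI A1_def A2_def Y_def \<kappa>_def .
   have me: "?b * ?H * (?O \<alpha>) = ?i k"
   proof -
    have "?m = H ^ ?n / \<kappa> ^ ?n" using powr_realpow[OF Y, of ?n] by (simp add: add.commute Y_def power_divide)
    moreover have "\<kappa> ^ ?n = ?H * (real k ^ ?d * ?l ^ ?d)" unfolding p(3)[symmetric] power_add by (simp add: \<kappa>_def power_mult_distrib)
    ultimately have y: "?H * ?m = H ^ ?n / (real k ^ ?d * ?l ^ ?d)" using \<kappa> by simp
    have "?b * ?H * (?O \<alpha>) = ?b * (?\<alpha> * (real m * Jc m p)) * (?H * ?m)"
     by (simp only: mult_ac)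
    also have "\<dots> = ?i k" unfolding y M0_def vb power_mult_distrib by (simp add: mult_ac)
    finally show ?thesis .
   qed
   have e1: "?b * ?H * (?e1 * A1 * ?j) = ?X * (A1 * X1 * ?F k)"
   proof -
    have "?P = X1 * ?F k"
    proof (rule ln_eqI)
     have kp: "0 < real k" using k by simp
     show "0 < ?P" using \<kappa> Y DA0 cs by simp
     show "0 < X1 * ?F k" using kp H D0 v0 by (simp add: X1_def)
     show "ln ?P = ln (X1 * ?F k)"
      unfolding X1_def DD vb Y_def \<kappa>_def using kp H l cs DA0 rp(1)
      by (simp add: ln_mult ln_div ln_powr ln_realpow algebra_simps del: power_Suc)
    qed
    hence "?X * A1 * ?P = ?X * A1 * (X1 * ?F k)" by simp
    thus ?thesis by (simp add: mult_ac)
   qed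
   have e2: "?b * ?H * (C1 * A2 * ?R) <= ?X * (A2 * X2 * ?W k)"
   proof -
    have kp: "0 < real k" using k by simp
    have "?H * ?R = ?A1 * ?a"
    proof (rule ln_eqI)
     show "0 < ?H * ?R" using \<kappa> Y by simp
     show "0 < ?A1 * ?a" using kp H l by (simp add: X2_def)
     show "ln (?H * ?R) = ln (?A1 * ?a)"
      unfolding X2_def Y_def \<kappa>_def using kp H l rp(1) by (simp add: ln_mult ln_div ln_powr ln_realpow algebra_simps)
    qed
    also have "\<dots> <= ?A1 * 1"
    proof (rule mult_left_mono)
     have "?a <= ?l powr 0" using l \<delta> by (intro powr_mono) auto
     thus "?a <= 1" using l by simp
    qed (use X0 in simp)
    finally have z: "?H * ?R <= ?A1" by simp
    have "?b * C1 * A2 * (?H * ?R) <= ?X * A2 * ?A1"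
    proof (rule mult_mono)
     have "?b <= ?Vp / 1" using V1 V by (intro frac_le) auto
     thus "?b * C1 * A2 <= ?X * A2" using C1(1) A by (intro mult_right_mono) auto
    qed (use z V C1(1) A \<kappa> Y in auto)
    thus ?thesis by (simp add: mult_ac)
   qed
   have "\<bar>?b * ?H * S - ?i k\<bar> = ?b * ?H * \<bar>S - ?O \<alpha>\<bar>"
    unfolding me[symmetric] right_diff_distrib[symmetric] abs_mult using V cs \<kappa> by simp
   also have "\<dots> <= ?b * ?H * (?e1 * A1 * ?j + C1 * A2 * ?R)"
    using V cs \<kappa> by (intro mult_left_mono[OF S]) auto
   also have "\<dots> <= ?X * (A1 * X1 * ?F k) + ?X * (A2 * X2 * ?W k)"
    unfolding distrib_left using e1 e2 by (intro add_mono) simp_all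
   finally show ?thesis unfolding S_def \<kappa>_def by (simp only: distrib_left)
  qed

  let ?v = "Gs (zs cs) ?d H"
  let ?E = "\<lambda>M. 1 / s0 (cmp cs M) * ldet M powr (2 - real p)"
  let ?Q = "\<lambda>N. \<Sum>k\<in>{1..N}. \<Sum>M\<in>?G k. ?f * ?E M"
  have E0: "0 <= ?E M \<and> 0 < ldet M" if M: "M \<in> Gs (zs cs) q U" for M U
  proof -
   have Mp: "sgrp M" "M \<subseteq> zs cs" "dim M = q" using M by (auto simp: Gs_def)
   have t0: "0 < ldet M" by (rule ldet_pos[OF dsg_sub[OF dsg_zs[OF cs(1)] Mp(1,2)]])
   note dc = dual_complement[OF cs(1) Mp(1,2)]
   have "0 < dim (cmp cs M)" using dc(5) Mp(3) cs(2) p by simp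
   from s0_bound(4)[OF bas_rev_du[OF cs(1)] dc(3,4) this] t0 show ?thesis by simp
  qed
  have err: "(?Q N) <= ?T" for N
  proof -
   let ?Y = "\<Sum>k\<in>{1..N}. \<Sum>M\<in>?G k. ?E M"
   have fX: "finite (Gs (zs cs) q X)" using c2'[OF nC(1) X] by blast
   have GX: "?G k = {M \<in> Gs (zs cs) q X. ?h k M <= X}" if k: "0 < k" for k
   proof -
    have "ldet M <= H / (?s k) \<longleftrightarrow> ?h k M <= X" for M :: "'a set" using k l by (simp add: X_def field_simps)
    moreover have "ldet M <= X" if "?h k M <= X" "0 <= ldet M" for M :: "'a set"
     using that k mult_right_mono[of 1 "real k" "ldet M"] by simp
    moreover have "0 <= ldet M" if "sgrp M" "M \<subseteq> zs cs" for M
     using ldet_pos[OF dsg_sub[OF dsg_zs[OF cs(1)] that]] by simp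
    ultimately show ?thesis unfolding Gs_def by auto
   qed
   have "?Y = (\<Sum>k\<in>{1..N}. \<Sum>M\<in>Gs (zs cs) q X. if ?h k M <= X then ?E M else 0)"
   proof (rule sum.cong[OF refl])
    fix k assume "k \<in> {1..N}"
    hence "0 < k" by simp
    show "(\<Sum>M\<in>?G k. ?E M) = (\<Sum>M\<in>Gs (zs cs) q X. if ?h k M <= X then ?E M else 0)"
     unfolding GX[OF \<open>0 < k\<close>] by (rule sum.inter_filter[OF fX])
   qed
   also have "\<dots> = (\<Sum>M\<in>Gs (zs cs) q X. \<Sum>k\<in>{1..N}. if ?h k M <= X then ?E M else 0)" by (rule sum.swap)
   \<comment> \<open>At most \<open>X / ldet M\<close> heights occur over a given
     \<open>M\<close>.\<close>
   also have "\<dots> <= (\<Sum>M\<in>Gs (zs cs) q X. X * (?M cs M))"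
   proof (rule sum_mono)
    fix M assume M: "M \<in> Gs (zs cs) q X"
    let ?k = "\<Sum>k\<in>{1..N}. if ?h k M <= X then ?E M else 0"
    let ?Z = "card {k \<in> {1..N}. ?h k M <= X}"
    have t0: "0 < ldet M" using E0[OF M] by simp
    have "?k = ?Z * ?E M"
     by (subst sum.inter_filter[symmetric]) auto
    also have "\<dots> <= X / ldet M * ?E M"
    proof (rule mult_right_mono)
     have "{k \<in> {1..N}. ?h k M <= X} \<subseteq> {1..nat \<lfloor>X / ldet M\<rfloor>}"
      using t0 by (auto simp: le_nat_floor pos_le_divide_eq)
     hence "?Z <= nat \<lfloor>X / ldet M\<rfloor>" by (metis card_atLeastAtMost card_mono diff_Suc_1 finite_atLeastAtMost)
     also have "real (nat \<lfloor>X / ldet M\<rfloor>) <= X / ldet M" using X t0 by (intro of_nat_floor) simp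
     finally show "real ?Z <= X / ldet M" by simp
    qed (use E0[OF M] in simp)
    also have "\<dots> = X * (?M cs M)"
    proof -
     have "ldet M powr (- ?e) = ldet M powr ((2 - real p) - 1)" by simp
     also have "\<dots> = ldet M powr (2 - real p) / ldet M" unfolding powr_diff using t0 by simp
     finally show ?thesis by simp
    qed
    finally show "?k <= X * (?M cs M)" .
   qed
   also have "\<dots> = X * (\<Sum>M\<in>Gs (zs cs) q X. ?M cs M)" by (simp add: sum_distrib_left)
   also have "\<dots> <= ?y"
    using X nC(4) by (intro mult_left_mono c4(2)[OF nC(1) X]) auto
   finally have S: "?Y <= ?y" .
   have K0: "0 < K" using K by simp
   have hp: "real (p - Suc 0) = ?e" using p by (simp add: of_nat_diff)
   have t1: "?K * ?A <= K * X1"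
   proof -
    have "?K * ?A =
     ?N"
    proof (rule ln_eqI)
     show "0 < ?K * ?A"
      using H X cs K0 l by simp
     show "0 < ?N" using H v0 K0 l by simp
     show "ln (?K * ?A) =
      ln ?N"
      unfolding X_def vb using H cs(3) K0 l(2) rp(1)
      by (simp add: ln_mult ln_div ln_powr ln_realpow hp algebra_simps del: power_Suc)
    qed
    also have "\<dots> <= K * X1"
    proof -
     have "?x <= D" using vD K0 l by (simp add: divide_le_eq mult.commute)
     hence "?x powr b <= D powr b" using v0 K0 l b by (intro powr_mono2) auto
     thus ?thesis unfolding X1_def using K0 v0 by (intro mult_left_mono divide_right_mono) auto
    qed
    finally show ?thesis .
   qed
   have t2: "?K * ?C <= K * X2"
   proof -
    have "?K * ?C = ?z"
    proof (rule ln_eqI)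
     show "0 < ?K * ?C" using H X cs K0 l by simp
     show "0 < ?z" using H cs K0 l by (simp add: X2_def)
     show "ln (?K * ?C) = ln ?z"
      unfolding X_def X2_def using H cs(3) K0 l(2) rp(1)
      by (simp add: ln_mult ln_div ln_powr ln_realpow hp algebra_simps)
    qed
    also have "\<dots> <= K * (X2 * 1)"
    proof (intro mult_left_mono)
     have "?a <= ?l powr 0" using l \<delta> by (intro powr_mono) auto
     hence "?a <= ?V" using l V1 by simp
     thus "?a / ?V <= 1" using cs by simp
    qed (use X0 K0 in auto)
    finally show ?thesis by simp
   qed
   have "(?Q N) = ?f * ?Y"
    by (simp add: sum_distrib_left)
   also have "\<dots> <= ?f * ?y"
    using c0 c5 cs H by (intro mult_left_mono[OF S]) auto
   also have "\<dots> = ?r * (?K * ?A +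
     ?K * ?C)"
   proof -
    have "c0 * c5 / w * h * (x * (c4 * (y + z))) = ?r * (h * x / w * y + h * x / w * z)" for w h x y z :: real
     by (simp add: distrib_left add_divide_distrib mult_ac)
    thus ?thesis .
   qed
   also have "\<dots> <= ?r * (K * X1 + K * X2)" using c0 c5 c4 by (intro mult_left_mono add_mono t1 t2) auto
   finally show ?thesis by (simp add: algebra_simps)
  qed

  have fA: "finite ?v" "real (card ?v) <= c2 * X2"
   using c2(2)[OF nC(1) H] by (auto simp: X2_def)
  let ?L1 = "{M \<in> Gs (zs bs) ?d H. M \<subseteq> zs cs}" and ?L2 = "{M \<in> Gs (zs bs) ?d H. \<not> M \<subseteq> zs cs}"
  have L1: "?L1 = ?v" unfolding bc using A_sub_L[OF nC(2)] by (auto simp: Gs_def)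
  \<comment> \<open>The count on the left does not depend on \<open>N\<close>, while the zeta sum is
    truncated at \<open>N\<close>. The bound is uniform for \<open>N >= N0\<close>, so
    \<open>N\<close> may tend to infinity.\<close>
  have B: "\<bar>?S - ?U N\<bar> <=
   ?L" if N: "N0 <= N" for N
  proof -
   let ?g = "\<Sum>k\<in>{1..N}. ?D k"
   let ?J = "\<Sum>k\<in>{1..N}. \<Sum>M\<in>?G k. cst_wt v cs H k M"
   have sc: "finite ?L2 \<and> real (card ?L2) = ?J"
    unfolding bc using snoc_count[OF nC(2), of ?d H N] finG emp N by simp
   have "card (?L1 \<union> ?L2) = card ?L1 + card ?L2" by (rule card_Un_disjoint) (use L1 fA sc in auto)
   moreover have "?L1 \<union> ?L2 = Gs (zs bs) ?d H" by blast
   ultimately have tot: "?S = real (card ?v) + ?J"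
    using sc unfolding L1 by simp
   have 1: "\<bar>?J - ?g\<bar> <= ?T"
   proof -
    have "\<bar>?J - ?g\<bar> =
     \<bar>\<Sum>k\<in>{1..N}. \<Sum>M\<in>?G k. cst_wt v cs H k M - ?b * (?s k) ^ p * ?t k M\<bar>"
     by (simp only: sum_subtractf sum_distrib_left)
    also have "\<dots> <= (?Q N)"
    proof (intro order_trans[OF sum_abs] sum_mono)
     fix k M assume "k \<in> {1..N}" "M \<in> ?G k"
     thus "\<bar>cst_wt v cs H k M - ?b * (?s k) ^ p * ?t k M\<bar> <= ?f * ?E M"
      unfolding c5_def by (intro cst_wt_approx[OF bs[unfolded bc] K p(1) c0 H _ _ p(2)]) auto
    qed
    also have "\<dots> <= ?T" by (rule err)
    finally show ?thesis .
   qed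
   have 2: "\<bar>?g - ?U N\<bar> <= ?X * ?c"
   proof -
    have "\<bar>?g - ?U N\<bar> =
     \<bar>\<Sum>k\<in>{1..N}. ?D k - ?i k\<bar>"
     unfolding sum_subtractf by (simp only: sum_distrib_left)
    also have "\<dots> <= (\<Sum>k\<in>{1..N}. ?X * (A1 * X1 * ?F k + A2 * X2 * ?W k))"
     by (intro order_trans[OF sum_abs] sum_mono main) auto
    also have "\<dots> = ?X * (A1 * X1 * (\<Sum>k\<in>{1..N}. ?F k) + A2 * X2 * (\<Sum>k\<in>{1..N}. ?W k))"
     by (simp add: sum_distrib_left sum.distrib distrib_left mult.assoc)
    also have "\<dots> <= ?X * ?c"
     using V C1 A X0 Z1(2) Z2(2) by (intro mult_left_mono add_mono) auto
    finally show ?thesis .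
   qed
   have tri: "\<bar>T - y\<bar> <= e0 + e2 + e1" if "T = x + S1" "\<bar>S1 - S2\<bar> <= e1" "\<bar>S2 - y\<bar> <= e2" "0 <= x" "x <= e0" for T y x S1 S2 e0 e1 e2 :: real
    using that by (simp add: abs_le_iff)
   show ?thesis by (rule tri[OF tot 1 2 _ fA(2)]) simp
  qed
  have "(\<lambda>N. \<bar>?S - ?U N\<bar>) \<longlonglongrightarrow> \<bar>?S - M0 * zeta_conv ?d\<bar>"
   by (intro tendsto_intros zeta_conv_lim) (use q in simp)
  from tendsto_upperbound[OF this eventually_sequentiallyI[of N0, OF B] sequentially_bot]
  have fin: "\<bar>?S - M0 * zeta_conv ?d\<bar> <= ?L"
   .
  have "M0 * zeta_conv ?d = c_const ?n ?d * (H ^ ?n / vol bs ^ ?d)"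
   using c_const_Suc_Suc[OF q, symmetric] unfolding M0_def p_def by (simp add: mult_ac)
  hence "cnt_err ?n ?d bs H <= ?L"
   using fin by simp
  also have "\<dots> <= c2 * ?q + ?X * (?w * ?q) + ?T"
  proof (intro add_mono mult_left_mono)
   have "A1 * Z1 * X1 + A2 * Z2 * X2 <= A1 * Z1 * ?q + A2 * Z2 * ?q"
    using A Z1 Z2 X0 by (intro add_mono mult_left_mono) auto
   thus "?c <= ?w * ?q" by (simp add: algebra_simps)
  qed (use c2(1) X0 V C1(1) c0(1) c5 c4(1) K in auto)
  also have "\<dots> = C * ?q" by (simp add: C_def algebra_simps)
  finally show ?thesis unfolding X1_def X2_def D_def .
 qed
 thus "\<exists>C\<ge>0. \<forall>(bs::'a list) H. nb ?n K bs --> 0 < H -->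
  cnt_err ?n ?d bs H <=
   C * (top_err ?n ?d b bs H + H powr ?o)"
  using C0 by blast
qed

section \<open>Scaling\<close>

text \<open>The corank \<open>p\<close> stays fixed while rank and dimension grow from rank one, so
  a single \<open>b\<close> with \<open>p * b <= 1\<close> serves throughout.\<close>

theorem Est_chain:
 assumes b: "0 < b" "b < 1" "real p * b <= 1" and p: "0 < p" and d: "0 < d"
 shows "Est TYPE('a::euclidean_space) (p + d) d b"
 using d
proof (induction d rule: nat_induct_non_zero)
 case 1
 show ?case using Est_1[of "p + 1" b, where 'a = 'a] b p by simp
next
 case (Suc d)
 show ?case using Est_snoc[OF Suc(1) _ b(1,2) _ Suc(2)] p b(3) by simp
qed

text \<open>In corank one \<open>Est_chain\<close> admits every \<open>b < 1\<close>, in particular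
  \<open>1 / d\<close> in dimension \<open>d + 1\<close>; from there \<open>Est_Cons\<close> raises
  the dimension.\<close>

theorem Est_lead:
 assumes "2 <= d" "d < n"
 shows "Est TYPE('a::euclidean_space) n d (1 / d)"
proof -
 have "Est TYPE('a) (Suc d + k) d (1 / d)" for k
 proof (induction k)
  case 0
  show ?case using Est_chain[of "1 / d" 1 d, where 'a = 'a] assms by simp
 next
  case (Suc k)
  show ?case using Est_Cons[OF assms(1) _ Suc] by simp
 qed
 from this[of "n - Suc d"] show ?thesis using assms by simp
qed

lemma prj_scale_both: "s \<noteq> 0 ==> prj (s *\<^sub>R x) (s *\<^sub>R y) = s *\<^sub>R prj x y"
 by (simp add: prj_def scaleR_diff_right)

lemma gs_scale: "0 < s ==> gs (map ((*\<^sub>R) s) xs) = map ((*) s) (gs xs)"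
proof (induction xs rule: gs.induct)
 case (2 x xs)
 have "map (prj (s *\<^sub>R x)) (map ((*\<^sub>R) s) xs) = map ((*\<^sub>R) s) (map (prj x) xs)"
  using 2(2) by (simp add: prj_scale_both)
 thus ?case using 2 by (simp del: map_map)
qed simp

lemma bas_scale: "0 < s ==> bas xs ==> bas (map ((*\<^sub>R) s) xs)"
 by (auto simp: bas_def gs_scale)

lemma prod_list_scale: "prod_list (map ((*) s) ls) = s ^ length ls * (prod_list ls :: real)"
 by (induction ls) auto

lemma linear_scale_map: "linear ((*\<^sub>R) s :: 'a::real_vector => 'a)"
 by (rule linear_scale_self)

lemma scale_zs: "(*\<^sub>R) s ` zs xs = zs (map ((*\<^sub>R) s) xs)"
 using zs_image[OF linear_scale_map] by metis

lemma ldet_scale: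
 assumes M: "dsg M" and s: "0 < s"
 shows "dsg ((*\<^sub>R) s ` M)" "dim ((*\<^sub>R) s ` M) = dim M" "ldet ((*\<^sub>R) s ` M) = s ^ dim M * ldet M"
proof -
 let ?A = "(*\<^sub>R) s"
 obtain xs where xs: "bas xs" "zs xs = M" "length xs = dim M" using dsg_basis[OF M] .
 have b: "bas (map ?A xs)" by (rule bas_scale[OF s xs(1)])
 have e: "?A ` M = zs (map ?A xs)" unfolding xs(2)[symmetric] by (rule scale_zs)
 show "dsg (?A ` M)" unfolding e by (rule dsg_zs[OF b])
 show "dim (?A ` M) = dim M" unfolding e dim_zs[OF b] using xs by simp
 show "ldet (?A ` M) = s ^ dim M * ldet M"
  unfolding e ldet_zs[OF b] using ldet_zs[OF xs(1)] xs by (simp add: vol_def gs_scale[OF s] prod_list_scale)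
qed

lemma Gs_scale:
 assumes L: "dsg L" and s: "0 < s"
 shows "card (Gs ((*\<^sub>R) s ` L) d (s ^ d * H)) = card (Gs L d H)"
proof -
 have sub: "(`) ((*\<^sub>R) r) ` Gs L d H \<subseteq> Gs ((*\<^sub>R) r ` L) d (r ^ d * H)" if L: "dsg L" and r: "0 < r" for r d H and L :: "'a set"
 proof safe
  fix M assume M: "M \<in> Gs L d H"
  have dM: "dsg M" by (rule Gs_dsg[OF L M])
  show "(*\<^sub>R) r ` M \<in> Gs ((*\<^sub>R) r ` L) d (r ^ d * H)"
   using M ldet_scale[OF dM r] r by (auto simp: Gs_def dsg_sgrp)
 qed
 have i: "(*\<^sub>R) (inverse s) ` (*\<^sub>R) s ` M = M" "(*\<^sub>R) s ` (*\<^sub>R) (inverse s) ` M = M" for M :: "'a set"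
  using s by (auto simp: image_image)
 have s': "0 < inverse s" using s by simp
 have "(`) ((*\<^sub>R) (inverse s)) ` Gs ((*\<^sub>R) s ` L) d (s ^ d * H) \<subseteq> Gs L d H"
 proof -
  have f: "inverse s ^ d * (s ^ d * H) = H" using s by (simp add: power_inverse)
  show ?thesis using sub[OF ldet_scale(1)[OF L s] s', of d "s ^ d * H"] unfolding i f .
 qed
 hence "bij_betw ((`) ((*\<^sub>R) s)) (Gs L d H) (Gs ((*\<^sub>R) s ` L) d (s ^ d * H))"
  using sub[OF L s, of d H] i by (intro bij_betw_byWitness[where f' = "(`) ((*\<^sub>R) (inverse s))"]) auto
 thus ?thesis by (metis bij_betw_same_card)
qed

text \<open>Scaling by \<open>K / gs bs ! 0\<close> makes all Gram--Schmidt norms at least 1 by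
  quasi-monotonicity. The main term and the leading error term are invariant under scaling, so only
  the secondary term records the factor.\<close>

theorem Est_scaled:
 fixes b G C c :: real
 assumes C: "\<And>(bs::'a::euclidean_space list) H. nb n K bs ==> 0 < H ==>
   cnt_err n d bs H <=
   C * (top_err n d b bs H) + c * H powr G"
  and K: "1 <= K" and d: "d <= n" "0 < n"
  and bs: "length bs = n" "bas (bs :: 'a list)" "qm K (gs bs)" and H: "0 < H"
 shows "cnt_err n d bs H <=
   C * (top_err n d b bs H) + c * ((K / gs bs ! 0) ^ d * H) powr G"
proof -
 let ?g = "gs bs ! 0"
 define s where "s = K / ?g"
 have g: "0 < ?g" using bas_nth_pos[OF bs(2), of 0] bs(1) d by simp
 have s: "0 < s" using g K by (simp add: s_def)
 define bs' where "bs' = map ((*\<^sub>R) s) bs"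
 have gs': "gs bs' = map ((*) s) (gs bs)" by (simp add: bs'_def gs_scale[OF s])
 have nb: "nb n K bs'"
 proof -
  have "1 <= s * gs bs ! i" if "i < n" for i
   using bs(1,3) that g by (simp add: s_def qm_def field_simps)
  hence "\<forall>x\<in>set (gs bs'). 1 <= x" using bs(1) by (auto simp: gs' in_set_conv_nth)
  moreover have "qm K (gs bs')" using bs(3) s by (auto simp: gs' qm_def mult.left_commute[of K])
  ultimately show ?thesis using bs bas_scale[OF s bs(2)] by (simp add: nb_def bs'_def)
 qed
 define D where "D = prod_list (drop (n - d) (gs bs))"
 let ?B = "\<lambda>H. (s ^ d * H) powr (real n - b) * (s ^ d * D) powr b / vol bs' ^ d"
 let ?A = "\<lambda>H bs. H powr (real n - b) * D powr b / vol bs ^ d"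
 have v: "0 < vol bs" by (rule vol_pos[OF bs(2)])
 have D: "0 < D" unfolding D_def by (rule prod_list_pos) (use bas_pos[OF bs(2)] in_set_dropD in metis)
 have v': "vol bs' = s ^ n * vol bs" using bs(1) by (simp add: vol_def gs' prod_list_scale)
 have D': "prod_list (drop (n - d) (gs bs')) = s ^ d * D" using bs(1) d by (simp add: gs' drop_map prod_list_scale D_def)
 have H': "0 < s ^ d * H" using s H by simp
 have cd: "card (Gs (zs bs') d (s ^ d * H)) = card (Gs (zs bs) d H)"
  unfolding bs'_def scale_zs[symmetric] by (rule Gs_scale[OF dsg_zs[OF bs(2)] s])
 have m: "(s ^ d * H) ^ n / vol bs' ^ d = H ^ n / vol bs ^ d"
  using s unfolding v' by (simp add: power_mult_distrib power_mult[symmetric] mult.commute)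
 have e: "?B H = ?A H bs"
 proof (rule ln_eqI)
  show "ln (?B H) = ln (?A H bs)"
   unfolding v' using s H D v by (simp add: ln_mult ln_div ln_powr ln_realpow algebra_simps)
 qed (use s H D v v' in auto)
 have "cnt_err n d bs H <=
   C * (?A H bs) + c * (s ^ d * H) powr G"
  using C[OF nb H'] unfolding cd m D' e .
 thus ?thesis unfolding s_def D_def .
qed

text \<open>The quotient of the determinants is an index, hence a positive integer.\<close>

lemma ldet_mono:
 assumes P: "dsg P" and M: "sgrp M" "M \<subseteq> P" "dim M = dim P"
 shows "ldet P <= ldet M"
proof -
 note i = index_count[OF P M]
 have "0 \<in> P" using sgrp_0[OF dsg_sgrp[OF P]] .
 hence "{(+) p ` M |p. p \<in> P} \<noteq> {}" by blast
 hence "0 < card {(+) p ` M |p. p \<in> P}" using i by (simp add: card_gt_0_iff)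
 hence "1 <= ldet M / ldet P" using i by linarith
 thus ?thesis using ldet_pos[OF P] by (simp add: le_divide_eq)
qed

section \<open>Covolumes\<close>

lemma sum_set_nth: "distinct xs ==> sum f (set xs) = (\<Sum>i<length xs. f (xs ! i))"
 using sum.reindex_bij_betw[OF bij_betw_nth[OF _ refl refl], of xs f] by simp

lemma zs_combI: "(\<Sum>i<length xs. of_int (c i) *\<^sub>R xs ! i) \<in> zs xs"
 by (intro sgrp_sum[OF sgrp_zs] sgrp_int[OF sgrp_zs] subsetD[OF set_sub_zs]) simp

lemma int_span_zs:
 assumes "distinct xs"
 shows "int_span (set xs) = zs xs"
proof
 show "int_span (set xs) \<subseteq> zs xs" unfolding int_span_def sum_set_nth[OF assms] by (rule subsetI) (elim CollectE exE conjE, simp only: zs_combI)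
 show "zs xs \<subseteq> int_span (set xs)"
 proof
  fix v assume "v \<in> zs xs"
  then obtain c :: "nat => int" where c: "v = (\<Sum>i<length xs. of_int (c i) *\<^sub>R xs ! i)" unfolding zs_comb by blast
  define c' where "c' b = c (inv_into {..<length xs} ((!) xs) b)" for b
  have "c' (xs ! i) = c i" if "i < length xs" for i
   using inv_into_f_f[OF inj_on_nth[OF assms], of "{..<length xs}" i] that by (simp add: c'_def)
  hence "v = (\<Sum>b\<in>set xs. of_int (c' b) *\<^sub>R b)" unfolding c sum_set_nth[OF assms] by (intro sum.cong) auto
  thus "v \<in> int_span (set xs)" unfolding int_span_def by blast
 qed
qed

lemma lattice_basis_list:
 assumes "is_lattice_basis B (M :: 'a::euclidean_space set)"
 obtains xs where "set xs = B" "distinct xs" "bas xs" "zs xs = M"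
proof -
 have B: "independent B" "M = int_span B" using assms by (auto simp: is_lattice_basis_def)
 obtain xs where xs: "set xs = B" "distinct xs" using finite_distinct_list[OF independent_imp_finite[OF B(1)]] by blast
 thus ?thesis using that[OF xs] bas_if_indep[of xs] B int_span_zs[OF xs(2)] by simp
qed

lemma is_lattice_iff: "is_lattice M \<longleftrightarrow> dsg (M :: 'a::euclidean_space set)"
proof
 assume "is_lattice M"
 thus "dsg M" unfolding is_lattice_def using lattice_basis_list dsg_zs by metis
next
 assume "dsg M"
 then obtain xs where xs: "bas xs" "zs xs = M" "length xs = dim M" using dsg_basis by metis
 hence "is_lattice_basis (set xs) M" using bas_indep[OF xs(1)] int_span_zs by (auto simp: is_lattice_basis_def)
 thus "is_lattice M" by (auto simp: is_lattice_def)
qed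

text \<open>Coordinates with respect to \<open>xs\<close> are inner products with the dual basis; in
  this form measurability and translation by lattice points are easy to express.\<close>

lemma parallelepiped_dual:
 assumes xs: "bas (xs :: 'a::euclidean_space list)"
 shows "fundamental_parallelepiped (set xs) = {v \<in> span (set xs). \<forall>i<length xs. 0 <= v \<bullet> du xs ! i \<and> v \<bullet> du xs ! i < 1}" (is "_ = ?R")
proof
 let ?A = "\<lambda>set xs. fundamental_parallelepiped (set xs)"
 have d: "distinct xs" using bas_indep[OF xs] by simp
 have F: "?A set xs = {\<Sum>i<length xs. c (xs ! i) *\<^sub>R xs ! i | c. \<forall>b\<in>set xs. 0 <= c b \<and> c b < 1}"
  unfolding fundamental_parallelepiped_def sum_set_nth[OF d] ..
 show "?A set xs \<subseteq> ?R"
 proof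
  fix v assume "v \<in> ?A set xs"
  then obtain c where c: "v = (\<Sum>i<length xs. c (xs ! i) *\<^sub>R xs ! i)" "\<forall>b\<in>set xs. 0 <= c b \<and> c b < 1" unfolding F by blast
  have "v \<bullet> du xs ! i = c (xs ! i)" if i: "i < length xs" for i
  proof -
   have "v \<bullet> du xs ! i = (\<Sum>j<length xs. if j = i then c (xs ! i) else 0)"
    unfolding c(1) inner_sum_left by (intro sum.cong) (use i du_inner[OF xs i] in \<open>auto simp: inner_commute\<close>)
   thus ?thesis using i by simp
  qed
  moreover have "v \<in> span (set xs)" unfolding c(1) by (intro span_sum span_scale span_base) simp
  ultimately show "v \<in> ?R" using c(2) by simp
 qed
 show "?R \<subseteq> ?A set xs"
 proof
  fix v assume v: "v \<in> ?R"
  define c where "c b = v \<bullet> du xs ! inv_into {..<length xs} ((!) xs) b" for b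
  have c: "c (xs ! i) = v \<bullet> du xs ! i" if "i < length xs" for i
   using inv_into_f_f[OF inj_on_nth[OF d], of "{..<length xs}" i] that by (simp add: c_def)
  have "v = (\<Sum>i<length xs. (v \<bullet> du xs ! i) *\<^sub>R xs ! i)" using v by (intro du_coords[OF xs]) simp
  also have "\<dots> = (\<Sum>i<length xs. c (xs ! i) *\<^sub>R xs ! i)" using c by (intro sum.cong) auto
  finally have "v = (\<Sum>i<length xs. c (xs ! i) *\<^sub>R xs ! i)" .
  moreover have "\<forall>b\<in>set xs. 0 <= c b \<and> c b < 1" using v c by (auto simp: in_set_conv_nth)
  ultimately show "v \<in> ?A set xs" unfolding F by blast
 qed
qed

lemma PiM_lborel_translate:
 fixes c :: "'i => real"
 assumes E: "finite E" and A: "A \<in> sets (PiM E (\<lambda>_. lborel :: real measure))"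
 shows "emeasure (PiM E (\<lambda>_. lborel)) ((\<lambda>x. \<lambda>e\<in>E. x e + c e) -` A \<inter> space (PiM E (\<lambda>_. lborel))) = emeasure (PiM E (\<lambda>_. lborel)) A"
proof -
 let ?P = "PiM E (\<lambda>_. lborel :: real measure)" and ?t = "\<lambda>x. \<lambda>e\<in>E. x e + c e"
 let ?B = "distr ?P ?P ?t"
 interpret product_sigma_finite "\<lambda>_::'i. lborel :: real measure" by standard
 have m: "?t \<in> measurable ?P ?P"
  by (intro measurable_restrict borel_measurable_add) auto
 have "?B = ?P"
 proof (rule PiM_eqI[OF E])
  fix B :: "'i => real set" assume B: "\<And>i. i \<in> E ==> B i \<in> sets lborel"
  let ?A = "\<lambda>e. (+) (c e) -` B e"
  have BE: "Pi\<^sub>E E B \<in> sets ?P" using B E by (intro sets_PiM_I_finite) auto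
  have "?t -` Pi\<^sub>E E B \<inter> space ?P = Pi\<^sub>E E (\<lambda>e. ?A e)"
   by (auto simp: space_PiM PiE_def Pi_def extensional_def add.commute)
  hence "emeasure ?B (Pi\<^sub>E E B) = emeasure ?P (Pi\<^sub>E E (\<lambda>e. ?A e))"
   using emeasure_distr[OF m BE] by simp
  also have "\<dots> = (\<Prod>e\<in>E. emeasure lborel (?A e))"
  proof (rule emeasure_PiM[OF E])
   fix e assume "e \<in> E"
   have "(+) (c e) \<in> measurable lborel lborel" by (simp add: measurable_lborel1)
   from measurable_sets[OF this B[OF \<open>e \<in> E\<close>]] show "?A e \<in> sets lborel" by simp
  qed
  also have "\<dots> = (\<Prod>e\<in>E. emeasure lborel (B e))"
  proof (rule prod.cong[OF refl])
   fix e assume e: "e \<in> E"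
   have "emeasure lborel (B e) = emeasure (distr lborel borel ((+) (c e))) (B e)" by (simp add: lborel_distr_plus)
   also have "\<dots> = emeasure lborel (?A e)" using B[OF e] by (subst emeasure_distr) auto
   finally show "emeasure lborel (?A e) = emeasure lborel (B e)" ..
  qed
  finally show "emeasure ?B (Pi\<^sub>E E B) = (\<Prod>i\<in>E. emeasure lborel (B i))" .
 qed simp
 thus ?thesis using emeasure_distr[OF m A] by simp
qed

text \<open>Translates of the fundamental domain by the lattice points in a large ball tile that ball up to its
 boundary, so the asymptotic count of lattice points determines the volume of the domain.\<close>

theorem parallelepiped_volume:
 fixes E :: "'a::euclidean_space set"
 assumes E: "pairwise orthogonal E" "\<forall>e\<in>E. norm e = 1" "span E = span (set xs)" and xs: "bas xs"
 shows "measure (PiM E (\<lambda>_. lborel :: real measure)) {x \<in> E \<rightarrow>\<^sub>E UNIV. (\<Sum>e\<in>E. x e *\<^sub>R e) \<in> fundamental_parallelepiped (set xs)} = vol xs"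
proof -
 let ?I = "\<lambda>E x. \<Sum>e\<in>E. (x e)\<^sup>2"
 let ?P = "PiM E (\<lambda>_. lborel :: real measure)" and ?r = "length xs"
 define T where "T x = (\<Sum>e\<in>E. x e *\<^sub>R e)" for x :: "'a => real"
 let ?C = "\<lambda>v. T (\<lambda>e. v \<bullet> e)"
 define D where "D i = du xs ! i" for i
 let ?H = "\<lambda>m i. m \<bullet> D i"
 let ?G = "\<lambda>v i. v \<bullet> D i"
 have "0 \<notin> E" using E(2) by force
 hence indE: "independent E" by (rule pairwise_orthogonal_independent[OF E(1)])
 have fE: "finite E" by (rule independent_imp_finite[OF indE])
 have "card E = dim (span (set xs))" using dim_span_eq_card_independent[OF indE] E(3) by simp
 also have "\<dots> = ?r" using bas_iff_dim[of xs] xs by simp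
 finally have cE: "card E = ?r" .
 have ee: "e \<bullet> f = (if e = f then 1 else 0)" if "e \<in> E" "f \<in> E" for e f
  using E(1,2) that by (auto simp: pairwise_def orthogonal_def dot_square_norm)
 have Te: "T x \<bullet> e = x e" if e: "e \<in> E" for x e
 proof -
  have "T x \<bullet> e = (\<Sum>f\<in>E. if f = e then x e else 0)" unfolding T_def inner_sum_left using ee e by (intro sum.cong) auto
  thus ?thesis using e fE by simp
 qed
 have nT: "norm (T x) = sqrt (?I E x)" for x
 proof -
  have "T x \<bullet> T x = (\<Sum>e\<in>E. x e * (T x \<bullet> e))" by (subst (2) T_def) (simp add: inner_sum_right)
  also have "\<dots> = (?I E x)" using Te by (intro sum.cong) (auto simp: power2_eq_square)
  finally show ?thesis by (simp add: norm_eq_sqrt_inner)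
 qed
 have Tspan: "T x \<in> span (set xs)" for x unfolding E(3)[symmetric] T_def by (intro span_sum span_scale span_base)
 have Tm: "?C v = v" if v: "v \<in> span (set xs)" for v
 proof -
  have "(v - ?C v) \<bullet> e = 0" if "e \<in> E" for e using Te[OF that] by (simp add: inner_diff_left)
  moreover have "v - ?C v \<in> span E" using v Tspan E(3) by (simp add: span_diff)
  ultimately have "v - ?C v = 0" using span_orth_0 by blast
  thus ?thesis by simp
 qed
 define Q where "Q v \<longleftrightarrow> (\<forall>i<?r. 0 <= ?G v i \<and> ?G v i < 1)" for v
 define F where "F m = {x \<in> space ?P. Q (T x - m)}" for m
 let ?D = "emeasure ?P (F 0)"
 have FP: "{x \<in> E \<rightarrow>\<^sub>E UNIV. (\<Sum>e\<in>E. x e *\<^sub>R e) \<in> fundamental_parallelepiped (set xs)} = F 0"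
  unfolding parallelepiped_dual[OF xs] F_def Q_def D_def using Tspan by (auto simp: space_PiM T_def)
 have FM: "F m \<in> sets ?P" for m
 proof -
  let ?A = "\<lambda>x i. (\<Sum>e\<in>E. x e * (e \<bullet> D i)) - ?H m i"
  have "(T x - m) \<bullet> D i = ?A x i" for x i
   by (simp add: T_def inner_diff_left inner_sum_left)
  hence "F m = {x \<in> space ?P. \<forall>i\<in>{..<?r}. 0 <= ?A x i \<and> ?A x i < 1}"
   by (auto simp: F_def Q_def)
  also have "\<dots> \<in> sets ?P" by measurable
  finally show ?thesis .
 qed
 have Feq: "emeasure ?P (F m) = ?D" if m: "m \<in> span (set xs)" for m
 proof -
  let ?t = "\<lambda>x. \<lambda>e\<in>E. x e + (- (m \<bullet> e))"
  have "T (?t x) = T x - m" for x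
  proof -
   have "T (?t x) = T x - T (\<lambda>e. m \<bullet> e)" unfolding T_def by (simp add: scaleR_diff_left sum_subtractf)
   thus ?thesis using Tm[OF m] by simp
  qed
  hence "F m = ?t -` F 0 \<inter> space ?P" by (auto simp: F_def space_PiM)
  thus ?thesis using PiM_lborel_translate[OF fE FM[of 0], of "\<lambda>e. - (m \<bullet> e)"] by simp
 qed
 \<comment> \<open>The domain lies in the ball of radius \<open>s\<close>, so the tiling by lattice
   points of norm at most \<open>y\<close> contains the ball of radius \<open>y - s\<close> and is
   contained in that of radius \<open>y + s\<close>.\<close>
 define s where "s = (\<Sum>i<?r. norm (xs ! i))"
 have s0: "0 <= s" by (simp add: s_def sum_nonneg)
 have Qs: "norm v <= s" if v: "v \<in> span (set xs)" "Q v" for v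
 proof -
  have "norm v = norm (\<Sum>i<?r. (?G v i) *\<^sub>R xs ! i)" using du_coords[OF xs v(1)] by (simp add: D_def)
  also have "\<dots> <= s" unfolding s_def
  proof (intro order_trans[OF norm_sum] sum_mono)
   fix i assume "i \<in> {..<?r}"
   hence "\<bar>?G v i\<bar> <= 1" using v(2) by (auto simp: Q_def)
   thus "norm ((?G v i) *\<^sub>R xs ! i) <= norm (xs ! i)" using mult_right_mono[of "\<bar>?G v i\<bar>" 1 "norm (xs ! i)"] by simp
  qed
  finally show ?thesis .
 qed
 have zsp: "m \<in> span (set xs)" if "m \<in> zs xs" for m using that span_zs[of xs] span_base by blast
 have disj: "F m \<inter> F m' = {}" if m: "m \<in> zs xs" "m' \<in> zs xs" "m \<noteq> m'" for m m'
 proof (rule ccontr)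
  assume "F m \<inter> F m' \<noteq> {}"
  then obtain x where x: "Q (T x - m)" "Q (T x - m')" by (auto simp: F_def)
  have "?H m i = m' \<bullet> D i" if i: "i < ?r" for i
  proof -
   let ?F = "T x \<bullet> D i"
   obtain c c' :: int where c: "?H m i = c" "m' \<bullet> D i = c'" using m i zs_iff_du[OF xs] unfolding D_def by meson
   have "0 <= ?F - c" "?F - c < 1" "0 <= ?F - c'" "?F - c' < 1"
    using x i c by (auto simp: Q_def inner_diff_left)
   hence "c = c'" by linarith
   thus ?thesis using c by simp
  qed
  hence "(\<Sum>i<?r. (?H m i) *\<^sub>R xs ! i) = (\<Sum>i<?r. (m' \<bullet> D i) *\<^sub>R xs ! i)" by (intro sum.cong) auto
  thus False using du_coords[OF xs zsp[OF m(1)]] du_coords[OF xs zsp[OF m(2)]] m(3) by (simp add: D_def)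
 qed
 have tile: "\<exists>m\<in>zs xs. Q (T x - m)" for x
 proof -
  define m where "m = (\<Sum>i<?r. of_int \<lfloor>T x \<bullet> D i\<rfloor> *\<^sub>R xs ! i)"
  have "m \<in> zs xs" unfolding m_def by (rule zs_combI)
  moreover have "?H m i = of_int \<lfloor>T x \<bullet> D i\<rfloor>" if i: "i < ?r" for i
  proof -
   have "?H m i = (\<Sum>j<?r. if j = i then of_int \<lfloor>T x \<bullet> D i\<rfloor> else 0)"
    unfolding m_def inner_sum_left by (intro sum.cong) (use i du_inner[OF xs i] in \<open>auto simp: inner_commute D_def\<close>)
   thus ?thesis using i by simp
  qed
  hence "Q (T x - m)" unfolding Q_def by (auto simp: inner_diff_left) linarith
  ultimately show ?thesis by blast
 qed
 let ?E = "\<lambda>zs (y::real). \<Union>m\<in>zs xs \<inter> cball 0 y. F m"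
 define N where "N y = card (zs xs \<inter> cball 0 y)" for y
 let ?B = "\<lambda>y. {f. sqrt (\<Sum>e\<in>E. (f e)\<^sup>2) <= y} \<inter> space ?P"
 have BM: "?B y \<in> sets ?P" for y
 proof -
  have "?B y = {f \<in> space ?P. sqrt (\<Sum>e\<in>E. (f e)\<^sup>2) <= y}" by auto
  also have "\<dots> \<in> sets ?P" by measurable
  finally show ?thesis .
 qed
 have eB: "emeasure ?P (?B y) = ennreal (unit_ball_vol ?r * y ^ ?r)" if "0 < y" for y
  using emeasure_cball_aux[OF fE that] cE by simp
 have eU: "emeasure ?P (?E zs y) = of_nat (N y) * ?D" for y
 proof -
  have "emeasure ?P (?E zs y) = (\<Sum>m\<in>zs xs \<inter> cball 0 y. emeasure ?P (F m))"
   using FM disj zs_finite[OF xs] by (intro sum_emeasure[symmetric]) (auto simp: disjoint_family_on_def)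
  also have "\<dots> = (\<Sum>m\<in>zs xs \<inter> cball 0 y. ?D)" using Feq zsp by (intro sum.cong) auto
  finally show ?thesis by (simp add: N_def)
 qed
 have up: "of_nat (N y) * ?D <= ennreal (unit_ball_vol ?r * (y + s) ^ ?r)" if y: "0 < y" for y
 proof -
  have "(?E zs y) \<subseteq> ?B (y + s)"
  proof safe
   fix m x assume m: "m \<in> zs xs" "m \<in> cball 0 y" "x \<in> F m"
   have "norm (T x - m) <= s" using m zsp[OF m(1)] Tspan by (intro Qs span_diff) (auto simp: F_def)
   hence "norm (T x) <= y + s" using m(2) norm_triangle_ineq[of "T x - m" m] by simp
   thus "sqrt (?I E x) <= y + s" "x \<in> space ?P" using m(3) by (auto simp: nT F_def)
  qed
  from emeasure_mono[OF this BM] show ?thesis unfolding eU using eB[of "y + s"] y s0 by simp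
 qed
 have lo: "ennreal (unit_ball_vol ?r * (y - s) ^ ?r) <= of_nat (N y) * emeasure ?P (F 0)" if y: "s < y" for y
 proof -
  have "?B (y - s) \<subseteq> (\<Union>m\<in>zs xs \<inter> cball 0 y. F m)"
  proof
   fix x assume "x \<in> ?B (y - s)"
   hence x: "x \<in> space ?P" "norm (T x) <= y - s" by (auto simp: nT)
   obtain m where m: "m \<in> zs xs" "Q (T x - m)" using tile by blast
   have "norm (T x - m) <= s" using m zsp[OF m(1)] Tspan by (intro Qs span_diff) auto
   hence "norm m <= y" using x(2) norm_triangle_ineq4[of "T x" "T x - m"] by simp
   thus "x \<in> (\<Union>m\<in>zs xs \<inter> cball 0 y. F m)" using m x by (auto simp: F_def)
  qed
  from emeasure_mono[OF this] have "emeasure ?P (?B (y - s)) <= of_nat (N y) * emeasure ?P (F 0)"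
   unfolding eU[symmetric] using FM zs_finite[OF xs] by (metis (no_types, lifting) sets.finite_UN)
  thus ?thesis using eB[of "y - s"] y by simp
 qed
 have N1: "0 < N y" if "0 < y" for y
  unfolding N_def using zs_finite[OF xs, of y] sgrp_0[OF sgrp_zs[of xs]] that by (auto simp: card_gt_0_iff)
 \<comment> \<open>Finiteness of the measure, without which the two enclosing bounds could not be
   read as inequalities between real numbers.\<close>
 have "emeasure ?P (F 0) <= of_nat (N 1) * emeasure ?P (F 0)" using N1[of 1] by (cases "N 1") (auto simp: distrib_right)
 also have "\<dots> < \<infinity>" using up[of 1] by (simp add: le_less_trans[OF _ ennreal_less_top])
 finally obtain u where u: "0 <= u" "emeasure ?P (F 0) = ennreal u" by (cases "emeasure ?P (F 0)") auto
 have NU: "of_nat (N y) * emeasure ?P (F 0) = ennreal (N y * u)" for y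
  unfolding u(2) ennreal_of_nat_eq_real_of_nat by (rule ennreal_mult[symmetric]) (use u in auto)
 have V: "0 < unit_ball_vol ?r" by simp
 have up': "N y * u <= unit_ball_vol ?r * (y + s) ^ ?r" if "0 < y" for y
  using up[OF that] that s0 V unfolding NU by (subst (asm) ennreal_le_iff) (auto intro!: mult_nonneg_nonneg)
 have lo': "unit_ball_vol ?r * (y - s) ^ ?r <= N y * u" if "s < y" for y
  using lo[OF that] u(1) unfolding NU by (subst (asm) ennreal_le_iff) auto
 have lim: "((\<lambda>y. N y / y ^ ?r * u) \<longlongrightarrow> unit_ball_vol ?r / vol xs * u) at_top"
  unfolding N_def by (intro tendsto_mult tendsto_const zs_lim[OF xs])
 have lp: "((\<lambda>y. unit_ball_vol ?r * ((y + c) / y) ^ ?r) \<longlongrightarrow> unit_ball_vol ?r * 1 ^ ?r) at_top" for c :: real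
 proof (intro tendsto_mult tendsto_const tendsto_power)
  have "((\<lambda>y. 1 + c / y) \<longlongrightarrow> 1 + 0) at_top"
   by (intro tendsto_add tendsto_const tendsto_divide_0[OF tendsto_const] filterlim_at_top_imp_at_infinity filterlim_ident)
  moreover have "\<forall>\<^sub>F y in at_top. 1 + c / y = (y + c) / y"
   using eventually_gt_at_top[of 0] by eventually_elim (simp add: add_divide_distrib)
  ultimately show "((\<lambda>y. (y + c) / y) \<longlongrightarrow> 1) at_top" using Lim_transform_eventually by fastforce
 qed
 have "unit_ball_vol ?r / vol xs * u <= unit_ball_vol ?r * 1 ^ ?r"
 proof (rule tendsto_le[OF _ lp[of s] lim])
  show "\<forall>\<^sub>F y in at_top. N y / y ^ ?r * u <= unit_ball_vol ?r * ((y + s) / y) ^ ?r"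
   using eventually_gt_at_top[of 0]
  proof eventually_elim
   case (elim y)
   thus ?case using divide_right_mono[OF up'[OF elim], of "y ^ ?r"] by (simp add: power_divide)
  qed
 qed simp
 moreover have "unit_ball_vol ?r * 1 ^ ?r <= unit_ball_vol ?r / vol xs * u"
 proof (rule tendsto_le[OF _ lim lp[of "- s"]])
  show "\<forall>\<^sub>F y in at_top. unit_ball_vol ?r * ((y + - s) / y) ^ ?r <= N y / y ^ ?r * u"
   using eventually_gt_at_top[of s]
  proof eventually_elim
   case (elim y)
   hence "0 <= y ^ ?r" using s0 by simp
   thus ?case using divide_right_mono[OF lo'[OF elim], of "y ^ ?r"] by (simp add: power_divide)
  qed
 qed simp
 ultimately have "unit_ball_vol ?r / vol xs * u = unit_ball_vol ?r" by simp
 hence "u = vol xs" using V vol_pos[OF xs] by (simp add: field_simps)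
 thus ?thesis unfolding FP measure_def u(2) using u(1) by simp
qed

theorem covolume_ldet:
 assumes M: "dsg (M :: 'a::euclidean_space set)"
 shows "covolume M = ldet M"
proof -
 define B where "B = (SOME B. is_lattice_basis B M)"
 have "is_lattice_basis B M" unfolding B_def using M someI_ex[of "\<lambda>B. is_lattice_basis B M"] by (simp add: is_lattice_iff[symmetric] is_lattice_def)
 then obtain xs where xs: "set xs = B" "distinct xs" "bas xs" "zs xs = M" by (rule lattice_basis_list)
 define E where "E = (SOME E. pairwise orthogonal E \<and> (\<forall>e\<in>E. norm e = 1) \<and> span E = span M)"
 obtain E' where "pairwise orthogonal E'" "\<And>x. x \<in> E' ==> norm x = 1" "span E' = span M"
  using orthonormal_basis_subspace[OF subspace_span[of M]] by metis
 hence "\<exists>E. pairwise orthogonal E \<and> (\<forall>e\<in>E. norm e = 1) \<and> span E = span M" by blast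
 from someI_ex[OF this] have E: "pairwise orthogonal E" "\<forall>e\<in>E. norm e = 1" "span E = span (set xs)"
  using xs(4) span_zs[of xs] by (auto simp: E_def[symmetric])
 show ?thesis unfolding covolume_def subspace_volume_def B_def[symmetric] E_def[symmetric] Let_def
  using parallelepiped_volume[OF E xs(3)] ldet_zs[OF xs(3)] xs(1,4) by simp
qed

lemma num_sublattices_Gs:
 assumes "dsg L"
 shows "num_sublattices L d H = card (Gs L d H)"
proof -
 have "{M. is_lattice M \<and> M \<subseteq> L \<and> dim (span M) = d \<and> covolume M <= H} = Gs L d H"
  using covolume_ldet dsg_sub[OF assms] dsg_sgrp by (auto simp: Gs_def is_lattice_iff dim_span)
 thus ?thesis by (simp add: num_sublattices_def)
qed

section \<open>Successive minima and flags\<close>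

lemma bas_take: "bas xs ==> bas (take i xs)"
 using bas_append[of "take i xs" "drop i xs"] by simp

text \<open>The first \<open>i\<close> vectors of a reduced basis lie in the ball of this radius:
  each is bounded by a sum of at most \<open>n\<close> Gram--Schmidt norms, and each of these is at
  most \<open>2 ^ n\<close> times the one with index \<open>i - 1\<close>.\<close>

lemma succ_min_le:
 assumes L: "dsg (L :: 'a::euclidean_space set)" and n: "dim L = n" and i: "1 <= i" "i <= n"
 shows "succ_min L i <= real n * 2 ^ n * gs (rb L) ! (i - 1)"
proof -
 define bs where "bs = rb L"
 let ?A = "gs bs ! (i - 1)"
 have bs: "red bs" "bas bs" "zs bs = L" "length bs = n" "qm (2 ^ n) (gs bs)"
  using rb[OF L] rb_bas[OF L] rb_length[OF L] n red_qm[of "rb L"] by (auto simp: bs_def)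
 let ?r = "real n * 2 ^ n * ?A"
 let ?B = "L \<inter> cball 0 ?r"
 have g: "0 < ?A" using bas_nth_pos[OF bs(2)] bs(4) i by simp
 have nm: "norm (bs ! j) <= ?r" if j: "j < i" for j
 proof -
  have "norm (bs ! j) <= (\<Sum>l\<le>j. gs bs ! l)" using bs(1,4) j i by (auto simp: red_def)
  also have "\<dots> <= (\<Sum>l\<le>j. 2 ^ n * ?A)" using bs(4,5) j i by (intro sum_mono) (auto simp: qm_def)
  also have "\<dots> = real (Suc j) * (2 ^ n * ?A)" by simp
  also have "\<dots> <= real n * (2 ^ n * ?A)" using j i g by (intro mult_right_mono) auto
  finally show ?thesis by simp
 qed
 have sub: "set (take i bs) \<subseteq> ?B"
 proof
  fix x assume "x \<in> set (take i bs)"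
  then obtain j where j: "j < i" "j < n" "x = bs ! j" using bs(4) by (auto simp: in_set_conv_nth)
  hence "x \<in> L" using set_sub_zs[of bs] bs(3,4) nth_mem by blast
  thus "x \<in> ?B" using nm[OF j(1)] j(3) by simp
 qed
 have "i = dim (set (take i bs))" using bas_take[OF bs(2), of i] bas_iff_dim[of "take i bs"] bs(4) i by simp
 also have "\<dots> <= dim (span ?B)" using dim_subset[OF sub] by (simp add: dim_span)
 finally have m: "?r \<in> {r. 0 < r \<and> i <= dim (span (L \<inter> cball 0 r))}" using g i by simp
 have "bdd_below {r. 0 < r \<and> i <= dim (span (L \<inter> cball 0 r))}" by (intro bdd_belowI[of _ 0]) auto
 from cInf_lower[OF m this] show ?thesis by (simp add: succ_min_def bs_def)
qed

text \<open>The vectors \<open>v j\<close> generate a subgroup of full rank in the flag lattice, and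
  its determinant is at most the product of their norms by Hadamard's inequality.\<close>

lemma flag_facts:
 assumes L: "dsg (L :: 'a::euclidean_space set)" and v: "\<And>j. j \<in> {1..n} ==> v j \<in> L" "inj_on v {1..n}" "independent (v ` {1..n})" and i: "i <= n"
 shows "dsg (flag_lattice L v i)" "dim (flag_lattice L v i) = i" "ldet (flag_lattice L v i) <= (\<Prod>j=1..i. norm (v j))"
proof -
 let ?M = "flag_lattice L v i"
 define ws where "ws = map v [1..<Suc i]"
 have sub: "{1..i} \<subseteq> {1..n}" using i by auto
 have ws: "set ws = v ` {1..i}" "length ws = i" by (auto simp: ws_def atLeastLessThanSuc_atLeastAtMost simp del: upt_Suc)
 have "distinct ws" unfolding ws_def using inj_on_subset[OF v(2) sub] by (simp add: distinct_map atLeastLessThanSuc_atLeastAtMost del: upt_Suc)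
 moreover have "independent (set ws)" unfolding ws(1) using independent_mono[OF v(3)] sub by blast
 ultimately have b: "bas ws" by (rule bas_if_indep[rotated])
 show d: "dsg ?M" unfolding flag_lattice_def by (rule dsg_sub[OF L]) (auto intro: sgrp_Int dsg_sgrp[OF L])
 have sw: "zs ws \<subseteq> ?M"
 proof (rule zs_least[OF dsg_sgrp[OF d]])
  show "set ws \<subseteq> ?M" unfolding ws(1) flag_lattice_def using v(1) sub by (auto intro: span_base)
 qed
 have "span ?M = span (zs ws)"
 proof (rule subset_antisym[OF span_minimal span_mono[OF sw]])
  show "?M \<subseteq> span (zs ws)" unfolding span_zs ws(1) flag_lattice_def by blast
 qed simp
 hence dd: "dim (zs ws) = dim ?M" by (metis dim_span)
 thus "dim ?M = i" using dim_zs[OF b] ws(2) by simp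
 have "ldet ?M <= ldet (zs ws)" by (rule ldet_mono[OF d sgrp_zs sw dd])
 also have "\<dots> = (\<Prod>j<i. gs ws ! j)" unfolding ldet_zs[OF b] using ws(2) by (simp add: vol_def prod_list_nth)
 also have "\<dots> <= (\<Prod>j<i. norm (ws ! j))"
  using gs_le_norm[of _ ws] bas_nth_pos[OF b] ws(2) by (intro prod_mono) (auto intro: less_imp_le)
 also have "\<dots> = (\<Prod>j<i. norm (v (Suc j)))" by (intro prod.cong) (auto simp: ws_def simp del: upt_Suc)
 also have "\<dots> = (\<Prod>j=1..i. norm (v j))" using prod.atLeast1_atMost_eq[of "\<lambda>j. norm (v j)" i] by simp
 finally show "ldet ?M <= (\<Prod>j=1..i. norm (v j))" .
qed

text \<open>The covolumes of the flag are compared with Gram--Schmidt norms from above only. This is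
  the direction needed, since they enter the error terms with nonpositive exponents.\<close>

lemma minimal_facts:
 fixes L :: "(real ^ 'n) set"
 assumes L: "is_full_lattice L" and v: "minimal_vectors L v"
 shows "dsg L" "dim L = CARD('n)" "covolume L = ldet L" "0 < covolume L" "flag_lattice L v CARD('n) = L"
  "\<And>i. i <= CARD('n) ==> dsg (flag_lattice L v i)" "\<And>i. i <= CARD('n) ==> dim (flag_lattice L v i) = i"
  "\<And>i. i <= CARD('n) ==> 0 < covolume (flag_lattice L v i)"
  "\<And>i. i <= CARD('n) ==> covolume (flag_lattice L v i) <= (real CARD('n) * 2 ^ CARD('n)) ^ i * (\<Prod>j<i. gs (rb L) ! j)"
proof -
 let ?A = "\<lambda>i. flag_lattice L v i"
 let ?n = "CARD('n)"
 let ?B = "real ?n * 2 ^ ?n"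
 have sp: "is_lattice L" "span L = UNIV" using L by (auto simp: is_full_lattice_def)
 show d: "dsg L" using sp is_lattice_iff by blast
 have "dim L = dim (span L)" by (simp add: dim_span)
 thus dn: "dim L = ?n" unfolding sp(2) by simp
 show "covolume L = ldet L" by (rule covolume_ldet[OF d])
 thus "0 < covolume L" using ldet_pos[OF d] by simp
 have v': "\<And>j. j \<in> {1..?n} ==> v j \<in> L" "\<And>j. j \<in> {1..?n} ==> norm (v j) = succ_min L j" "inj_on v {1..?n}" "independent (v ` {1..?n})"
  using v by (auto simp: minimal_vectors_def)
 have ff: "dsg (?A i)" "dim (?A i) = i" "ldet (?A i) <= (\<Prod>j=1..i. norm (v j))" if "i <= ?n" for i
  using flag_facts[OF d v'(1,3,4) that] by blast+
 show "dsg (?A i)" "dim (?A i) = i" if "i <= ?n" for i using ff[OF that] by blast+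
 show "0 < covolume (?A i)" if "i <= ?n" for i using covolume_ldet[OF ff(1)[OF that]] ldet_pos[OF ff(1)[OF that]] by simp
 have "card (v ` {1..?n}) = ?n" using card_image[OF v'(3)] by simp
 hence "dim (span (v ` {1..?n})) = dim (UNIV :: (real ^ 'n) set)" using dim_span_eq_card_independent[OF v'(4)] by simp
 hence "span (v ` {1..?n}) = UNIV" by (intro subspace_dim_equal[OF subspace_span subspace_UNIV]) (simp_all only: subset_UNIV order_refl)
 thus "flag_lattice L v ?n = L" by (simp add: flag_lattice_def)
 show "covolume (?A i) <= ?B ^ i * (\<Prod>j<i. gs (rb L) ! j)" if i: "i <= ?n" for i
 proof -
  have "covolume (?A i) <= (\<Prod>j=1..i. norm (v j))" using covolume_ldet[OF ff(1)[OF i]] ff(3)[OF i] by simp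
  also have "\<dots> <= (\<Prod>j=1..i. ?B * gs (rb L) ! (j - 1))"
   using v'(2) succ_min_le[OF d dn] i by (intro prod_mono) (auto simp flip: v'(2))
  also have "\<dots> = (\<Prod>j<i. ?B * gs (rb L) ! j)"
   using prod.atLeast1_atMost_eq[of "\<lambda>j. ?B * gs (rb L) ! (j - 1)" i] by simp
  finally show ?thesis by (simp add: prod.distrib)
 qed
qed

text \<open>The identity for the sum of \<open>real i * h j i\<close> in
  \<open>exponent_system\<close> makes the powers of \<open>t\<close> cancel.\<close>

lemma scale_invariance:
 fixes L :: "(real ^ 'n) set"
 assumes E: "exponent_system CARD('n) d F g h" and L: "is_full_lattice L" "minimal_vectors L v" and H: "0 < H" and t: "0 < t"
 shows "main_term d ((\<lambda>x. t *\<^sub>R x) ` L) (t ^ d * H) = main_term d L H"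
  "error_sum F g h ((\<lambda>x. t *\<^sub>R x) ` L) (\<lambda>i. t *\<^sub>R v i) (t ^ d * H) = error_sum F g h L v H"
proof -
 let ?G = "(*\<^sub>R) t :: real ^ 'n => real ^ 'n"
 let ?B = "\<lambda>i. t *\<^sub>R v i"
 let ?A = "(\<lambda>x. t *\<^sub>R x) ` L"
 let ?n = "CARD('n)"
 note mf = minimal_facts[OF L]
 have "covolume (?G ` L) = t ^ ?n * covolume L"
  using covolume_ldet[OF ldet_scale(1)[OF mf(1) t]] ldet_scale(3)[OF mf(1) t] mf(2,3) by simp
 thus "main_term d ?A (t ^ d * H) = main_term d L H"
  using t by (simp add: main_term_def power_mult_distrib power_mult[symmetric] mult.commute)
 have fl: "flag_lattice ?A ?B i = ?G ` flag_lattice L v i" for i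
 proof -
  have "?B ` {1..i} = ?G ` v ` {1..i}" by (auto simp: image_image)
  hence s: "span (?B ` {1..i}) = ?G ` span (v ` {1..i})" by (simp add: span_linear_image[OF linear_scale_map])
  have "inj ?G" using t by (intro injI) simp
  thus ?thesis unfolding flag_lattice_def s by (simp add: image_Int)
 qed
 have cv: "covolume (flag_lattice ?A ?B i) = t ^ i * covolume (flag_lattice L v i)" if "i <= ?n" for i
  unfolding fl using covolume_ldet[OF ldet_scale(1)[OF mf(6)[OF that] t]] ldet_scale(3)[OF mf(6)[OF that] t] mf(7)[OF that] covolume_ldet[OF mf(6)[OF that]] by simp
 show "error_sum F g h ?A ?B (t ^ d * H) = error_sum F g h L v H"
  unfolding error_sum_def
 proof (rule sum.cong[OF refl])
  fix j assume j: "j \<in> F"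
  let ?F = "b_coeff (h j) ?A ?B"
  let ?E = "b_coeff (h j) L v"
  let ?D = "\<lambda>i. t powr (- (real i * h j i)) * covolume (flag_lattice L v i) powr (- h j i)"
  let ?C = "real d * g j"
  have s: "(\<Sum>i=1..?n. real i * h j i) = ?C" using E j by (auto simp: exponent_system_def)
  have "?F = (\<Prod>i=1..?n. ?D i)"
   unfolding b_coeff_def
  proof (rule prod.cong[OF refl])
   fix i assume "i \<in> {1..?n}"
   hence i: "i <= ?n" by simp
   show "covolume (flag_lattice ?A ?B i) powr - h j i = ?D i"
    unfolding cv[OF i] powr_mult powr_realpow[OF t, symmetric] powr_powr by simp
  qed
  also have "\<dots> = t powr (\<Sum>i=1..?n. - (real i * h j i)) * ?E"
   unfolding prod.distrib b_coeff_def using t by (subst powr_sum) auto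
  also have "\<dots> = t powr (- ?C) * ?E" by (simp only: sum_negf s)
  finally have b: "?F = t powr (- ?C) * ?E" .
  have "(t ^ d * H) powr g j = t powr ?C * H powr g j"
   unfolding powr_mult powr_realpow[OF t, symmetric] powr_powr ..
  moreover have "t powr (- ?C) * t powr ?C = 1" unfolding powr_add[symmetric] using t by simp
  ultimately show "?F * (t ^ d * H) powr g j = ?E * H powr g j"
   unfolding b by (metis (no_types, opaque_lifting) mult.assoc mult.commute mult.left_neutral)
 qed
qed

section \<open>Estimates in terms of flag covolumes\<close>

abbreviation num_err where
 "num_err d L H \<equiv> \<bar>real (num_sublattices L d H) - main_term d L H\<bar>"

abbreviation low_term :: "nat => real => (real ^ 'n) set => (nat => real ^ 'n) => real => real" where
 "low_term d b L v H \<equiv> H powr (real CARD('n) - b) /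
   (covolume L powr (real d - b) * covolume (flag_lattice L v (CARD('n) - d)) powr b)"

abbreviation min_term :: "nat => real => (real ^ 'n) set => (nat => real ^ 'n) => real => real" where
 "min_term d g L v H \<equiv> H powr g * covolume (flag_lattice L v 1) powr (- (real d * g))"

text \<open>The two constants are kept apart so that the first term can be switched off with
  \<open>C = 0\<close>, as is done for \<open>d = n - 1\<close>.\<close>

definition two_term :: "(real ^ 'n) itself => nat => real => real => real => real => bool" where
 "two_term T d C c b g \<longleftrightarrow> (\<forall>(L :: (real ^ 'n) set) v H. is_full_lattice L --> minimal_vectors L v --> 0 < H -->
   num_err d L H <= C * low_term d b L v H + c * min_term d g L v H)"

definition asymptotic :: "(real ^ 'n) itself => nat => real => nat set => (nat => real) => (nat => nat => real) => bool" where
 "asymptotic T d C F g b \<longleftrightarrow> (\<forall>(L :: (real ^ 'n) set) v H. is_full_lattice L --> minimal_vectors L v --> 0 < H -->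
   num_err d L H <= C * error_sum F g b L v H)"

definition leading :: "(real ^ 'n) itself => nat => nat set => (nat => real) => (nat => nat => real) => bool" where
 "leading T d F g b \<longleftrightarrow> (\<exists>j\<^sub>0\<in>F. g j\<^sub>0 = real CARD('n) - b_exp CARD('n) d \<and> (\<forall>j\<in>F - {j\<^sub>0}. g j < g j\<^sub>0) \<and>
   (\<forall>(L :: (real ^ 'n) set) v H. is_full_lattice L \<and> minimal_vectors L v \<and> 0 < H -->
    b_coeff (b j\<^sub>0) L v * H powr g j\<^sub>0 = low_term d (b_exp CARD('n) d) L v H))"

text \<open>\<open>Est_scaled\<close> is applied to a reduced basis of \<open>L\<close>. The product
  of the last \<open>d\<close> Gram--Schmidt norms is \<open>covolume L\<close> over the product of
  the first \<open>n - d\<close>, and the latter is bounded below by the flag covolume of index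
  \<open>n - d\<close>; the flag covolume of index 1 does the same for the first norm.\<close>

theorem count_bound:
 fixes b g C c :: real
 assumes C: "0 <= C" "0 <= c" "\<And>(bs::(real ^ 'n) list) H. nb CARD('n) (2 ^ CARD('n)) bs ==> 0 < H ==>
   cnt_err CARD('n) d bs H <=
   C * (top_err CARD('n) d b bs H) + c * H powr g"
  and d: "1 <= d" "d < CARD('n)" and b: "0 <= b" and g: "0 <= g"
 shows "\<exists>C'\<ge>0. two_term TYPE(real ^ 'n) d (C' * C) (C' * c) b g"
proof -
 let ?n = "CARD('n)"
 let ?L = "?n - d"
 define M where "M = real ?n * 2 ^ ?n"
 let ?F = "(M ^ ?L) powr b"
 let ?E = "((2 ^ ?n * M) ^ d) powr g"
 have n0: "0 < ?n" by simp
 have M: "0 < M" by (simp add: M_def)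
 define C' where "C' = ?F + ?E"
 have C': "0 <= C'" "?F <= C'" "?E <= C'" by (auto simp: C'_def)
 have "num_err d L H <= C' * C * low_term d b L v H + C' * c * min_term d g L v H"
  if L: "is_full_lattice L" "minimal_vectors L v" and H: "0 < H" for L :: "(real ^ 'n) set" and v H
 proof -
  let ?J = "H powr (real ?n - b)"
  let ?C = "covolume L"
  note mf = minimal_facts[OF L]
  define bs where "bs = rb L"
  have bs: "bas bs" "zs bs = L" "length bs = ?n" "qm (2 ^ ?n) (gs bs)"
   using rb[OF mf(1)] rb_bas[OF mf(1)] rb_length[OF mf(1)] mf(2) red_qm[of "rb L"] by (auto simp: bs_def)
  have v: "vol bs = ?C" using ldet_zs[OF bs(1)] bs(2) mf(3) by simp
  let ?D = "prod_list (drop ?L (gs bs))" and ?f = "covolume (flag_lattice L v ?L)" and ?f1 = "covolume (flag_lattice L v 1)"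
  let ?H = "H powr g * ?f1 powr (- (real d * g))"
  let ?G = "?J / (?C powr (real d - b) * ?f powr b)"
  have f: "0 < ?f" "0 < ?f1" "0 < ?C" using mf(4) mf(8)[of "?n - d"] mf(8)[of 1] n0 by (auto simp: Suc_le_eq)
  have gp: "0 < gs bs ! i" if "i < ?n" for i using bas_nth_pos[OF bs(1)] bs(3) that by simp
  let ?K = "\<Prod>i<?n - d. gs bs ! i"
  let ?I = "((2 ^ ?n / gs bs ! 0) ^ d * H) powr g"
  have Dp: "0 < ?D" by (rule prod_list_pos) (use bas_pos[OF bs(1)] in_set_dropD in metis)
  have "vol bs = prod_list (take ?L (gs bs)) * ?D" unfolding vol_def by (simp flip: prod_list.append)
  also have "prod_list (take ?L (gs bs)) = ?K" unfolding prod_list_nth using bs(3) by simp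
  finally have vD: "?C = ?K * ?D" using v by simp
  have "?f * ?D <= M ^ ?L * ?K * ?D"
   using mf(9)[of "?n - d"] Dp unfolding M_def bs_def by (intro mult_right_mono) auto
  hence "?f * ?D <= M ^ ?L * ?C" using vD by (simp add: mult.assoc)
  hence "?D <= M ^ ?L * (?C / ?f)" using f by (simp add: field_simps)
  hence "?D powr b <= (M ^ ?L * (?C / ?f)) powr b" using Dp b by (intro powr_mono2) auto
  also have "\<dots> = ?F * (?C powr b / ?f powr b)" by (simp only: powr_mult powr_divide)
  finally have "?J * ?D powr b / ?C ^ d <= ?J * (?F * (?C powr b / ?f powr b)) / ?C ^ d"
   using f by (intro divide_right_mono mult_left_mono) auto
  also have "\<dots> = ?F * ?G"
  proof -
   have "?C powr b / ?C ^ d = 1 / ?C powr (real d - b)"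
    using f by (simp add: powr_diff powr_realpow)
   moreover have "h * (m * (y / x)) / z = m * (h / (r * x))" if "y / z = 1 / r" for h m x y z r :: real
   proof -
    have "h * (m * (y / x)) / z = m * h / x * (y / z)" by simp
    thus ?thesis unfolding that by (simp add: mult.commute)
   qed
   ultimately show ?thesis by blast
  qed
  finally have 1: "?J * ?D powr b / ?C ^ d <= ?F * ?G" .
  have "?f1 <= M * gs bs ! 0" using mf(9)[of 1] n0 unfolding M_def bs_def by (simp add: Suc_le_eq)
  hence "1 / gs bs ! 0 <= M / ?f1" using f gp[OF n0] by (simp add: field_simps)
  hence "2 ^ ?n * (1 / gs bs ! 0) <= 2 ^ ?n * (M / ?f1)" by (intro mult_left_mono) auto
  hence "(2 ^ ?n / gs bs ! 0) ^ d * H <= (2 ^ ?n * M / ?f1) ^ d * H"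
   using gp[OF n0] H by (intro mult_right_mono power_mono) auto
  hence "?I <= ((2 ^ ?n * M / ?f1) ^ d * H) powr g"
   using gp[OF n0] H g by (intro powr_mono2) auto
  also have "\<dots> = ?E * ?H"
  proof -
   have "(?f1 ^ d) powr g = ?f1 powr (real d * g)" unfolding powr_realpow[OF f(2), symmetric] powr_powr ..
   thus ?thesis by (simp add: power_divide powr_mult powr_divide powr_minus_divide)
  qed
  finally have 2: "?I <= ?E * ?H" .
  let ?A = "?G" and ?B = "?H"
  have AB: "0 <= ?A" "0 <= ?B" by auto
  have "cnt_err ?n d bs H <=
   C * (?J * ?D powr b / vol bs ^ d) + c * ?I"
   by (rule Est_scaled[OF C(3) _ _ n0 bs(3,1,4) H]) (use d in auto)
  also have "\<dots> <= C * (?F * ?A) + c * (?E * ?B)"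
   unfolding v by (intro mult_left_mono add_mono 1 2 C(1,2))
  also have "\<dots> <= C * (C' * ?A) + c * (C' * ?B)" by (intro add_mono mult_left_mono mult_right_mono C' C(1,2) AB)
  finally have "\<bar>real (card (Gs L d H)) - c_const ?n d * (H ^ ?n / ?C ^ d)\<bar> <= C' * C * ?A + C' * c * ?B"
   unfolding bs(2) v by (simp only: mult_ac)
  thus ?thesis unfolding num_sublattices_Gs[OF mf(1)] main_term_def .
 qed
 thus ?thesis using C'(1) unfolding two_term_def by blast
qed

section \<open>The main theorem\<close>

lemma b_coeff_two:
 fixes L :: "(real ^ 'n) set"
 assumes L: "is_full_lattice L" "minimal_vectors L v" and m: "1 <= m" "m < CARD('n)"
 shows "b_coeff (\<lambda>i. if i = CARD('n) then x else if i = m then y else 0) L v = covolume L powr (- x) * covolume (flag_lattice L v m) powr (- y)"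
proof -
 let ?A = "covolume (flag_lattice L v m) powr (- y)"
 let ?n = "CARD('n)"
 note mf = minimal_facts[OF L]
 have "b_coeff (\<lambda>i. if i = ?n then x else if i = m then y else 0) L v =
  (\<Prod>i=1..?n. (if i = ?n then covolume L powr (- x) else 1) * (if i = m then ?A else 1))"
  unfolding b_coeff_def using mf(5,8) m by (intro prod.cong) (auto simp: less_imp_neq[OF mf(8), symmetric])
 also have "\<dots> = covolume L powr (- x) * ?A"
  unfolding prod.distrib using m by (simp add: prod.delta)
 finally show ?thesis .
qed

lemma b_coeff_one:
 fixes L :: "(real ^ 'n) set"
 assumes L: "is_full_lattice L" "minimal_vectors L v"
 shows "b_coeff (\<lambda>i. if i = 1 then x else 0) L v = covolume (flag_lattice L v 1) powr (- x)"
proof -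
 let ?A = "covolume (flag_lattice L v 1) powr (- x)"
 note mf = minimal_facts[OF L]
 have "b_coeff (\<lambda>i. if i = 1 then x else 0) L v = (\<Prod>i=1..CARD('n). if i = 1 then ?A else 1)"
  unfolding b_coeff_def using mf(8) by (intro prod.cong) (auto simp: less_imp_neq[OF mf(8), symmetric])
 also have "\<dots> = ?A" by (simp add: prod.delta Suc_le_eq)
 finally show ?thesis .
qed

lemma error_sum_nonneg: "0 <= H ==> 0 <= error_sum F g b L v H"
 unfolding error_sum_def b_coeff_def by (intro sum_nonneg mult_nonneg_nonneg prod_nonneg) auto

lemma sum_two: "(\<Sum>j\<in>{0, 1::nat}. f j) = f 0 + f 1"
 by simp

lemma card_index: "2 <= n ==> card {0, 1::nat} <= n ^ (3 * n)"
proof -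
 assume n: "2 <= n"
 have "card {0, 1::nat} = 2" by simp
 also have "2 <= n ^ 1" using n by simp
 also have "n ^ 1 <= n ^ (3 * n)" using n by (intro power_increasing) auto
 finally show ?thesis .
qed

text \<open>Two indices suffice: index 0 is the leading term, and index 1 carries all secondary
  errors through the first flag lattice. The secondary exponent must stay strictly below
  \<open>n - b\<close>. For \<open>d >= 2\<close> one has \<open>b <= 1 / 2\<close>, and
  \<open>n - 3 / 4\<close> is small enough. For \<open>d = 1\<close>, where \<open>b = 1\<close>,
  the secondary term of \<open>Est\<close> is too large, and \<open>rank_one_asymptotic\<close>
  supplies the exponent \<open>n - 2\<close>.\<close>

theorem low_rank:
 assumes n: "n = CARD('n::finite)" and d: "1 <= d" "d < n - 1"
 shows "\<exists>C\<ge>0. \<exists>F G B. exponent_system n d F G B \<and> (\<forall>j\<in>F. G j <= real n - b_exp n d) \<and>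
  asymptotic TYPE(real ^ 'n) d C F G B \<and> leading TYPE(real ^ 'n) d F G B"
proof -
 define b where "b = b_exp n d"
 define K where "K = (2::real) ^ n"
 have K: "1 <= K" by (simp add: K_def)
 have p: "2 <= n - d" "d <= n" using d by auto
 have bp: "1 / real (n - d) <= 1 / 2" using p by (intro divide_left_mono) auto
 have b1: "0 < b" "b <= 1"
 proof -
  have "0 < 1 / real d" "1 / real d <= 1" using d by auto
  moreover have "1 / real (n - d) <= 1" by (rule order_trans[OF bp]) simp
  ultimately show "0 < b" "b <= 1" unfolding b_def b_exp_def less_max_iff_disj max.bounded_iff by blast+
 qed
 have "\<exists>\<gamma>1 C. 0 <= \<gamma>1 \<and> \<gamma>1 < real n - b \<and> 0 <= C \<and> (\<forall>(bs::(real ^ 'n) list) H. nb n K bs --> 0 < H -->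
  cnt_err n d bs H <=
   C * (top_err n d b bs H + H powr \<gamma>1))"
 proof (cases "d = 1")
  case True
  have "b = 1" using True bp by (simp add: b_def b_exp_def)
  have n2: "2 <= n" using d by simp
  obtain C where C: "0 <= C" "\<And>(bs::(real ^ 'n) list) H. length bs = n ==> bas bs ==> qm K (gs bs) ==> (\<forall>g\<in>set (gs bs). 1 <= g) ==> 0 < H ==>
   \<bar>real (card (Gs (zs bs) 1 H)) - c_const n 1 * (H ^ n / vol bs)\<bar> <= C * (H ^ (n - 1) * gs bs ! (n - 1) / vol bs + H ^ (n - 2))"
   using rank_one_asymptotic[OF n2 K, where 'a = "real ^ 'n"] by blast
  have "cnt_err n d bs H <=
   C * (top_err n d b bs H + H powr real (n - 2))"
   if bs: "nb n K bs" and H: "0 < H" for bs :: "(real ^ 'n) list" and H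
  proof -
   have "drop (n - 1) (gs bs) = [gs bs ! (n - 1)]"
    using nb_pos(3)[OF bs] n2 by (subst Cons_nth_drop_Suc[symmetric]) auto
   hence D: "prod_list (drop (n - d) (gs bs)) powr b = gs bs ! (n - 1)"
    using True \<open>b = 1\<close> nb_nth[OF bs, of "n - 1"] n2 by simp
   have "H powr (real n - b) = H ^ (n - 1)" using \<open>b = 1\<close> n2 powr_realpow[OF H, of "n - 1"] by (simp add: of_nat_diff)
   moreover have "H powr real (n - 2) = H ^ (n - 2)" by (rule powr_realpow[OF H])
   ultimately show ?thesis unfolding D using C(2)[of bs H] bs H True by (simp add: nb_def)
  qed
  thus ?thesis using C(1) \<open>b = 1\<close> n2 by (intro exI[of _ "real (n - 2)"] exI[of _ C]) (auto simp: of_nat_diff)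
 next
  case False
  hence d2: "2 <= d" using d by simp
  have dd: "1 / real d <= 1 / 2" using d2 by (intro divide_left_mono) auto
  hence bh: "b <= 1 / 2" using bp unfolding b_def b_exp_def max.bounded_iff by simp
  have "Est TYPE(real ^ 'n) n d b"
  proof (cases "1 / real (n - d) <= 1 / real d")
   case True
   hence "b = 1 / d" by (simp add: b_def b_exp_def)
   thus ?thesis using Est_lead[of d n, where 'a = "real ^ 'n"] d2 d by simp
  next
   case False
   hence "b = 1 / real (n - d)" by (simp add: b_def b_exp_def)
   thus ?thesis using Est_chain[of b "n - d" d, where 'a = "real ^ 'n"] b1 bh d p by simp
  qed
  moreover have "0 < 1 / 4 * (1::real)" by simp
  ultimately obtain C where "0 <= C" "\<And>(bs::(real ^ 'n) list) H. nb n K bs ==> 0 < H ==>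
   cnt_err n d bs H <=
   C * (top_err n d b bs H + H powr (real n - 1 + 1 / 4 * 1))"
   using K unfolding Est_def by blast
  thus ?thesis using bh d by (intro exI[of _ "real n - 1 + 1 / 4 * 1"] exI[of _ C]) auto
 qed
 then obtain \<gamma>1 C where g1: "0 <= \<gamma>1" "\<gamma>1 < real n - b" and C: "0 <= C" "\<And>(bs::(real ^ 'n) list) H. nb n K bs ==> 0 < H ==>
  cnt_err n d bs H <=
   C * (top_err n d b bs H + H powr \<gamma>1)" by blast
 have "\<exists>C'\<ge>0. two_term TYPE(real ^ 'n) d (C' * C) (C' * C) b \<gamma>1"
  by (rule count_bound) (use C d b1 g1 in \<open>simp_all add: n K_def distrib_left\<close>)
 then obtain C'' where C'': "0 <= C''" "two_term TYPE(real ^ 'n) d (C'' * C) (C'' * C) b \<gamma>1" by blast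
 define G where "G j = (if j = 0 then real n - b else \<gamma>1)" for j :: nat
 \<comment> \<open>For index 0 the required identity reads
   \<open>n * (d - b) + (n - d) * b = d * (n - b)\<close>.\<close>
 define B where "B j = (if j = 0 then (\<lambda>i. if i = n then real d - b else if i = n - d then b else 0) else (\<lambda>i. if i = 1 then real d * \<gamma>1 else 0))" for j :: nat
 have nd: "1 <= n - d" "n - d < n" "n - d \<noteq> n" using d by auto
 have lead: "b_coeff (B 0) L v * H powr G 0 = low_term d b L v H" "b_coeff (B 1) L v * H powr G 1 = min_term d \<gamma>1 L v H"
  if L: "is_full_lattice L" "minimal_vectors L v" for L :: "(real ^ 'n) set" and v H
  unfolding B_def G_def n using b_coeff_two[OF L nd(1)[unfolded n] nd(2)[unfolded n]] b_coeff_one[OF L, of "real d * \<gamma>1"]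
  by (simp_all add: powr_minus_divide)
 have s0: "(\<Sum>i=1..n. real i * B 0 i) = real d * G 0"
 proof -
  have "(\<Sum>i=1..n. real i * B 0 i) = (\<Sum>i=1..n. (if i = n then real n * (real d - b) else 0) + (if i = n - d then real (n - d) * b else 0))"
   unfolding B_def using nd(3) by (intro sum.cong) auto
  also have "\<dots> = real n * (real d - b) + real (n - d) * b" unfolding sum.distrib using nd nd(1)[THEN order_trans, of n] by (simp add: sum.delta)
  also have "\<dots> = real d * G 0" using p by (simp add: G_def of_nat_diff algebra_simps)
  finally show ?thesis .
 qed
 have s1: "(\<Sum>i=1..n. real i * B 1 i) = real d * G 1"
 proof -
  have "(\<Sum>i=1..n. real i * B 1 i) = (\<Sum>i=1..n. if i = 1 then real d * \<gamma>1 else 0)" unfolding B_def by (intro sum.cong) auto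
  thus ?thesis using d by (simp add: sum.delta G_def)
 qed
 have "exponent_system n d {0, 1} G B"
  unfolding exponent_system_def
 proof (intro conjI ballI)
  show "card {0, 1::nat} <= n ^ (3 * n)" using d by (intro card_index) simp
  fix j :: nat assume j: "j \<in> {0, 1}"
  show "0 <= G j" using g1 b1 d by (auto simp: G_def)
  show "0 <= B j i" for i using g1 b1 d by (auto simp: B_def)
  show "(\<Sum>i=1..n. real i * B j i) = real d * G j" using j s0 s1 by auto
 qed simp
 moreover have "\<forall>j\<in>{0, 1}. G j <= real n - b" using g1 by (simp add: G_def)
 moreover have "asymptotic TYPE(real ^ 'n) d (C'' * C) {0, 1} G B"
  unfolding asymptotic_def error_sum_def sum_two distrib_left using C''(2) lead by (simp add: two_term_def)
 moreover have "leading TYPE(real ^ 'n) d {0, 1} G B"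
  unfolding leading_def n[symmetric] b_def[symmetric] using lead(1) g1 by (intro bexI[of _ 0]) (auto simp: G_def n)
 moreover have "0 <= C'' * C" using C''(1) C(1) by simp
 ultimately show ?thesis unfolding b_def by blast
qed

text \<open>Here \<open>b_exp\<close> is 1, which \<open>Est_chain\<close> does not reach, so
  \<open>1 - e\<close> is used. On normalised bases the product of the last \<open>d\<close>
  Gram--Schmidt norms is at most \<open>vol bs\<close>, and the leading error is absorbed by the
  power \<open>n - 1 + e\<close> of \<open>H\<close>.\<close>

theorem corank_one:
 assumes n: "n = CARD('n::finite)" and d: "1 <= d" "d = n - 1" and h: "0 < h"
 shows "\<exists>C\<ge>0. \<exists>F c b. exponent_system n d F c b \<and>
  asymptotic TYPE(real ^ 'n) d C F c b \<and>
  (\<exists>j\<^sub>0\<in>F. c j\<^sub>0 = real n - 1 + h \<and> (\<forall>j\<in>F - {j\<^sub>0}. c j <= real n - b_exp n d))"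
proof -
 let ?B = "real n - 1"
 define K where "K = (2::real) ^ n"
 have K: "1 <= K" by (simp add: K_def)
 have nd: "n = 1 + d" "2 <= n" "d < n" using d by auto
 \<comment> \<open>The cap keeps \<open>1 - e\<close> positive when \<open>h\<close> is
   large.\<close>
 define e where "e = min h (1 / 2)"
 let ?C = "1 - e"
 have e: "0 < e" "e < 1" "e <= h" using h by (auto simp: e_def)
 have "Est TYPE(real ^ 'n) n d ?C" unfolding nd(1) using e d by (intro Est_chain) auto
 then obtain C where C: "0 <= C" "\<And>(bs::(real ^ 'n) list) H. nb n K bs ==> 0 < H ==>
   cnt_err n d bs H <=
   C * (top_err n d ?C bs H + H powr (?B + e))"
  unfolding Est_def using e(1) K by blast
 let ?g = "?B + e"
 have g0: "0 <= ?g" using nd e by simp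
 have C2: "cnt_err n d bs H <= C * 2 * H powr ?g"
  if bs: "nb n K bs" and H: "0 < H" for bs :: "(real ^ 'n) list" and H
 proof -
  let ?A = "prod_list (drop (n - d) (gs bs))"
  have D1: "1 <= ?A"
   by (rule prod_list_ge1) (use bs in \<open>auto simp: nb_def dest: in_set_dropD\<close>)
  have vD: "?A <= vol bs"
  proof -
   have "vol bs = prod_list (take (n - d) (gs bs)) * ?A" unfolding vol_def by (simp flip: prod_list.append)
   moreover have "1 <= prod_list (take (n - d) (gs bs))"
    by (rule prod_list_ge1) (use bs in \<open>auto simp: nb_def dest: in_set_takeD\<close>)
   ultimately show ?thesis using D1 by simp
  qed
  have v1: "1 <= vol bs" using D1 vD by simp
  have "?A powr ?C <= vol bs powr 1"
   using D1 vD v1 e by (intro order_trans[OF powr_mono2[of "1 - e" _ "vol bs"] powr_mono]) auto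
  also have "\<dots> <= vol bs ^ d" using v1 d self_le_power[of "vol bs" d] by simp
  finally have "?A powr ?C / vol bs ^ d <= 1" using v1 by simp
  hence "H powr ?g * (?A powr ?C / vol bs ^ d) <= H powr ?g * 1" by (intro mult_left_mono) auto
  hence "top_err n d ?C bs H + H powr ?g <= 2 * H powr ?g"
   by (simp add: algebra_simps)
  from mult_left_mono[OF this C(1)] C(2)[OF bs H] show ?thesis by simp
 qed
 have "\<exists>C'\<ge>0. two_term TYPE(real ^ 'n) d (C' * 0) (C' * (C * 2)) 0 ?g"
  by (rule count_bound) (use C(1) C2 d nd g0 in \<open>simp_all add: n K_def\<close>)
 then obtain C' where C': "0 <= C'" "two_term TYPE(real ^ 'n) d 0 (C' * (C * 2)) 0 ?g" by auto
 let ?D = "C' * (C * 2)"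
 define c where "c j = (if j = 0 then ?B + h else ?B)" for j :: nat
 define b where "b j = (\<lambda>i::nat. if i = 1 then real d * c j else 0)" for j
 have gp: "0 <= c j" for j using nd h by (simp add: c_def)
 have "exponent_system n d {0, 1} c b"
  unfolding exponent_system_def
 proof (intro conjI ballI)
  show "card {0, 1::nat} <= n ^ (3 * n)" by (rule card_index[OF nd(2)])
  fix j :: nat
  show "0 <= c j" "0 <= b j i" for i using gp by (auto simp: b_def)
  let ?G = "\<Sum>i=1..n. real i * b j i"
  have "?G = (\<Sum>i=1..n. if i = 1 then real d * c j else 0)" unfolding b_def by (intro sum.cong) auto
  thus "?G = real d * c j" using nd by (simp add: sum.delta)
 qed simp
 moreover have "num_err d L H <= ?D * error_sum {0, 1} c b L v H"
  if L: "is_full_lattice L" "minimal_vectors L v" and H: "0 < H" for L :: "(real ^ 'n) set" and v H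
 proof -
  let ?F = "error_sum {0, 1} c b L v H"
  let ?f = "covolume (flag_lattice L v 1)"
  have f: "0 < ?f" using minimal_facts(8)[OF L, of 1] by (simp add: Suc_le_eq)
  \<comment> \<open>By scale invariance all terms are powers of \<open>y\<close>. The exponent
    \<open>?g\<close> lies between \<open>n - 1\<close> and \<open>n - 1 + h\<close>, so its power
    is bounded by one of the two outer ones according to whether \<open>y\<close> is below or above
    1; hence the second index.\<close>
  define y where "y = H * ?f powr (- real d)"
  have y: "0 < y" using f H by (simp add: y_def)
  have yp: "H powr x * ?f powr (- (real d * x)) = y powr x" for x unfolding y_def by (simp add: powr_mult powr_powr)
  have "y powr ?g <= y powr (?B + h) + y powr ?B"
  proof (cases "1 <= y")
   case True
   hence "y powr ?g <= y powr (?B + h)" using e by (intro powr_mono) auto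
   thus ?thesis by (simp add: add_increasing2)
  next
   case False
   hence "y powr ?g <= y powr ?B" using e y by (intro powr_mono') auto
   thus ?thesis by (simp add: add_increasing)
  qed
  also have "\<dots> = ?F"
   unfolding error_sum_def sum_two b_def b_coeff_one[OF L] mult.commute[of _ "H powr _"] yp by (simp add: c_def)
  finally have "?D * y powr ?g <= ?D * ?F"
   using C'(1) C(1) by (intro mult_left_mono) auto
  moreover have "num_err d L H <= ?D * min_term d ?g L v H" using C'(2) L H by (simp add: two_term_def)
  ultimately show ?thesis unfolding yp by linarith
 qed
 hence "asymptotic TYPE(real ^ 'n) d ?D {0, 1} c b" by (simp add: asymptotic_def)
 moreover have "b_exp n d = 1"
 proof -
  have "1 / real d <= 1" using d by simp
  moreover have "n - d = 1" using nd by simp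
  ultimately show ?thesis by (simp add: b_exp_def)
 qed
 hence "c 0 = ?B + h" "\<forall>j\<in>{0, 1} - {0}. c j <= real n - b_exp n d" by (auto simp: c_def)
 moreover have "0 <= ?D" using C'(1) C(1) by simp
 ultimately show ?thesis
  by (intro exI[of _ "?D"] exI[of _ "{0, 1}"] exI[of _ c] exI[of _ b] conjI bexI[of _ 0]) auto
qed

lemma asymptotic_scale:
 fixes L :: "(real ^ 'n) set"
 assumes a: "asymptotic TYPE(real ^ 'n) d c F g b" "exponent_system n d F g b" "n = CARD('n)" "c <= C"
  and L: "is_full_lattice L \<and> minimal_vectors L v \<and> 0 < H"
 shows "num_err d L H <= C * error_sum F g b L v H \<and>
  (\<forall>t>0. main_term d ((\<lambda>x. t *\<^sub>R x) ` L) (t ^ d * H) = main_term d L H \<and>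
   error_sum F g b ((\<lambda>x. t *\<^sub>R x) ` L) (\<lambda>i. t *\<^sub>R v i) (t ^ d * H) = error_sum F g b L v H)"
proof -
 have "num_err d L H <= c * error_sum F g b L v H" using a(1) L unfolding asymptotic_def by blast
 also have "\<dots> <= C * error_sum F g b L v H" using L by (intro mult_right_mono a(4) error_sum_nonneg) auto
 finally show ?thesis using scale_invariance[OF a(2)[unfolded a(3)]] L by blast
qed

theorem theorem1p4:
  fixes n :: nat
  assumes n: "n = CARD('n::finite)"
  shows
    "(\<exists>C. \<forall>d. 1 \<le> d \<and> d < n - 1 \<longrightarrow>
       (\<exists>F \<gamma> \<beta>. exponent_system n d F \<gamma> \<beta> \<and> (\<forall>j\<in>F. \<gamma> j \<le> real n - b_exp n d) \<and>
          (\<forall>(L :: (real ^ 'n) set) v H. is_full_lattice L \<and> minimal_vectors L v \<and> 0 < H \<longrightarrow>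
             \<bar>real (num_sublattices L d H) - main_term d L H\<bar> \<le> C * error_sum F \<gamma> \<beta> L v H \<and>
             (\<forall>t>0. main_term d ((\<lambda>x. t *\<^sub>R x) ` L) (t ^ d * H) = main_term d L H \<and>
                    error_sum F \<gamma> \<beta> ((\<lambda>x. t *\<^sub>R x) ` L) (\<lambda>i. t *\<^sub>R v i) (t ^ d * H)
                      = error_sum F \<gamma> \<beta> L v H)) \<and>
          (\<exists>j\<^sub>0\<in>F. \<gamma> j\<^sub>0 = real n - b_exp n d \<and> (\<forall>j\<in>F - {j\<^sub>0}. \<gamma> j < \<gamma> j\<^sub>0) \<and>
             (\<forall>(L :: (real ^ 'n) set) v H. is_full_lattice L \<and> minimal_vectors L v \<and> 0 < H \<longrightarrow>
                b_coeff (\<beta> j\<^sub>0) L v * H powr \<gamma> j\<^sub>0 =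
                  H powr (real n - b_exp n d) /
                    (covolume L powr (real d - b_exp n d) *
                     covolume (flag_lattice L v (n - d)) powr b_exp n d))))) \<and>
     (\<forall>\<eta>>0. \<exists>C. \<forall>d. 1 \<le> d \<and> d = n - 1 \<longrightarrow>
       (\<exists>F \<gamma> \<beta>. exponent_system n d F \<gamma> \<beta> \<and>
          (\<forall>(L :: (real ^ 'n) set) v H. is_full_lattice L \<and> minimal_vectors L v \<and> 0 < H \<longrightarrow>
             \<bar>real (num_sublattices L d H) - main_term d L H\<bar> \<le> C * error_sum F \<gamma> \<beta> L v H \<and>
             (\<forall>t>0. main_term d ((\<lambda>x. t *\<^sub>R x) ` L) (t ^ d * H) = main_term d L H \<and>
                    error_sum F \<gamma> \<beta> ((\<lambda>x. t *\<^sub>R x) ` L) (\<lambda>i. t *\<^sub>R v i) (t ^ d * H)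
                      = error_sum F \<gamma> \<beta> L v H)) \<and>
          (\<exists>j\<^sub>0\<in>F. \<gamma> j\<^sub>0 = real n - 1 + \<eta> \<and> (\<forall>j\<in>F - {j\<^sub>0}. \<gamma> j \<le> real n - b_exp n d))))"
proof -
 \<comment> \<open>The constant must not depend on \<open>d\<close>; since only finitely many
   \<open>d\<close> occur, the individual constants can be added up.\<close>
 let ?D = "\<lambda>C. \<Sum>d<n. \<bar>C d\<bar>"
 let "(\<exists>C. \<forall>d. ?c d --> ?A C d) \<and> (\<forall>\<eta>>0. \<exists>C. \<forall>d. ?c' d --> ?B \<eta> C d)" = ?thesis
 have "\<forall>d. \<exists>C. ?c d --> 0 <= C \<and> (\<exists>F \<gamma> \<beta>. exponent_system n d F \<gamma> \<beta> \<and> (\<forall>j\<in>F. \<gamma> j <= real n - b_exp n d) \<and>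
   asymptotic TYPE(real ^ 'n) d C F \<gamma> \<beta> \<and> leading TYPE(real ^ 'n) d F \<gamma> \<beta>)"
  using low_rank[OF n] by blast
 from choice[OF this] obtain C where C: "?c d ==> 0 <= C d \<and> (\<exists>F \<gamma> \<beta>. exponent_system n d F \<gamma> \<beta> \<and> (\<forall>j\<in>F. \<gamma> j <= real n - b_exp n d) \<and>
   asymptotic TYPE(real ^ 'n) d (C d) F \<gamma> \<beta> \<and> leading TYPE(real ^ 'n) d F \<gamma> \<beta>)" for d
  by blast
 have "?A (?D C) d" if d: "?c d" for d
 proof -
  have "C d <= \<bar>C d\<bar>" by simp
  also have "\<dots> <= (?D C)" using d by (intro member_le_sum) auto
  finally have le: "C d <= (?D C)" .
  obtain F \<gamma> \<beta> where F: "exponent_system n d F \<gamma> \<beta>" "\<forall>j\<in>F. \<gamma> j <= real n - b_exp n d"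
    "asymptotic TYPE(real ^ 'n) d (C d) F \<gamma> \<beta>" "leading TYPE(real ^ 'n) d F \<gamma> \<beta>"
   using C[OF d] by blast
  show ?thesis
   using F(1,2) asymptotic_scale[OF F(3,1) n le] F(4)[unfolded leading_def n[symmetric]]
   by (intro exI[of _ F] exI[of _ \<gamma>] exI[of _ \<beta>] conjI) blast+
 qed
 moreover have "\<exists>C. \<forall>d. ?c' d --> ?B \<eta> C d" if \<eta>: "0 < \<eta>" for \<eta>
 proof (cases "1 <= n - 1")
  case True
  obtain C F \<gamma> \<beta> where F: "exponent_system n (n - 1) F \<gamma> \<beta>" "asymptotic TYPE(real ^ 'n) (n - 1) C F \<gamma> \<beta>"
    "\<exists>j\<^sub>0\<in>F. \<gamma> j\<^sub>0 = real n - 1 + \<eta> \<and> (\<forall>j\<in>F - {j\<^sub>0}. \<gamma> j <= real n - b_exp n (n - 1))"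
   using corank_one[OF n True refl \<eta>] by blast
  have "?B \<eta> C (n - 1)"
   using F(1,3) asymptotic_scale[OF F(2,1) n order_refl] by (intro exI[of _ F] exI[of _ \<gamma>] exI[of _ \<beta>] conjI) blast+
  thus ?thesis by blast
 qed auto
 ultimately show ?thesis by blast
qed

end
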